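(* Let $\mathcal{R}\subset\mathbb{R}^N\setminus\{0\}$ be a reduced root system with a non-negative multiplicity function $k$, and let $a>0$ with $a+2\langle k\rangle+N-2>0$. Write $L^2=L^2(\mathbb{R}^N,\vartheta_{k,a}(x)dx)$ and $\mathcal{I}_{k,a}(z)=\exp(\frac{z}{a}\Delta_{k,a})$ for $z\in\mathbb{C}$, $\operatorname{Re}z\ge0$. Then: 1) $\mathcal{I}_{k,a}(z)$ is a holomorphic semigroup in the complex right half-plane $\{z\in\mathbb{C}:\operatorname{Re}z>0\}$, in the sense that $\mathcal{I}_{k,a}(z)$ is a Hilbert–Schmidt operator on $L^2$ satisfying $\mathcal{I}_{k,a}(z_1)\circ\mathcal{I}_{k,a}(z_2)=\mathcal{I}_{k,a}(z_1+z_2)$ for $\operatorname{Re}z_1,\operatorname{Re}z_2>0$, and the scalar product $(\mathcal{I}_{k,a}(z)f,g)$ is a holomorphic function of $z$ for $\operatorname{Re}z>0$, for any $f,g\in L^2$. 2) $\mathcal{I}_{k,a}(z)$ is a one-parameter group of unitary operators on the imaginary axis $\operatorname{Re}z=0$.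
   Context: Let $N\ge1$, $\langle\cdot,\cdot\rangle$ the standard inner product on $\mathbb{R}^N$, $\|x\|=\langle x,x\rangle^{1/2}$, and for $\alpha\neq0$ let $r_\alpha(x)=x-2\frac{\langle\alpha,x\rangle}{\|\alpha\|^2}\alpha$. A (reduced) root system is a finite set $\mathcal{R}\subset\mathbb{R}^N\setminus\{0\}$ with $r_\alpha(\mathcal{R})=\mathcal{R}$ and $\mathcal{R}\cap\mathbb{R}\alpha=\{\pm\alpha\}$ for all $\alpha\in\mathcal{R}$. $\mathfrak{C}$ is the finite Coxeter group generated by $\{r_\alpha\}$, $\mathcal{R}^+$ a positive subsystem. A multiplicity function is a $\mathfrak{C}$-invariant function $k=(k_\alpha)$ on $\mathcal{R}$; non-negative means $k_\alpha\ge0$ for all $\alpha$. Put $\langle k\rangle=\sum_{\alpha\in\mathcal{R}^+}k_\alpha$. Dunkl operators: $T_\xi(k)f(x)=\partial_\xi f(x)+\sum_{\alpha\in\mathcal{R}^+}k_\alpha\langle\alpha,\xi\rangle\frac{f(x)-f(r_\alpha x)}{\langle\alpha,x\rangle}$; Dunkl Laplacian: $\Delta_k=\sum_{j=1}^NT_{\xi_j}(k)^2$ for an orthonormal basis $\xi_1,\dots,\xi_N$. Density: $\vartheta_{k,a}(x)=\|x\|^{a-2}\prod_{\alpha\in\mathcal{R}}|\langle\alpha,x\rangle|^{k_\alpha}$. Put $\Delta_{k,a}=\|x\|^{2-a}\Delta_k-\|x\|^a$. Let $\mathcal{H}_k^m(\mathbb{R}^N)$ be the space of homogeneous polynomials $p$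 of degree $m$ with $\Delta_kp=0$, $\lambda_{k,a,m}=\frac{2m+2\langle k\rangle+N-2}{a}$, $L_\ell^{(\lambda)}(t)=\sum_{j=0}^\ell\frac{(-1)^j\Gamma(\lambda+\ell+1)}{(\ell-j)!\,\Gamma(\lambda+j+1)}\frac{t^j}{j!}$, and $\Phi_\ell^{(a)}(p,x)=p(x)L_\ell^{(\lambda_{k,a,m})}(\frac2a\|x\|^a)\exp(-\frac1a\|x\|^a)$. The operator $\Delta_{k,a}$, with domain $W_{k,a}(\mathbb{R}^N)=\mathbb{C}\text{-span}\{\Phi_\ell^{(a)}(p,\cdot):\ell,m\in\mathbb{N},\,p\in\mathcal{H}_k^m(\mathbb{R}^N)\}$, is essentially self-adjoint on $L^2$; the same symbol denotes its self-adjoint closure, and $\exp(\frac za\Delta_{k,a})$ is defined by functional calculus. *)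

theory Defs
  imports "HOL-Analysis.Analysis"
begin

section \<open>The Hilbert space of square-integrable functions and its operators\<close>

text \<open>
  Elements of $L^2(M)$ are represented by functions, and equality in $L^2(M)$ is equality almost
  everywhere.  An operator in $L^2(M)$, possibly unbounded, is represented by its graph, a set of
  pairs of such functions.  The graphs produced below by closure and by spectral integration are
  closed under changing either component on a null set, so set equality of such graphs
  is equality of operators, domains included, and \<^const>\<open>relcomp\<close> is composition of operators.
\<close>

definition sq_integrable :: "'x measure \<Rightarrow> ('x \<Rightarrow> complex) set" where
  "sq_integrable M = {f \<in> borel_measurable M. integrable M (\<lambda>x. (cmod (f x))\<^sup>2)}"

definition l2_inner :: "'x measure \<Rightarrow> ('x \<Rightarrow> complex) \<Rightarrow> ('x \<Rightarrow> complex) \<Rightarrow> complex" where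
  "l2_inner M f g = (LINT x|M. f x * cnj (g x))"

definition l2_norm :: "'x measure \<Rightarrow> ('x \<Rightarrow> complex) \<Rightarrow> real" where
  "l2_norm M f = sqrt (LINT x|M. (cmod (f x))\<^sup>2)"

type_synonym 'x op_graph = "(('x \<Rightarrow> complex) \<times> ('x \<Rightarrow> complex)) set"

definition op_app :: "'x op_graph \<Rightarrow> ('x \<Rightarrow> complex) \<Rightarrow> 'x \<Rightarrow> complex" where
  "op_app T f = (SOME g. (f, g) \<in> T)"

definition op_closure :: "'x measure \<Rightarrow> 'x op_graph \<Rightarrow> 'x op_graph" where
  "op_closure M T =
    {(f, g). f \<in> sq_integrable M \<and> g \<in> sq_integrable M \<and>
      (\<exists>u v. (\<forall>n::nat. (u n, v n) \<in> T \<inter> sq_integrable M \<times> sq_integrable M) \<and>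
        (\<lambda>n. l2_norm M (\<lambda>x. u n x - f x)) \<longlonglongrightarrow> 0 \<and>
        (\<lambda>n. l2_norm M (\<lambda>x. v n x - g x)) \<longlonglongrightarrow> 0)}"

definition op_identity :: "'x measure \<Rightarrow> 'x op_graph" where
  "op_identity M =
    {(f, g). f \<in> sq_integrable M \<and> g \<in> sq_integrable M \<and> (AE x in M. f x = g x)}"

definition everywhere_defined_linear :: "'x measure \<Rightarrow> 'x op_graph \<Rightarrow> bool" where
  "everywhere_defined_linear M T \<longleftrightarrow>
    T \<subseteq> sq_integrable M \<times> sq_integrable M \<and>
    (\<forall>f\<in>sq_integrable M. \<exists>g. (f, g) \<in> T) \<and>
    (\<forall>f g f' g' c. (f, g) \<in> T \<longrightarrow> (f', g') \<in> T \<longrightarrow>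
      ((\<lambda>x. c * f x + f' x), (\<lambda>x. c * g x + g' x)) \<in> T)"

text \<open>
  In both of the following definitions the norm condition together with linearity forces the graph
  to be single-valued up to null sets.
\<close>

definition bounded_operator :: "'x measure \<Rightarrow> 'x op_graph \<Rightarrow> bool" where
  "bounded_operator M T \<longleftrightarrow>
    everywhere_defined_linear M T \<and> (\<exists>C. \<forall>(f, g)\<in>T. l2_norm M g \<le> C * l2_norm M f)"

definition unitary_operator :: "'x measure \<Rightarrow> 'x op_graph \<Rightarrow> bool" where
  "unitary_operator M T \<longleftrightarrow>
    everywhere_defined_linear M T \<and>
    (\<forall>(f, g)\<in>T. \<forall>(f', g')\<in>T. l2_inner M g g' = l2_inner M f f') \<and>
    (\<forall>g\<in>sq_integrable M. \<exists>f. (f, g) \<in> T)"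

definition orthonormal_basis :: "'x measure \<Rightarrow> ('x \<Rightarrow> complex) set \<Rightarrow> bool" where
  "orthonormal_basis M B \<longleftrightarrow>
    B \<subseteq> sq_integrable M \<and>
    (\<forall>e\<in>B. \<forall>e'\<in>B. l2_inner M e e' = (if e = e' then 1 else 0)) \<and>
    (\<forall>f\<in>sq_integrable M. (\<forall>e\<in>B. l2_inner M f e = 0) \<longrightarrow> (AE x in M. f x = 0))"

definition hilbert_schmidt :: "'x measure \<Rightarrow> 'x op_graph \<Rightarrow> bool" where
  "hilbert_schmidt M T \<longleftrightarrow>
    bounded_operator M T \<and>
    (\<exists>B. orthonormal_basis M B \<and> (\<lambda>e. (l2_norm M (op_app T e))\<^sup>2) summable_on B)"

definition one_parameter_unitary_group :: "'x measure \<Rightarrow> (real \<Rightarrow> 'x op_graph) \<Rightarrow> bool" where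
  "one_parameter_unitary_group M U \<longleftrightarrow>
    (\<forall>t. unitary_operator M (U t)) \<and>
    U 0 = op_identity M \<and>
    (\<forall>s t. U t O U s = U (s + t)) \<and>
    (\<forall>f\<in>sq_integrable M. \<forall>t.
      ((\<lambda>s. l2_norm M (\<lambda>x. op_app (U s) f x - op_app (U t) f x)) \<longlongrightarrow> 0) (at t))"


section \<open>Functional calculus\<close>

text \<open>
  A resolution of the identity on the Borel sets of the real line.  Symmetry of the everywhere
  defined maps \<open>E B\<close> already makes them linear and compatible with equality almost everywhere.
\<close>

definition projection_valued_measure ::
  "'x measure \<Rightarrow> (real set \<Rightarrow> ('x \<Rightarrow> complex) \<Rightarrow> ('x \<Rightarrow> complex)) \<Rightarrow> bool" where
  "projection_valued_measure M E \<longleftrightarrow>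
    (\<forall>B\<in>sets borel. \<forall>f\<in>sq_integrable M. E B f \<in> sq_integrable M) \<and>
    (\<forall>B\<in>sets borel. \<forall>f\<in>sq_integrable M. \<forall>g\<in>sq_integrable M.
      l2_inner M (E B f) g = l2_inner M f (E B g)) \<and>
    (\<forall>f\<in>sq_integrable M. AE x in M. E UNIV f x = f x) \<and>
    (\<forall>A\<in>sets borel. \<forall>B\<in>sets borel. \<forall>f\<in>sq_integrable M.
      AE x in M. E (A \<inter> B) f x = E A (E B f) x) \<and>
    (\<forall>B :: nat \<Rightarrow> real set. range B \<subseteq> sets borel \<longrightarrow> disjoint_family B \<longrightarrow>
      (\<forall>f\<in>sq_integrable M. \<forall>g\<in>sq_integrable M.
        (\<lambda>i. l2_inner M (E (B i) f) g) sums l2_inner M (E (\<Union>i. B i) f) g))"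

definition spectral_distribution ::
  "'x measure \<Rightarrow> (real set \<Rightarrow> ('x \<Rightarrow> complex) \<Rightarrow> ('x \<Rightarrow> complex)) \<Rightarrow> ('x \<Rightarrow> complex) \<Rightarrow> real measure"
  where
  "spectral_distribution M E f =
    measure_of UNIV (sets borel) (\<lambda>B. ennreal (Re (l2_inner M (E B f) f)))"

definition spectral_domain ::
  "'x measure \<Rightarrow> (real set \<Rightarrow> ('x \<Rightarrow> complex) \<Rightarrow> ('x \<Rightarrow> complex)) \<Rightarrow> (real \<Rightarrow> complex)
    \<Rightarrow> ('x \<Rightarrow> complex) set" where
  "spectral_domain M E \<phi> =
    {f \<in> sq_integrable M. integrable (spectral_distribution M E f) (\<lambda>t. (cmod (\<phi> t))\<^sup>2)}"

text \<open>
  The operator $\int \varphi\,dE$ on its natural domain: it sends \<open>f\<close> to the \<open>g\<close> with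
  $(g, h) = \int \varphi(t)\, d(E(t)f, h)$ for all \<open>h\<close> in that (dense) domain.  The complex measure
  $(E(\cdot)f, h)$ is expanded by polarization into the finite positive measures
  $(E(\cdot)u, u)$, $u = f + i^n h$.
\<close>

definition spectral_integral ::
  "'x measure \<Rightarrow> (real set \<Rightarrow> ('x \<Rightarrow> complex) \<Rightarrow> ('x \<Rightarrow> complex)) \<Rightarrow> (real \<Rightarrow> complex) \<Rightarrow> 'x op_graph"
  where
  "spectral_integral M E \<phi> =
    {(f, g). f \<in> spectral_domain M E \<phi> \<and> g \<in> sq_integrable M \<and>
      (\<forall>h\<in>spectral_domain M E \<phi>. l2_inner M g h =
        (\<Sum>n<4. \<i> ^ n * (LINT t|spectral_distribution M E (\<lambda>x. f x + \<i> ^ n * h x). \<phi> t)) / 4)}"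

text \<open>
  $\varphi(A) = \int \varphi\,dE$ for the spectral measure $E$ of $A$, that is
  $A = \int t\,dE(t)$.  A self-adjoint $A$ has exactly one such $E$ up to null sets; if $A$ is not
  self-adjoint there is none and \<open>functional_calculus M A \<phi>\<close> is the empty graph, which satisfies
  neither \<^const>\<open>hilbert_schmidt\<close> nor \<^const>\<open>unitary_operator\<close>.
\<close>

definition functional_calculus ::
  "'x measure \<Rightarrow> 'x op_graph \<Rightarrow> (real \<Rightarrow> complex) \<Rightarrow> 'x op_graph" where
  "functional_calculus M A \<phi> =
    {(f, g). \<exists>E. projection_valued_measure M E \<and>
      spectral_integral M E complex_of_real = A \<and> (f, g) \<in> spectral_integral M E \<phi>}"


section \<open>Root systems and Dunkl operators\<close>

definition reflection :: "(real^'n) \<Rightarrow> (real^'n) \<Rightarrow> (real^'n)" where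
  "reflection \<alpha> x = x - (2 * inner \<alpha> x / (norm \<alpha>)\<^sup>2) *\<^sub>R \<alpha>"

definition root_system :: "(real^'n) set \<Rightarrow> bool" where
  "root_system R \<longleftrightarrow>
    finite R \<and> 0 \<notin> R \<and> (\<forall>\<alpha>\<in>R. reflection \<alpha> ` R = R) \<and> (\<forall>\<alpha>\<in>R. R \<inter> span {\<alpha>} = {\<alpha>, - \<alpha>})"

definition positive_subsystem :: "(real^'n) set \<Rightarrow> (real^'n) set \<Rightarrow> bool" where
  "positive_subsystem R P \<longleftrightarrow>
    (\<exists>u. (\<forall>\<alpha>\<in>R. inner \<alpha> u \<noteq> 0) \<and> P = {\<alpha> \<in> R. inner \<alpha> u > 0})"

text \<open>Reflections are involutions, so no inverses are needed to generate the group.\<close>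

inductive_set coxeter_group :: "(real^'n) set \<Rightarrow> ((real^'n) \<Rightarrow> (real^'n)) set"
  for R :: "(real^'n) set" where
  one: "id \<in> coxeter_group R"
| mult: "\<alpha> \<in> R \<Longrightarrow> w \<in> coxeter_group R \<Longrightarrow> reflection \<alpha> \<circ> w \<in> coxeter_group R"

definition multiplicity_function :: "(real^'n) set \<Rightarrow> (real^'n \<Rightarrow> real) \<Rightarrow> bool" where
  "multiplicity_function R k \<longleftrightarrow> (\<forall>w\<in>coxeter_group R. \<forall>\<alpha>\<in>R. k (w \<alpha>) = k \<alpha>)"

definition mult_sum :: "(real^'n) set \<Rightarrow> (real^'n \<Rightarrow> real) \<Rightarrow> real" where
  "mult_sum P k = (\<Sum>\<alpha>\<in>P. k \<alpha>)"

definition dir_deriv :: "(real^'n) \<Rightarrow> (real^'n \<Rightarrow> complex) \<Rightarrow> (real^'n) \<Rightarrow> complex" where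
  "dir_deriv \<xi> f x = vector_derivative (\<lambda>t::real. f (x + t *\<^sub>R \<xi>)) (at 0)"

text \<open>
  $(f(x) - f(r_\alpha x)) / \langle\alpha, x\rangle$.  On the hyperplane $\langle\alpha, x\rangle = 0$
  the quotient means its limit, which for smooth $f$ is $2\,\partial_\alpha f(x)/\|\alpha\|^2$;
  division by zero would give 0 there.
\<close>

definition dunkl_quotient :: "(real^'n) \<Rightarrow> (real^'n \<Rightarrow> complex) \<Rightarrow> (real^'n) \<Rightarrow> complex" where
  "dunkl_quotient \<alpha> f x =
    (if inner \<alpha> x = 0 then of_real (2 / (norm \<alpha>)\<^sup>2) * dir_deriv \<alpha> f x
     else (f x - f (reflection \<alpha> x)) / of_real (inner \<alpha> x))"

definition dunkl_operator ::
  "(real^'n) set \<Rightarrow> (real^'n \<Rightarrow> real) \<Rightarrow> (real^'n) \<Rightarrow> (real^'n \<Rightarrow> complex) \<Rightarrow> (real^'n) \<Rightarrow> complex"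
  where
  "dunkl_operator P k \<xi> f x =
    dir_deriv \<xi> f x + (\<Sum>\<alpha>\<in>P. of_real (k \<alpha> * inner \<alpha> \<xi>) * dunkl_quotient \<alpha> f x)"

definition dunkl_laplacian ::
  "(real^'n) set \<Rightarrow> (real^'n \<Rightarrow> real) \<Rightarrow> (real^'n \<Rightarrow> complex) \<Rightarrow> (real^'n) \<Rightarrow> complex" where
  "dunkl_laplacian P k f x = (\<Sum>\<xi>\<in>Basis. dunkl_operator P k \<xi> (dunkl_operator P k \<xi> f) x)"


section \<open>The operator $\Delta_{k,a}$ and the Laguerre semigroup\<close>

text \<open>
  Isabelle's \<open>0 powr 0\<close> is 0 rather than 1.  This affects the density, and \<open>Delta_ka\<close>, only on the
  null set formed by the root hyperplanes and the origin.
\<close>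

definition theta :: "(real^'n) set \<Rightarrow> (real^'n \<Rightarrow> real) \<Rightarrow> real \<Rightarrow> (real^'n) \<Rightarrow> real" where
  "theta R k a x = norm x powr (a - 2) * (\<Prod>\<alpha>\<in>R. \<bar>inner \<alpha> x\<bar> powr k \<alpha>)"

definition theta_measure ::
  "(real^'n) set \<Rightarrow> (real^'n \<Rightarrow> real) \<Rightarrow> real \<Rightarrow> (real^'n) measure" where
  "theta_measure R k a = density lborel (\<lambda>x. ennreal (theta R k a x))"

definition Delta_ka ::
  "(real^'n) set \<Rightarrow> (real^'n \<Rightarrow> real) \<Rightarrow> real \<Rightarrow> (real^'n \<Rightarrow> complex) \<Rightarrow> (real^'n) \<Rightarrow> complex" where
  "Delta_ka P k a f x =
    of_real (norm x powr (2 - a)) * dunkl_laplacian P k f x - of_real (norm x powr a) * f x"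

definition homogeneous_polynomial :: "nat \<Rightarrow> (real^'n \<Rightarrow> complex) \<Rightarrow> bool" where
  "homogeneous_polynomial m p \<longleftrightarrow>
    (\<exists>c :: ('n \<Rightarrow> nat) \<Rightarrow> complex.
      p = (\<lambda>x. \<Sum>\<beta> | (\<Sum>i\<in>UNIV. \<beta> i) = m. c \<beta> * of_real (\<Prod>i\<in>UNIV. (x $ i) ^ \<beta> i)))"

definition harmonics ::
  "(real^'n) set \<Rightarrow> (real^'n \<Rightarrow> real) \<Rightarrow> nat \<Rightarrow> (real^'n \<Rightarrow> complex) set" where
  "harmonics P k m = {p. homogeneous_polynomial m p \<and> (\<forall>x. dunkl_laplacian P k p x = 0)}"

definition lambda_kam :: "(real^'n) set \<Rightarrow> (real^'n \<Rightarrow> real) \<Rightarrow> real \<Rightarrow> nat \<Rightarrow> real" where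
  "lambda_kam P k a m = (2 * real m + 2 * mult_sum P k + real CARD('n) - 2) / a"

definition laguerre :: "nat \<Rightarrow> real \<Rightarrow> real \<Rightarrow> real" where
  "laguerre l lam t =
    (\<Sum>j\<le>l. (-1) ^ j * Gamma (lam + real l + 1) / (fact (l - j) * Gamma (lam + real j + 1))
      * (t ^ j / fact j))"

definition Phi ::
  "(real^'n) set \<Rightarrow> (real^'n \<Rightarrow> real) \<Rightarrow> real \<Rightarrow> nat \<Rightarrow> nat \<Rightarrow> (real^'n \<Rightarrow> complex)
    \<Rightarrow> (real^'n) \<Rightarrow> complex" where
  "Phi P k a l m p x =
    p x * of_real (laguerre l (lambda_kam P k a m) (2 / a * norm x powr a)
      * exp (- (1 / a) * norm x powr a))"

definition complex_span :: "('x \<Rightarrow> complex) set \<Rightarrow> ('x \<Rightarrow> complex) set" where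
  "complex_span G = {f. \<exists>S c. finite S \<and> S \<subseteq> G \<and> f = (\<lambda>x. \<Sum>g\<in>S. c g * g x)}"

definition W_ka ::
  "(real^'n) set \<Rightarrow> (real^'n \<Rightarrow> real) \<Rightarrow> real \<Rightarrow> (real^'n \<Rightarrow> complex) set" where
  "W_ka P k a = complex_span {Phi P k a l m p | l m p. p \<in> harmonics P k m}"

definition Delta_ka_closed ::
  "(real^'n) set \<Rightarrow> (real^'n) set \<Rightarrow> (real^'n \<Rightarrow> real) \<Rightarrow> real \<Rightarrow> (real^'n) op_graph" where
  "Delta_ka_closed R P k a =
    op_closure (theta_measure R k a) {(f, Delta_ka P k a f) | f. f \<in> W_ka P k a}"

definition laguerre_semigroup ::
  "(real^'n) set \<Rightarrow> (real^'n) set \<Rightarrow> (real^'n \<Rightarrow> real) \<Rightarrow> real \<Rightarrow> complex \<Rightarrow> (real^'n) op_graph" where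
  "laguerre_semigroup R P k a z =
    functional_calculus (theta_measure R k a) (Delta_ka_closed R P k a)
      (\<lambda>t. exp (z / of_real a * of_real t))"

end

theory Submission
  imports Defs "HOL-Complex_Analysis.Complex_Analysis"
begin

text \<open>
  The operator $\Delta_{k,a}$ has an explicit complete system of eigenfunctions, so everything is
  read off from its eigenvalues.

  If $p$ is a harmonic polynomial of degree $m$, then $\Phi^{(a)}_\ell(p,\cdot)$ is an eigenfunction
  of $\Delta_{k,a}$ with eigenvalue $-(2a\ell + 2m + 2\langle k\rangle + N - 2 + a) < 0$
  (\<open>Phi_eigenfunction\<close>): on $p(x)\psi(\|x\|)$ the Dunkl Laplacian acts like a Laplacian in dimension
  $N + 2\langle k\rangle$, and the radial equation is that of Laguerre.  Two such functions with
  different $(\ell, m)$ are orthogonal in $L^2$ (\<open>Phi_orthogonal\<close>).  For different $m$ this is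
  Green's formula for $\Delta_k$, which rests on the antisymmetry of the Dunkl operators for the
  weight $w(x) = \prod_\alpha |\langle\alpha,x\rangle|^{k_\alpha}$ (\<open>dunkl_antisymmetric\<close>); for equal $m$ and
  different $\ell$ the moments of $e^{-c\|x\|^a}$, computed by differentiating under dilations
  (\<open>moment_recursion\<close>), reduce it to the orthogonality of Laguerre polynomials.

  The system is complete (\<open>eigenfunctions_total\<close>).  A function $f$ orthogonal to it is orthogonal
  to $h(x)\|x\|^{aj}e^{-\|x\|^a/a}$ for harmonic $h$, then, by a power series expansion, to $h$ times
  $e^{-(1/a + n/(2a))\|x\|^a}$, and by Weierstrass approximation in $u = e^{-\|x\|^a/(2a)}$ to $h$ times
  every radial function of bounded support.  Since every polynomial is a sum of terms $\|x\|^{2j}h$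
  (\<open>harmonic_decomposition\<close>), $f$ is orthogonal to all polynomials times such radial functions,
  hence $f = 0$ almost everywhere.

  Choosing an orthonormal basis $e_n$ inside the eigenspaces makes the closure of $\Delta_{k,a}$ the
  diagonal operator with the eigenvalues $\mu_n$ (\<open>closure_eq_diag\<close>); the finite combinations of
  eigenfunctions form a core, which is the essential self-adjointness.  The spectral measure of a
  diagonal operator is forced to be the diagonal one, so its functional calculus multiplies
  coefficients by $\varphi(\mu_n)$ (\<open>functional_calculus_diag\<close>).  With
  $\varphi(t) = e^{zt/a}$ all claims are statements about the numbers $e^{z\mu_n/a}$
  (\<open>diag_semigroup\<close>): they are multiplicative in $z$, entire in $z$, of modulus at most $1$ for
  $\mathrm{Re}\,z \ge 0$ and of modulus $1$ on the imaginary axis, and square summable for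
  $\mathrm{Re}\,z > 0$ because $\mu_n$ decreases linearly in $\ell$ and in the multi-index that labels the
  harmonic polynomial (\<open>summable_geometric_multiindex\<close>).
\<close>

section \<open>The space of square-integrable functions\<close>

lemma borel_measurable_cnj [measurable (raw)]:
  "f \<in> borel_measurable M \<Longrightarrow> (\<lambda>x. cnj (f x)) \<in> borel_measurable M"
  by (rule borel_measurable_continuous_on[where f = cnj]) (auto intro!: continuous_intros)

lemma sq_integrable_integrable:
  "f \<in> sq_integrable M \<Longrightarrow> integrable M (\<lambda>x. (cmod (f x))\<^sup>2)"
  by (simp add: sq_integrable_def)

lemma norm_product_le_squares: "cmod (a * b) \<le> (cmod a)\<^sup>2 + (cmod b)\<^sup>2"
proof -
  have "0 \<le> (cmod a - cmod b)\<^sup>2" by simp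
  hence "2 * (cmod a * cmod b) \<le> (cmod a)\<^sup>2 + (cmod b)\<^sup>2"
    by (simp add: power2_eq_square algebra_simps)
  moreover have "0 \<le> cmod a * cmod b" by simp
  ultimately show ?thesis unfolding norm_mult by linarith
qed

lemma norm_add_sq_le: "(cmod (a + b))\<^sup>2 \<le> 2 * (cmod a)\<^sup>2 + 2 * (cmod b)\<^sup>2"
proof -
  have "(cmod (a + b))\<^sup>2 \<le> (cmod a + cmod b)\<^sup>2"
    by (intro power_mono norm_triangle_ineq) simp
  also have "\<dots> \<le> 2 * (cmod a)\<^sup>2 + 2 * (cmod b)\<^sup>2"
    using sum_squares_ge_zero[of "cmod a - cmod b" 0] by (simp add: power2_eq_square algebra_simps)
  finally show ?thesis .
qed

lemma sq_integrable_zero [simp, intro]: "(\<lambda>x. 0) \<in> sq_integrable M"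
  by (simp add: sq_integrable_def)

lemma sq_integrable_scale [intro]:
  assumes "f \<in> sq_integrable M" shows "(\<lambda>x. c * f x) \<in> sq_integrable M"
  using assms by (auto simp: sq_integrable_def norm_mult power_mult_distrib)

lemma sq_integrable_add [intro]:
  assumes "f \<in> sq_integrable M" "g \<in> sq_integrable M"
  shows "(\<lambda>x. f x + g x) \<in> sq_integrable M"
proof -
  have [measurable]: "f \<in> borel_measurable M" "g \<in> borel_measurable M"
    using assms by (auto simp: sq_integrable_def)
  have "integrable M (\<lambda>x. 2 * (cmod (f x))\<^sup>2 + 2 * (cmod (g x))\<^sup>2)"
    using assms by (auto simp: sq_integrable_def)
  hence "integrable M (\<lambda>x. (cmod (f x + g x))\<^sup>2)"
    by (rule Bochner_Integration.integrable_bound) (auto simp: norm_add_sq_le)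
  thus ?thesis by (simp add: sq_integrable_def)
qed

lemma sq_integrable_diff [intro]:
  assumes "f \<in> sq_integrable M" "g \<in> sq_integrable M"
  shows "(\<lambda>x. f x - g x) \<in> sq_integrable M"
  using sq_integrable_add[OF assms(1) sq_integrable_scale[OF assms(2), of "-1"]] by simp

lemma sq_integrable_sum [intro]:
  assumes "\<And>i. i \<in> A \<Longrightarrow> f i \<in> sq_integrable M"
  shows "(\<lambda>x. \<Sum>i\<in>A. f i x) \<in> sq_integrable M"
  using assms by (induction A rule: infinite_finite_induct) auto

lemma integrable_l2_product [intro]:
  assumes "f \<in> sq_integrable M" "g \<in> sq_integrable M"
  shows "integrable M (\<lambda>x. f x * cnj (g x))"
proof -
  have [measurable]: "f \<in> borel_measurable M" "g \<in> borel_measurable M"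
    using assms by (auto simp: sq_integrable_def)
  have "integrable M (\<lambda>x. (cmod (f x))\<^sup>2 + (cmod (g x))\<^sup>2)"
    using assms by (auto simp: sq_integrable_def)
  thus ?thesis
  proof (rule Bochner_Integration.integrable_bound)
    show "AE x in M. norm (f x * cnj (g x)) \<le> norm ((cmod (f x))\<^sup>2 + (cmod (g x))\<^sup>2)"
      using norm_product_le_squares[of "f _" "cnj (g _)"] by simp
  qed measurable
qed

lemma l2_inner_cnj: "cnj (l2_inner M f g) = l2_inner M g f"
  unfolding l2_inner_def by (subst Bochner_Integration.integral_cnj[symmetric]) (simp add: mult.commute)

lemma l2_inner_scale_left: "l2_inner M (\<lambda>x. c * f x) g = c * l2_inner M f g"
  by (simp add: l2_inner_def mult.assoc)

lemma l2_inner_scale_right: "l2_inner M f (\<lambda>x. c * g x) = cnj c * l2_inner M f g"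
  by (simp add: l2_inner_def mult.left_commute)

lemma l2_inner_add_left:
  "\<lbrakk>f \<in> sq_integrable M; f' \<in> sq_integrable M; g \<in> sq_integrable M\<rbrakk>
    \<Longrightarrow> l2_inner M (\<lambda>x. f x + f' x) g = l2_inner M f g + l2_inner M f' g"
  by (simp add: l2_inner_def distrib_right integrable_l2_product)

lemma l2_inner_add_right:
  "\<lbrakk>f \<in> sq_integrable M; g \<in> sq_integrable M; g' \<in> sq_integrable M\<rbrakk>
    \<Longrightarrow> l2_inner M f (\<lambda>x. g x + g' x) = l2_inner M f g + l2_inner M f g'"
  by (simp add: l2_inner_def distrib_left integrable_l2_product)

lemma l2_inner_diff_left:
  "\<lbrakk>f \<in> sq_integrable M; f' \<in> sq_integrable M; g \<in> sq_integrable M\<rbrakk>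
    \<Longrightarrow> l2_inner M (\<lambda>x. f x - f' x) g = l2_inner M f g - l2_inner M f' g"
  by (simp add: l2_inner_def left_diff_distrib integrable_l2_product)

lemma l2_inner_diff_right:
  "\<lbrakk>f \<in> sq_integrable M; g \<in> sq_integrable M; g' \<in> sq_integrable M\<rbrakk>
    \<Longrightarrow> l2_inner M f (\<lambda>x. g x - g' x) = l2_inner M f g - l2_inner M f g'"
  by (simp add: l2_inner_def right_diff_distrib integrable_l2_product)

lemma l2_inner_zero_left [simp]: "l2_inner M (\<lambda>x. 0) g = 0"
  by (simp add: l2_inner_def)

lemma l2_inner_zero_right [simp]: "l2_inner M f (\<lambda>x. 0) = 0"
  by (simp add: l2_inner_def)

lemma l2_inner_sum_left:
  assumes "\<And>i. i \<in> A \<Longrightarrow> f i \<in> sq_integrable M" "g \<in> sq_integrable M"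
  shows "l2_inner M (\<lambda>x. \<Sum>i\<in>A. f i x) g = (\<Sum>i\<in>A. l2_inner M (f i) g)"
  using assms
  by (induction A rule: infinite_finite_induct) (auto simp: l2_inner_add_left sq_integrable_sum)

lemma l2_inner_sum_right:
  assumes "\<And>i. i \<in> A \<Longrightarrow> g i \<in> sq_integrable M" "f \<in> sq_integrable M"
  shows "l2_inner M f (\<lambda>x. \<Sum>i\<in>A. g i x) = (\<Sum>i\<in>A. l2_inner M f (g i))"
  using assms
  by (induction A rule: infinite_finite_induct) (auto simp: l2_inner_add_right sq_integrable_sum)

lemma l2_inner_cong_AE:
  assumes "AE x in M. f x = f' x" "AE x in M. g x = g' x"
    "f \<in> borel_measurable M" "f' \<in> borel_measurable M" "g \<in> borel_measurable M" "g' \<in> borel_measurable M"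
  shows "l2_inner M f g = l2_inner M f' g'"
  unfolding l2_inner_def using assms by (intro integral_cong_AE) auto

lemma l2_norm_nonneg [simp]: "l2_norm M f \<ge> 0"
  by (simp add: l2_norm_def)

lemma l2_norm_power2: "(l2_norm M f)\<^sup>2 = (LINT x|M. (cmod (f x))\<^sup>2)"
  by (simp add: l2_norm_def)

lemma l2_inner_self: "l2_inner M f f = complex_of_real ((l2_norm M f)\<^sup>2)"
proof -
  have "l2_inner M f f = (LINT x|M. complex_of_real ((cmod (f x))\<^sup>2))"
    unfolding l2_inner_def by (intro Bochner_Integration.integral_cong refl) (simp only: complex_norm_square)
  thus ?thesis unfolding l2_norm_power2 by (simp only: integral_complex_of_real)
qed

lemma l2_norm_scale: "l2_norm M (\<lambda>x. c * f x) = cmod c * l2_norm M f"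
  by (simp add: l2_norm_def norm_mult power_mult_distrib real_sqrt_mult)

lemma l2_norm_minus_commute: "l2_norm M (\<lambda>x. f x - g x) = l2_norm M (\<lambda>x. g x - f x)"
  by (simp add: l2_norm_def norm_minus_commute)

lemma l2_norm_cong_AE:
  assumes "AE x in M. f x = g x" "f \<in> borel_measurable M" "g \<in> borel_measurable M"
  shows "l2_norm M f = l2_norm M g"
  unfolding l2_norm_def using assms by (intro arg_cong[of _ _ sqrt] integral_cong_AE) auto

lemma l2_norm_eq_0_iff:
  assumes "f \<in> sq_integrable M"
  shows "l2_norm M f = 0 \<longleftrightarrow> (AE x in M. f x = 0)"
  unfolding l2_norm_def
  using integral_nonneg_eq_0_iff_AE[OF sq_integrable_integrable[OF assms]] by simp

lemma l2_Cauchy_Schwarz: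
  assumes "f \<in> sq_integrable M" "g \<in> sq_integrable M"
  shows "cmod (l2_inner M f g) \<le> l2_norm M f * l2_norm M g"
proof (cases "l2_norm M g = 0")
  case True
  hence "AE x in M. g x = 0" using assms l2_norm_eq_0_iff by blast
  hence "l2_inner M f g = l2_inner M f (\<lambda>x. 0)"
    using assms by (intro l2_inner_cong_AE) (auto simp: sq_integrable_def)
  thus ?thesis using True by simp
next
  case False
  define c where "c = l2_inner M f g / complex_of_real ((l2_norm M g)\<^sup>2)"
  let ?h = "\<lambda>x. f x - c * g x"
  have nz: "(complex_of_real (l2_norm M g))\<^sup>2 \<noteq> 0" using False by simp
  have "l2_inner M ?h g = l2_inner M f g - c * complex_of_real ((l2_norm M g)\<^sup>2)"
    using assms by (simp add: l2_inner_diff_left sq_integrable_scale l2_inner_scale_left l2_inner_self)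
  hence hg: "l2_inner M ?h g = 0" unfolding c_def using nz by simp
  have "l2_inner M ?h ?h = l2_inner M ?h f"
    using assms hg by (simp add: l2_inner_diff_right sq_integrable_diff sq_integrable_scale l2_inner_scale_right)
  also have "\<dots> = complex_of_real ((l2_norm M f)\<^sup>2) - c * l2_inner M g f"
    using assms by (simp add: l2_inner_diff_left sq_integrable_scale l2_inner_scale_left l2_inner_self)
  also have "c * l2_inner M g f = complex_of_real ((cmod (l2_inner M f g))\<^sup>2 / (l2_norm M g)\<^sup>2)"
    unfolding c_def
    by (subst l2_inner_cnj[symmetric]) (simp only: times_divide_eq_left of_real_divide complex_norm_square)
  finally have "complex_of_real ((l2_norm M ?h)\<^sup>2)
      = complex_of_real ((l2_norm M f)\<^sup>2 - (cmod (l2_inner M f g))\<^sup>2 / (l2_norm M g)\<^sup>2)"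
    by (simp only: l2_inner_self of_real_diff)
  hence "(l2_norm M ?h)\<^sup>2 = (l2_norm M f)\<^sup>2 - (cmod (l2_inner M f g))\<^sup>2 / (l2_norm M g)\<^sup>2"
    by (simp only: of_real_eq_iff)
  moreover have "0 \<le> (l2_norm M ?h)\<^sup>2" by simp
  ultimately have "(cmod (l2_inner M f g))\<^sup>2 / (l2_norm M g)\<^sup>2 \<le> (l2_norm M f)\<^sup>2" by linarith
  hence "(cmod (l2_inner M f g))\<^sup>2 \<le> (l2_norm M f * l2_norm M g)\<^sup>2"
    using False by (simp add: field_simps power_mult_distrib)
  thus ?thesis by (rule power2_le_imp_le) simp
qed

lemma l2_norm_triangle:
  assumes "f \<in> sq_integrable M" "g \<in> sq_integrable M"
  shows "l2_norm M (\<lambda>x. f x + g x) \<le> l2_norm M f + l2_norm M g"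
proof -
  have "complex_of_real ((l2_norm M (\<lambda>x. f x + g x))\<^sup>2)
      = complex_of_real ((l2_norm M f)\<^sup>2) + (l2_inner M f g + cnj (l2_inner M f g)) + complex_of_real ((l2_norm M g)\<^sup>2)"
    using assms
    by (simp add: l2_inner_self[symmetric] l2_inner_add_left l2_inner_add_right sq_integrable_add l2_inner_cnj
        del: of_real_power)
  hence "(l2_norm M (\<lambda>x. f x + g x))\<^sup>2 = (l2_norm M f)\<^sup>2 + 2 * Re (l2_inner M f g) + (l2_norm M g)\<^sup>2"
    by (subst (asm) complex_add_cnj) (simp only: of_real_add[symmetric] of_real_eq_iff)
  also have "\<dots> \<le> (l2_norm M f)\<^sup>2 + 2 * (l2_norm M f * l2_norm M g) + (l2_norm M g)\<^sup>2"
    using l2_Cauchy_Schwarz[OF assms] complex_Re_le_cmod[of "l2_inner M f g"] by linarith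
  also have "\<dots> = (l2_norm M f + l2_norm M g)\<^sup>2" by (simp add: power2_eq_square algebra_simps)
  finally show ?thesis by (rule power2_le_imp_le) simp
qed

lemma l2_inner_tendsto:
  assumes "\<And>n. u n \<in> sq_integrable M" "f \<in> sq_integrable M" "g \<in> sq_integrable M"
    and lim: "(\<lambda>n. l2_norm M (\<lambda>x. u n x - f x)) \<longlonglongrightarrow> 0"
  shows "(\<lambda>n. l2_inner M (u n) g) \<longlonglongrightarrow> l2_inner M f g"
proof -
  have "(\<lambda>n. l2_norm M (\<lambda>x. u n x - f x) * l2_norm M g) \<longlonglongrightarrow> 0"
    using tendsto_mult_right[OF lim] by simp
  hence "(\<lambda>n. l2_inner M (\<lambda>x. u n x - f x) g) \<longlonglongrightarrow> 0"
    by (rule Lim_null_comparison[rotated])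
       (use assms l2_Cauchy_Schwarz[of "\<lambda>x. u _ x - f x" M g] in \<open>auto intro!: always_eventually\<close>)
  hence "(\<lambda>n. l2_inner M (u n) g - l2_inner M f g) \<longlonglongrightarrow> 0"
    using assms by (simp add: l2_inner_diff_left)
  thus ?thesis by (simp add: Lim_null[symmetric] LIM_zero_iff)
qed

text \<open>
  Completeness of $L^2$ (Riesz and Fischer).  Along a subsequence whose consecutive differences
  $u_k$ satisfy $\|u_k\|^2 \le 8^{-k}$, the function $\sum_k 2^k |u_k|^2$ is integrable, hence finite
  almost everywhere, and $2 |u_k| \le 2^k |u_k|^2 + 2^{-k}$ then gives pointwise convergence;
  Fatou's lemma identifies the pointwise limit as the limit in norm.
\<close>

lemma l2_complete:
  assumes S: "\<And>n. S n \<in> sq_integrable M"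
    and cauchy: "\<And>\<epsilon>. \<epsilon> > 0 \<Longrightarrow> \<exists>N. \<forall>m\<ge>N. \<forall>n\<ge>N. (l2_norm M (\<lambda>x. S m x - S n x))\<^sup>2 \<le> \<epsilon>"
  shows "\<exists>f\<in>sq_integrable M. (\<lambda>n. l2_norm M (\<lambda>x. S n x - f x)) \<longlonglongrightarrow> 0"
proof -
  have [measurable]: "\<And>n. S n \<in> borel_measurable M" using S by (simp add: sq_integrable_def)
  have "\<exists>N. \<forall>k. (\<forall>m\<ge>N k. \<forall>n\<ge>N k. (l2_norm M (\<lambda>x. S m x - S n x))\<^sup>2 \<le> (1/8)^k)"
    by (rule choice) (use cauchy in auto)
  then obtain N0 where N0: "\<And>k m n. m \<ge> N0 k \<Longrightarrow> n \<ge> N0 k \<Longrightarrow> (l2_norm M (\<lambda>x. S m x - S n x))\<^sup>2 \<le> (1/8)^k"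
    by blast
  \<comment> \<open>$N_k$ is nondecreasing and at least $k$ and the threshold for the bound $8^{-k}$\<close>
  define N where "N k = k + (\<Sum>j\<le>k. N0 j)" for k
  have NN0: "N0 k \<le> N k" for k
    unfolding N_def using member_le_sum[of k "{..k}" N0] by force
  have Nmono: "N k \<le> N (Suc k)" for k by (simp add: N_def)
  have Nk: "k \<le> N k" for k by (simp add: N_def)
  define u where "u k x = S (N (Suc k)) x - S (N k) x" for k x
  have uS: "u k \<in> sq_integrable M" for k unfolding u_def using S by auto
  hence [measurable]: "\<And>k. u k \<in> borel_measurable M" by (simp add: sq_integrable_def)
  have un: "(l2_norm M (u k))\<^sup>2 \<le> (1/8)^k" for k
    unfolding u_def using N0[of k "N (Suc k)" "N k"] NN0[of k] Nmono[of k] by auto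
  have nn: "(\<integral>\<^sup>+x. ennreal (2^k * (cmod (u k x))\<^sup>2) \<partial>M) \<le> ennreal ((1/4)^k)" for k
  proof -
    have "(\<integral>\<^sup>+x. ennreal (2^k * (cmod (u k x))\<^sup>2) \<partial>M) = ennreal (LINT x|M. 2^k * (cmod (u k x))\<^sup>2)"
      using sq_integrable_integrable[OF uS[of k]] by (intro nn_integral_eq_integral) auto
    also have "\<dots> = ennreal (2^k * (l2_norm M (u k))\<^sup>2)" by (simp add: l2_norm_power2)
    also have "\<dots> \<le> ennreal (2^k * (1/8)^k)" using un[of k] by (intro ennreal_leI mult_left_mono) auto
    also have "(2::real)^k * (1/8)^k = (1/4)^k" by (simp flip: power_mult_distrib)
    finally show ?thesis .
  qed
  have "(\<integral>\<^sup>+x. (\<Sum>k. ennreal (2^k * (cmod (u k x))\<^sup>2)) \<partial>M) = (\<Sum>k. \<integral>\<^sup>+x. ennreal (2^k * (cmod (u k x))\<^sup>2) \<partial>M)"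
    by (rule nn_integral_suminf) measurable
  also have "\<dots> \<le> (\<Sum>k. ennreal ((1/4)^k))" by (intro suminf_le nn) auto
  also have "\<dots> = ennreal (\<Sum>k. (1/4)^k)" by (rule suminf_ennreal2) auto
  finally have "(\<integral>\<^sup>+x. (\<Sum>k. ennreal (2^k * (cmod (u k x))\<^sup>2)) \<partial>M) \<noteq> \<infinity>" by (auto simp: top_unique)
  hence "AE x in M. (\<Sum>k. ennreal (2^k * (cmod (u k x))\<^sup>2)) \<noteq> \<infinity>"
    by (intro nn_integral_noteq_infinite) auto
  hence ae: "AE x in M. convergent (\<lambda>k. S (N k) x)"
  proof eventually_elim
    case (elim x)
    hence s1: "summable (\<lambda>k. 2^k * (cmod (u k x))\<^sup>2)"
      by (intro summable_suminf_not_top) auto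
    have "summable (\<lambda>k. 2^k * (cmod (u k x))\<^sup>2 + (1/2)^k)"
      by (intro summable_add s1 summable_geometric) simp
    hence "summable (\<lambda>k. u k x)"
    proof (rule summable_comparison_test[rotated], intro exI allI impI)
      fix k :: nat
      have "0 \<le> 2^k * (cmod (u k x) - (1/2)^k)\<^sup>2" by simp
      also have "\<dots> = 2^k * (cmod (u k x))\<^sup>2 + (1/2)^k - 2 * cmod (u k x)"
      proof -
        define q where "q = (1/2::real)^k"
        have q: "(2::real)^k * q = 1" unfolding q_def by (simp flip: power_mult_distrib)
        have "2^k * (cmod (u k x) - q)\<^sup>2 = 2^k * (cmod (u k x))\<^sup>2 - 2 * cmod (u k x) * (2^k * q) + (2^k * q) * q"
          by (simp add: power2_eq_square algebra_simps)
        also have "\<dots> = 2^k * (cmod (u k x))\<^sup>2 + q - 2 * cmod (u k x)" unfolding q by simp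
        finally show ?thesis unfolding q_def .
      qed
      finally show "norm (u k x) \<le> 2^k * (cmod (u k x))\<^sup>2 + (1/2)^k" 
        using norm_ge_zero[of "u k x"] by linarith
    qed
    hence "convergent (\<lambda>n. \<Sum>k<n. u k x)" by (simp add: summable_iff_convergent)
    moreover have "(\<Sum>k<n. u k x) = S (N n) x - S (N 0) x" for n
      unfolding u_def by (rule sum_lessThan_telescope)
    ultimately have "convergent (\<lambda>n. S (N n) x - S (N 0) x)" by simp
    hence "convergent (\<lambda>n. (S (N n) x - S (N 0) x) + S (N 0) x)" by (intro convergent_add convergent_const)
    thus ?case by simp
  qed
  define f where "f x = lim (\<lambda>k. S (N k) x)" for x
  have fm[measurable]: "f \<in> borel_measurable M" unfolding f_def by measurable
  have ptw: "AE x in M. (\<lambda>k. S (N k) x) \<longlonglongrightarrow> f x"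
    using ae by eventually_elim (simp add: f_def convergent_LIMSEQ_iff)
  have fatou: "(\<integral>\<^sup>+x. ennreal ((cmod (S n x - f x))\<^sup>2) \<partial>M) \<le> ennreal \<epsilon>"
    if n: "\<And>m. m \<ge> n0 \<Longrightarrow> (l2_norm M (\<lambda>x. S n x - S m x))\<^sup>2 \<le> \<epsilon>" for n n0 \<epsilon>
  proof -
    have "(\<integral>\<^sup>+x. ennreal ((cmod (S n x - f x))\<^sup>2) \<partial>M)
        = (\<integral>\<^sup>+x. liminf (\<lambda>k. ennreal ((cmod (S n x - S (N k) x))\<^sup>2)) \<partial>M)"
    proof (rule nn_integral_cong_AE, use ptw in eventually_elim)
      case (elim x)
      have "(\<lambda>k. ennreal ((cmod (S n x - S (N k) x))\<^sup>2)) \<longlonglongrightarrow> ennreal ((cmod (S n x - f x))\<^sup>2)"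
        by (intro tendsto_ennrealI tendsto_power tendsto_norm tendsto_diff tendsto_const elim)
      from lim_imp_Liminf[OF _ this] show ?case by simp
    qed
    also have "\<dots> \<le> liminf (\<lambda>k. \<integral>\<^sup>+x. ennreal ((cmod (S n x - S (N k) x))\<^sup>2) \<partial>M)"
      by (rule nn_integral_liminf) measurable
    also have "\<dots> \<le> liminf (\<lambda>k. ennreal \<epsilon>)"
    proof (rule Liminf_mono, rule eventually_sequentiallyI[of n0])
      fix k assume "n0 \<le> k"
      hence "N k \<ge> n0" using Nk[of k] by linarith
      have "(\<integral>\<^sup>+x. ennreal ((cmod (S n x - S (N k) x))\<^sup>2) \<partial>M) = ennreal (LINT x|M. (cmod (S n x - S (N k) x))\<^sup>2)"
        using S by (intro nn_integral_eq_integral sq_integrable_integrable sq_integrable_diff) auto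
      thus "(\<integral>\<^sup>+x. ennreal ((cmod (S n x - S (N k) x))\<^sup>2) \<partial>M) \<le> ennreal \<epsilon>"
        using n[OF \<open>N k \<ge> n0\<close>] by (simp add: l2_norm_power2 ennreal_leI)
    qed
    finally show ?thesis by (simp add: Liminf_const)
  qed
  have diffL2: "(\<lambda>x. S n x - f x) \<in> sq_integrable M \<and> (l2_norm M (\<lambda>x. S n x - f x))\<^sup>2 \<le> \<epsilon>"
    if "\<epsilon> > 0" "\<And>m. m \<ge> n0 \<Longrightarrow> (l2_norm M (\<lambda>x. S n x - S m x))\<^sup>2 \<le> \<epsilon>" for n n0 \<epsilon>
  proof -
    note F = fatou[OF that(2)]
    have I: "integrable M (\<lambda>x. (cmod (S n x - f x))\<^sup>2)"
      by (rule integrableI_nonneg) (use le_less_trans[OF F ennreal_less_top] in auto)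
    hence "ennreal ((l2_norm M (\<lambda>x. S n x - f x))\<^sup>2) \<le> ennreal \<epsilon>"
      using F by (simp add: nn_integral_eq_integral l2_norm_power2)
    thus ?thesis using I \<open>\<epsilon> > 0\<close> by (simp add: sq_integrable_def)
  qed
  obtain n1 where n1: "\<forall>m\<ge>n1. \<forall>n\<ge>n1. (l2_norm M (\<lambda>x. S m x - S n x))\<^sup>2 \<le> 1" using cauchy[of 1] by auto
  have "(\<lambda>x. S n1 x - f x) \<in> sq_integrable M" using diffL2[of 1 n1 n1] n1 by auto
  from sq_integrable_diff[OF S[of n1] this] have fL2: "f \<in> sq_integrable M" by simp
  moreover have "(\<lambda>n. l2_norm M (\<lambda>x. S n x - f x)) \<longlonglongrightarrow> 0"
  proof (rule LIMSEQ_I)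
    fix r :: real assume r: "r > 0"
    obtain n0 where n0: "\<forall>m\<ge>n0. \<forall>n\<ge>n0. (l2_norm M (\<lambda>x. S m x - S n x))\<^sup>2 \<le> (r/2)\<^sup>2"
      using cauchy[of "(r/2)\<^sup>2"] r by auto
    show "\<exists>no. \<forall>n\<ge>no. norm (l2_norm M (\<lambda>x. S n x - f x) - 0) < r"
    proof (intro exI allI impI)
      fix n assume "n \<ge> n0"
      hence "(l2_norm M (\<lambda>x. S n x - f x))\<^sup>2 \<le> (r/2)\<^sup>2" using diffL2[of "(r/2)\<^sup>2" n0 n] n0 r by auto
      hence "l2_norm M (\<lambda>x. S n x - f x) \<le> r/2" by (rule power2_le_imp_le) (use r in simp)
      thus "norm (l2_norm M (\<lambda>x. S n x - f x) - 0) < r" using r by simp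
    qed
  qed
  ultimately show ?thesis by blast
qed

section \<open>Orthonormal systems and diagonal operators\<close>

text \<open>
  The vectors of norm $0$ are permitted because the Gram--Schmidt process below produces them
  whenever a vector depends on its predecessors; the vectors of norm $1$ form the orthonormal basis.
\<close>

locale diagonal_system =
  fixes M :: "'x measure" and e :: "nat \<Rightarrow> 'x \<Rightarrow> complex" and \<mu> :: "nat \<Rightarrow> real"
  assumes e_L2: "e n \<in> sq_integrable M"
    and e_orth: "m \<noteq> n \<Longrightarrow> l2_inner M (e m) (e n) = 0"
    and e_norm: "l2_norm M (e n) = 0 \<or> l2_norm M (e n) = 1"
    and e_total: "f \<in> sq_integrable M \<Longrightarrow> (\<And>n. l2_inner M f (e n) = 0) \<Longrightarrow> AE x in M. f x = 0"
begin

definition coeff :: "('x \<Rightarrow> complex) \<Rightarrow> nat \<Rightarrow> complex" where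
  "coeff f n = l2_inner M f (e n)"

lemma coeff_null:
  assumes "f \<in> sq_integrable M" "l2_norm M (e n) = 0" shows "coeff f n = 0"
  using l2_Cauchy_Schwarz[OF assms(1) e_L2[of n]] assms(2) by (simp add: coeff_def)

lemma coeff_add: "\<lbrakk>f \<in> sq_integrable M; g \<in> sq_integrable M\<rbrakk>
    \<Longrightarrow> coeff (\<lambda>x. f x + g x) n = coeff f n + coeff g n"
  by (simp add: coeff_def l2_inner_add_left e_L2)

lemma coeff_diff: "\<lbrakk>f \<in> sq_integrable M; g \<in> sq_integrable M\<rbrakk>
    \<Longrightarrow> coeff (\<lambda>x. f x - g x) n = coeff f n - coeff g n"
  by (simp add: coeff_def l2_inner_diff_left e_L2)

lemma coeff_scale: "coeff (\<lambda>x. c * f x) n = c * coeff f n"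
  by (simp add: coeff_def l2_inner_scale_left)

lemma coeff_e: "coeff (e m) n = (if m = n then complex_of_real ((l2_norm M (e n))\<^sup>2) else 0)"
  by (auto simp: coeff_def e_orth l2_inner_self)

lemma AE_eq_of_coeff_eq:
  assumes "f \<in> sq_integrable M" "g \<in> sq_integrable M" "\<And>n. coeff f n = coeff g n"
  shows "AE x in M. f x = g x"
proof -
  have "AE x in M. f x - g x = 0"
    using assms coeff_diff[OF assms(1,2)] by (intro e_total) (auto simp: coeff_def)
  thus ?thesis by simp
qed

lemma coeff_cong_AE:
  assumes "AE x in M. f x = g x" "f \<in> sq_integrable M" "g \<in> sq_integrable M"
  shows "coeff f n = coeff g n"
  unfolding coeff_def using assms e_L2[of n]
  by (intro l2_inner_cong_AE) (auto simp: sq_integrable_def)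

lemma combination_L2: "(\<lambda>x. \<Sum>n\<in>A. c n * e n x) \<in> sq_integrable M"
  using e_L2 by (intro sq_integrable_sum sq_integrable_scale)

lemma coeff_combination:
  assumes "finite A"
  shows "coeff (\<lambda>x. \<Sum>n\<in>A. c n * e n x) m = (if m \<in> A then c m * complex_of_real ((l2_norm M (e m))\<^sup>2) else 0)"
proof -
  have "coeff (\<lambda>x. \<Sum>n\<in>A. c n * e n x) m = (\<Sum>n\<in>A. c n * coeff (e n) m)"
    unfolding coeff_def using e_L2 by (simp add: l2_inner_sum_left sq_integrable_scale l2_inner_scale_left)
  also have "\<dots> = (\<Sum>n\<in>A. if n = m then c m * complex_of_real ((l2_norm M (e m))\<^sup>2) else 0)"
    by (intro sum.cong refl) (auto simp: coeff_e)
  finally show ?thesis using assms by simp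
qed

lemma norm_combination:
  assumes "finite A"
  shows "(l2_norm M (\<lambda>x. \<Sum>n\<in>A. c n * e n x))\<^sup>2 = (\<Sum>n\<in>A. (cmod (c n))\<^sup>2 * (l2_norm M (e n))\<^sup>2)"
proof -
  let ?S = "\<lambda>x. \<Sum>n\<in>A. c n * e n x"
  have "complex_of_real ((l2_norm M ?S)\<^sup>2) = (\<Sum>n\<in>A. cnj (c n) * coeff ?S n)"
    unfolding l2_inner_self[symmetric] coeff_def
    using e_L2 by (subst l2_inner_sum_right) (auto simp: combination_L2 l2_inner_scale_right intro: sq_integrable_scale)
  also have "\<dots> = (\<Sum>n\<in>A. complex_of_real ((cmod (c n))\<^sup>2 * (l2_norm M (e n))\<^sup>2))"
    using assms by (intro sum.cong refl)
      (simp only: coeff_combination if_True complex_norm_square of_real_mult mult.assoc mult.commute mult.left_commute)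
  finally show ?thesis by (simp only: of_real_sum[symmetric] of_real_eq_iff)
qed

text \<open>
  By Pythagoras the partial sums are Cauchy.  A null vector $e_n$ has vanishing coefficient against
  every function, so only sequences with $c_n = 0$ there can be coefficient sequences.
\<close>

lemma riesz_fischer:
  assumes c: "summable (\<lambda>n. (cmod (c n))\<^sup>2)" and null: "\<And>n. l2_norm M (e n) = 0 \<Longrightarrow> c n = 0"
  shows "\<exists>f\<in>sq_integrable M. (\<forall>n. coeff f n = c n) \<and>
    (\<lambda>N. l2_norm M (\<lambda>x. (\<Sum>n<N. c n * e n x) - f x)) \<longlonglongrightarrow> 0"
proof -
  define S where "S N x = (\<Sum>n<N. c n * e n x)" for N x
  have SL2: "S N \<in> sq_integrable M" for N unfolding S_def by (rule combination_L2)
  have diff: "(l2_norm M (\<lambda>x. S m x - S n x))\<^sup>2 \<le> (\<Sum>i\<in>{n..<m}. (cmod (c i))\<^sup>2)" if "n \<le> m" for m n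
  proof -
    have "S m x - S n x = (\<Sum>i\<in>{n..<m}. c i * e i x)" for x
      unfolding S_def lessThan_atLeast0 using sum_diff_nat_ivl[OF le0 that] by simp
    hence "(l2_norm M (\<lambda>x. S m x - S n x))\<^sup>2 = (\<Sum>i\<in>{n..<m}. (cmod (c i))\<^sup>2 * (l2_norm M (e i))\<^sup>2)"
      by (simp add: norm_combination)
    also have "\<dots> \<le> (\<Sum>i\<in>{n..<m}. (cmod (c i))\<^sup>2)"
    proof (intro sum_mono)
      fix i show "(cmod (c i))\<^sup>2 * (l2_norm M (e i))\<^sup>2 \<le> (cmod (c i))\<^sup>2" using e_norm[of i] by auto
    qed
    finally show ?thesis .
  qed
  have "\<exists>f\<in>sq_integrable M. (\<lambda>n. l2_norm M (\<lambda>x. S n x - f x)) \<longlonglongrightarrow> 0"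
  proof (rule l2_complete[OF SL2])
    fix \<epsilon> :: real assume "\<epsilon> > 0"
    then obtain N where N: "\<And>m n. m \<ge> N \<Longrightarrow> norm (\<Sum>i\<in>{m..<n}. (cmod (c i))\<^sup>2) < \<epsilon>"
      using c unfolding summable_Cauchy by blast
    have "(l2_norm M (\<lambda>x. S m x - S n x))\<^sup>2 \<le> \<epsilon>" if "N \<le> m" "N \<le> n" for m n
    proof (cases "n \<le> m")
      case True
      thus ?thesis using diff[OF True] N[OF that(2), of m] by (smt (verit) real_norm_def)
    next
      case False
      hence "(l2_norm M (\<lambda>x. S n x - S m x))\<^sup>2 \<le> norm (\<Sum>i\<in>{m..<n}. (cmod (c i))\<^sup>2)"
        using diff[of m n] by (simp add: sum_nonneg)
      thus ?thesis using N[OF that(1), of n] by (simp only: l2_norm_minus_commute[of M "S m" "S n"])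
    qed
    thus "\<exists>N. \<forall>m\<ge>N. \<forall>n\<ge>N. (l2_norm M (\<lambda>x. S m x - S n x))\<^sup>2 \<le> \<epsilon>" by blast
  qed
  then obtain f where f: "f \<in> sq_integrable M" "(\<lambda>n. l2_norm M (\<lambda>x. S n x - f x)) \<longlonglongrightarrow> 0" by blast
  have "coeff f n = c n" for n
  proof -
    have "(\<lambda>N. coeff (S N) n) \<longlonglongrightarrow> coeff f n"
      unfolding coeff_def by (rule l2_inner_tendsto[OF SL2 f(1) e_L2 f(2)])
    moreover have "eventually (\<lambda>N. coeff (S N) n = c n) sequentially"
    proof (rule eventually_sequentiallyI[of "Suc n"])
      fix N assume "Suc n \<le> N"
      thus "coeff (S N) n = c n"
        unfolding S_def using e_norm[of n] null[of n] by (subst coeff_combination) auto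
    qed
    ultimately show ?thesis by (metis LIMSEQ_unique tendsto_eventually)
  qed
  thus ?thesis using f unfolding S_def by blast
qed

lemma bessel:
  assumes f: "f \<in> sq_integrable M"
  shows "summable (\<lambda>n. (cmod (coeff f n))\<^sup>2)"
proof (rule summableI_nonneg_bounded)
  fix N :: nat
  let ?S = "\<lambda>x. \<Sum>n<N. coeff f n * e n x"
  have S: "?S \<in> sq_integrable M" by (rule combination_L2)
  have nrm: "(l2_norm M ?S)\<^sup>2 = (\<Sum>n<N. (cmod (coeff f n))\<^sup>2)"
    using e_norm coeff_null[OF f] by (auto simp: norm_combination intro!: sum.cong) (metis mult_1_right power_one mult_zero_left norm_zero zero_power2)
  have "l2_inner M f ?S = (\<Sum>n<N. cnj (coeff f n) * coeff f n)"
    using e_L2 f by (subst l2_inner_sum_right) (auto simp: l2_inner_scale_right coeff_def intro: sq_integrable_scale)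
  also have "\<dots> = complex_of_real (\<Sum>n<N. (cmod (coeff f n))\<^sup>2)"
    by (simp only: complex_norm_square of_real_sum mult.commute)
  finally have "cmod (l2_inner M f ?S) = (l2_norm M ?S)\<^sup>2"
    unfolding nrm by (simp add: sum_nonneg del: of_real_sum)
  hence "(l2_norm M ?S)\<^sup>2 \<le> l2_norm M f * l2_norm M ?S"
    using l2_Cauchy_Schwarz[OF f S] by simp
  hence "l2_norm M ?S \<le> l2_norm M f"
    using l2_norm_nonneg[of M ?S] l2_norm_nonneg[of M f] 
    by (cases "l2_norm M ?S = 0") (auto simp: power2_eq_square)
  hence "(l2_norm M ?S)\<^sup>2 \<le> (l2_norm M f)\<^sup>2" by (intro power_mono) auto
  thus "(\<Sum>n<N. (cmod (coeff f n))\<^sup>2) \<le> (l2_norm M f)\<^sup>2" by (simp add: nrm)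
qed auto

lemma fourier_expansion:
  assumes f: "f \<in> sq_integrable M"
  shows "(\<lambda>N. l2_norm M (\<lambda>x. (\<Sum>n<N. coeff f n * e n x) - f x)) \<longlonglongrightarrow> 0"
proof -
  obtain g where g: "g \<in> sq_integrable M" "\<And>n. coeff g n = coeff f n"
    "(\<lambda>N. l2_norm M (\<lambda>x. (\<Sum>n<N. coeff f n * e n x) - g x)) \<longlonglongrightarrow> 0"
    using riesz_fischer[OF bessel[OF f] coeff_null[OF f]] by auto
  have ae: "AE x in M. g x = f x" using AE_eq_of_coeff_eq[OF g(1) f] g(2) by blast
  have "l2_norm M (\<lambda>x. (\<Sum>n<N. coeff f n * e n x) - g x) = l2_norm M (\<lambda>x. (\<Sum>n<N. coeff f n * e n x) - f x)" for N
  proof (rule l2_norm_cong_AE)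
    show "AE x in M. (\<Sum>n<N. coeff f n * e n x) - g x = (\<Sum>n<N. coeff f n * e n x) - f x"
      using ae by eventually_elim simp
    have "(\<lambda>x. \<Sum>n<N. coeff f n * e n x) \<in> sq_integrable M" by (rule combination_L2)
    from sq_integrable_diff[OF this g(1)] sq_integrable_diff[OF this f]
    show "(\<lambda>x. (\<Sum>n<N. coeff f n * e n x) - g x) \<in> borel_measurable M"
      "(\<lambda>x. (\<Sum>n<N. coeff f n * e n x) - f x) \<in> borel_measurable M"
      by (auto simp: sq_integrable_def)
  qed
  thus ?thesis using g(3) by simp
qed

lemma parseval_sums:
  assumes f: "f \<in> sq_integrable M" and g: "g \<in> sq_integrable M"
  shows "(\<lambda>n. coeff f n * cnj (coeff g n)) sums l2_inner M f g"
proof -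
  have "(\<lambda>N. l2_inner M (\<lambda>x. \<Sum>n<N. coeff f n * e n x) g) \<longlonglongrightarrow> l2_inner M f g"
    by (rule l2_inner_tendsto[OF combination_L2 f g fourier_expansion[OF f]])
  moreover have "l2_inner M (\<lambda>x. \<Sum>n<N. coeff f n * e n x) g = (\<Sum>n<N. coeff f n * cnj (coeff g n))" for N
    using e_L2 g by (subst l2_inner_sum_left)
      (auto simp: l2_inner_scale_left coeff_def l2_inner_cnj intro: sq_integrable_scale)
  ultimately show ?thesis by (simp add: sums_def)
qed

lemma parseval_integrable:
  assumes f: "f \<in> sq_integrable M" and g: "g \<in> sq_integrable M"
  shows "integrable (count_space UNIV) (\<lambda>n. coeff f n * cnj (coeff g n))"
proof -
  have "summable (\<lambda>n. (cmod (coeff f n))\<^sup>2 + (cmod (coeff g n))\<^sup>2)"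
    by (intro summable_add bessel f g)
  hence "summable (\<lambda>n. norm (coeff f n * cnj (coeff g n)))"
    by (rule summable_comparison_test[rotated])
       (use norm_product_le_squares[of "coeff f _" "cnj (coeff g _)"] in auto)
  thus ?thesis by (simp add: integrable_count_space_nat_iff)
qed

lemma parseval:
  assumes f: "f \<in> sq_integrable M" and g: "g \<in> sq_integrable M"
  shows "l2_inner M f g = (LINT n|count_space UNIV. coeff f n * cnj (coeff g n))"
  using sums_unique2[OF parseval_sums[OF f g] sums_integral_count_space_nat[OF parseval_integrable[OF f g]]] .

lemma parseval_norm:
  assumes f: "f \<in> sq_integrable M"
  shows "(l2_norm M f)\<^sup>2 = (LINT n|count_space UNIV. (cmod (coeff f n))\<^sup>2)"
proof -
  have "complex_of_real ((l2_norm M f)\<^sup>2) = (LINT n|count_space UNIV. complex_of_real ((cmod (coeff f n))\<^sup>2))"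
    unfolding l2_inner_self[symmetric] parseval[OF f f] by (simp only: complex_norm_square)
  also have "\<dots> = complex_of_real (LINT n|count_space UNIV. (cmod (coeff f n))\<^sup>2)"
    by (rule integral_complex_of_real)
  finally show ?thesis by (simp only: of_real_eq_iff)
qed

text \<open>
  For unbounded $\varphi$ the square integrability of $g$ is the domain condition
  $\sum_n |\varphi(\mu_n)\,(f,e_n)|^2 < \infty$ on $f$.
\<close>

definition diag :: "(real \<Rightarrow> complex) \<Rightarrow> 'x op_graph" where
  "diag \<phi> = {(f, g). f \<in> sq_integrable M \<and> g \<in> sq_integrable M \<and>
    (\<forall>n. coeff g n = \<phi> (\<mu> n) * coeff f n)}"

lemma diag_everywhere:
  assumes bd: "\<And>n. cmod (\<phi> (\<mu> n)) \<le> C" and f: "f \<in> sq_integrable M"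
  shows "\<exists>g. (f, g) \<in> diag \<phi>"
proof -
  have "summable (\<lambda>n. C\<^sup>2 * (cmod (coeff f n))\<^sup>2)" by (intro summable_mult bessel f)
  hence "summable (\<lambda>n. (cmod (\<phi> (\<mu> n) * coeff f n))\<^sup>2)"
  proof (rule summable_comparison_test[rotated], intro exI allI impI)
    fix n :: nat
    show "norm ((cmod (\<phi> (\<mu> n) * coeff f n))\<^sup>2) \<le> C\<^sup>2 * (cmod (coeff f n))\<^sup>2"
      using bd[of n] by (simp add: norm_mult power_mult_distrib mult_right_mono power_mono)
  qed
  then obtain g where "g \<in> sq_integrable M" "\<And>n. coeff g n = \<phi> (\<mu> n) * coeff f n"
    using riesz_fischer[of "\<lambda>n. \<phi> (\<mu> n) * coeff f n"] coeff_null[OF f] by auto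
  thus ?thesis using f by (auto simp: diag_def)
qed

lemma diag_linear:
  assumes bd: "\<And>n. cmod (\<phi> (\<mu> n)) \<le> C"
  shows "everywhere_defined_linear M (diag \<phi>)"
  unfolding everywhere_defined_linear_def
proof (intro conjI allI impI ballI)
  show "diag \<phi> \<subseteq> sq_integrable M \<times> sq_integrable M" by (auto simp: diag_def)
  show "\<exists>g. (f, g) \<in> diag \<phi>" if "f \<in> sq_integrable M" for f by (rule diag_everywhere[where \<phi> = \<phi>, OF bd that])
  show "(\<lambda>x. c * f x + f' x, \<lambda>x. c * g x + g' x) \<in> diag \<phi>"
    if "(f, g) \<in> diag \<phi>" "(f', g') \<in> diag \<phi>" for f g f' g' c
    using that by (auto simp: diag_def coeff_add coeff_scale sq_integrable_add sq_integrable_scale algebra_simps)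
qed

lemma diag_bounded:
  assumes bd: "\<And>n. cmod (\<phi> (\<mu> n)) \<le> C"
  shows "bounded_operator M (diag \<phi>)"
  unfolding bounded_operator_def
proof (intro conjI exI ballI)
  show "everywhere_defined_linear M (diag \<phi>)" by (rule diag_linear[where \<phi> = \<phi>, OF bd])
  fix p assume "p \<in> diag \<phi>"
  then obtain f g where p: "p = (f, g)" and f: "f \<in> sq_integrable M" and g: "g \<in> sq_integrable M"
    and fg: "\<And>n. coeff g n = \<phi> (\<mu> n) * coeff f n" by (auto simp: diag_def)
  have C: "C \<ge> 0" using bd[of 0] norm_ge_zero order_trans by blast
  have "(l2_norm M g)\<^sup>2 \<le> (LINT n|count_space UNIV. C\<^sup>2 * (cmod (coeff f n))\<^sup>2)"
    unfolding parseval_norm[OF g]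
  proof (rule integral_mono)
    show "integrable (count_space UNIV) (\<lambda>n. (cmod (coeff g n))\<^sup>2)"
      "integrable (count_space UNIV) (\<lambda>n. C\<^sup>2 * (cmod (coeff f n))\<^sup>2)"
      using bessel[OF f] bessel[OF g] by (auto simp: integrable_count_space_nat_iff summable_mult)
    show "(cmod (coeff g n))\<^sup>2 \<le> C\<^sup>2 * (cmod (coeff f n))\<^sup>2" for n
      using bd[of n] by (simp add: fg norm_mult power_mult_distrib mult_right_mono power_mono)
  qed
  also have "\<dots> = (C * l2_norm M f)\<^sup>2" by (simp add: parseval_norm[OF f] power_mult_distrib)
  finally have "l2_norm M g \<le> C * l2_norm M f" by (rule power2_le_imp_le) (use C in simp)
  thus "case p of (f, g) \<Rightarrow> l2_norm M g \<le> C * l2_norm M f" by (simp add: p)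
qed

lemma diag_app:
  assumes bd: "\<And>n. cmod (\<phi> (\<mu> n)) \<le> C" and f: "f \<in> sq_integrable M"
  shows "op_app (diag \<phi>) f \<in> sq_integrable M" "coeff (op_app (diag \<phi>) f) n = \<phi> (\<mu> n) * coeff f n"
proof -
  have "(f, op_app (diag \<phi>) f) \<in> diag \<phi>"
    unfolding op_app_def using diag_everywhere[where \<phi> = \<phi>, OF bd f] by (rule someI_ex)
  thus "op_app (diag \<phi>) f \<in> sq_integrable M" "coeff (op_app (diag \<phi>) f) n = \<phi> (\<mu> n) * coeff f n"
    by (auto simp: diag_def)
qed

lemma basis: "orthonormal_basis M (e ` {n. l2_norm M (e n) = 1})"
  and inj_basis: "inj_on e {n. l2_norm M (e n) = 1}"
proof -
  show inj: "inj_on e {n. l2_norm M (e n) = 1}"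
  proof (rule inj_onI)
    fix m n assume *: "m \<in> {n. l2_norm M (e n) = 1}" "n \<in> {n. l2_norm M (e n) = 1}" "e m = e n"
    show "m = n"
    proof (rule ccontr)
      assume "m \<noteq> n"
      hence "l2_inner M (e m) (e m) = 0" using e_orth[of m n] *(3) by simp
      thus False using *(1) by (simp add: l2_inner_self)
    qed
  qed
  show "orthonormal_basis M (e ` {n. l2_norm M (e n) = 1})"
    unfolding orthonormal_basis_def
  proof (intro conjI ballI impI)
    show "e ` {n. l2_norm M (e n) = 1} \<subseteq> sq_integrable M" using e_L2 by auto
    show "l2_inner M u v = (if u = v then 1 else 0)"
      if uv: "u \<in> e ` {n. l2_norm M (e n) = 1}" "v \<in> e ` {n. l2_norm M (e n) = 1}" for u v
    proof -
      obtain m n where mn: "u = e m" "v = e n" "l2_norm M (e m) = 1" "l2_norm M (e n) = 1" using uv by blast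
      show ?thesis
      proof (cases "u = v")
        case True thus ?thesis using mn by (simp add: l2_inner_self)
      next
        case False thus ?thesis using mn e_orth[of m n] by auto
      qed
    qed
    show "AE x in M. f x = 0" if "f \<in> sq_integrable M" "\<forall>u\<in>e ` {n. l2_norm M (e n) = 1}. l2_inner M f u = 0" for f
      using that e_norm coeff_null[OF that(1)] by (intro e_total) (auto simp: coeff_def)
  qed
qed

lemma diag_hilbert_schmidt:
  assumes bd: "\<And>n. cmod (\<phi> (\<mu> n)) \<le> C" and s: "summable (\<lambda>n. (cmod (\<phi> (\<mu> n)))\<^sup>2)"
  shows "hilbert_schmidt M (diag \<phi>)"
  unfolding hilbert_schmidt_def
proof (intro conjI exI)
  let ?I = "{n. l2_norm M (e n) = 1}"
  show "bounded_operator M (diag \<phi>)" by (rule diag_bounded[where \<phi> = \<phi>, OF bd])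
  show "orthonormal_basis M (e ` ?I)" by (rule basis)
  have "(l2_norm M (op_app (diag \<phi>) (e n)))\<^sup>2 = (cmod (\<phi> (\<mu> n)))\<^sup>2" if "n \<in> ?I" for n
  proof -
    have cf: "coeff (op_app (diag \<phi>) (e n)) m = (if m \<in> {n} then \<phi> (\<mu> n) else 0)" for m
      using diag_app(2)[where \<phi> = \<phi>, OF bd e_L2[of n], of m] that by (simp add: coeff_e)
    have "(\<lambda>m. (cmod (coeff (op_app (diag \<phi>) (e n)) m))\<^sup>2) sums (l2_norm M (op_app (diag \<phi>) (e n)))\<^sup>2"
      unfolding parseval_norm[OF diag_app(1)[where \<phi> = \<phi>, OF bd e_L2]]
      using bessel[OF diag_app(1)[where \<phi> = \<phi>, OF bd e_L2[of n]]]
      by (intro sums_integral_count_space_nat) (simp add: integrable_count_space_nat_iff)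
    moreover have "(\<lambda>m. (cmod (coeff (op_app (diag \<phi>) (e n)) m))\<^sup>2) sums (\<Sum>m\<in>{n}. (cmod (coeff (op_app (diag \<phi>) (e n)) m))\<^sup>2)"
      by (rule sums_finite) (auto simp: cf)
    ultimately show ?thesis using sums_unique2 by (fastforce simp: cf)
  qed
  hence "((\<lambda>u. (l2_norm M (op_app (diag \<phi>) u))\<^sup>2) \<circ> e) summable_on ?I \<longleftrightarrow> (\<lambda>n. (cmod (\<phi> (\<mu> n)))\<^sup>2) summable_on ?I"
    by (intro summable_on_cong) auto
  moreover have "(\<lambda>n. (cmod (\<phi> (\<mu> n)))\<^sup>2) summable_on ?I"
    by (rule summable_on_subset[of _ UNIV]) (use s in \<open>auto intro!: norm_summable_imp_summable_on\<close>)
  ultimately show "(\<lambda>u. (l2_norm M (op_app (diag \<phi>) u))\<^sup>2) summable_on e ` ?I"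
    by (simp add: summable_on_reindex[OF inj_basis])
qed

lemma diag_comp:
  assumes bd: "\<And>n. cmod (\<phi> (\<mu> n)) \<le> C" and eq: "\<And>n. \<omega> (\<mu> n) = \<psi> (\<mu> n) * \<phi> (\<mu> n)"
  shows "diag \<phi> O diag \<psi> = diag \<omega>"
proof (intro equalityI subsetI)
  fix p assume "p \<in> diag \<phi> O diag \<psi>"
  thus "p \<in> diag \<omega>" by (auto simp: diag_def eq mult.assoc)
next
  fix p assume "p \<in> diag \<omega>"
  then obtain f h where p: "p = (f, h)" and f: "f \<in> sq_integrable M" and h: "h \<in> sq_integrable M"
    and fh: "\<And>n. coeff h n = \<omega> (\<mu> n) * coeff f n" by (auto simp: diag_def)
  obtain g where g: "(f, g) \<in> diag \<phi>" using diag_everywhere[where \<phi> = \<phi>, OF bd f] by blast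
  hence "(g, h) \<in> diag \<psi>" using h fh by (auto simp: diag_def eq)
  thus "p \<in> diag \<phi> O diag \<psi>" using g p by auto
qed

lemma diag_unitary:
  assumes one: "\<And>n. cmod (\<phi> (\<mu> n)) = 1"
  shows "unitary_operator M (diag \<phi>)"
  unfolding unitary_operator_def
proof (intro conjI ballI)
  have bd: "cmod (\<phi> (\<mu> n)) \<le> 1" for n by (simp add: one)
  show "everywhere_defined_linear M (diag \<phi>)" by (rule diag_linear[where \<phi> = \<phi>, OF bd])
  fix p assume p: "p \<in> diag \<phi>"
  show "case p of (f, g) \<Rightarrow> \<forall>(f', g')\<in>diag \<phi>. l2_inner M g g' = l2_inner M f f'"
  proof (clarify)
    fix f g f' g' assume "p = (f, g)" "(f', g') \<in> diag \<phi>"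
    with p have L: "f \<in> sq_integrable M" "g \<in> sq_integrable M" "f' \<in> sq_integrable M" "g' \<in> sq_integrable M"
      and c: "\<And>n. coeff g n = \<phi> (\<mu> n) * coeff f n" "\<And>n. coeff g' n = \<phi> (\<mu> n) * coeff f' n" by (auto simp: diag_def)
    have "\<phi> (\<mu> n) * cnj (\<phi> (\<mu> n)) = 1" for n
      using complex_norm_square[of "\<phi> (\<mu> n)"] one[of n] by simp
    moreover have "coeff g n * cnj (coeff g' n)
        = (\<phi> (\<mu> n) * cnj (\<phi> (\<mu> n))) * (coeff f n * cnj (coeff f' n))" for n
      by (simp add: c)
    ultimately have "coeff g n * cnj (coeff g' n) = coeff f n * cnj (coeff f' n)" for n by simp
    thus "l2_inner M g g' = l2_inner M f f'" using L by (simp add: parseval)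
  qed
next
  fix g assume g: "g \<in> sq_integrable M"
  have "cmod (1 / \<phi> (\<mu> n)) \<le> 1" for n by (simp add: one norm_divide)
  from diag_everywhere[of "\<lambda>t. 1 / \<phi> t", OF this g] obtain f where f: "f \<in> sq_integrable M"
    "\<And>n. coeff f n = 1 / \<phi> (\<mu> n) * coeff g n" by (auto simp: diag_def)
  have "\<phi> (\<mu> n) \<noteq> 0" for n using one[of n] by auto
  hence "(f, g) \<in> diag \<phi>" using f g by (auto simp: diag_def)
  thus "\<exists>f. (f, g) \<in> diag \<phi>" by blast
qed

lemma diag_identity:
  assumes one: "\<And>n. \<phi> (\<mu> n) = 1"
  shows "diag \<phi> = op_identity M"
proof (intro equalityI subsetI)
  fix p assume "p \<in> diag \<phi>"
  thus "p \<in> op_identity M" using AE_eq_of_coeff_eq by (auto simp: diag_def op_identity_def one)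
next
  fix p assume "p \<in> op_identity M"
  thus "p \<in> diag \<phi>" using coeff_cong_AE by (fastforce simp: diag_def op_identity_def one)
qed

text \<open>
  By Parseval this is dominated convergence for the series of squared coefficients
  $|\varphi_s(\mu_n) - \varphi_t(\mu_n)|^2\,|(f,e_n)|^2 \le 4\,|(f,e_n)|^2$.
\<close>

lemma diag_strongly_continuous:
  fixes \<Phi> :: "real \<Rightarrow> real \<Rightarrow> complex"
  assumes bd: "\<And>s n. cmod (\<Phi> s (\<mu> n)) \<le> 1" and cont: "\<And>n. ((\<lambda>s. \<Phi> s (\<mu> n)) \<longlongrightarrow> \<Phi> t (\<mu> n)) (at t)"
    and f: "f \<in> sq_integrable M"
  shows "((\<lambda>s. l2_norm M (\<lambda>x. op_app (diag (\<Phi> s)) f x - op_app (diag (\<Phi> t)) f x)) \<longlongrightarrow> 0) (at t)"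
  unfolding tendsto_at_iff_sequentially comp_def
proof (intro allI impI)
  fix X :: "nat \<Rightarrow> real" assume X: "\<forall>i. X i \<in> UNIV - {t}" "X \<longlonglongrightarrow> t"
  let ?d = "\<lambda>i x. op_app (diag (\<Phi> (X i))) f x - op_app (diag (\<Phi> t)) f x"
  have sq: "(l2_norm M (?d i))\<^sup>2 = (LINT n|count_space UNIV. (cmod ((\<Phi> (X i) (\<mu> n) - \<Phi> t (\<mu> n)) * coeff f n))\<^sup>2)" for i
    by (subst parseval_norm) (auto simp: coeff_diff diag_app[where \<phi> = "\<Phi> s" for s, OF bd f] left_diff_distrib sq_integrable_diff)
  have "(\<lambda>i. LINT n|count_space UNIV. (cmod ((\<Phi> (X i) (\<mu> n) - \<Phi> t (\<mu> n)) * coeff f n))\<^sup>2)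
      \<longlonglongrightarrow> (LINT n|count_space (UNIV::nat set). 0)"
  proof (rule integral_dominated_convergence[where w = "\<lambda>n. 4 * (cmod (coeff f n))\<^sup>2"])
    show "integrable (count_space UNIV) (\<lambda>n. 4 * (cmod (coeff f n))\<^sup>2)"
      using bessel[OF f] by (simp add: integrable_count_space_nat_iff)
    show "AE n in count_space UNIV. (\<lambda>i. (cmod ((\<Phi> (X i) (\<mu> n) - \<Phi> t (\<mu> n)) * coeff f n))\<^sup>2) \<longlonglongrightarrow> 0"
    proof (rule AE_I2)
      fix n :: nat
      have "(\<lambda>i. \<Phi> (X i) (\<mu> n)) \<longlonglongrightarrow> \<Phi> t (\<mu> n)"
        using cont[of n] X unfolding tendsto_at_iff_sequentially comp_def by blast
      hence "(\<lambda>i. (cmod ((\<Phi> (X i) (\<mu> n) - \<Phi> t (\<mu> n)) * coeff f n))\<^sup>2) \<longlonglongrightarrow> (cmod ((\<Phi> t (\<mu> n) - \<Phi> t (\<mu> n)) * coeff f n))\<^sup>2"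
        by (intro tendsto_intros)
      thus "(\<lambda>i. (cmod ((\<Phi> (X i) (\<mu> n) - \<Phi> t (\<mu> n)) * coeff f n))\<^sup>2) \<longlonglongrightarrow> 0" by simp
    qed
    show "AE n in count_space UNIV. norm ((cmod ((\<Phi> (X i) (\<mu> n) - \<Phi> t (\<mu> n)) * coeff f n))\<^sup>2) \<le> 4 * (cmod (coeff f n))\<^sup>2" for i
    proof (rule AE_I2)
      fix n :: nat
      have "cmod (\<Phi> (X i) (\<mu> n) - \<Phi> t (\<mu> n)) \<le> 2"
        using norm_triangle_ineq4[of "\<Phi> (X i) (\<mu> n)" "\<Phi> t (\<mu> n)"] bd[of "X i" n] bd[of t n] by linarith
      hence "(cmod (\<Phi> (X i) (\<mu> n) - \<Phi> t (\<mu> n)))\<^sup>2 \<le> 2\<^sup>2" by (intro power_mono) auto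
      thus "norm ((cmod ((\<Phi> (X i) (\<mu> n) - \<Phi> t (\<mu> n)) * coeff f n))\<^sup>2) \<le> 4 * (cmod (coeff f n))\<^sup>2"
        by (simp add: norm_mult power_mult_distrib mult_right_mono)
    qed
  qed auto
  hence "(\<lambda>i. (l2_norm M (?d i))\<^sup>2) \<longlonglongrightarrow> 0" unfolding sq by simp
  hence "(\<lambda>i. sqrt ((l2_norm M (?d i))\<^sup>2)) \<longlonglongrightarrow> sqrt 0" by (rule tendsto_real_sqrt)
  thus "(\<lambda>i. l2_norm M (?d i)) \<longlonglongrightarrow> 0" by simp
qed

end

section \<open>Spectral measures\<close>

lemma pvm_L2: "\<lbrakk>projection_valued_measure M E; B \<in> sets borel; f \<in> sq_integrable M\<rbrakk> \<Longrightarrow> E B f \<in> sq_integrable M"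
  by (simp add: projection_valued_measure_def)

lemma pvm_sym: "\<lbrakk>projection_valued_measure M E; B \<in> sets borel; f \<in> sq_integrable M; g \<in> sq_integrable M\<rbrakk>
    \<Longrightarrow> l2_inner M (E B f) g = l2_inner M f (E B g)"
  by (simp add: projection_valued_measure_def)

lemma pvm_Int:
  assumes E: "projection_valued_measure M E" and A: "A \<in> sets borel" and B: "B \<in> sets borel"
    and f: "f \<in> sq_integrable M" and g: "g \<in> sq_integrable M"
  shows "l2_inner M (E A (E B f)) g = l2_inner M (E (A \<inter> B) f) g"
proof (rule l2_inner_cong_AE)
  have "AE x in M. E (A \<inter> B) f x = E A (E B f) x"
    using E A B f by (simp add: projection_valued_measure_def)
  thus "AE x in M. E A (E B f) x = E (A \<inter> B) f x" by eventually_elim simp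
  have "E A (E B f) \<in> sq_integrable M" "E (A \<inter> B) f \<in> sq_integrable M"
    using pvm_L2[OF E] A B f by auto
  thus "E A (E B f) \<in> borel_measurable M" "E (A \<inter> B) f \<in> borel_measurable M"
    by (auto simp: sq_integrable_def)
qed (use g in \<open>auto simp: sq_integrable_def\<close>)

lemma pvm_UNIV:
  assumes E: "projection_valued_measure M E" and f: "f \<in> sq_integrable M" and g: "g \<in> sq_integrable M"
  shows "l2_inner M (E UNIV f) g = l2_inner M f g"
proof (rule l2_inner_cong_AE)
  show "AE x in M. E UNIV f x = f x" using E f by (simp add: projection_valued_measure_def)
  show "E UNIV f \<in> borel_measurable M" using pvm_L2[OF E _ f, of UNIV] by (simp add: sq_integrable_def)
qed (use f g in \<open>auto simp: sq_integrable_def\<close>)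

lemma pvm_sums:
  assumes "projection_valued_measure M E" "range B \<subseteq> sets borel" "disjoint_family B"
    "f \<in> sq_integrable M" "g \<in> sq_integrable M"
  shows "(\<lambda>i. l2_inner M (E (B i) f) g) sums l2_inner M (E (\<Union>i. B i) f) g"
  using assms unfolding projection_valued_measure_def by blast

lemma pvm_quadratic:
  assumes E: "projection_valued_measure M E" and B: "B \<in> sets borel" and f: "f \<in> sq_integrable M"
  shows "l2_inner M (E B f) f = complex_of_real ((l2_norm M (E B f))\<^sup>2)"
proof -
  have "l2_inner M (E B f) (E B f) = l2_inner M (E B (E B f)) f"
    using pvm_sym[OF E B pvm_L2[OF E B f] f] by simp
  also have "\<dots> = l2_inner M (E B f) f" using pvm_Int[OF E B B f f] by simp
  finally show ?thesis by (simp only: l2_inner_self)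
qed

lemma pvm_empty:
  assumes E: "projection_valued_measure M E" and f: "f \<in> sq_integrable M" and g: "g \<in> sq_integrable M"
  shows "l2_inner M (E {} f) g = 0"
proof -
  have "(\<lambda>i::nat. l2_inner M (E {} f) g) sums l2_inner M (E {} f) g"
    using pvm_sums[OF E _ _ f g, of "\<lambda>_. {}"] by (simp add: disjoint_family_on_def)
  hence "summable (\<lambda>i::nat. l2_inner M (E {} f) g)" by (simp add: sums_iff)
  thus ?thesis by (simp add: summable_const_iff)
qed

lemma emeasure_spectral_distribution:
  assumes E: "projection_valued_measure M E" and f: "f \<in> sq_integrable M" and B: "B \<in> sets borel"
  shows "emeasure (spectral_distribution M E f) B = ennreal (Re (l2_inner M (E B f) f))"
proof (rule emeasure_measure_of[OF spectral_distribution_def])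
  show "positive (sets (spectral_distribution M E f)) (\<lambda>B. ennreal (Re (l2_inner M (E B f) f)))"
    by (simp add: positive_def pvm_empty[OF E f f])
  have sets_sd: "sets (spectral_distribution M E f) = sets borel"
    unfolding spectral_distribution_def by (metis sets.sigma_sets_eq sets_measure_of sets.space_closed space_borel)
  show "countably_additive (sets (spectral_distribution M E f)) (\<lambda>B. ennreal (Re (l2_inner M (E B f) f)))"
    unfolding countably_additive_def sets_sd
  proof (intro allI impI)
    fix A :: "nat \<Rightarrow> real set" assume A: "range A \<subseteq> sets borel" "disjoint_family A"
    from sums_Re[OF pvm_sums[OF E A f f]]
    show "(\<Sum>i. ennreal (Re (l2_inner M (E (A i) f) f))) = ennreal (Re (l2_inner M (E (\<Union>i. A i) f) f))"
      using A by (intro suminf_ennreal_eq) (auto simp: pvm_quadratic[OF E _ f])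
  qed
  show "B \<in> sets (spectral_distribution M E f)" using B sets_sd by simp
qed simp

lemma sets_spectral_distribution [simp, measurable_cong]:
  "sets (spectral_distribution M E f) = sets borel"
  unfolding spectral_distribution_def by (metis sets.sigma_sets_eq sets_measure_of sets.space_closed space_borel)

lemma space_spectral_distribution [simp]: "space (spectral_distribution M E f) = UNIV"
  using sets_eq_imp_space_eq[OF sets_spectral_distribution] by simp

lemma spectral_distribution_eqI:
  assumes N: "sets N = sets borel"
    and eq: "\<And>B. B \<in> sets borel \<Longrightarrow> emeasure N B = ennreal (Re (l2_inner M (E B f) f))"
  shows "spectral_distribution M E f = N"
proof -
  have "spectral_distribution M E f = measure_of UNIV (sets borel) (emeasure N)"
    unfolding spectral_distribution_def
    by (rule measure_of_eq) (auto simp: eq sets.sigma_sets_eq[where M = "borel::real measure", simplified])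
  also have "\<dots> = N" using measure_of_of_measure[of N] N sets_eq_imp_space_eq[OF N] by simp
  finally show ?thesis .
qed

lemma finite_spectral_distribution:
  assumes E: "projection_valued_measure M E" and f: "f \<in> sq_integrable M"
  shows "finite_measure (spectral_distribution M E f)"
  by (rule finite_measureI) (simp add: emeasure_spectral_distribution[OF E f])

lemma measure_spectral_distribution:
  assumes E: "projection_valued_measure M E" and f: "f \<in> sq_integrable M" and B: "B \<in> sets borel"
  shows "measure (spectral_distribution M E f) B = Re (l2_inner M (E B f) f)"
  unfolding measure_def emeasure_spectral_distribution[OF E f B]
  using pvm_quadratic[OF E B f] by simp

text \<open>
  The four vectors $f + i^n E(B)f$ of the polarization formula have spectral distributions with
  explicit densities relative to that of $f$, because $E(A)E(B) = E(A \cap B)$.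
\<close>

lemma spectral_distribution_perturbed:
  assumes E: "projection_valued_measure M E" and f: "f \<in> sq_integrable M" and B: "B \<in> sets borel"
    and c: "cmod c = 1" and d: "d = 1 + 2 * Re c"
  shows "spectral_distribution M E (\<lambda>x. f x + c * E B f x)
    = density (spectral_distribution M E f) (\<lambda>t. ennreal (1 + d * indicator B t))"
proof (rule spectral_distribution_eqI)
  let ?\<nu> = "spectral_distribution M E f" and ?u = "\<lambda>x. f x + c * E B f x"
  interpret finite_measure ?\<nu> by (rule finite_spectral_distribution[OF E f])
  fix A :: "real set" assume A: "A \<in> sets borel"
  have Bm[measurable]: "B \<in> sets borel" by (rule B)
  have Am[measurable]: "A \<in> sets borel" by (rule A)
  note L = pvm_L2[OF E]
  have AB: "A \<inter> B \<in> sets borel" using A B by blast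
  define z where "z = l2_inner M (E (A \<inter> B) f) f"
  have u: "?u \<in> sq_integrable M" using f L[OF B f] by (intro sq_integrable_add sq_integrable_scale)
  have z1: "l2_inner M (E A (E B f)) f = z" using pvm_Int[OF E A B f f] by (simp add: z_def)
  have z2: "l2_inner M (E A f) (E B f) = z"
    using pvm_sym[OF E B L[OF A f] f] pvm_Int[OF E B A f f] by (simp add: z_def Int_commute)
  have z3: "l2_inner M (E A (E B f)) (E B f) = z"
  proof -
    have "l2_inner M (E A (E B f)) (E B f) = l2_inner M (E (A \<inter> B) f) (E B f)"
      by (rule pvm_Int[OF E A B f L[OF B f]])
    also have "\<dots> = l2_inner M (E B (E (A \<inter> B) f)) f" using pvm_sym[OF E B L[OF AB f] f] by simp
    also have "\<dots> = z" using pvm_Int[OF E B AB f f] by (simp add: z_def Int_commute Int_left_commute)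
    finally show ?thesis .
  qed
  have "l2_inner M (E A ?u) ?u = l2_inner M ?u (E A ?u)" by (rule pvm_sym[OF E A u u])
  also have "\<dots> = l2_inner M f (E A ?u) + c * l2_inner M (E B f) (E A ?u)"
    using f L[OF B f] L[OF A u] by (simp add: l2_inner_add_left sq_integrable_scale l2_inner_scale_left)
  also have "\<dots> = l2_inner M (E A f) ?u + c * l2_inner M (E A (E B f)) ?u"
    using pvm_sym[OF E A f u] pvm_sym[OF E A L[OF B f] u] by simp
  also have "\<dots> = (l2_inner M (E A f) f + cnj c * z) + c * (z + cnj c * z)"
    using f L[OF B f] L[OF A f] L[OF A L[OF B f]]
    by (simp add: l2_inner_add_right sq_integrable_scale l2_inner_scale_right z1 z2 z3)
  also have "\<dots> = l2_inner M (E A f) f + (c + cnj c + c * cnj c) * z" by (simp add: algebra_simps)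
  also have "c + cnj c + c * cnj c = complex_of_real d"
    using complex_norm_square[of c] by (simp add: complex_add_cnj c d)
  finally have eq: "Re (l2_inner M (E A ?u) ?u) = measure ?\<nu> A + d * measure ?\<nu> (A \<inter> B)"
    by (simp add: measure_spectral_distribution[OF E f] A AB z_def)
  have dge: "0 \<le> 1 + d" using complex_Re_le_cmod[of "-c"] c by (simp add: d)
  have "emeasure (density ?\<nu> (\<lambda>t. ennreal (1 + d * indicator B t))) A
      = (\<integral>\<^sup>+t. ennreal ((1 + d * indicator B t) * indicator A t) \<partial>?\<nu>)"
    by (subst emeasure_density) (auto intro!: nn_integral_cong simp: indicator_def)
  also have "\<dots> = ennreal (LINT t|?\<nu>. indicator A t + d * indicator (A \<inter> B) t)"
  proof (subst nn_integral_eq_integral[symmetric])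
    show "integrable ?\<nu> (\<lambda>t. indicator A t + d * indicator (A \<inter> B) t)"
      by (intro Bochner_Integration.integrable_add integrable_mult_right integrable_real_indicator)
         (auto simp: less_top[symmetric])
  qed (use dge in \<open>auto intro!: nn_integral_cong AE_I2 simp: indicator_def\<close>)
  also have "(LINT t|?\<nu>. indicator A t + d * indicator (A \<inter> B) t) = measure ?\<nu> A + d * measure ?\<nu> (A \<inter> B)"
    by (subst Bochner_Integration.integral_add) (auto simp: less_top[symmetric])
  finally show "emeasure (density ?\<nu> (\<lambda>t. ennreal (1 + d * indicator B t))) A
      = ennreal (Re (l2_inner M (E A ?u) ?u))" by (simp add: eq)
qed simp

lemma spectral_distribution_projected:
  assumes E: "projection_valued_measure M E" and f: "f \<in> sq_integrable M" and B: "B \<in> sets borel"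
  shows "spectral_distribution M E (E B f) = density (spectral_distribution M E f) (\<lambda>t. ennreal (indicator B t))"
proof (rule spectral_distribution_eqI)
  fix A :: "real set" assume A: "A \<in> sets borel"
  have Bm[measurable]: "B \<in> sets borel" by (rule B)
  have Am[measurable]: "A \<in> sets borel" by (rule A)
  have AB: "A \<inter> B \<in> sets borel" using A B by blast
  note L = pvm_L2[OF E]
  have "l2_inner M (E A (E B f)) (E B f) = l2_inner M (E (A \<inter> B) f) (E B f)"
    by (rule pvm_Int[OF E A B f L[OF B f]])
  also have "\<dots> = l2_inner M (E B (E (A \<inter> B) f)) f" using pvm_sym[OF E B L[OF AB f] f] by simp
  also have "\<dots> = l2_inner M (E (A \<inter> B) f) f" using pvm_Int[OF E B AB f f] by (simp add: Int_commute Int_left_commute)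
  finally have "ennreal (Re (l2_inner M (E A (E B f)) (E B f))) = emeasure (spectral_distribution M E f) (A \<inter> B)"
    by (simp add: emeasure_spectral_distribution[OF E f AB])
  moreover have "emeasure (density (spectral_distribution M E f) (\<lambda>t. ennreal (indicator B t))) A
      = (\<integral>\<^sup>+t. indicator (A \<inter> B) t \<partial>spectral_distribution M E f)"
    by (subst emeasure_density, simp, simp, intro nn_integral_cong) (auto simp: indicator_def)
  ultimately show "emeasure (density (spectral_distribution M E f) (\<lambda>t. ennreal (indicator B t))) A
      = ennreal (Re (l2_inner M (E A (E B f)) (E B f)))" by simp
qed simp

lemma polarization:
  "(\<Sum>n<4. \<i> ^ n * complex_of_real ((cmod (a + \<i> ^ n * b))\<^sup>2)) / 4 = a * cnj b"
proof -
  have "{..<4::nat} = {0, 1, 2, 3}" by auto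
  thus ?thesis by (simp only: complex_norm_square) (simp add: power3_eq_cube power2_eq_square algebra_simps)
qed

context diagonal_system
begin

text \<open>
  A spectral measure is diagonal as soon as its identity function integrates to the diagonal
  operator: testing $(\int t\,dE) e_n = \mu_n e_n$ against $E(B)e_n$ gives
  $\mu_n \nu(B) = \int_B t\,d\nu(t)$ for the distribution $\nu$ of $e_n$.  Taking for $B$ the two open
  half-lines with end point $\mu_n$ shows that $\nu$ is concentrated at $\mu_n$.
\<close>

lemma pvm_diagonal:
  assumes E: "projection_valued_measure M E" and A: "spectral_integral M E complex_of_real = diag complex_of_real"
    and B: "B \<in> sets borel" and f: "f \<in> sq_integrable M"
  shows "coeff (E B f) n = indicator B (\<mu> n) * coeff f n"
proof -
  define \<nu> where "\<nu> = spectral_distribution M E (e n)"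
  interpret \<nu>: finite_measure \<nu> unfolding \<nu>_def by (rule finite_spectral_distribution[OF E e_L2])
  have sets\<nu>[measurable_cong]: "sets \<nu> = sets borel" by (simp add: \<nu>_def)
  have "(e n, \<lambda>x. complex_of_real (\<mu> n) * e n x) \<in> diag complex_of_real"
    by (auto simp: diag_def e_L2 sq_integrable_scale coeff_scale coeff_e)
  hence dom: "e n \<in> spectral_domain M E complex_of_real" and
    test: "\<And>h. h \<in> spectral_domain M E complex_of_real \<Longrightarrow>
      l2_inner M (\<lambda>x. complex_of_real (\<mu> n) * e n x) h =
        (\<Sum>k<4. \<i> ^ k * (LINT t|spectral_distribution M E (\<lambda>x. e n x + \<i> ^ k * h x). complex_of_real t)) / 4"
    unfolding A[symmetric] by (auto simp: spectral_integral_def)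
  have int2: "integrable \<nu> (\<lambda>t. t\<^sup>2)" using dom by (simp add: spectral_domain_def \<nu>_def)
  have int1: "integrable \<nu> (\<lambda>t. t)"
  proof (rule Bochner_Integration.integrable_bound)
    show "integrable \<nu> (\<lambda>t. 1 + t\<^sup>2)" using int2 by simp
    have "\<bar>t\<bar> \<le> 1 + t\<^sup>2" for t :: real
    proof -
      have "0 \<le> (\<bar>t\<bar> - 1)\<^sup>2" by simp
      thus ?thesis by (simp add: power2_diff)
    qed
    thus "AE t in \<nu>. norm t \<le> norm (1 + t\<^sup>2)" by (intro AE_I2) simp
  qed simp
  have moment: "\<mu> n * measure \<nu> X = (LINT t|\<nu>. indicator X t * t)" if X[measurable]: "X \<in> sets borel" for X
  proof -
    let ?I = "LINT t|\<nu>. t" and ?IX = "LINT t|\<nu>. indicator X t * t"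
    have intX: "integrable \<nu> (\<lambda>t. indicator X t * t)"
      using integrable_mult_indicator[of X \<nu> "\<lambda>t. t"] int1 X by (simp add: sets\<nu>)
    have intX2: "integrable \<nu> (\<lambda>t. indicator X t * t\<^sup>2)"
      using integrable_mult_indicator[of X \<nu> "\<lambda>t. t\<^sup>2"] int2 X by (simp add: sets\<nu>)
    have EL: "E X (e n) \<in> sq_integrable M" by (rule pvm_L2[OF E X e_L2])
    have "E X (e n) \<in> spectral_domain M E complex_of_real"
      unfolding spectral_domain_def using EL intX2
      by (simp add: spectral_distribution_projected[OF E e_L2 X] \<nu>_def[symmetric])
         (subst integrable_density, auto)
    note T = test[OF this]
    have P: "(LINT t|spectral_distribution M E (\<lambda>x. e n x + \<i> ^ k * E X (e n) x). complex_of_real t)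
        = complex_of_real (?I + (1 + 2 * Re (\<i> ^ k)) * ?IX)" for k
    proof -
      define d where "d = 1 + 2 * Re (\<i> ^ k)"
      have c1: "cmod (\<i> ^ k) = 1" by (simp add: norm_power)
      have dge: "0 \<le> 1 + d" using complex_Re_le_cmod[of "- (\<i> ^ k)"] c1 by (simp add: d_def)
      have "(LINT t|spectral_distribution M E (\<lambda>x. e n x + \<i> ^ k * E X (e n) x). complex_of_real t)
          = (LINT t|\<nu>. (1 + d * indicator X t) *\<^sub>R complex_of_real t)"
        unfolding spectral_distribution_perturbed[OF E e_L2 X c1 d_def] \<nu>_def[symmetric]
        using dge by (intro integral_density) (auto simp: indicator_def)
      also have "\<dots> = (LINT t|\<nu>. complex_of_real (t + d * (indicator X t * t)))"
        by (intro Bochner_Integration.integral_cong refl) (auto simp: scaleR_conv_of_real algebra_simps)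
      also have "\<dots> = complex_of_real (LINT t|\<nu>. t + d * (indicator X t * t))" by (rule integral_complex_of_real)
      also have "(LINT t|\<nu>. t + d * (indicator X t * t)) = ?I + d * ?IX"
        using int1 intX by simp
      finally show ?thesis by (simp add: d_def)
    qed
    have four: "{..<4::nat} = {0, 1, 2, 3}" by auto
    have "(\<Sum>k<4. \<i> ^ k * complex_of_real (?I + (1 + 2 * Re (\<i> ^ k)) * ?IX)) / 4 = complex_of_real ?IX"
      by (simp add: four power3_eq_cube power2_eq_square algebra_simps)
    hence "l2_inner M (\<lambda>x. complex_of_real (\<mu> n) * e n x) (E X (e n)) = complex_of_real ?IX"
      unfolding T P .
    moreover have "l2_inner M (e n) (E X (e n)) = complex_of_real (measure \<nu> X)"
      using pvm_sym[OF E X e_L2 e_L2, of n n] pvm_quadratic[OF E X e_L2, of n]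
        measure_spectral_distribution[OF E e_L2 X, of n]
      unfolding \<nu>_def by (metis Re_complex_of_real)
    ultimately show ?thesis by (simp add: l2_inner_scale_left flip: of_real_mult)
  qed
  \<comment> \<open>the sign of $s$ selects the half-line; on it $s\,(t - \mu_n)$ is positive, but has integral $0$\<close>
  have half: "measure \<nu> X = 0" if X[measurable]: "X \<in> sets borel" and s: "s \<noteq> 0" "\<And>t. t \<in> X \<Longrightarrow> 0 < s * (t - \<mu> n)" for X s
  proof -
    have intX: "integrable \<nu> (\<lambda>t. indicator X t * t)" "integrable \<nu> (\<lambda>t. indicator X t :: real)"
      using integrable_mult_indicator[of X \<nu> "\<lambda>t. t"] int1 X
        integrable_mult_indicator[of X \<nu> "\<lambda>t. 1::real"] by (simp_all add: sets\<nu>)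
    have "(LINT t|\<nu>. s * (indicator X t * t - \<mu> n * indicator X t)) = 0"
      using moment[OF X] intX X by (simp add: sets\<nu> sets_eq_imp_space_eq[OF sets\<nu>])
    moreover have "0 \<le> s * (indicator X t * t - \<mu> n * indicator X t)" for t
      using s(2)[of t] by (cases "t \<in> X") (auto simp: right_diff_distrib)
    moreover have "integrable \<nu> (\<lambda>t. s * (indicator X t * t - \<mu> n * indicator X t))" using intX by simp
    ultimately have "AE t in \<nu>. s * (indicator X t * t - \<mu> n * indicator X t) = 0"
      using integral_nonneg_eq_0_iff_AE[of \<nu> "\<lambda>t. s * (indicator X t * t - \<mu> n * indicator X t)"] by simp
    hence "AE t in \<nu>. t \<notin> X"
    proof eventually_elim
      case (elim t) show ?case using s(2)[of t] elim by (auto simp: right_diff_distrib)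
    qed
    thus ?thesis using AE_iff_measurable[of X \<nu> "\<lambda>t. t \<notin> X"] X by (simp add: sets\<nu> sets_eq_imp_space_eq[OF sets\<nu>] measure_def)
  qed
  \<comment> \<open>$\nu$ lives on $\{\mu_n\}$\<close>
  have off: "measure \<nu> X = 0" if X: "X \<in> sets borel" "\<mu> n \<notin> X" for X
  proof -
    have "measure \<nu> X \<le> measure \<nu> ({\<mu> n<..} \<union> {..<\<mu> n})"
      using X by (intro \<nu>.finite_measure_mono) (auto simp: sets\<nu>, metis linorder_neqE)
    also have "\<dots> \<le> measure \<nu> {\<mu> n<..} + measure \<nu> {..<\<mu> n}"
      by (rule measure_Un_le) (auto simp: sets\<nu>)
    also have "\<dots> = 0" using half[of "{\<mu> n<..}" 1] half[of "{..<\<mu> n}" "-1"] by simp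
    finally show ?thesis using measure_nonneg[of \<nu> X] by linarith
  qed
  have norm\<nu>: "(l2_norm M (E X (e n)))\<^sup>2 = measure \<nu> X" if X: "X \<in> sets borel" for X
    using pvm_quadratic[OF E X e_L2, of n] measure_spectral_distribution[OF E e_L2 X, of n] by (simp add: \<nu>_def)
  have cf: "coeff (E B f) n = l2_inner M f (E B (e n))"
    unfolding coeff_def by (rule pvm_sym[OF E B f e_L2])
  have EL: "E B (e n) \<in> sq_integrable M" by (rule pvm_L2[OF E B e_L2])
  show ?thesis
  proof (cases "\<mu> n \<in> B")
    case False
    hence "l2_norm M (E B (e n)) = 0" using norm\<nu>[OF B] off[OF B] by simp
    thus ?thesis using l2_Cauchy_Schwarz[OF f EL] False by (simp add: cf)
  next
    case True
    have in1: "l2_inner M (E B (e n)) (e n) = complex_of_real (measure \<nu> B)"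
      using pvm_quadratic[OF E B e_L2, of n] norm\<nu>[OF B] by simp
    have in2: "l2_inner M (e n) (E B (e n)) = complex_of_real (measure \<nu> B)"
      using pvm_sym[OF E B e_L2 e_L2, of n n] in1 by simp
    have in3: "l2_inner M (E B (e n)) (E B (e n)) = complex_of_real (measure \<nu> B)"
      by (simp only: l2_inner_self norm\<nu>[OF B])
    \<comment> \<open>all mass of $\nu$ lies in $B$, hence $E(B)e_n = e_n$ in $L^2$\<close>
    have "complex_of_real ((l2_norm M (\<lambda>x. E B (e n) x - e n x))\<^sup>2)
        = complex_of_real (measure \<nu> B) - complex_of_real (measure \<nu> B) - complex_of_real (measure \<nu> B)
          + complex_of_real ((l2_norm M (e n))\<^sup>2)"
      unfolding l2_inner_self[symmetric] using EL e_L2[of n]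
      by (simp only: l2_inner_diff_left l2_inner_diff_right sq_integrable_diff in1 in2 in3)
        (simp add: algebra_simps)
    also have "(l2_norm M (e n))\<^sup>2 = measure \<nu> UNIV"
      using pvm_UNIV[OF E e_L2 e_L2, of n n] measure_spectral_distribution[OF E e_L2, of UNIV n]
      by (simp add: \<nu>_def l2_inner_self)
    also have "measure \<nu> UNIV = measure \<nu> B + measure \<nu> (- B)"
      using \<nu>.finite_measure_Union[of B "- B"] B by (simp add: sets\<nu>)
    also have "measure \<nu> (- B) = 0" using off[of "- B"] B True by simp
    finally have "l2_norm M (\<lambda>x. E B (e n) x - e n x) = 0" by simp
    hence "l2_inner M f (\<lambda>x. E B (e n) x - e n x) = 0"
      using l2_Cauchy_Schwarz[OF f sq_integrable_diff[OF EL e_L2], of n] by simp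
    thus ?thesis using True f EL e_L2[of n] by (simp add: cf l2_inner_diff_right) (simp add: coeff_def)
  qed
qed

text \<open>
  The projections multiply coefficients by $1_B(\mu_n)$; countable additivity is dominated convergence
  in Parseval's series.
\<close>

lemma pvm_exists:
  "\<exists>E. projection_valued_measure M E \<and>
    (\<forall>B\<in>sets borel. \<forall>f\<in>sq_integrable M. \<forall>n. coeff (E B f) n = indicator B (\<mu> n) * coeff f n)"
proof -
  define E where "E B f = op_app (diag (indicator B)) f" for B f
  have bd: "cmod (indicator B (\<mu> n)) \<le> 1" for B n by (simp add: indicator_def)
  have EL: "E B f \<in> sq_integrable M" and cE: "coeff (E B f) n = indicator B (\<mu> n) * coeff f n"
    if "f \<in> sq_integrable M" for B f n
    unfolding E_def using diag_app[where \<phi> = "indicator B", OF bd that] by auto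
  have "projection_valued_measure M E"
    unfolding projection_valued_measure_def
  proof (intro conjI ballI allI impI)
    show "E B f \<in> sq_integrable M" if "f \<in> sq_integrable M" for B f by (rule EL[OF that])
    show "l2_inner M (E B f) g = l2_inner M f (E B g)"
      if "f \<in> sq_integrable M" "g \<in> sq_integrable M" for B f g
      using that by (simp add: parseval EL cE mult_ac) (simp add: indicator_def of_bool_def if_distrib cong: if_cong)
    show "AE x in M. E UNIV f x = f x" if "f \<in> sq_integrable M" for f
      using that by (intro AE_eq_of_coeff_eq) (auto simp: EL cE)
    show "AE x in M. E (A \<inter> B) f x = E A (E B f) x" if "f \<in> sq_integrable M" for A B f
      using that by (intro AE_eq_of_coeff_eq) (auto simp: EL cE indicator_def)
    show "(\<lambda>i. l2_inner M (E (B i) f) g) sums l2_inner M (E (\<Union>i. B i) f) g"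
      if dis: "disjoint_family B" and f: "f \<in> sq_integrable M" and g: "g \<in> sq_integrable M"
      for B :: "nat \<Rightarrow> real set" and f g
    proof -
      let ?s = "\<lambda>n. coeff f n * cnj (coeff g n)"
      have par: "l2_inner M (E X f) g = (LINT n|count_space UNIV. complex_of_real (indicator X (\<mu> n)) * ?s n)" for X
        using f g by (simp add: parseval EL cE mult.assoc of_real_indicator)
      have int: "integrable (count_space UNIV) (\<lambda>n. complex_of_real (indicator X (\<mu> n)) * ?s n)" for X
        using parseval_integrable[OF EL[OF f] g, of X] by (simp add: cE[OF f] mult.assoc of_real_indicator)
      have ps: "(\<Sum>i<k. l2_inner M (E (B i) f) g)
          = (LINT n|count_space UNIV. complex_of_real (\<Sum>i<k. indicator (B i) (\<mu> n)) * ?s n)" for k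
        unfolding par by (subst Bochner_Integration.integral_sum[symmetric]) (use int in \<open>auto simp: sum_distrib_right\<close>)
      have ind: "(\<lambda>k. \<Sum>i<k. indicator (B i) x) \<longlonglongrightarrow> (indicator (\<Union>i. B i) x :: real)" for x
        using indicator_sums[of B x] dis unfolding sums_def disjoint_family_on_def by blast
      have le1: "(\<Sum>i<k. indicator (B i) x) \<le> (1::real)" for k x
      proof -
        have "(\<Sum>i<k. indicator (B i) x) = (indicator (\<Union>i<k. B i) x :: real)"
          using dis by (intro indicator_UN_disjoint[symmetric]) (auto simp: disjoint_family_on_def)
        thus ?thesis by (simp add: indicator_def)
      qed
      show ?thesis
        unfolding sums_def ps unfolding par
      proof (rule integral_dominated_convergence[where w = "\<lambda>n. cmod (?s n)"])
        show "integrable (count_space UNIV) (\<lambda>n. cmod (?s n))"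
          using parseval_integrable[OF f g] by (rule integrable_norm)
        show "AE n in count_space UNIV. (\<lambda>k. complex_of_real (\<Sum>i<k. indicator (B i) (\<mu> n)) * ?s n)
            \<longlonglongrightarrow> complex_of_real (indicator (\<Union>i. B i) (\<mu> n)) * ?s n"
          by (intro AE_I2 tendsto_mult tendsto_of_real ind tendsto_const)
        show "AE n in count_space UNIV. norm (complex_of_real (\<Sum>i<k. indicator (B i) (\<mu> n)) * ?s n) \<le> cmod (?s n)" for k
          by (intro AE_I2) (unfold norm_mult norm_of_real, rule mult_left_le_one_le,
            auto simp: sum_nonneg le1)
      qed auto
    qed
  qed
  thus ?thesis using cE by blast
qed

lemma spectral_distribution_diagonal:
  assumes E: "\<And>B. B \<in> sets borel \<Longrightarrow> E B f \<in> sq_integrable M"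
    and cE: "\<And>B n. B \<in> sets borel \<Longrightarrow> coeff (E B f) n = indicator B (\<mu> n) * coeff f n"
    and f: "f \<in> sq_integrable M"
  shows "spectral_distribution M E f
    = distr (density (count_space UNIV) (\<lambda>n. ennreal ((cmod (coeff f n))\<^sup>2))) borel \<mu>"
proof (rule spectral_distribution_eqI)
  fix B :: "real set" assume B[measurable]: "B \<in> sets borel"
  have int: "integrable (count_space UNIV) (\<lambda>n. indicator B (\<mu> n) * (cmod (coeff f n))\<^sup>2)"
  proof (rule Bochner_Integration.integrable_bound)
    show "integrable (count_space UNIV) (\<lambda>n. (cmod (coeff f n))\<^sup>2)"
      using bessel[OF f] by (simp add: integrable_count_space_nat_iff)
  qed (auto simp: indicator_def)
  have "l2_inner M (E B f) f = (LINT n|count_space UNIV. complex_of_real (indicator B (\<mu> n) * (cmod (coeff f n))\<^sup>2))"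
    unfolding parseval[OF E[OF B] f] cE[OF B]
    by (intro Bochner_Integration.integral_cong refl) (simp only: mult.assoc of_real_mult complex_norm_square of_real_indicator)
  hence "Re (l2_inner M (E B f) f) = (LINT n|count_space UNIV. indicator B (\<mu> n) * (cmod (coeff f n))\<^sup>2)"
    by (simp only: integral_complex_of_real Re_complex_of_real)
  moreover have "emeasure (distr (density (count_space UNIV) (\<lambda>n. ennreal ((cmod (coeff f n))\<^sup>2))) borel \<mu>) B
      = (\<integral>\<^sup>+n. ennreal (indicator B (\<mu> n) * (cmod (coeff f n))\<^sup>2) \<partial>count_space UNIV)"
    by (subst emeasure_distr) (auto simp: emeasure_density indicator_def intro!: nn_integral_cong)
  ultimately show "emeasure (distr (density (count_space UNIV) (\<lambda>n. ennreal ((cmod (coeff f n))\<^sup>2))) borel \<mu>) B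
      = ennreal (Re (l2_inner M (E B f) f))"
    using nn_integral_eq_integral[OF int] by simp
qed simp

text \<open>
  For a diagonal spectral measure the complex measure $(E(\cdot)f, h)$ gives mass
  $(f, e_n)\overline{(h, e_n)}$ to $\mu_n$, so spectral integrals are the diagonal operators.
\<close>

lemma spectral_integral_diagonal:
  assumes E: "\<And>B f. \<lbrakk>B \<in> sets borel; f \<in> sq_integrable M\<rbrakk> \<Longrightarrow> E B f \<in> sq_integrable M"
    and cE: "\<And>B f n. \<lbrakk>B \<in> sets borel; f \<in> sq_integrable M\<rbrakk> \<Longrightarrow> coeff (E B f) n = indicator B (\<mu> n) * coeff f n"
    and \<phi>[measurable]: "\<phi> \<in> borel_measurable borel"
  shows "spectral_integral M E \<phi> = diag \<phi>"
proof -
  let ?C = "count_space (UNIV :: nat set)"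
  have sd: "spectral_distribution M E f = distr (density ?C (\<lambda>n. ennreal ((cmod (coeff f n))\<^sup>2))) borel \<mu>"
    if "f \<in> sq_integrable M" for f
    using that by (intro spectral_distribution_diagonal) (auto simp: E cE)
  have dom: "f \<in> spectral_domain M E \<phi> \<longleftrightarrow>
      f \<in> sq_integrable M \<and> integrable ?C (\<lambda>n. (cmod (\<phi> (\<mu> n)))\<^sup>2 * (cmod (coeff f n))\<^sup>2)" for f
    unfolding spectral_domain_def mem_Collect_eq
    by (rule conj_cong[OF refl], subst sd, assumption, subst integrable_distr_eq)
       (auto simp: integrable_density mult.commute)
  have int\<phi>: "(LINT t|spectral_distribution M E f. \<phi> t) = (LINT n|?C. complex_of_real ((cmod (coeff f n))\<^sup>2) * \<phi> (\<mu> n))"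
    if "f \<in> sq_integrable M" for f
    by (subst sd[OF that], subst integral_distr) (auto simp: integral_density scaleR_conv_of_real)
  have pol: "(\<Sum>k<4. \<i> ^ k * (LINT t|spectral_distribution M E (\<lambda>x. f x + \<i> ^ k * h x). \<phi> t)) / 4
      = (LINT n|?C. \<phi> (\<mu> n) * (coeff f n * cnj (coeff h n)))"
    if f: "f \<in> spectral_domain M E \<phi>" and h: "h \<in> spectral_domain M E \<phi>" for f h
  proof -
    have fL: "f \<in> sq_integrable M" and hL: "h \<in> sq_integrable M" using f h by (auto simp: dom)
    let ?q = "\<lambda>k n. complex_of_real ((cmod (coeff f n + \<i> ^ k * coeff h n))\<^sup>2) * \<phi> (\<mu> n)"
    have int: "integrable ?C (?q k)" for k
    proof (rule Bochner_Integration.integrable_bound)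
      show "integrable ?C (\<lambda>n. 2 * (cmod (coeff f n))\<^sup>2 + 2 * (cmod (coeff h n))\<^sup>2
          + 2 * ((cmod (\<phi> (\<mu> n)))\<^sup>2 * (cmod (coeff f n))\<^sup>2) + 2 * ((cmod (\<phi> (\<mu> n)))\<^sup>2 * (cmod (coeff h n))\<^sup>2))"
        using f h bessel[OF fL] bessel[OF hL]
        by (intro Bochner_Integration.integrable_add integrable_mult_right)
           (auto simp: dom integrable_count_space_nat_iff)
      show "AE n in ?C. norm (?q k n) \<le> norm (2 * (cmod (coeff f n))\<^sup>2 + 2 * (cmod (coeff h n))\<^sup>2
          + 2 * ((cmod (\<phi> (\<mu> n)))\<^sup>2 * (cmod (coeff f n))\<^sup>2) + 2 * ((cmod (\<phi> (\<mu> n)))\<^sup>2 * (cmod (coeff h n))\<^sup>2))"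
      proof (rule AE_I2)
        fix n :: nat
        have a: "(cmod (coeff f n + \<i> ^ k * coeff h n))\<^sup>2 \<le> 2 * (cmod (coeff f n))\<^sup>2 + 2 * (cmod (coeff h n))\<^sup>2"
          using norm_add_sq_le[of "coeff f n" "\<i> ^ k * coeff h n"] by (simp add: norm_mult norm_power)
        have b: "cmod (\<phi> (\<mu> n)) \<le> 1 + (cmod (\<phi> (\<mu> n)))\<^sup>2"
          using norm_product_le_squares[of 1 "\<phi> (\<mu> n)"] by simp
        have "norm (?q k n) = (cmod (coeff f n + \<i> ^ k * coeff h n))\<^sup>2 * cmod (\<phi> (\<mu> n))"
          unfolding norm_mult norm_of_real by simp
        also have "\<dots> \<le> (2 * (cmod (coeff f n))\<^sup>2 + 2 * (cmod (coeff h n))\<^sup>2) * (1 + (cmod (\<phi> (\<mu> n)))\<^sup>2)"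
          using a b by (intro mult_mono) auto
        also have "\<dots> = norm (2 * (cmod (coeff f n))\<^sup>2 + 2 * (cmod (coeff h n))\<^sup>2
          + 2 * ((cmod (\<phi> (\<mu> n)))\<^sup>2 * (cmod (coeff f n))\<^sup>2) + 2 * ((cmod (\<phi> (\<mu> n)))\<^sup>2 * (cmod (coeff h n))\<^sup>2))"
          by (simp add: algebra_simps)
        finally show "norm (?q k n) \<le> norm (2 * (cmod (coeff f n))\<^sup>2 + 2 * (cmod (coeff h n))\<^sup>2
          + 2 * ((cmod (\<phi> (\<mu> n)))\<^sup>2 * (cmod (coeff f n))\<^sup>2) + 2 * ((cmod (\<phi> (\<mu> n)))\<^sup>2 * (cmod (coeff h n))\<^sup>2))" .
      qed
    qed simp
    have "(\<lambda>x. f x + \<i> ^ k * h x) \<in> sq_integrable M" for k using fL hL by (intro sq_integrable_add sq_integrable_scale)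
    hence "(LINT t|spectral_distribution M E (\<lambda>x. f x + \<i> ^ k * h x). \<phi> t) = (LINT n|?C. ?q k n)" for k
      by (subst int\<phi>) (auto simp: coeff_add coeff_scale fL hL sq_integrable_scale)
    hence "(\<Sum>k<4. \<i> ^ k * (LINT t|spectral_distribution M E (\<lambda>x. f x + \<i> ^ k * h x). \<phi> t)) / 4
        = (\<Sum>k<4. (LINT n|?C. \<i> ^ k * ?q k n)) / 4" by simp
    also have "\<dots> = (LINT n|?C. (\<Sum>k<4. \<i> ^ k * ?q k n)) / 4"
      using int by (subst Bochner_Integration.integral_sum) auto
    also have "\<dots> = (LINT n|?C. (\<Sum>k<4. \<i> ^ k * ?q k n) / 4)" by simp
    also have "\<dots> = (LINT n|?C. \<phi> (\<mu> n) * (coeff f n * cnj (coeff h n)))"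
    proof (rule Bochner_Integration.integral_cong[OF refl])
      fix n
      have "(\<Sum>k<4. \<i> ^ k * ?q k n) / 4
          = \<phi> (\<mu> n) * ((\<Sum>k<4. \<i> ^ k * complex_of_real ((cmod (coeff f n + \<i> ^ k * coeff h n))\<^sup>2)) / 4)"
        unfolding times_divide_eq_right sum_distrib_left by (simp only: mult_ac)
      thus "(\<Sum>k<4. \<i> ^ k * ?q k n) / 4 = \<phi> (\<mu> n) * (coeff f n * cnj (coeff h n))"
        by (simp only: polarization)
    qed
    finally show ?thesis .
  qed
  show ?thesis
  proof (intro equalityI subsetI)
    fix p assume "p \<in> spectral_integral M E \<phi>"
    then obtain f g where p: "p = (f, g)" and f: "f \<in> spectral_domain M E \<phi>" and g: "g \<in> sq_integrable M"
      and fg: "\<And>h. h \<in> spectral_domain M E \<phi> \<Longrightarrow> l2_inner M g h =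
        (\<Sum>k<4. \<i> ^ k * (LINT t|spectral_distribution M E (\<lambda>x. f x + \<i> ^ k * h x). \<phi> t)) / 4"
      by (auto simp: spectral_integral_def)
    have fL: "f \<in> sq_integrable M" using f by (simp add: dom)
    have "coeff g n = \<phi> (\<mu> n) * coeff f n" for n
    proof -
      have "e n \<in> spectral_domain M E \<phi>"
        unfolding dom integrable_count_space_nat_iff
        by (intro conjI e_L2, rule summable_finite[of "{n}"], simp, simp add: coeff_e)
      hence eq: "coeff g n = (LINT m|?C. \<phi> (\<mu> m) * (coeff f m * cnj (coeff (e n) m)))"
        unfolding coeff_def[of g] using fg pol[OF f] by simp
      have "integrable ?C (\<lambda>m. \<phi> (\<mu> m) * (coeff f m * cnj (coeff (e n) m)))"
        unfolding integrable_count_space_nat_iff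
        by (rule summable_finite[of "{n}"], simp, simp add: coeff_e)
      from sums_integral_count_space_nat[OF this]
      have s1: "(\<lambda>m. \<phi> (\<mu> m) * (coeff f m * cnj (coeff (e n) m))) sums
          (LINT m|?C. \<phi> (\<mu> m) * (coeff f m * cnj (coeff (e n) m)))" .
      have s2: "(\<lambda>m. \<phi> (\<mu> m) * (coeff f m * cnj (coeff (e n) m))) sums
          (\<Sum>m\<in>{n}. \<phi> (\<mu> m) * (coeff f m * cnj (coeff (e n) m)))"
        by (rule sums_finite, simp, simp add: coeff_e)
      have "coeff g n = \<phi> (\<mu> n) * (coeff f n * cnj (coeff (e n) n))"
        using sums_unique2[OF s1 s2] eq by simp
      thus ?thesis using e_norm[of n] coeff_null[OF fL, of n] by (auto simp: coeff_e)
    qed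
    thus "p \<in> diag \<phi>" using p fL g by (simp add: diag_def)
  next
    fix p assume "p \<in> diag \<phi>"
    then obtain f g where p: "p = (f, g)" and f: "f \<in> sq_integrable M" and g: "g \<in> sq_integrable M"
      and fg: "\<And>n. coeff g n = \<phi> (\<mu> n) * coeff f n" by (auto simp: diag_def)
    have fd: "f \<in> spectral_domain M E \<phi>"
      using bessel[OF g] f by (simp add: dom fg norm_mult power_mult_distrib integrable_count_space_nat_iff)
    have "l2_inner M g h = (LINT n|?C. \<phi> (\<mu> n) * (coeff f n * cnj (coeff h n)))" if "h \<in> sq_integrable M" for h
      unfolding parseval[OF g that] by (simp add: fg mult.assoc)
    thus "p \<in> spectral_integral M E \<phi>"
      unfolding spectral_integral_def using p fd g pol[OF fd] by (auto simp: dom)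
  qed
qed

text \<open>
  The functional calculus admits every spectral measure whose identity function integrates to the
  operator.  Each of them is diagonal by \<open>pvm_diagonal\<close>, so they all give the same result, and
  \<open>pvm_exists\<close> provides one.
\<close>

theorem functional_calculus_diag:
  assumes \<phi>: "\<phi> \<in> borel_measurable borel"
  shows "functional_calculus M (diag complex_of_real) \<phi> = diag \<phi>"
proof (intro equalityI subsetI)
  fix p assume "p \<in> functional_calculus M (diag complex_of_real) \<phi>"
  then obtain E where E: "projection_valued_measure M E" "spectral_integral M E complex_of_real = diag complex_of_real"
    "p \<in> spectral_integral M E \<phi>" by (auto simp: functional_calculus_def)
  have "spectral_integral M E \<phi> = diag \<phi>"
    using pvm_L2[OF E(1)] pvm_diagonal[OF E(1,2)] \<phi> by (intro spectral_integral_diagonal) auto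
  thus "p \<in> diag \<phi>" using E(3) by simp
next
  fix p assume p: "p \<in> diag \<phi>"
  obtain E where E: "projection_valued_measure M E"
    and cE: "\<And>B f n. \<lbrakk>B \<in> sets borel; f \<in> sq_integrable M\<rbrakk> \<Longrightarrow> coeff (E B f) n = indicator B (\<mu> n) * coeff f n"
    using pvm_exists by blast
  have SI: "spectral_integral M E \<psi> = diag \<psi>" if "\<psi> \<in> borel_measurable borel" for \<psi>
    using pvm_L2[OF E] cE that by (intro spectral_integral_diagonal) auto
  have "spectral_integral M E complex_of_real = diag complex_of_real" by (rule SI) simp
  thus "p \<in> functional_calculus M (diag complex_of_real) \<phi>"
    using p E SI[OF \<phi>] by (cases p) (auto simp: functional_calculus_def)
qed

end

section \<open>The semigroup generated by a diagonal operator\<close>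

context diagonal_system
begin

text \<open>
  Coefficients are continuous in $L^2$, so the diagonal operator is closed and contains the closure
  of $T$.  Conversely $T$ maps the partial sums of the expansion of $f$ to those of the expansion of
  $g$, since coefficients determine a function up to a null set.
\<close>

lemma closure_eq_diag:
  assumes T: "\<And>f g. (f, g) \<in> T \<Longrightarrow> (f, g) \<in> diag complex_of_real"
    and core: "\<And>c N. \<exists>g. (\<lambda>x. \<Sum>n<N::nat. c n * e n x, g) \<in> T"
  shows "op_closure M T = diag complex_of_real"
proof (intro equalityI subsetI)
  fix p assume "p \<in> op_closure M T"
  then obtain f g u v where p: "p = (f, g)" and f: "f \<in> sq_integrable M" and g: "g \<in> sq_integrable M"
    and uvT: "\<forall>n::nat. (u n, v n) \<in> T \<inter> sq_integrable M \<times> sq_integrable M"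
    and lim: "(\<lambda>n. l2_norm M (\<lambda>x. u n x - f x)) \<longlonglongrightarrow> 0" "(\<lambda>n. l2_norm M (\<lambda>x. v n x - g x)) \<longlonglongrightarrow> 0"
    unfolding op_closure_def by blast
  have uv: "(u n, v n) \<in> T" and u: "u n \<in> sq_integrable M" and v: "v n \<in> sq_integrable M" for n
    using uvT by auto
  have "coeff g k = complex_of_real (\<mu> k) * coeff f k" for k
  proof -
    have "(\<lambda>n. coeff (v n) k) \<longlonglongrightarrow> coeff g k"
      unfolding coeff_def by (rule l2_inner_tendsto[OF v g e_L2 lim(2)])
    moreover have "(\<lambda>n. complex_of_real (\<mu> k) * coeff (u n) k) \<longlonglongrightarrow> complex_of_real (\<mu> k) * coeff f k"
      unfolding coeff_def by (intro tendsto_mult_left l2_inner_tendsto[OF u f e_L2 lim(1)])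
    moreover have "coeff (v n) k = complex_of_real (\<mu> k) * coeff (u n) k" for n
      using T[OF uv[of n]] by (simp add: diag_def)
    ultimately show ?thesis using LIMSEQ_unique by (metis (no_types, lifting) ext)
  qed
  thus "p \<in> diag complex_of_real" using p f g by (simp add: diag_def)
next
  fix p assume "p \<in> diag complex_of_real"
  then obtain f g where p: "p = (f, g)" and f: "f \<in> sq_integrable M" and g: "g \<in> sq_integrable M"
    and fg: "\<And>n. coeff g n = complex_of_real (\<mu> n) * coeff f n" by (auto simp: diag_def)
  define u where "u N x = (\<Sum>n<N. coeff f n * e n x)" for N x
  have "\<exists>v. \<forall>N. (u N, v N) \<in> T" by (rule choice) (use core in \<open>auto simp: u_def[abs_def]\<close>)
  then obtain v where v: "\<And>N. (u N, v N) \<in> T" by blast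
  have uL: "u N \<in> sq_integrable M" and vL: "v N \<in> sq_integrable M" for N
    using T[OF v[of N]] by (auto simp: diag_def)
  have "l2_norm M (\<lambda>x. v N x - g x) = l2_norm M (\<lambda>x. (\<Sum>n<N. coeff g n * e n x) - g x)" for N
  proof (rule l2_norm_cong_AE)
    have "AE x in M. v N x = (\<Sum>n<N. coeff g n * e n x)"
    proof (rule AE_eq_of_coeff_eq[OF vL combination_L2])
      fix k
      have "coeff (v N) k = complex_of_real (\<mu> k) * coeff (u N) k" using T[OF v[of N]] by (simp add: diag_def)
      thus "coeff (v N) k = coeff (\<lambda>x. \<Sum>n<N. coeff g n * e n x) k"
        by (simp add: u_def[abs_def] coeff_combination fg)
    qed
    thus "AE x in M. v N x - g x = (\<Sum>n<N. coeff g n * e n x) - g x" by eventually_elim simp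
    have "(\<lambda>x. \<Sum>n<N. coeff g n * e n x) \<in> sq_integrable M" by (rule combination_L2)
    from sq_integrable_diff[OF this g] sq_integrable_diff[OF vL[of N] g]
    show "(\<lambda>x. v N x - g x) \<in> borel_measurable M" "(\<lambda>x. (\<Sum>n<N. coeff g n * e n x) - g x) \<in> borel_measurable M"
      by (auto simp: sq_integrable_def)
  qed
  hence "(\<lambda>N. l2_norm M (\<lambda>x. v N x - g x)) \<longlonglongrightarrow> 0" using fourier_expansion[OF g] by simp
  moreover have "(\<lambda>N. l2_norm M (\<lambda>x. u N x - f x)) \<longlonglongrightarrow> 0"
    using fourier_expansion[OF f] by (simp add: u_def)
  ultimately show "p \<in> op_closure M T"
    unfolding op_closure_def p using f g v uL vL by blast
qed

text \<open>
  $U(z)$ multiplies the $n$-th coefficient by $e^{z\mu_n/a}$.  The matrix coefficients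
  $\sum_n e^{z\mu_n/a} (f,e_n)\overline{(g,e_n)}$ converge uniformly on the half-plane, dominated by the
  absolutely convergent series of Parseval, which makes them holomorphic.
\<close>

theorem diag_semigroup:
  fixes a :: real
  assumes a: "a > 0" and neg: "\<And>n. \<mu> n \<le> 0" and trace: "\<And>s. s > 0 \<Longrightarrow> summable (\<lambda>n. exp (s * \<mu> n))"
  defines "U \<equiv> \<lambda>z::complex. functional_calculus M (diag complex_of_real) (\<lambda>t. exp (z / of_real a * of_real t))"
  shows "(\<forall>z. Re z > 0 \<longrightarrow> hilbert_schmidt M (U z)) \<and>
    (\<forall>z1 z2. Re z1 > 0 \<longrightarrow> Re z2 > 0 \<longrightarrow> U z2 O U z1 = U (z1 + z2)) \<and>
    (\<forall>f\<in>sq_integrable M. \<forall>g\<in>sq_integrable M. (\<lambda>z. l2_inner M (op_app (U z) f) g) holomorphic_on {z. Re z > 0}) \<and>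
    one_parameter_unitary_group M (\<lambda>t. U (\<i> * of_real t))"
proof -
  define \<phi> where "\<phi> z t = exp (z / of_real a * of_real t)" for z :: complex and t :: real
  have U: "U z = diag (\<phi> z)" for z
    unfolding U_def \<phi>_def by (rule functional_calculus_diag) (auto intro!: borel_measurable_continuous_onI continuous_intros)
  have nrm: "cmod (\<phi> z t) = exp (Re z * t / a)" for z t
    by (simp add: \<phi>_def norm_exp_eq_Re)
  have bd: "cmod (\<phi> z (\<mu> n)) \<le> 1" if "Re z \<ge> 0" for z n
    unfolding nrm using that neg[of n] a by (simp add: mult_nonneg_nonpos divide_nonpos_pos)
  have \<phi>_add: "\<phi> (z1 + z2) t = \<phi> z1 t * \<phi> z2 t" for z1 z2 t
    by (simp add: \<phi>_def distrib_right add_divide_distrib exp_add)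
  have HS: "hilbert_schmidt M (U z)" if z: "Re z > 0" for z
    unfolding U
  proof (rule diag_hilbert_schmidt)
    show "cmod (\<phi> z (\<mu> n)) \<le> 1" for n using bd z by simp
    have "(cmod (\<phi> z (\<mu> n)))\<^sup>2 = exp (2 * Re z / a * \<mu> n)" for n
      unfolding nrm by (simp add: power2_eq_square flip: exp_add)
    thus "summable (\<lambda>n. (cmod (\<phi> z (\<mu> n)))\<^sup>2)" using trace[of "2 * Re z / a"] z a by simp
  qed
  have comp: "U z2 O U z1 = U (z1 + z2)" if "Re z1 \<ge> 0" "Re z2 \<ge> 0" for z1 z2
    unfolding U by (rule diag_comp[where C = 1]) (auto simp: bd that \<phi>_add)
  have hol: "(\<lambda>z. l2_inner M (op_app (U z) f) g) holomorphic_on {z. Re z > 0}"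
    if f: "f \<in> sq_integrable M" and g: "g \<in> sq_integrable M" for f g
  proof -
    define s where "s n = coeff f n * cnj (coeff g n)" for n
    have ss: "summable (\<lambda>n. cmod (s n))"
      using parseval_integrable[OF f g] by (simp add: integrable_count_space_nat_iff s_def)
    have val: "(\<lambda>n. \<phi> z (\<mu> n) * s n) sums l2_inner M (op_app (U z) f) g" if z: "Re z > 0" for z
    proof -
      have bz: "cmod (\<phi> z (\<mu> n)) \<le> 1" for n using bd z by simp
      show ?thesis using parseval_sums[OF diag_app(1)[where \<phi> = "\<phi> z", OF bz f] g]
        by (simp add: diag_app(2)[where \<phi> = "\<phi> z", OF bz f] U s_def mult.assoc)
    qed
    have unif: "uniform_limit {z. Re z > 0} (\<lambda>N z. \<Sum>n<N. \<phi> z (\<mu> n) * s n) (\<lambda>z. \<Sum>n. \<phi> z (\<mu> n) * s n) sequentially"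
    proof (rule Weierstrass_m_test[OF _ ss])
      fix n z assume "z \<in> {z. Re z > 0}"
      thus "norm (\<phi> z (\<mu> n) * s n) \<le> cmod (s n)"
        using bd[of z n] by (simp add: norm_mult mult_left_le_one_le)
    qed
    have "(\<lambda>z. \<Sum>n. \<phi> z (\<mu> n) * s n) holomorphic_on {z. Re z > 0}"
    proof (rule holomorphic_uniform_sequence)
      show "open {z. Re z > 0}" by (rule open_halfspace_Re_gt)
      show "(\<lambda>z. \<Sum>n<N. \<phi> z (\<mu> n) * s n) holomorphic_on {z. Re z > 0}" for N
        unfolding \<phi>_def using a by (intro holomorphic_intros) auto
      fix z assume "z \<in> {z. Re z > 0}"
      then obtain d where "d > 0" "cball z d \<subseteq> {z. Re z > 0}"
        using open_halfspace_Re_gt[of 0] unfolding open_contains_cball by blast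
      thus "\<exists>d>0. cball z d \<subseteq> {z. Re z > 0} \<and>
          uniform_limit (cball z d) (\<lambda>N z. \<Sum>n<N. \<phi> z (\<mu> n) * s n) (\<lambda>z. \<Sum>n. \<phi> z (\<mu> n) * s n) sequentially"
        using uniform_limit_on_subset[OF unif] by blast
    qed
    thus ?thesis by (rule holomorphic_transform) (use val in \<open>auto simp: sums_iff\<close>)
  qed
  have unitary: "unitary_operator M (U (\<i> * of_real t))" for t
    unfolding U by (rule diag_unitary) (simp add: nrm)
  have cont: "((\<lambda>s. l2_norm M (\<lambda>x. op_app (U (\<i> * of_real s)) f x - op_app (U (\<i> * of_real t)) f x)) \<longlongrightarrow> 0) (at t)"
    if "f \<in> sq_integrable M" for f t
    unfolding U
  proof (rule diag_strongly_continuous[OF _ _ that])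
    show "cmod (\<phi> (\<i> * of_real s) (\<mu> n)) \<le> 1" for s n by (simp add: nrm)
    show "((\<lambda>s. \<phi> (\<i> * of_real s) (\<mu> n)) \<longlongrightarrow> \<phi> (\<i> * of_real t) (\<mu> n)) (at t)" for n
      unfolding \<phi>_def using a by (intro tendsto_intros) auto
  qed
  have "one_parameter_unitary_group M (\<lambda>t. U (\<i> * of_real t))"
    unfolding one_parameter_unitary_group_def
  proof (intro conjI allI ballI)
    show "U (\<i> * of_real 0) = op_identity M" unfolding U by (rule diag_identity) (simp add: \<phi>_def)
    show "U (\<i> * of_real t) O U (\<i> * of_real s) = U (\<i> * of_real (s + t))" for s t
      using comp[of "\<i> * of_real s" "\<i> * of_real t"] by (simp add: distrib_left)
  qed (use unitary cont in auto)
  thus ?thesis using HS comp hol by simp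
qed

end

section \<open>Orthonormalization within eigenspaces\<close>

text \<open>
  A function of norm $0$ is sent to the zero function, as $1/0 = 0$.
\<close>

definition l2_normalize :: "'x measure \<Rightarrow> ('x \<Rightarrow> complex) \<Rightarrow> 'x \<Rightarrow> complex" where
  "l2_normalize M r = (\<lambda>x. complex_of_real (1 / l2_norm M r) * r x)"

function gram_schmidt :: "'x measure \<Rightarrow> (nat \<Rightarrow> 'x \<Rightarrow> complex) \<Rightarrow> nat \<Rightarrow> 'x \<Rightarrow> complex" where
  "gram_schmidt M v n = l2_normalize M (\<lambda>x. v n x -
    (\<Sum>j<n. l2_inner M (v n) (gram_schmidt M v j) * gram_schmidt M v j x))"
  by auto
termination by (relation "Wellfounded.measure (\<lambda>(M, v, n). n)") auto

declare gram_schmidt.simps [simp del]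

text \<open>
  If each $v_n$ lies in the eigenspace $X(\mu_n)$ and distinct eigenspaces are orthogonal, the
  Gram--Schmidt corrections of $v_n$ only involve vectors of the same eigenspace, so the
  orthonormalized sequence consists of eigenvectors for the same sequence of eigenvalues.
\<close>

lemma eigenvector_basis_exists:
  fixes X :: "real \<Rightarrow> ('x \<Rightarrow> complex) set"
  assumes v: "\<And>n. v n \<in> X (\<mu> n)"
    and XL: "\<And>t u. u \<in> X t \<Longrightarrow> u \<in> sq_integrable M"
    and Xlin: "\<And>t u w c. u \<in> X t \<Longrightarrow> w \<in> X t \<Longrightarrow> (\<lambda>x. c * u x + w x) \<in> X t"
    and X0: "\<And>t. (\<lambda>x. 0) \<in> X t"
    and orth: "\<And>s t u w. s \<noteq> t \<Longrightarrow> u \<in> X s \<Longrightarrow> w \<in> X t \<Longrightarrow> l2_inner M u w = 0"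
    and total: "\<And>f. f \<in> sq_integrable M \<Longrightarrow> (\<And>n. l2_inner M f (v n) = 0) \<Longrightarrow> AE x in M. f x = 0"
  shows "\<exists>e. diagonal_system M e \<and> (\<forall>n. e n \<in> X (\<mu> n))"
proof -
  define e where "e = gram_schmidt M v"
  define r where "r n x = v n x - (\<Sum>j<n. l2_inner M (v n) (e j) * e j x)" for n x
  have e: "e n = l2_normalize M (r n)" for n
    unfolding e_def r_def by (subst gram_schmidt.simps) (rule refl)
  have Xsum: "(\<lambda>x. \<Sum>j\<in>A. w j x) \<in> X t" if "\<And>j. j \<in> A \<Longrightarrow> w j \<in> X t" for A :: "nat set" and w t
    using that
  proof (induction A rule: infinite_finite_induct)
    case (insert j A)
    thus ?case using Xlin[of "w j" t "\<lambda>x. \<Sum>j\<in>A. w j x" 1] by simp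
  qed (auto simp: X0)
  have Xscale: "(\<lambda>x. c * u x) \<in> X t" if "u \<in> X t" for c u t
    using Xlin[OF that X0, of c] by simp
  have main: "r n \<in> X (\<mu> n) \<and> e n \<in> X (\<mu> n) \<and> (l2_norm M (e n) = 0 \<or> l2_norm M (e n) = 1) \<and> (\<forall>j<n. l2_inner M (e n) (e j) = 0)" for n
  proof (induction n rule: less_induct)
    case (less n)
    hence eX: "e j \<in> X (\<mu> j)" if "j < n" for j using that by blast
    hence eL: "e j \<in> sq_integrable M" if "j < n" for j using that XL by blast
    have vL: "v n \<in> sq_integrable M" using v XL by blast
    have orth_below: "l2_inner M (e j) (e i) = 0" if "j < n" "i < n" "i \<noteq> j" for i j
    proof (cases "i < j")
      case True thus ?thesis using less that by blast
    next
      case False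
      hence "l2_inner M (e i) (e j) = 0" using less that by (metis linorder_neqE_nat)
      thus ?thesis by (metis l2_inner_cnj complex_cnj_zero)
    qed
    have "(\<lambda>x. \<Sum>j<n. l2_inner M (v n) (e j) * e j x) \<in> X (\<mu> n)"
    proof (rule Xsum)
      fix j assume j: "j \<in> {..<n}"
      show "(\<lambda>x. l2_inner M (v n) (e j) * e j x) \<in> X (\<mu> n)"
      proof (cases "\<mu> j = \<mu> n")
        case True thus ?thesis using eX[of j] j Xscale by simp
      next
        case False
        hence "l2_inner M (v n) (e j) = 0" using orth[of "\<mu> n" "\<mu> j"] v eX j by auto
        thus ?thesis using X0 by simp
      qed
    qed
    from Xlin[OF this v[of n], of "-1"] have rX: "r n \<in> X (\<mu> n)" by (simp add: r_def[abs_def])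
    have nX: "e n \<in> X (\<mu> n)" unfolding e l2_normalize_def by (rule Xscale[OF rX])
    have nrm: "l2_norm M (e n) = 0 \<or> l2_norm M (e n) = 1"
      unfolding e l2_normalize_def l2_norm_scale by (cases "l2_norm M (r n) = 0") (auto simp: norm_divide)
    have "l2_inner M (e n) (e i) = 0" if i: "i < n" for i
    proof -
      have "l2_inner M (r n) (e i) = l2_inner M (v n) (e i) - (\<Sum>j<n. l2_inner M (v n) (e j) * l2_inner M (e j) (e i))"
        unfolding r_def using vL eL i
        by (subst l2_inner_diff_left, simp, force intro: sq_integrable_sum sq_integrable_scale, simp)
          (subst l2_inner_sum_left, auto simp: l2_inner_scale_left sq_integrable_scale)
      also have "(\<Sum>j<n. l2_inner M (v n) (e j) * l2_inner M (e j) (e i))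
          = (\<Sum>j<n. if j = i then l2_inner M (v n) (e i) * l2_inner M (e i) (e i) else 0)"
        using orth_below i by (intro sum.cong refl) auto
      also have "\<dots> = l2_inner M (v n) (e i) * complex_of_real ((l2_norm M (e i))\<^sup>2)"
        using i by (simp add: l2_inner_self)
      also have "\<dots> = l2_inner M (v n) (e i)"
        using less.IH[OF i] l2_Cauchy_Schwarz[OF vL eL[OF i]] by auto
      finally have "l2_inner M (r n) (e i) = 0" by simp
      thus ?thesis unfolding e[of n] l2_normalize_def l2_inner_scale_left by simp
    qed
    thus ?case using rX nX nrm by blast
  qed
  have "diagonal_system M e"
  proof
    show "e n \<in> sq_integrable M" for n using main XL by blast
    show "l2_inner M (e m) (e n) = 0" if "m \<noteq> n" for m n
      using that main[of m] main[of n] l2_inner_cnj[of M "e n" "e m"] by (metis complex_cnj_zero linorder_neqE_nat)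
    show "l2_norm M (e n) = 0 \<or> l2_norm M (e n) = 1" for n using main by blast
    fix f assume f: "f \<in> sq_integrable M" and fe: "\<And>n. l2_inner M f (e n) = 0"
    show "AE x in M. f x = 0"
    proof (rule total[OF f])
      fix n
      have rL: "r n \<in> sq_integrable M" and eL: "e j \<in> sq_integrable M" for j using main XL by blast+
      have fr: "l2_inner M f (r n) = 0"
      proof (cases "l2_norm M (r n) = 0")
        case True thus ?thesis using l2_Cauchy_Schwarz[OF f rL] by simp
      next
        case False
        thus ?thesis using fe[of n] unfolding e l2_normalize_def l2_inner_scale_right by simp
      qed
      have "v n = (\<lambda>x. r n x + (\<Sum>j<n. l2_inner M (v n) (e j) * e j x))" by (simp add: r_def)
      hence "l2_inner M f (v n) = l2_inner M f (\<lambda>x. r n x + (\<Sum>j<n. l2_inner M (v n) (e j) * e j x))" by metis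
      also have "\<dots> = 0" using f rL eL fr fe
        by (subst l2_inner_add_right) (auto simp: l2_inner_sum_right l2_inner_scale_right sq_integrable_sum sq_integrable_scale)
      finally show "l2_inner M f (v n) = 0" .
    qed
  qed
  thus ?thesis using main by blast
qed

section \<open>Directional derivatives\<close>

text \<open>
  Dunkl operators involve a function only along lines and at reflected points, so differentiability
  along each line is the natural regularity; \<open>dir_smooth\<close> below demands it in all directions at a
  point.
\<close>

definition has_dir :: "(real^'n \<Rightarrow> complex) \<Rightarrow> real^'n \<Rightarrow> real^'n \<Rightarrow> complex \<Rightarrow> bool" where
  "has_dir f x \<xi> d \<longleftrightarrow> ((\<lambda>t::real. f (x + t *\<^sub>R \<xi>)) has_vector_derivative d) (at 0)"

lemma has_dir_unique: "has_dir f x \<xi> d \<Longrightarrow> dir_deriv \<xi> f x = d"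
  unfolding has_dir_def dir_deriv_def by (rule vector_derivative_at)

lemma has_dir_const: "has_dir (\<lambda>x. c) x \<xi> 0"
  by (simp add: has_dir_def)

lemma has_dir_add: "\<lbrakk>has_dir f x \<xi> d; has_dir g x \<xi> d'\<rbrakk> \<Longrightarrow> has_dir (\<lambda>x. f x + g x) x \<xi> (d + d')"
  unfolding has_dir_def by (rule has_vector_derivative_add)

lemma has_dir_sum: "(\<And>i. i \<in> A \<Longrightarrow> has_dir (f i) x \<xi> (d i)) \<Longrightarrow> has_dir (\<lambda>x. \<Sum>i\<in>A. f i x) x \<xi> (\<Sum>i\<in>A. d i)"
  unfolding has_dir_def by (rule has_vector_derivative_sum)

lemma has_dir_mult:
  assumes "has_dir f x \<xi> d" "has_dir g x \<xi> d'"
  shows "has_dir (\<lambda>x. f x * g x) x \<xi> (f x * d' + d * g x)"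
  using has_vector_derivative_mult[OF assms[unfolded has_dir_def]] by (simp add: has_dir_def)

lemma has_dir_cmult: "has_dir f x \<xi> d \<Longrightarrow> has_dir (\<lambda>x. c * f x) x \<xi> (c * d)"
  using has_dir_mult[OF has_dir_const, of f x \<xi> d c] by simp

lemma has_dir_linear: "has_dir (\<lambda>x. complex_of_real (v \<bullet> x)) x \<xi> (complex_of_real (v \<bullet> \<xi>))"
proof -
  have "((\<lambda>t::real. complex_of_real (v \<bullet> x + t * (v \<bullet> \<xi>))) has_vector_derivative complex_of_real (0 + 1 * (v \<bullet> \<xi>))) (at 0)"
    by (intro derivative_eq_intros | simp)+
  thus ?thesis by (simp add: has_dir_def inner_add_right)
qed

lemma has_dir_radial:
  assumes "(\<psi> has_real_derivative D) (at (x \<bullet> x))"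
  shows "has_dir (\<lambda>x. complex_of_real (\<psi> (x \<bullet> x))) x \<xi> (complex_of_real (2 * (x \<bullet> \<xi>) * D))"
proof -
  have "((\<lambda>t::real. (x + t *\<^sub>R \<xi>) \<bullet> (x + t *\<^sub>R \<xi>)) has_real_derivative 2 * (x \<bullet> \<xi>)) (at 0)"
    unfolding inner_add_left inner_add_right
    by (auto intro!: derivative_eq_intros simp: inner_commute)
  moreover have "(\<psi> has_real_derivative D) (at ((x + 0 *\<^sub>R \<xi>) \<bullet> (x + 0 *\<^sub>R \<xi>)))" using assms by simp
  ultimately have "((\<lambda>t. \<psi> ((x + t *\<^sub>R \<xi>) \<bullet> (x + t *\<^sub>R \<xi>))) has_real_derivative D * (2 * (x \<bullet> \<xi>))) (at 0)"
    by (rule DERIV_chain2[rotated])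
  hence "((\<lambda>t. \<psi> ((x + t *\<^sub>R \<xi>) \<bullet> (x + t *\<^sub>R \<xi>))) has_vector_derivative 2 * (x \<bullet> \<xi>) * D) (at 0)"
    by (simp add: has_real_derivative_iff_has_vector_derivative mult.commute)
  thus ?thesis unfolding has_dir_def
    by (rule bounded_linear.has_vector_derivative[OF bounded_linear_of_real])
qed

lemma has_dir_cong:
  assumes U: "open U" "x \<in> U" and eq: "\<And>y. y \<in> U \<Longrightarrow> f y = g y" and g: "has_dir g x \<xi> d"
  shows "has_dir f x \<xi> d"
proof -
  have "continuous (at 0) (\<lambda>t::real. x + t *\<^sub>R \<xi>)" by (intro continuous_intros)
  hence "((\<lambda>t::real. x + t *\<^sub>R \<xi>) \<longlongrightarrow> x) (nhds 0)"
    unfolding continuous_at tendsto_nhds_iff by simp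
  hence "eventually (\<lambda>t. x + t *\<^sub>R \<xi> \<in> U) (nhds 0)" using U topological_tendstoD by blast
  hence ev: "eventually (\<lambda>t. g (x + t *\<^sub>R \<xi>) = f (x + t *\<^sub>R \<xi>)) (nhds 0)"
    by eventually_elim (simp add: eq)
  show ?thesis
    using g has_vector_derivative_transform_within_open ev unfolding has_dir_def
    by (subst has_vector_derivative_cong_ev[where g = "\<lambda>t. g (x + t *\<^sub>R \<xi>)"])
      (auto simp: eq U elim!: eventually_mono)
qed

lemma reflection_inner: "v \<bullet> reflection \<alpha> x = v \<bullet> x - 2 * (\<alpha> \<bullet> x) * (v \<bullet> \<alpha>) / (norm \<alpha>)\<^sup>2"
  by (simp add: reflection_def inner_diff_right)

lemma reflection_fixed: "\<alpha> \<bullet> x = 0 \<Longrightarrow> reflection \<alpha> x = x"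
  by (simp add: reflection_def)

lemma reflection_norm: "reflection \<alpha> x \<bullet> reflection \<alpha> x = x \<bullet> x"
proof (cases "\<alpha> = 0")
  case False
  hence "(norm \<alpha>)\<^sup>2 \<noteq> 0" by simp
  moreover have "\<alpha> \<bullet> \<alpha> = (norm \<alpha>)\<^sup>2" by (simp add: power2_norm_eq_inner)
  ultimately show ?thesis
    by (simp add: reflection_def inner_diff_left inner_diff_right inner_commute power2_eq_square field_simps)
qed (simp add: reflection_def)

section \<open>Homogeneous polynomials\<close>

text \<open>
  Building homogeneous polynomials up from constants by multiplication with coordinates allows the
  divisibility of $p - p \circ r_\alpha$ by $\langle\alpha, x\rangle$, and all product rules, to be
  proved by induction.
\<close>

inductive hpoly :: "nat \<Rightarrow> (real^'n \<Rightarrow> complex) \<Rightarrow> bool" where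
  const: "hpoly 0 (\<lambda>x. c)"
| coord: "hpoly m p \<Longrightarrow> hpoly (Suc m) (\<lambda>x. complex_of_real (x $ i) * p x)"
| add: "hpoly m p \<Longrightarrow> hpoly m q \<Longrightarrow> hpoly m (\<lambda>x. p x + q x)"

lemma hpoly_zero: "hpoly m (\<lambda>x. 0)"
proof (induction m)
  case (Suc m) from hpoly.coord[OF this] show ?case by simp
qed (rule hpoly.const)

lemma hpoly_cmult: "hpoly m p \<Longrightarrow> hpoly m (\<lambda>x. c * p x)"
proof (induction rule: hpoly.induct)
  case (coord m p i)
  from hpoly.coord[OF coord.IH] show ?case by (simp add: mult.left_commute)
next
  case (add m p q)
  from hpoly.add[OF add.IH] show ?case by (simp add: distrib_left)
qed (rule hpoly.const)

lemma hpoly_sum: "(\<And>i. i \<in> A \<Longrightarrow> hpoly m (p i)) \<Longrightarrow> hpoly m (\<lambda>x. \<Sum>i\<in>A. p i x)"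
  by (induction A rule: infinite_finite_induct) (auto simp: hpoly_zero intro: hpoly.add)

lemma hpoly_diff: "hpoly m p \<Longrightarrow> hpoly m q \<Longrightarrow> hpoly m (\<lambda>x. p x - q x)"
  using hpoly.add[OF _ hpoly_cmult[of m q "-1"]] by simp

lemma inner_vec_expand: "v \<bullet> (x::real^'n) = (\<Sum>i\<in>UNIV. v $ i * x $ i)"
  by (simp add: inner_vec_def)

lemma hpoly_linear_mult:
  assumes "hpoly m p" shows "hpoly (Suc m) (\<lambda>x. complex_of_real (v \<bullet> x) * p x)"
proof -
  have "hpoly (Suc m) (\<lambda>x. \<Sum>i\<in>UNIV. complex_of_real (v $ i) * (complex_of_real (x $ i) * p x))"
    by (intro hpoly_sum hpoly_cmult hpoly.coord assms)
  thus ?thesis by (simp add: inner_vec_expand sum_distrib_right mult.assoc)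
qed

lemma hpoly_reflection: "hpoly m p \<Longrightarrow> hpoly m (\<lambda>x. p (reflection \<alpha> x))"
proof (induction rule: hpoly.induct)
  case (coord m p i)
  have "reflection \<alpha> x $ i = (axis i 1 - (2 * \<alpha> $ i / (norm \<alpha>)\<^sup>2) *\<^sub>R \<alpha>) \<bullet> x" for x
    by (simp add: reflection_def inner_diff_left inner_axis')
  thus ?case using hpoly_linear_mult[OF coord.IH] by simp
qed (auto intro: hpoly.intros)

lemma hpoly_mult: "hpoly m p \<Longrightarrow> hpoly n q \<Longrightarrow> hpoly (m + n) (\<lambda>x. p x * q x)"
proof (induction rule: hpoly.induct)
  case (const c)
  thus ?case by (simp add: hpoly_cmult)
next
  case (coord m p i)
  from hpoly.coord[OF coord.IH[OF coord.prems], of i] show ?case by (simp add: mult.assoc)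
next
  case (add m p q)
  thus ?case using hpoly.add by (fastforce simp: distrib_right)
qed

lemma hpoly_cnj: "hpoly m p \<Longrightarrow> hpoly m (\<lambda>x. cnj (p x))"
  by (induction rule: hpoly.induct) (auto intro: hpoly.intros)

lemma hpoly_radius: "hpoly 2 (\<lambda>x::real^'n. complex_of_real (x \<bullet> x))"
proof -
  have "hpoly (Suc (Suc 0)) (\<lambda>x::real^'n. \<Sum>i\<in>UNIV. complex_of_real (x $ i) * (complex_of_real (x $ i) * 1))"
    by (intro hpoly_sum hpoly.intros)
  thus ?thesis by (simp add: inner_vec_expand numeral_2_eq_2)
qed

lemma hpoly_radius_power: "hpoly m h \<Longrightarrow> hpoly (m + 2 * j) (\<lambda>x. complex_of_real ((x \<bullet> x) ^ j) * h x)"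
proof (induction j)
  case (Suc j)
  from hpoly_mult[OF hpoly_radius Suc.IH[OF Suc.prems]] show ?case by (simp add: mult.assoc)
qed simp

lemma hpoly_continuous: "hpoly m p \<Longrightarrow> continuous_on A p"
  by (induction rule: hpoly.induct) (auto intro!: continuous_intros)

lemma hpoly_homogeneous: "hpoly m p \<Longrightarrow> p (c *\<^sub>R x) = complex_of_real (c ^ m) * p x"
  by (induction rule: hpoly.induct) (auto simp: distrib_left)

lemma hpoly_bound: "hpoly m p \<Longrightarrow> \<exists>C\<ge>0. \<forall>x. cmod (p x) \<le> C * norm x ^ m"
proof (induction rule: hpoly.induct)
  case (const c) show ?case by (rule exI[of _ "cmod c"]) simp
next
  case (coord m p i)
  then obtain C where C: "C \<ge> 0" "\<And>x. cmod (p x) \<le> C * norm x ^ m" by blast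
  have "cmod (complex_of_real (x $ i) * p x) \<le> C * norm x ^ Suc m" for x
  proof -
    have "\<bar>x $ i\<bar> * cmod (p x) \<le> norm x * (C * norm x ^ m)"
      using component_le_norm_cart[of x i] C by (intro mult_mono) auto
    thus ?thesis by (simp add: norm_mult mult_ac)
  qed
  thus ?case using C(1) by blast
next
  case (add m p q)
  then obtain C D where C: "C \<ge> 0" "\<And>x. cmod (p x) \<le> C * norm x ^ m"
    and D: "D \<ge> 0" "\<And>x. cmod (q x) \<le> D * norm x ^ m" by blast
  have "cmod (p x + q x) \<le> (C + D) * norm x ^ m" for x
    using norm_triangle_ineq[of "p x" "q x"] C(2)[of x] D(2)[of x] by (simp add: distrib_right)
  thus ?case using C(1) D(1) by (intro exI[of _ "C + D"]) auto
qed

definition dir_smooth :: "(real^'n \<Rightarrow> complex) \<Rightarrow> real^'n \<Rightarrow> bool" where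
  "dir_smooth f x \<longleftrightarrow> (\<forall>\<xi>. has_dir f x \<xi> (dir_deriv \<xi> f x))"

lemma dir_smoothI: "(\<And>\<xi>. has_dir f x \<xi> (d \<xi>)) \<Longrightarrow> dir_smooth f x"
  unfolding dir_smooth_def using has_dir_unique by metis

lemma dir_smoothD: "dir_smooth f x \<Longrightarrow> has_dir f x \<xi> (dir_deriv \<xi> f x)"
  by (simp add: dir_smooth_def)

lemma dir_smooth_add: "\<lbrakk>dir_smooth f x; dir_smooth g x\<rbrakk> \<Longrightarrow> dir_smooth (\<lambda>x. f x + g x) x"
  by (rule dir_smoothI, rule has_dir_add) (auto dest: dir_smoothD)

lemma dir_smooth_cmult: "dir_smooth f x \<Longrightarrow> dir_smooth (\<lambda>x. c * f x) x"
  by (rule dir_smoothI, rule has_dir_cmult) (auto dest: dir_smoothD)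

lemma dir_smooth_mult: "\<lbrakk>dir_smooth f x; dir_smooth g x\<rbrakk> \<Longrightarrow> dir_smooth (\<lambda>x. f x * g x) x"
  by (rule dir_smoothI, rule has_dir_mult) (auto dest: dir_smoothD)

lemma dir_smooth_sum: "(\<And>i. i \<in> A \<Longrightarrow> dir_smooth (f i) x) \<Longrightarrow> dir_smooth (\<lambda>x. \<Sum>i\<in>A. f i x) x"
  by (rule dir_smoothI, rule has_dir_sum) (auto dest: dir_smoothD)

lemma hpoly_smooth: "hpoly m p \<Longrightarrow> dir_smooth p x"
proof (induction rule: hpoly.induct)
  case (const c) show ?case by (rule dir_smoothI, rule has_dir_const)
next
  case (coord m p i)
  have "dir_smooth (\<lambda>x. complex_of_real (axis i 1 \<bullet> x)) x" by (rule dir_smoothI, rule has_dir_linear)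
  from dir_smooth_mult[OF this coord.IH] show ?case by (simp add: inner_axis')
next
  case (add m p q) thus ?case by (intro dir_smooth_add)
qed

lemma dir_deriv_linear_mult:
  assumes "dir_smooth p x"
  shows "dir_deriv \<xi> (\<lambda>x. complex_of_real (v \<bullet> x) * p x) x
    = complex_of_real (v \<bullet> \<xi>) * p x + complex_of_real (v \<bullet> x) * dir_deriv \<xi> p x"
  using has_dir_unique[OF has_dir_mult[OF has_dir_linear dir_smoothD[OF assms]]] by (simp add: add.commute)

lemma dir_deriv_add: "\<lbrakk>dir_smooth f x; dir_smooth g x\<rbrakk> \<Longrightarrow> dir_deriv \<xi> (\<lambda>x. f x + g x) x = dir_deriv \<xi> f x + dir_deriv \<xi> g x"
  by (rule has_dir_unique, rule has_dir_add) (auto dest: dir_smoothD)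

lemma dir_deriv_cmult: "dir_smooth f x \<Longrightarrow> dir_deriv \<xi> (\<lambda>x. c * f x) x = c * dir_deriv \<xi> f x"
  by (rule has_dir_unique, rule has_dir_cmult) (auto dest: dir_smoothD)

lemma dir_deriv_const: "dir_deriv \<xi> (\<lambda>x. c) x = 0"
  by (rule has_dir_unique, rule has_dir_const)

text \<open>
  Differentiation lowers the degree by one and kills constants.  The case distinction keeps the
  information that the result is zero for $m = 0$, where $m - 1 = 0$ on natural numbers.
\<close>

lemma hpoly_dir_deriv_aux:
  "hpoly m p \<Longrightarrow> (case m of 0 \<Rightarrow> dir_deriv \<xi> p = (\<lambda>x. 0) | Suc k \<Rightarrow> hpoly k (dir_deriv \<xi> p))"
proof (induction rule: hpoly.induct)
  case (const c) show ?case by (simp add: fun_eq_iff dir_deriv_const)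
next
  case (coord m p i)
  have eq: "dir_deriv \<xi> (\<lambda>x. complex_of_real (x $ i) * p x)
      = (\<lambda>x. complex_of_real (\<xi> $ i) * p x + complex_of_real (x $ i) * dir_deriv \<xi> p x)"
    using dir_deriv_linear_mult[OF hpoly_smooth[OF coord.hyps], where v = "axis i 1"] by (simp add: inner_axis' fun_eq_iff)
  have "hpoly m (\<lambda>x. complex_of_real (x $ i) * dir_deriv \<xi> p x)"
    using coord.IH by (cases m) (auto simp: hpoly_zero intro: hpoly.coord)
  thus ?case unfolding eq using coord.hyps by (auto intro!: hpoly.add hpoly_cmult)
next
  case (add m p q)
  have "dir_deriv \<xi> (\<lambda>x. p x + q x) = (\<lambda>x. dir_deriv \<xi> p x + dir_deriv \<xi> q x)"
    using hpoly_smooth[OF add.hyps(1)] hpoly_smooth[OF add.hyps(2)] by (simp add: fun_eq_iff dir_deriv_add)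
  thus ?case using add.IH by (cases m) (auto intro: hpoly.add)
qed

section \<open>Dunkl operators on polynomials and radial functions\<close>

text \<open>
  Product rule for the difference quotient, from
  $\langle v, r_\alpha x\rangle = \langle v,x\rangle - \frac{2\langle v,\alpha\rangle}{\|\alpha\|^2}\langle\alpha,x\rangle$.
  On the hyperplane the quotient is a directional derivative, and the same formula results because
  $r_\alpha x = x$ there.
\<close>

lemma dunkl_quotient_linear_mult:
  assumes p: "dir_smooth p x" and \<alpha>: "\<alpha> \<noteq> 0"
  shows "dunkl_quotient \<alpha> (\<lambda>x. complex_of_real (v \<bullet> x) * p x) x
    = complex_of_real (v \<bullet> x) * dunkl_quotient \<alpha> p x
      + complex_of_real (2 * (v \<bullet> \<alpha>) / (norm \<alpha>)\<^sup>2) * p (reflection \<alpha> x)"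
proof (cases "\<alpha> \<bullet> x = 0")
  case True
  thus ?thesis using dir_deriv_linear_mult[OF p, of \<alpha> v]
    by (simp add: dunkl_quotient_def reflection_fixed algebra_simps)
next
  case False
  have "v \<bullet> reflection \<alpha> x = v \<bullet> x - (\<alpha> \<bullet> x) * (2 * (v \<bullet> \<alpha>) / (norm \<alpha>)\<^sup>2)"
    by (simp add: reflection_inner)
  hence "complex_of_real (v \<bullet> reflection \<alpha> x) = complex_of_real (v \<bullet> x)
      - complex_of_real (\<alpha> \<bullet> x) * complex_of_real (2 * (v \<bullet> \<alpha>) / (norm \<alpha>)\<^sup>2)"
    by (simp only: of_real_diff of_real_mult)
  thus ?thesis using False
    by (simp add: dunkl_quotient_def divide_simps del: of_real_divide of_real_mult) (simp add: algebra_simps)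
qed

lemma dunkl_quotient_add: "\<lbrakk>dir_smooth f x; dir_smooth g x\<rbrakk> \<Longrightarrow>
    dunkl_quotient \<alpha> (\<lambda>x. f x + g x) x = dunkl_quotient \<alpha> f x + dunkl_quotient \<alpha> g x"
  by (simp add: dunkl_quotient_def dir_deriv_add add_divide_distrib diff_divide_distrib algebra_simps)

lemma dunkl_quotient_cmult: "dir_smooth f x \<Longrightarrow> dunkl_quotient \<alpha> (\<lambda>x. c * f x) x = c * dunkl_quotient \<alpha> f x"
  by (simp add: dunkl_quotient_def dir_deriv_cmult right_diff_distrib)

lemma inner_dunkl_quotient:
  "complex_of_real (\<alpha> \<bullet> x) * dunkl_quotient \<alpha> p x = p x - p (reflection \<alpha> x)"
  by (simp add: dunkl_quotient_def reflection_fixed)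

lemma hpoly_dunkl_quotient_aux:
  assumes "\<alpha> \<noteq> 0"
  shows "hpoly m p \<Longrightarrow> (case m of 0 \<Rightarrow> dunkl_quotient \<alpha> p = (\<lambda>x. 0) | Suc k \<Rightarrow> hpoly k (dunkl_quotient \<alpha> p))"
proof (induction rule: hpoly.induct)
  case (const c) show ?case by (simp add: fun_eq_iff dunkl_quotient_def dir_deriv_const)
next
  case (coord m p i)
  have eq: "dunkl_quotient \<alpha> (\<lambda>x. complex_of_real (x $ i) * p x)
      = (\<lambda>x. complex_of_real (x $ i) * dunkl_quotient \<alpha> p x
        + complex_of_real (2 * \<alpha> $ i / (norm \<alpha>)\<^sup>2) * p (reflection \<alpha> x))"
    using dunkl_quotient_linear_mult[OF hpoly_smooth[OF coord.hyps] assms, where v = "axis i 1"]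
    by (simp add: inner_axis' fun_eq_iff)
  have "hpoly m (\<lambda>x. complex_of_real (x $ i) * dunkl_quotient \<alpha> p x)"
    using coord.IH by (cases m) (auto simp: hpoly_zero intro: hpoly.coord)
  thus ?case unfolding eq nat.case by (intro hpoly.add hpoly_cmult hpoly_reflection coord.hyps)
next
  case (add m p q)
  have "dunkl_quotient \<alpha> (\<lambda>x. p x + q x) = (\<lambda>x. dunkl_quotient \<alpha> p x + dunkl_quotient \<alpha> q x)"
    using hpoly_smooth[OF add.hyps(1)] hpoly_smooth[OF add.hyps(2)] by (simp add: fun_eq_iff dunkl_quotient_add)
  thus ?case using add.IH by (cases m) (auto intro: hpoly.add)
qed

lemma dunkl_operator_add: "\<lbrakk>dir_smooth f x; dir_smooth g x\<rbrakk> \<Longrightarrow>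
    dunkl_operator P k \<xi> (\<lambda>x. f x + g x) x = dunkl_operator P k \<xi> f x + dunkl_operator P k \<xi> g x"
  by (simp add: dunkl_operator_def dir_deriv_add dunkl_quotient_add distrib_left sum.distrib)

lemma dunkl_operator_cmult: "dir_smooth f x \<Longrightarrow>
    dunkl_operator P k \<xi> (\<lambda>x. c * f x) x = c * dunkl_operator P k \<xi> f x"
  by (simp add: dunkl_operator_def dir_deriv_cmult dunkl_quotient_cmult distrib_left sum_distrib_left mult.left_commute)

lemma dunkl_operator_const: "dunkl_operator P k \<xi> (\<lambda>x. c) x = 0"
proof -
  have "dunkl_quotient \<alpha> (\<lambda>x. c) x = 0" for \<alpha> by (simp add: dunkl_quotient_def dir_deriv_const)
  thus ?thesis by (simp add: dunkl_operator_def dir_deriv_const)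
qed

lemma dunkl_operator_sum: "(\<And>i. i \<in> A \<Longrightarrow> dir_smooth (f i) x) \<Longrightarrow>
    dunkl_operator P k \<xi> (\<lambda>x. \<Sum>i\<in>A. f i x) x = (\<Sum>i\<in>A. dunkl_operator P k \<xi> (f i) x)"
proof (induction A rule: infinite_finite_induct)
  case (insert i A)
  thus ?case by (simp add: dunkl_operator_add dir_smooth_sum)
qed (auto simp: dunkl_operator_const)

lemma dunkl_operator_cong:
  assumes U: "open U" "x \<in> U" "\<And>\<alpha> y. y \<in> U \<Longrightarrow> reflection \<alpha> y \<in> U"
    and eq: "\<And>y. y \<in> U \<Longrightarrow> f y = g y" and g: "dir_smooth g x"
  shows "dunkl_operator P k \<xi> f x = dunkl_operator P k \<xi> g x" "dir_smooth f x"
proof -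
  have "has_dir f x \<xi> (dir_deriv \<xi> g x)" for \<xi> by (rule has_dir_cong[OF U(1,2) eq dir_smoothD[OF g]])
  thus "dir_smooth f x" by (rule dir_smoothI)
  have "dir_deriv \<xi> f x = dir_deriv \<xi> g x" for \<xi>
    by (rule has_dir_unique) (rule has_dir_cong[OF U(1,2) eq dir_smoothD[OF g]])
  thus "dunkl_operator P k \<xi> f x = dunkl_operator P k \<xi> g x"
    using U eq by (simp add: dunkl_operator_def dunkl_quotient_def cong: if_cong)
qed

lemma hpoly_dunkl_aux:
  assumes "0 \<notin> P" "hpoly m p"
  shows "case m of 0 \<Rightarrow> dunkl_operator P k \<xi> p = (\<lambda>x. 0) | Suc j \<Rightarrow> hpoly j (dunkl_operator P k \<xi> p)"
proof -
  have Q: "case m of 0 \<Rightarrow> dunkl_quotient \<alpha> p = (\<lambda>x. 0) | Suc j \<Rightarrow> hpoly j (dunkl_quotient \<alpha> p)" if "\<alpha> \<in> P" for \<alpha>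
    using hpoly_dunkl_quotient_aux[OF _ assms(2), of \<alpha>] that assms(1) by auto
  note D = hpoly_dir_deriv_aux[OF assms(2), of \<xi>]
  show ?thesis
  proof (cases m)
    case 0 thus ?thesis using Q D by (simp add: dunkl_operator_def fun_eq_iff)
  next
    case (Suc j)
    have "hpoly j (\<lambda>x. dir_deriv \<xi> p x + (\<Sum>\<alpha>\<in>P. complex_of_real (k \<alpha> * (\<alpha> \<bullet> \<xi>)) * dunkl_quotient \<alpha> p x))"
      using Q D Suc by (intro hpoly.add hpoly_sum hpoly_cmult) auto
    thus ?thesis using Suc by (simp add: dunkl_operator_def[abs_def])
  qed
qed

lemma hpoly_dunkl: "\<lbrakk>0 \<notin> P; hpoly m p\<rbrakk> \<Longrightarrow> hpoly (m - 1) (dunkl_operator P k \<xi> p)"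
  using hpoly_dunkl_aux[of P m p k \<xi>] by (cases m) (auto simp: hpoly_zero)

lemma hpoly_laplacian: "\<lbrakk>0 \<notin> P; hpoly (m + 2) p\<rbrakk> \<Longrightarrow> hpoly m (dunkl_laplacian P k p)"
  unfolding dunkl_laplacian_def[abs_def]
  using hpoly_dunkl[of P "m + 2" p k] hpoly_dunkl[of P "Suc m" _ k] by (intro hpoly_sum) auto

lemma laplacian_low_degree:
  assumes P: "0 \<notin> P" and p: "hpoly m p" and m: "m < 2"
  shows "dunkl_laplacian P k p x = 0"
proof -
  have "dunkl_operator P k \<xi> (dunkl_operator P k \<xi> p) x = 0" for \<xi>
  proof (cases m)
    case 0
    hence "dunkl_operator P k \<xi> p = (\<lambda>x. 0)" using hpoly_dunkl_aux[OF P p] by simp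
    thus ?thesis using hpoly_dunkl_aux[OF P hpoly.const[of 0]] by simp
  next
    case (Suc j)
    hence "hpoly 0 (dunkl_operator P k \<xi> p)" using hpoly_dunkl_aux[OF P p] m by simp
    thus ?thesis using hpoly_dunkl_aux[OF P, of 0 "dunkl_operator P k \<xi> p"] by simp
  qed
  thus ?thesis by (simp add: dunkl_laplacian_def)
qed

lemma laplacian_add:
  assumes P: "0 \<notin> P" and p: "hpoly m p" "hpoly m q"
  shows "dunkl_laplacian P k (\<lambda>x. c * p x + q x) x = c * dunkl_laplacian P k p x + dunkl_laplacian P k q x"
proof -
  have "dunkl_operator P k \<xi> (\<lambda>x. c * p x + q x) = (\<lambda>x. c * dunkl_operator P k \<xi> p x + dunkl_operator P k \<xi> q x)" for \<xi>
    using hpoly_smooth[OF p(1)] hpoly_smooth[OF p(2)]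
    by (simp add: fun_eq_iff dunkl_operator_add dunkl_operator_cmult dir_smooth_cmult)
  moreover have "dir_smooth (dunkl_operator P k \<xi> p) x" "dir_smooth (dunkl_operator P k \<xi> q) x" for \<xi>
    using hpoly_smooth[OF hpoly_dunkl[OF P p(1)]] hpoly_smooth[OF hpoly_dunkl[OF P p(2)]] by auto
  ultimately show ?thesis
    by (simp add: dunkl_laplacian_def dunkl_operator_add dunkl_operator_cmult dir_smooth_cmult sum.distrib sum_distrib_left)
qed

lemma sum_Basis_product: "(\<Sum>\<xi>\<in>Basis. (x \<bullet> \<xi>) * (y \<bullet> \<xi>)) = x \<bullet> (y::real^'n)"
  by (rule euclidean_inner[symmetric])

lemma euler_identity:
  "hpoly m p \<Longrightarrow> (\<Sum>\<xi>\<in>Basis. complex_of_real (x \<bullet> \<xi>) * dir_deriv \<xi> p x) = of_nat m * p x"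
proof (induction rule: hpoly.induct)
  case (const c) show ?case by (simp add: dir_deriv_const)
next
  case (coord m p i)
  have "dir_deriv \<xi> (\<lambda>x. complex_of_real (x $ i) * p x) x
      = complex_of_real (\<xi> $ i) * p x + complex_of_real (x $ i) * dir_deriv \<xi> p x" for \<xi>
    using dir_deriv_linear_mult[OF hpoly_smooth[OF coord.hyps], where v = "axis i 1"] by (simp add: inner_axis')
  hence "(\<Sum>\<xi>\<in>Basis. complex_of_real (x \<bullet> \<xi>) * dir_deriv \<xi> (\<lambda>x. complex_of_real (x $ i) * p x) x)
      = complex_of_real (\<Sum>\<xi>\<in>Basis. (x \<bullet> \<xi>) * (axis i 1 \<bullet> \<xi>)) * p x
        + complex_of_real (x $ i) * (\<Sum>\<xi>\<in>Basis. complex_of_real (x \<bullet> \<xi>) * dir_deriv \<xi> p x)"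
    by (simp add: inner_axis' distrib_left sum.distrib sum_distrib_left sum_distrib_right mult_ac)
  also have "(\<Sum>\<xi>\<in>Basis. (x \<bullet> \<xi>) * (axis i 1 \<bullet> \<xi>)) = x $ i"
    by (simp add: sum_Basis_product inner_axis)
  finally show ?case unfolding coord.IH by (simp add: algebra_simps)
next
  case (add m p q)
  thus ?case using hpoly_smooth[OF add.hyps(1)] hpoly_smooth[OF add.hyps(2)]
    by (simp add: dir_deriv_add distrib_left sum.distrib)
qed

lemma sum_swap_reflection_term:
  fixes A :: "real^'n \<Rightarrow> complex"
  shows "(\<Sum>\<xi>\<in>Basis. complex_of_real (x \<bullet> \<xi>) * (\<Sum>\<alpha>\<in>P. complex_of_real (k \<alpha> * (\<alpha> \<bullet> \<xi>)) * A \<alpha>))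
    = (\<Sum>\<alpha>\<in>P. complex_of_real (k \<alpha>) * (complex_of_real (\<alpha> \<bullet> x) * A \<alpha>))"
proof -
  have "(\<Sum>\<xi>\<in>Basis. complex_of_real (x \<bullet> \<xi>) * (\<Sum>\<alpha>\<in>P. complex_of_real (k \<alpha> * (\<alpha> \<bullet> \<xi>)) * A \<alpha>))
      = (\<Sum>\<alpha>\<in>P. complex_of_real (k \<alpha>) * (complex_of_real (\<Sum>\<xi>\<in>Basis. (\<alpha> \<bullet> \<xi>) * (x \<bullet> \<xi>)) * A \<alpha>))"
    unfolding sum_distrib_left by (subst sum.swap) (simp add: sum_distrib_left sum_distrib_right mult_ac)
  thus ?thesis by (simp add: sum_Basis_product)
qed

lemma dunkl_euler:
  assumes "hpoly m p"
  shows "(\<Sum>\<xi>\<in>Basis. complex_of_real (x \<bullet> \<xi>) * dunkl_operator P k \<xi> p x)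
    = of_nat m * p x + (\<Sum>\<alpha>\<in>P. complex_of_real (k \<alpha>) * (p x - p (reflection \<alpha> x)))"
  unfolding dunkl_operator_def distrib_left sum.distrib euler_identity[OF assms]
    sum_swap_reflection_term inner_dunkl_quotient ..

text \<open>
  The commutator $[T_\xi, x_\xi] = 1 + \sum_\alpha 2k_\alpha\frac{\langle\alpha,\xi\rangle^2}{\|\alpha\|^2}\,r_\alpha$ sums over an
  orthonormal basis to $N + 2\sum_\alpha k_\alpha r_\alpha$, which turns the signs of the reflection terms of
  \<open>dunkl_euler\<close>.
\<close>

lemma dunkl_euler_adjoint:
  fixes x :: "real^'n"
  assumes p: "hpoly m p" and P: "0 \<notin> P"
  shows "(\<Sum>\<xi>\<in>Basis. dunkl_operator P k \<xi> (\<lambda>y. complex_of_real (\<xi> \<bullet> y) * p y) x)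
    = of_nat (CARD('n) + m) * p x + (\<Sum>\<alpha>\<in>P. complex_of_real (k \<alpha>) * (p x + p (reflection \<alpha> x)))"
proof -
  have "dunkl_operator P k \<xi> (\<lambda>y. complex_of_real (\<xi> \<bullet> y) * p y) x
      = p x + complex_of_real (x \<bullet> \<xi>) * dunkl_operator P k \<xi> p x
        + (\<Sum>\<alpha>\<in>P. complex_of_real (k \<alpha> * 2 / (norm \<alpha>)\<^sup>2 * ((\<alpha> \<bullet> \<xi>) * (\<alpha> \<bullet> \<xi>))) * p (reflection \<alpha> x))"
    if \<xi>: "\<xi> \<in> Basis" for \<xi> :: "real^'n"
  proof -
    have dq: "dunkl_quotient \<alpha> (\<lambda>y. complex_of_real (\<xi> \<bullet> y) * p y) x
        = complex_of_real (x \<bullet> \<xi>) * dunkl_quotient \<alpha> p x + complex_of_real (2 * (\<alpha> \<bullet> \<xi>) / (norm \<alpha>)\<^sup>2) * p (reflection \<alpha> x)"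
      if "\<alpha> \<in> P" for \<alpha>
      using dunkl_quotient_linear_mult[OF hpoly_smooth[OF p], of \<alpha> \<xi> x] that P by (auto simp: inner_commute)
    have "\<xi> \<bullet> \<xi> = 1" using \<xi> by simp
    thus ?thesis using dir_deriv_linear_mult[OF hpoly_smooth[OF p], of \<xi> \<xi> x] dq
      by (simp add: dunkl_operator_def distrib_left sum.distrib sum_distrib_left inner_commute mult_ac cong: sum.cong)
  qed
  hence "(\<Sum>\<xi>\<in>Basis. dunkl_operator P k \<xi> (\<lambda>y. complex_of_real (\<xi> \<bullet> y) * p y) x)
      = of_nat (CARD('n)) * p x + (of_nat m * p x + (\<Sum>\<alpha>\<in>P. complex_of_real (k \<alpha>) * (p x - p (reflection \<alpha> x))))
        + (\<Sum>\<xi>\<in>Basis. \<Sum>\<alpha>\<in>P. complex_of_real (k \<alpha> * 2 / (norm \<alpha>)\<^sup>2 * ((\<alpha> \<bullet> \<xi>) * (\<alpha> \<bullet> \<xi>))) * p (reflection \<alpha> x))"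
    by (simp add: sum.distrib dunkl_euler[OF p])
  also have "(\<Sum>\<xi>\<in>Basis. \<Sum>\<alpha>\<in>P. complex_of_real (k \<alpha> * 2 / (norm \<alpha>)\<^sup>2 * ((\<alpha> \<bullet> \<xi>) * (\<alpha> \<bullet> \<xi>))) * p (reflection \<alpha> x))
      = (\<Sum>\<alpha>\<in>P. complex_of_real (k \<alpha>) * (2 * p (reflection \<alpha> x)))"
  proof (subst sum.swap, rule sum.cong[OF refl])
    fix \<alpha> assume "\<alpha> \<in> P"
    hence nz: "\<alpha> \<bullet> \<alpha> \<noteq> 0" using P by auto
    have "(\<Sum>\<xi>\<in>Basis. complex_of_real (k \<alpha> * 2 / (norm \<alpha>)\<^sup>2 * ((\<alpha> \<bullet> \<xi>) * (\<alpha> \<bullet> \<xi>))) * p (reflection \<alpha> x))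
        = complex_of_real (k \<alpha> * 2 / (norm \<alpha>)\<^sup>2 * (\<Sum>\<xi>\<in>Basis. (\<alpha> \<bullet> \<xi>) * (\<alpha> \<bullet> \<xi>))) * p (reflection \<alpha> x)"
      by (simp only: sum_distrib_left sum_distrib_right of_real_sum)
    also have "k \<alpha> * 2 / (norm \<alpha>)\<^sup>2 * (\<Sum>\<xi>\<in>Basis. (\<alpha> \<bullet> \<xi>) * (\<alpha> \<bullet> \<xi>)) = k \<alpha> * 2"
      unfolding sum_Basis_product power2_norm_eq_inner using nz by simp
    finally show "(\<Sum>\<xi>\<in>Basis. complex_of_real (k \<alpha> * 2 / (norm \<alpha>)\<^sup>2 * ((\<alpha> \<bullet> \<xi>) * (\<alpha> \<bullet> \<xi>))) * p (reflection \<alpha> x))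
        = complex_of_real (k \<alpha>) * (2 * p (reflection \<alpha> x))" by simp
  qed
  also have "of_nat (CARD('n)) * p x + (of_nat m * p x + (\<Sum>\<alpha>\<in>P. complex_of_real (k \<alpha>) * (p x - p (reflection \<alpha> x))))
        + (\<Sum>\<alpha>\<in>P. complex_of_real (k \<alpha>) * (2 * p (reflection \<alpha> x)))
      = of_nat (CARD('n) + m) * p x + ((\<Sum>\<alpha>\<in>P. complex_of_real (k \<alpha>) * (p x - p (reflection \<alpha> x)))
        + (\<Sum>\<alpha>\<in>P. complex_of_real (k \<alpha>) * (2 * p (reflection \<alpha> x))))"
    by (simp add: algebra_simps)
  also have "(\<Sum>\<alpha>\<in>P. complex_of_real (k \<alpha>) * (p x - p (reflection \<alpha> x)))
        + (\<Sum>\<alpha>\<in>P. complex_of_real (k \<alpha>) * (2 * p (reflection \<alpha> x)))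
      = (\<Sum>\<alpha>\<in>P. complex_of_real (k \<alpha>) * (p x + p (reflection \<alpha> x)))"
    unfolding sum.distrib[symmetric] by (intro sum.cong refl) (simp add: algebra_simps)
  finally show ?thesis .
qed

text \<open>
  Reflections preserve $\|x\|$, so a radial factor passes through the difference quotients and $T_\xi$
  satisfies the Leibniz rule as a derivation would.
\<close>

lemma dunkl_radial_mult:
  assumes p: "dir_smooth p x" and \<psi>: "(\<psi> has_real_derivative D) (at (x \<bullet> x))"
  shows "dunkl_operator P k \<xi> (\<lambda>x. p x * complex_of_real (\<psi> (x \<bullet> x))) x
      = dunkl_operator P k \<xi> p x * complex_of_real (\<psi> (x \<bullet> x)) + complex_of_real (\<xi> \<bullet> x) * p x * complex_of_real (2 * D)"
    and "dir_smooth (\<lambda>x. p x * complex_of_real (\<psi> (x \<bullet> x))) x"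
proof -
  note hd = has_dir_mult[OF dir_smoothD[OF p] has_dir_radial[OF \<psi>]]
  show "dir_smooth (\<lambda>x. p x * complex_of_real (\<psi> (x \<bullet> x))) x" by (rule dir_smoothI, rule hd)
  have dq: "dunkl_quotient \<alpha> (\<lambda>x. p x * complex_of_real (\<psi> (x \<bullet> x))) x = dunkl_quotient \<alpha> p x * complex_of_real (\<psi> (x \<bullet> x))" for \<alpha>
    using has_dir_unique[OF hd, of \<alpha>]
    by (auto simp: dunkl_quotient_def reflection_norm inner_commute left_diff_distrib diff_divide_distrib mult.assoc)
  show "dunkl_operator P k \<xi> (\<lambda>x. p x * complex_of_real (\<psi> (x \<bullet> x))) x
      = dunkl_operator P k \<xi> p x * complex_of_real (\<psi> (x \<bullet> x)) + complex_of_real (\<xi> \<bullet> x) * p x * complex_of_real (2 * D)"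
    using has_dir_unique[OF hd, of \<xi>]
    by (simp add: dunkl_operator_def dq distrib_right sum_distrib_right sum_distrib_left distrib_left inner_commute mult_ac)
qed

text \<open>
  The Dunkl Laplacian acts on $p(x)\psi(\|x\|^2)$ like the Laplacian in dimension
  $N + 2\langle k\rangle$, because $\sum_\xi (x_\xi T_\xi + T_\xi x_\xi)
  = N + 2\langle k\rangle + 2m$ on polynomials of degree $m$.
\<close>

lemma laplacian_radial:
  fixes p :: "real^'n \<Rightarrow> complex"
  assumes P: "0 \<notin> P" and p: "hpoly m p"
    and U: "open U" "\<And>\<alpha> y. y \<in> U \<Longrightarrow> reflection \<alpha> y \<in> U"
    and \<psi>: "\<And>y. y \<in> U \<Longrightarrow> (\<psi> has_real_derivative \<psi>1 (y \<bullet> y)) (at (y \<bullet> y))"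
    and \<psi>1: "\<And>y. y \<in> U \<Longrightarrow> (\<psi>1 has_real_derivative \<psi>2 (y \<bullet> y)) (at (y \<bullet> y))"
    and x: "x \<in> U"
  defines "f \<equiv> \<lambda>x. p x * complex_of_real (\<psi> (x \<bullet> x))"
  shows "dunkl_laplacian P k f x = dunkl_laplacian P k p x * complex_of_real (\<psi> (x \<bullet> x))
      + complex_of_real (2 * (real CARD('n) + 2 * mult_sum P k + 2 * real m) * \<psi>1 (x \<bullet> x) + 4 * (x \<bullet> x) * \<psi>2 (x \<bullet> x)) * p x"
    and "dir_smooth f x" "dir_smooth (dunkl_operator P k \<xi> f) x"
proof -
  let ?T = "dunkl_operator P k"
  have sp: "dir_smooth p y" for y by (rule hpoly_smooth[OF p])
  have sTp: "dir_smooth (?T \<xi> p) y" for y \<xi> by (rule hpoly_smooth[OF hpoly_dunkl[OF P p]])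
  have slp: "dir_smooth (\<lambda>y. complex_of_real (\<xi> \<bullet> y) * p y) z" for \<xi> z
    by (rule hpoly_smooth[OF hpoly_linear_mult[OF p]])
  show "dir_smooth f x" unfolding f_def by (rule dunkl_radial_mult(2)[OF sp \<psi>[OF x]])
  define g where "g \<xi> y = ?T \<xi> p y * complex_of_real (\<psi> (y \<bullet> y))
      + 2 * ((complex_of_real (\<xi> \<bullet> y) * p y) * complex_of_real (\<psi>1 (y \<bullet> y)))" for \<xi> y
  have fg: "?T \<xi> f y = g \<xi> y" if "y \<in> U" for \<xi> y
    unfolding f_def g_def using dunkl_radial_mult(1)[OF sp \<psi>[OF that]] by simp
  have sg: "dir_smooth (g \<xi>) x" for \<xi>
    unfolding g_def[abs_def]
    by (intro dir_smooth_add dir_smooth_cmult dunkl_radial_mult(2)[OF sTp \<psi>[OF x]] dunkl_radial_mult(2)[OF slp \<psi>1[OF x]])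
  note cong = dunkl_operator_cong[where f = "?T \<xi> f" and g = "g \<xi>" for \<xi>, OF U(1) x U(2) fg sg]
  show "dir_smooth (?T \<xi> f) x" by (rule cong(2))
  have TT: "?T \<xi> (?T \<xi> f) x = ?T \<xi> (?T \<xi> p) x * complex_of_real (\<psi> (x \<bullet> x))
      + complex_of_real (2 * \<psi>1 (x \<bullet> x)) * (complex_of_real (x \<bullet> \<xi>) * ?T \<xi> p x)
      + complex_of_real (2 * \<psi>1 (x \<bullet> x)) * ?T \<xi> (\<lambda>y. complex_of_real (\<xi> \<bullet> y) * p y) x
      + complex_of_real ((x \<bullet> \<xi>) * (x \<bullet> \<xi>)) * (complex_of_real (4 * \<psi>2 (x \<bullet> x)) * p x)" for \<xi>
  proof -
    have "?T \<xi> (?T \<xi> f) x = ?T \<xi> (g \<xi>) x" by (rule cong(1))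
    also have "\<dots> = ?T \<xi> (\<lambda>y. ?T \<xi> p y * complex_of_real (\<psi> (y \<bullet> y))) x
        + 2 * ?T \<xi> (\<lambda>y. (complex_of_real (\<xi> \<bullet> y) * p y) * complex_of_real (\<psi>1 (y \<bullet> y))) x"
      unfolding g_def[abs_def]
      using dunkl_radial_mult(2)[OF sTp \<psi>[OF x]] dunkl_radial_mult(2)[OF slp \<psi>1[OF x]]
      by (subst dunkl_operator_add) (auto simp: dir_smooth_cmult dunkl_operator_cmult)
    also have "?T \<xi> (\<lambda>y. ?T \<xi> p y * complex_of_real (\<psi> (y \<bullet> y))) x
        = ?T \<xi> (?T \<xi> p) x * complex_of_real (\<psi> (x \<bullet> x)) + complex_of_real (\<xi> \<bullet> x) * ?T \<xi> p x * complex_of_real (2 * \<psi>1 (x \<bullet> x))"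
      by (rule dunkl_radial_mult(1)[OF sTp \<psi>[OF x]])
    also have "?T \<xi> (\<lambda>y. (complex_of_real (\<xi> \<bullet> y) * p y) * complex_of_real (\<psi>1 (y \<bullet> y))) x
        = ?T \<xi> (\<lambda>y. complex_of_real (\<xi> \<bullet> y) * p y) x * complex_of_real (\<psi>1 (x \<bullet> x))
          + complex_of_real (\<xi> \<bullet> x) * (complex_of_real (\<xi> \<bullet> x) * p x) * complex_of_real (2 * \<psi>2 (x \<bullet> x))"
      by (rule dunkl_radial_mult(1)[OF slp \<psi>1[OF x]])
    finally show ?thesis by (simp add: algebra_simps inner_commute)
  qed
  have "dunkl_laplacian P k f x = dunkl_laplacian P k p x * complex_of_real (\<psi> (x \<bullet> x))
      + complex_of_real (2 * \<psi>1 (x \<bullet> x)) * (\<Sum>\<xi>\<in>Basis. complex_of_real (x \<bullet> \<xi>) * ?T \<xi> p x)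
      + complex_of_real (2 * \<psi>1 (x \<bullet> x)) * (\<Sum>\<xi>\<in>Basis. ?T \<xi> (\<lambda>y. complex_of_real (\<xi> \<bullet> y) * p y) x)
      + complex_of_real (\<Sum>\<xi>\<in>Basis. (x \<bullet> \<xi>) * (x \<bullet> \<xi>)) * (complex_of_real (4 * \<psi>2 (x \<bullet> x)) * p x)"
    unfolding dunkl_laplacian_def TT by (simp only: sum.distrib sum_distrib_left sum_distrib_right of_real_sum)
  also have "(\<Sum>\<xi>\<in>Basis. (x \<bullet> \<xi>) * (x \<bullet> \<xi>)) = x \<bullet> x" by (rule sum_Basis_product)
  finally show "dunkl_laplacian P k f x = dunkl_laplacian P k p x * complex_of_real (\<psi> (x \<bullet> x))
      + complex_of_real (2 * (real CARD('n) + 2 * mult_sum P k + 2 * real m) * \<psi>1 (x \<bullet> x) + 4 * (x \<bullet> x) * \<psi>2 (x \<bullet> x)) * p x"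
    unfolding dunkl_euler[OF p] dunkl_euler_adjoint[OF p P]
    by (simp add: mult_sum_def sum.distrib sum_subtractf algebra_simps sum_distrib_left sum_distrib_right)
qed

section \<open>Harmonic decomposition of polynomials\<close>

definition monomial :: "('n \<Rightarrow> nat) \<Rightarrow> real^'n \<Rightarrow> complex" where
  "monomial \<beta> x = complex_of_real (\<Prod>i\<in>UNIV. (x $ i) ^ \<beta> i)"

lemma homogeneous_polynomial_monomial:
  "homogeneous_polynomial m p \<longleftrightarrow> (\<exists>c. p = (\<lambda>x. \<Sum>\<beta> | sum \<beta> UNIV = m. c \<beta> * monomial \<beta> x))"
  unfolding homogeneous_polynomial_def monomial_def by (rule refl)

lemma finite_exponents: "finite {\<beta> :: 'n::finite \<Rightarrow> nat. sum \<beta> UNIV = m}"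
proof (rule finite_subset)
  show "{\<beta> :: 'n \<Rightarrow> nat. sum \<beta> UNIV = m} \<subseteq> (UNIV :: 'n set) \<rightarrow>\<^sub>E {..m}"
  proof
    fix \<beta> :: "'n \<Rightarrow> nat" assume "\<beta> \<in> {\<beta>. sum \<beta> UNIV = m}"
    hence "\<beta> i \<le> m" for i using member_le_sum[of i UNIV \<beta>] by simp
    thus "\<beta> \<in> (UNIV :: 'n set) \<rightarrow>\<^sub>E {..m}" by (simp add: PiE_UNIV_domain)
  qed
  show "finite ((UNIV :: 'n set) \<rightarrow>\<^sub>E {..m})" by (intro finite_PiE) auto
qed

lemma sum_exponents_Suc: "sum (\<beta>(i := Suc (\<beta> i))) UNIV = Suc (sum \<beta> (UNIV :: 'n::finite set))"
proof -
  have "sum (\<beta>(i := Suc (\<beta> i))) UNIV = Suc (\<beta> i) + sum (\<beta>(i := Suc (\<beta> i))) (UNIV - {i})"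
    by (subst sum.remove[of _ i]) auto
  also have "sum (\<beta>(i := Suc (\<beta> i))) (UNIV - {i}) = sum \<beta> (UNIV - {i})" by (intro sum.cong) auto
  finally show ?thesis by (simp add: sum.remove[of UNIV i \<beta>])
qed

lemma monomial_Suc: "monomial (\<beta>(i := Suc (\<beta> i))) x = complex_of_real (x $ i) * monomial \<beta> x"
proof -
  have "(\<Prod>j\<in>UNIV. (x $ j) ^ (\<beta>(i := Suc (\<beta> i))) j) = (x $ i) ^ Suc (\<beta> i) * (\<Prod>j\<in>UNIV - {i}. (x $ j) ^ (\<beta>(i := Suc (\<beta> i))) j)"
    by (subst prod.remove[of _ i]) auto
  also have "(\<Prod>j\<in>UNIV - {i}. (x $ j) ^ (\<beta>(i := Suc (\<beta> i))) j) = (\<Prod>j\<in>UNIV - {i}. (x $ j) ^ \<beta> j)"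
    by (intro prod.cong) auto
  finally have "(\<Prod>j\<in>UNIV. (x $ j) ^ (\<beta>(i := Suc (\<beta> i))) j) = x $ i * (\<Prod>j\<in>UNIV. (x $ j) ^ \<beta> j)"
    by (simp add: prod.remove[of UNIV i "\<lambda>j. (x $ j) ^ \<beta> j"])
  thus ?thesis by (simp add: monomial_def)
qed

lemma exponents_Suc_bij:
  "bij_betw (\<lambda>\<beta>. \<beta>(i := Suc (\<beta> i))) {\<beta>. sum \<beta> UNIV = m} {\<beta> :: 'n::finite \<Rightarrow> nat. sum \<beta> UNIV = Suc m \<and> \<beta> i > 0}"
proof (rule bij_betwI[where g = "\<lambda>\<beta>. \<beta>(i := \<beta> i - 1)"])
  show "(\<lambda>\<beta>. \<beta>(i := \<beta> i - 1)) \<in> {\<beta>. sum \<beta> UNIV = Suc m \<and> \<beta> i > 0} \<rightarrow> {\<beta>. sum \<beta> UNIV = m}"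
  proof
    fix \<beta> :: "'n \<Rightarrow> nat" assume \<beta>: "\<beta> \<in> {\<beta>. sum \<beta> UNIV = Suc m \<and> \<beta> i > 0}"
    have "sum ((\<beta>(i := \<beta> i - 1))(i := Suc ((\<beta>(i := \<beta> i - 1)) i))) UNIV = Suc (sum (\<beta>(i := \<beta> i - 1)) UNIV)"
      by (rule sum_exponents_Suc)
    moreover have "(\<beta>(i := \<beta> i - 1))(i := Suc ((\<beta>(i := \<beta> i - 1)) i)) = \<beta>" using \<beta> by auto
    ultimately have "sum \<beta> UNIV = Suc (sum (\<beta>(i := \<beta> i - 1)) UNIV)" by metis
    thus "\<beta>(i := \<beta> i - 1) \<in> {\<beta>. sum \<beta> UNIV = m}" using \<beta> by (simp del: fun_upd_apply)
  qed
  show "(\<lambda>\<beta>. \<beta>(i := Suc (\<beta> i))) \<in> {\<beta>. sum \<beta> UNIV = m} \<rightarrow> {\<beta>. sum \<beta> UNIV = Suc m \<and> \<beta> i > 0}"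
    using sum_exponents_Suc[of _ i] by (auto simp del: fun_upd_apply) (simp only: fun_upd_same)
qed auto

lemma hpoly_monomial: "hpoly (sum \<beta> UNIV) (monomial \<beta>)"
proof (induction "sum \<beta> UNIV" arbitrary: \<beta>)
  case 0
  hence "\<beta> = (\<lambda>_. 0)" by (auto simp: fun_eq_iff)
  thus ?case using hpoly.const[of 1] by (simp add: monomial_def[abs_def])
next
  case (Suc m)
  then obtain i where i: "\<beta> i > 0" by (metis sum.neutral gr0I nat.distinct(1))
  define \<gamma> where "\<gamma> = \<beta>(i := \<beta> i - 1)"
  have \<beta>: "\<beta> = \<gamma>(i := Suc (\<gamma> i))" using i by (auto simp: \<gamma>_def)
  hence m: "m = sum \<gamma> UNIV" using Suc.hyps(2) sum_exponents_Suc[of \<gamma> i] by simp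
  have "hpoly (Suc (sum \<gamma> UNIV)) (\<lambda>x. complex_of_real (x $ i) * monomial \<gamma> x)"
    by (rule hpoly.coord[OF Suc.hyps(1)[OF m]])
  hence "hpoly (Suc (sum \<gamma> UNIV)) (monomial (\<gamma>(i := Suc (\<gamma> i))))" by (simp add: monomial_Suc[abs_def])
  thus ?case unfolding \<beta>[symmetric] Suc.hyps(2)[symmetric] m .
qed

lemma homogeneous_polynomial_iff_hpoly: "homogeneous_polynomial m p \<longleftrightarrow> hpoly m p"
proof
  assume "homogeneous_polynomial m p"
  then obtain c where p: "p = (\<lambda>x. \<Sum>\<beta> | sum \<beta> UNIV = m. c \<beta> * monomial \<beta> x)"
    by (auto simp: homogeneous_polynomial_monomial)
  show "hpoly m p" unfolding p by (intro hpoly_sum hpoly_cmult) (use hpoly_monomial in auto)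
next
  assume "hpoly m p"
  thus "homogeneous_polynomial m p"
  proof (induction rule: hpoly.induct)
    case (const c)
    have "{\<beta> :: 'a \<Rightarrow> nat. sum \<beta> UNIV = 0} = {\<lambda>_. 0}" by (auto simp: fun_eq_iff)
    thus ?case unfolding homogeneous_polynomial_monomial
      by (intro exI[of _ "\<lambda>_. c"]) (simp add: monomial_def)
  next
    case (coord m p i)
    then obtain c where c: "p = (\<lambda>x. \<Sum>\<beta> | sum \<beta> UNIV = m. c \<beta> * monomial \<beta> x)"
      by (auto simp: homogeneous_polynomial_monomial)
    define d where "d \<beta> = (if \<beta> i > 0 then c (\<beta>(i := \<beta> i - 1)) else 0)" for \<beta>
    have "complex_of_real (x $ i) * p x = (\<Sum>\<beta> | sum \<beta> UNIV = Suc m. d \<beta> * monomial \<beta> x)" for x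
    proof -
      have "(\<Sum>\<beta> | sum \<beta> UNIV = Suc m. d \<beta> * monomial \<beta> x)
          = (\<Sum>\<beta> | sum \<beta> UNIV = Suc m \<and> \<beta> i > 0. d \<beta> * monomial \<beta> x)"
        by (rule sum.mono_neutral_right[OF finite_exponents]) (auto simp: d_def)
      also have "\<dots> = (\<Sum>\<beta> | sum \<beta> UNIV = m. d (\<beta>(i := Suc (\<beta> i))) * monomial (\<beta>(i := Suc (\<beta> i))) x)"
        by (rule sum.reindex_bij_betw[OF exponents_Suc_bij, symmetric])
      also have "\<dots> = complex_of_real (x $ i) * p x"
        unfolding c sum_distrib_left by (intro sum.cong refl) (simp add: monomial_Suc d_def mult_ac)
      finally show ?thesis by simp
    qed
    thus ?case unfolding homogeneous_polynomial_monomial by blast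
  next
    case (add m p q)
    then obtain c d where "p = (\<lambda>x. \<Sum>\<beta> | sum \<beta> UNIV = m. c \<beta> * monomial \<beta> x)"
      "q = (\<lambda>x. \<Sum>\<beta> | sum \<beta> UNIV = m. d \<beta> * monomial \<beta> x)"
      by (auto simp: homogeneous_polynomial_monomial)
    hence "(\<lambda>x. p x + q x) = (\<lambda>x. \<Sum>\<beta> | sum \<beta> UNIV = m. (c \<beta> + d \<beta>) * monomial \<beta> x)"
      by (simp add: sum.distrib distrib_right)
    thus ?case unfolding homogeneous_polynomial_monomial by (intro exI[of _ "\<lambda>\<beta>. c \<beta> + d \<beta>"])
  qed
qed

lemma harmonics_iff: "p \<in> harmonics P k m \<longleftrightarrow> hpoly m p \<and> (\<forall>x. dunkl_laplacian P k p x = 0)"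
  by (simp add: harmonics_def homogeneous_polynomial_iff_hpoly)

lemma laplacian_zero: "dunkl_laplacian P k (\<lambda>x. 0) x = 0"
proof -
  have "dunkl_operator P k \<xi> (\<lambda>x. 0) = (\<lambda>x. 0)" for \<xi> by (simp add: fun_eq_iff dunkl_operator_const)
  thus ?thesis by (simp add: dunkl_laplacian_def)
qed

lemma harmonics_cmult:
  assumes P: "0 \<notin> P" and h: "h \<in> harmonics P k m"
  shows "(\<lambda>x. c * h x) \<in> harmonics P k m"
proof -
  have hp: "hpoly m h" and h0: "\<And>x. dunkl_laplacian P k h x = 0" using h by (auto simp: harmonics_iff)
  have "dunkl_laplacian P k (\<lambda>x. c * h x) x = 0" for x
    using laplacian_add[OF P hp hpoly_zero, of k c x] by (simp add: h0 laplacian_zero)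
  thus ?thesis using hpoly_cmult[OF hp] by (simp add: harmonics_iff)
qed

text \<open>
  The span of the polynomials $\|x\|^{2j}h$ of degree $m$ with $h$ harmonic, which turns out to be the
  space of all homogeneous polynomials of degree $m$.
\<close>

inductive radial_harmonic_sum :: "(real^'n) set \<Rightarrow> (real^'n \<Rightarrow> real) \<Rightarrow> nat \<Rightarrow> (real^'n \<Rightarrow> complex) \<Rightarrow> bool"
  for P k where
  base: "h \<in> harmonics P k d \<Longrightarrow> radial_harmonic_sum P k (d + 2 * j) (\<lambda>x. complex_of_real ((x \<bullet> x) ^ j) * h x)"
| add: "radial_harmonic_sum P k m p \<Longrightarrow> radial_harmonic_sum P k m q \<Longrightarrow> radial_harmonic_sum P k m (\<lambda>x. p x + q x)"

lemma laplacian_radius_power: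
  fixes h :: "real^'n \<Rightarrow> complex"
  assumes P: "0 \<notin> P" and h: "h \<in> harmonics P k d"
  shows "dunkl_laplacian P k (\<lambda>x. complex_of_real ((x \<bullet> x) ^ Suc j) * h x) x
    = complex_of_real (2 * (real j + 1) * (real CARD('n) + 2 * mult_sum P k + 2 * real d + 2 * real j))
      * (complex_of_real ((x \<bullet> x) ^ j) * h x)"
proof -
  let ?K = "real CARD('n) + 2 * mult_sum P k + 2 * real d"
  have hp: "hpoly d h" and h0: "dunkl_laplacian P k h x = 0" using h by (auto simp: harmonics_iff)
  have "dunkl_laplacian P k (\<lambda>x. h x * complex_of_real ((x \<bullet> x) ^ Suc j)) x
      = dunkl_laplacian P k h x * complex_of_real ((x \<bullet> x) ^ Suc j)
        + complex_of_real (2 * ?K * ((real j + 1) * (x \<bullet> x) ^ j)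
          + 4 * (x \<bullet> x) * ((real j + 1) * (real j * (x \<bullet> x) ^ (j - 1)))) * h x"
  proof (rule laplacian_radial(1)[OF P hp, of UNIV "\<lambda>s. s ^ Suc j" "\<lambda>s. (real j + 1) * s ^ j" "\<lambda>s. (real j + 1) * (real j * s ^ (j - 1))"])
    show "((\<lambda>s. s ^ Suc j) has_real_derivative (real j + 1) * (y \<bullet> y) ^ j) (at (y \<bullet> y))" for y :: "real^'n"
      by (rule DERIV_cong[OF DERIV_pow]) simp
    show "((\<lambda>s. (real j + 1) * s ^ j) has_real_derivative (real j + 1) * (real j * (y \<bullet> y) ^ (j - 1))) (at (y \<bullet> y))" for y :: "real^'n"
      by (rule DERIV_cong[OF DERIV_cmult[OF DERIV_pow]]) simp
  qed auto
  also have "4 * (x \<bullet> x) * ((real j + 1) * (real j * (x \<bullet> x) ^ (j - 1))) = 4 * ((real j + 1) * (real j * (x \<bullet> x) ^ j))"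
    by (cases j) auto
  finally show ?thesis by (simp add: h0 mult.commute[of _ "h _"] algebra_simps)
qed

text \<open>
  The constant by which $q \mapsto \Delta_k(\|x\|^2 q)$ multiplies $\|x\|^{2j}h$ is at least $2N > 0$ for
  nonnegative $\langle k\rangle$, so preimages are obtained by dividing term by term.
\<close>

lemma laplacian_surjective_on_radial_sums:
  fixes q :: "real^'n \<Rightarrow> complex"
  assumes P: "0 \<notin> P" and k: "mult_sum P k \<ge> 0"
  shows "radial_harmonic_sum P k m q \<Longrightarrow> \<exists>q0. hpoly m q0 \<and>
    radial_harmonic_sum P k (m + 2) (\<lambda>x. complex_of_real (x \<bullet> x) * q0 x) \<and>
    (\<forall>x. dunkl_laplacian P k (\<lambda>x. complex_of_real (x \<bullet> x) * q0 x) x = q x)"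
proof (induction rule: radial_harmonic_sum.induct)
  case (base h d j)
  define c where "c = 2 * (real j + 1) * (real CARD('n) + 2 * mult_sum P k + 2 * real d + 2 * real j)"
  have "0 < real CARD('n) + 2 * mult_sum P k + 2 * real d + 2 * real j"
  proof -
    have "0 < real CARD('n)" by simp
    thus ?thesis using k by linarith
  qed
  hence c: "c > 0" by (simp add: c_def)
  have hp: "hpoly d h" using base by (simp add: harmonics_iff)
  let ?q0 = "\<lambda>x. complex_of_real (1 / c) * (complex_of_real ((x \<bullet> x) ^ j) * h x)"
  have "(\<lambda>x. complex_of_real (1 / c) * h x) \<in> harmonics P k d"
    by (rule harmonics_cmult[OF P base])
  from radial_harmonic_sum.base[OF this, of "Suc j"]
  have "radial_harmonic_sum P k (d + 2 * j + 2) (\<lambda>x. complex_of_real (x \<bullet> x) * ?q0 x)"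
    by (simp add: mult_ac)
  moreover have "hpoly (d + 2 * j) ?q0" by (intro hpoly_cmult hpoly_radius_power hp)
  moreover have "dunkl_laplacian P k (\<lambda>x. complex_of_real (x \<bullet> x) * ?q0 x) x = complex_of_real ((x \<bullet> x) ^ j) * h x" for x
  proof -
    have hps: "hpoly (d + 2 * Suc j) (\<lambda>x. complex_of_real ((x \<bullet> x) ^ Suc j) * h x)" by (rule hpoly_radius_power[OF hp])
    have "dunkl_laplacian P k (\<lambda>x. complex_of_real (x \<bullet> x) * ?q0 x) x
        = dunkl_laplacian P k (\<lambda>x. complex_of_real (1 / c) * (complex_of_real ((x \<bullet> x) ^ Suc j) * h x) + 0) x"
      by (simp add: mult_ac)
    also have "\<dots> = complex_of_real (1 / c) * (complex_of_real c * (complex_of_real ((x \<bullet> x) ^ j) * h x))"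
      unfolding laplacian_add[OF P hps hpoly_zero] laplacian_radius_power[OF P base] c_def
      by (simp add: laplacian_zero)
    finally show ?thesis using c by simp
  qed
  ultimately show ?case by blast
next
  case (add m p q)
  then obtain p0 q0 where A: "hpoly m p0" "radial_harmonic_sum P k (m + 2) (\<lambda>x. complex_of_real (x \<bullet> x) * p0 x)"
    "\<And>x. dunkl_laplacian P k (\<lambda>x. complex_of_real (x \<bullet> x) * p0 x) x = p x"
    and B: "hpoly m q0" "radial_harmonic_sum P k (m + 2) (\<lambda>x. complex_of_real (x \<bullet> x) * q0 x)"
    "\<And>x. dunkl_laplacian P k (\<lambda>x. complex_of_real (x \<bullet> x) * q0 x) x = q x" by blast
  have hp: "hpoly (2 + m) (\<lambda>x. complex_of_real (x \<bullet> x) * p0 x)" "hpoly (2 + m) (\<lambda>x. complex_of_real (x \<bullet> x) * q0 x)"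
    using hpoly_mult[OF hpoly_radius] A(1) B(1) by auto
  have "hpoly m (\<lambda>x. p0 x + q0 x)" by (rule hpoly.add[OF A(1) B(1)])
  moreover have "radial_harmonic_sum P k (m + 2) (\<lambda>x. complex_of_real (x \<bullet> x) * (p0 x + q0 x))"
    using radial_harmonic_sum.add[OF A(2) B(2)] by (simp add: distrib_left)
  moreover have "dunkl_laplacian P k (\<lambda>x. complex_of_real (x \<bullet> x) * (p0 x + q0 x)) x = p x + q x" for x
    using laplacian_add[OF P hp, of k 1 x] A(3)[of x] B(3)[of x] by (simp add: distrib_left)
  ultimately show ?case by blast
qed

text \<open>
  Every polynomial of degree $m$ is a harmonic one plus $\|x\|^2$ times one of degree $m-2$.  The
  operator $q \mapsto \Delta_k(\|x\|^2 q)$ multiplies $\|x\|^{2j}h$, with $h$ harmonic, by a positive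
  constant, so by induction on the degree it is onto, and $\Delta_k p$ can be matched.
\<close>

lemma harmonic_decomposition:
  fixes p :: "real^'n \<Rightarrow> complex"
  assumes P: "0 \<notin> P" and k: "mult_sum P k \<ge> 0" and p: "hpoly m p"
  shows "\<exists>h q. h \<in> harmonics P k m \<and> (if m < 2 then q = (\<lambda>x. 0) else hpoly (m - 2) q) \<and>
    p = (\<lambda>x. h x + complex_of_real (x \<bullet> x) * q x) \<and> radial_harmonic_sum P k m p"
  using p
proof (induction m arbitrary: p rule: less_induct)
  case (less m)
  show ?case
  proof (cases "m < 2")
    case True
    hence "p \<in> harmonics P k m" using less.prems laplacian_low_degree[OF P less.prems] by (simp add: harmonics_iff)
    thus ?thesis using True radial_harmonic_sum.base[of p P k m 0] by (intro exI[of _ p] exI[of _ "\<lambda>x. 0"]) simp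
  next
    case False
    then obtain m' where m: "m = m' + 2" by (metis add.commute le_add_diff_inverse not_less)
    have "hpoly m' (dunkl_laplacian P k p)" using hpoly_laplacian[OF P] less.prems m by blast
    hence "radial_harmonic_sum P k m' (dunkl_laplacian P k p)" using less.IH[of m' "dunkl_laplacian P k p"] m by auto
    then obtain q0 where q0: "hpoly m' q0" "radial_harmonic_sum P k (m' + 2) (\<lambda>x. complex_of_real (x \<bullet> x) * q0 x)"
      "\<And>x. dunkl_laplacian P k (\<lambda>x. complex_of_real (x \<bullet> x) * q0 x) x = dunkl_laplacian P k p x"
      using laplacian_surjective_on_radial_sums[OF P k] by blast
    define h where "h x = p x - complex_of_real (x \<bullet> x) * q0 x" for x
    have hq: "hpoly m (\<lambda>x. complex_of_real (x \<bullet> x) * q0 x)"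
      using hpoly_mult[OF hpoly_radius q0(1)] m by (simp add: add.commute)
    have hh: "hpoly m h" unfolding h_def[abs_def] by (rule hpoly_diff[OF less.prems hq])
    have "dunkl_laplacian P k h x = 0" for x
    proof -
      have "h = (\<lambda>x. (-1) * (complex_of_real (x \<bullet> x) * q0 x) + p x)" by (simp add: h_def fun_eq_iff)
      thus ?thesis using laplacian_add[OF P hq less.prems, of k "-1" x] q0(3)[of x] by simp
    qed
    hence hH: "h \<in> harmonics P k m" using hh by (simp add: harmonics_iff)
    have ph: "p = (\<lambda>x. h x + complex_of_real (x \<bullet> x) * q0 x)" by (simp add: h_def)
    have "radial_harmonic_sum P k m p"
      using radial_harmonic_sum.add[OF radial_harmonic_sum.base[OF hH, of 0, simplified] q0(2)[folded m]] ph by simp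
    thus ?thesis using hH ph q0(1) m by (intro exI[of _ h] exI[of _ q0]) simp
  qed
qed

section \<open>Laguerre polynomials\<close>

definition laguerre_poly :: "nat \<Rightarrow> real \<Rightarrow> real poly" where
  "laguerre_poly l lam = (\<Sum>j\<le>l. monom ((-1) ^ j * Gamma (lam + real l + 1) / (fact (l - j) * Gamma (lam + real j + 1)) / fact j) j)"

lemma laguerre_eq_poly: "laguerre l lam t = poly (laguerre_poly l lam) t"
  by (simp add: laguerre_def laguerre_poly_def poly_sum poly_monom)

lemma coeff_laguerre_poly: "coeff (laguerre_poly l lam) j =
    (if j \<le> l then (-1) ^ j * Gamma (lam + real l + 1) / (fact (l - j) * Gamma (lam + real j + 1)) / fact j else 0)"
  unfolding laguerre_poly_def coeff_sum coeff_monom by simp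

lemma degree_laguerre_poly:
  assumes "lam > -1" shows "coeff (laguerre_poly l lam) l \<noteq> 0" "degree (laguerre_poly l lam) = l"
proof -
  have "Gamma (lam + real l + 1) > 0" using assms by (intro Gamma_real_pos) simp
  thus nz: "coeff (laguerre_poly l lam) l \<noteq> 0" by (simp add: coeff_laguerre_poly)
  show "degree (laguerre_poly l lam) = l"
    by (rule antisym[OF degree_le le_degree[OF nz]]) (simp add: coeff_laguerre_poly)
qed

lemma laguerre_recurrence:
  assumes lam: "lam > -1"
  shows "(real j + 1) * (lam + real j + 1) * coeff (laguerre_poly l lam) (Suc j)
    = (real j - real l) * coeff (laguerre_poly l lam) j"
proof (cases "Suc j \<le> l")
  case True
  define G where "G = Gamma (lam + real j + 1)"
  have G: "G > 0" unfolding G_def using lam by (intro Gamma_real_pos) simp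
  have Gs: "Gamma (lam + real (Suc j) + 1) = (lam + real j + 1) * G"
    using Gamma_plus1[of "lam + real j + 1"] lam by (auto simp: G_def add_ac nonpos_Ints_def)
  have fs: "(fact (l - j) :: real) = (real l - real j) * fact (l - Suc j)"
  proof -
    have "real (l - j) = real l - real j" using True by (simp add: of_nat_diff)
    thus ?thesis using True fact_reduce[of "l - j", where 'a = real] by simp
  qed
  have nz: "lam + real j + 1 \<noteq> 0" "real l - real j \<noteq> 0" "real j + 1 \<noteq> 0" using lam True by auto
  show ?thesis
  proof -
    have key: "v * u * ((- s) * A / (B * (u * G)) / (v * F)) = - d * (s * A / (d * B * G) / F)"
      if "v \<noteq> 0" "u \<noteq> 0" "d \<noteq> 0" for v u d s A B F :: real
      using that by simp
    show ?thesis
      using key[OF nz(3,1,2), of "(-1) ^ j" "Gamma (lam + real l + 1)" "fact (l - Suc j)" "fact j"] True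
      unfolding coeff_laguerre_poly Gs fs G_def[symmetric] by (simp add: add.commute)
  qed
next
  case False
  thus ?thesis by (auto simp: coeff_laguerre_poly)
qed

lemma laguerre_ode:
  fixes l :: nat
  assumes lam: "lam > -1"
  defines "y \<equiv> laguerre_poly l lam"
  shows "pCons 0 (pderiv (pderiv y)) + [:lam + 1, -1:] * pderiv y + smult (real l) y = 0"
proof (rule poly_eqI)
  fix n
  have "coeff (pCons 0 (pderiv (pderiv y))) n = real n * (real n + 1) * coeff y (Suc n)"
    by (cases n) (auto simp: coeff_pderiv algebra_simps)
  moreover have "coeff ([:lam + 1, -1:] * pderiv y) n = (lam + 1) * (real n + 1) * coeff y (Suc n) - real n * coeff y n"
    by (cases n) (auto simp: coeff_pderiv algebra_simps)
  ultimately show "coeff (pCons 0 (pderiv (pderiv y)) + [:lam + 1, -1:] * pderiv y + smult (real l) y) n = coeff 0 n"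
    using laguerre_recurrence[OF lam, of n l, folded y_def] by (simp add: algebra_simps)
qed

lemma laguerre_ode_at:
  assumes "lam > -1"
  shows "t * poly (pderiv (pderiv (laguerre_poly l lam))) t + (lam + 1 - t) * poly (pderiv (laguerre_poly l lam)) t
    + real l * poly (laguerre_poly l lam) t = 0"
  using arg_cong[OF laguerre_ode[OF assms, of l], of "\<lambda>p. poly p t"] by (simp add: algebra_simps)

text \<open>
  The functional $\Lambda$ stands for integration against a weight with moments
  $m_{j+1} = (\lambda+1+j) m_j$, but may be complex valued.  The recursion says that
  $\Lambda(t p' + (\lambda + 1 - t) p) = 0$ for every polynomial $p$, which is integration by parts and
  makes the Laguerre differential operator symmetric.
\<close>

lemma laguerre_orthogonal:
  fixes \<Lambda> :: "real poly \<Rightarrow> complex" and mom :: "nat \<Rightarrow> complex"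
  assumes lam: "lam > -1" and add: "\<And>p q. \<Lambda> (p + q) = \<Lambda> p + \<Lambda> q"
    and smult: "\<And>c p. \<Lambda> (smult c p) = complex_of_real c * \<Lambda> p"
    and mom: "\<And>j. \<Lambda> (monom 1 (Suc j)) = complex_of_real (lam + 1 + real j) * \<Lambda> (monom 1 j)"
    and "l \<noteq> l'"
  shows "\<Lambda> (laguerre_poly l lam * laguerre_poly l' lam) = 0"
proof -
  have zero: "\<Lambda> 0 = 0" using smult[of 0 0] by simp
  have by_parts: "\<Lambda> (pCons 0 (pderiv p) + [:lam + 1, -1:] * p) = 0" for p
  proof -
    define D where "D p = pCons 0 (pderiv p) + [:lam + 1, -1:] * p" for p :: "real poly"
    have Dadd: "D (p + q) = D p + D q" for p q
      by (simp add: D_def pderiv_add smult_add_right poly_eq_iff coeff_pCons algebra_simps split: nat.split)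
    have Dsm: "D (smult c p) = smult c (D p)" for c p by (simp add: D_def pderiv_smult smult_add_right)
    have Dm: "\<Lambda> (D (monom 1 j)) = 0" for j
    proof -
      have "D (monom 1 j) = smult (lam + 1 + real j) (monom 1 j) + smult (-1) (monom 1 (Suc j))"
        by (auto simp: D_def poly_eq_iff coeff_pCons coeff_pderiv algebra_simps split: nat.splits)
      thus ?thesis by (simp only: add smult mom) simp
    qed
    have "\<Lambda> (D (\<Sum>j\<in>A. smult (coeff p j) (monom 1 j))) = 0" if "finite A" for A
      using that
    proof (induction A)
      case empty
      show ?case by (simp add: D_def zero)
    next
      case (insert j A)
      thus ?case by (simp add: Dadd add Dsm smult Dm)
    qed
    from this[of "{..degree p}"] show ?thesis
      by (simp add: smult_monom poly_as_sum_of_monoms D_def)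
  qed
  \<comment> \<open>the Dirichlet form $\Lambda(t\,y'z')$; its symmetry gives $l\,\Lambda(yz) = l'\,\Lambda(yz)$\<close>
  define E where "E y z = \<Lambda> (pCons 0 (pderiv y * pderiv z))" for y z
  have sym: "complex_of_real (real l) * \<Lambda> (laguerre_poly l lam * z) = E (laguerre_poly l lam) z" for l z
  proof -
    let ?y = "laguerre_poly l lam"
    define X C where "X = [:0, 1::real:]" and "C = [:lam + 1, -1:]"
    have X: "pCons 0 q = X * q" for q by (simp add: X_def)
    have "(pCons 0 (pderiv (pderiv ?y)) + [:lam + 1, -1:] * pderiv ?y + smult (real l) ?y) * z = 0"
      by (simp only: laguerre_ode[OF lam] mult_zero_left)
    hence "(X * pderiv (pderiv ?y) + C * pderiv ?y + smult (real l) ?y) * z = 0" unfolding X C_def .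
    hence "smult (real l) (?y * z) = X * (pderiv ?y * pderiv z)
        - (X * (pderiv (pderiv ?y) * z + pderiv ?y * pderiv z) + C * (pderiv ?y * z))"
      by (simp add: distrib_left distrib_right mult.assoc add_eq_0_iff)
    hence "smult (real l) (?y * z) = pCons 0 (pderiv ?y * pderiv z)
        + smult (-1) (pCons 0 (pderiv (pderiv ?y * z)) + [:lam + 1, -1:] * (pderiv ?y * z))"
      unfolding X C_def[symmetric] by (simp add: pderiv_mult mult.commute add.commute)
    hence "\<Lambda> (smult (real l) (?y * z)) = \<Lambda> (pCons 0 (pderiv ?y * pderiv z))
        + \<Lambda> (smult (-1) (pCons 0 (pderiv (pderiv ?y * z)) + [:lam + 1, -1:] * (pderiv ?y * z)))"
      by (metis add)
    hence "\<Lambda> (smult (real l) (?y * z)) = E ?y z" unfolding smult[of "-1"] by_parts E_def by simp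
    thus ?thesis by (simp add: smult)
  qed
  have "complex_of_real (real l) * \<Lambda> (laguerre_poly l lam * laguerre_poly l' lam)
      = complex_of_real (real l') * \<Lambda> (laguerre_poly l lam * laguerre_poly l' lam)"
    using sym[of l "laguerre_poly l' lam"] sym[of l' "laguerre_poly l lam"] by (simp add: E_def mult.commute)
  thus ?thesis using \<open>l \<noteq> l'\<close> by simp
qed

section \<open>Eigenfunctions\<close>

lemma norm_powr_inner: "norm x powr a = (x \<bullet> x) powr (a / 2)"
proof -
  have "norm x = (x \<bullet> x) powr (1 / 2)" by (simp add: norm_eq_sqrt_inner powr_half_sqrt)
  thus ?thesis by (simp add: powr_powr)
qed

lemma DERIV_poly_exp:
  "((\<lambda>t. poly p t * exp (- t / 2)) has_real_derivative poly (pderiv p - smult (1 / 2) p) t * exp (- t / 2)) (at t)"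
  by (auto intro!: derivative_eq_intros simp: algebra_simps)

definition eigenvalue :: "(real^'n) set \<Rightarrow> (real^'n \<Rightarrow> real) \<Rightarrow> real \<Rightarrow> nat \<Rightarrow> nat \<Rightarrow> real" where
  "eigenvalue P k a l m = - (a * (2 * real l + lambda_kam P k a m + 1))"

text \<open>
  In the variable $\tau = \frac{2}{a}\|x\|^a$ the radial part of $\|x\|^{2-a}\Delta_k$ is $2a$ times
  $\tau\,\partial_\tau^2 + (\lambda+1)\partial_\tau$, so the eigenvalue equation is Laguerre's
  equation.  The origin has to be left out because of the factor $\|x\|^{2-a}$.
\<close>

lemma Phi_eigenfunction:
  fixes p :: "real^'n \<Rightarrow> complex"
  assumes P: "0 \<notin> P" and a: "a > 0" and lam: "lambda_kam P k a m > -1"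
    and p: "p \<in> harmonics P k m" and x: "x \<noteq> 0"
  shows "Delta_ka P k a (Phi P k a l m p) x = complex_of_real (eigenvalue P k a l m) * Phi P k a l m p x"
    and "dir_smooth (Phi P k a l m p) x" "dir_smooth (dunkl_operator P k \<xi> (Phi P k a l m p)) x"
proof -
  have hp: "hpoly m p" and p0: "dunkl_laplacian P k p x = 0" using p by (auto simp: harmonics_iff)
  define lam where "lam = lambda_kam P k a m"
  define y where "y = laguerre_poly l lam"
  \<comment> \<open>$y_1$ and $y_2$ are the polynomial factors of the first two derivatives of $y(\tau)e^{-\tau/2}$;
    the radial profile $\psi$ is a function of $s = \|x\|^2$\<close>
  define y1 where "y1 = pderiv y - smult (1 / 2) y"
  define y2 where "y2 = pderiv y1 - smult (1 / 2) y1"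
  define \<tau> where "\<tau> s = 2 / a * s powr (a / 2)" for s :: real
  define \<psi> where "\<psi> s = poly y (\<tau> s) * exp (- \<tau> s / 2)" for s
  define \<psi>1 where "\<psi>1 s = a / 2 * (poly y1 (\<tau> s) * exp (- \<tau> s / 2)) * (\<tau> s / s)" for s
  define \<psi>2 where "\<psi>2 s = a / 2 * ((poly y2 (\<tau> s) * exp (- \<tau> s / 2)) * (a / 2 * \<tau> s / s) * (\<tau> s / s)
      + (poly y1 (\<tau> s) * exp (- \<tau> s / 2)) * ((a / 2 - 1) * \<tau> s / s\<^sup>2))" for s
  have \<tau>': "(\<tau> has_real_derivative a / 2 * \<tau> s / s) (at s)" if "s > 0" for s
  proof -
    have "(\<tau> has_real_derivative 2 / a * (a / 2 * s powr (a / 2 - 1))) (at s)"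
      unfolding \<tau>_def by (intro DERIV_cmult has_real_derivative_powr that)
    thus ?thesis using that a by (simp add: \<tau>_def powr_diff)
  qed
  have d\<psi>: "(\<psi> has_real_derivative \<psi>1 s) (at s)" if "s > 0" for s
    unfolding \<psi>_def \<psi>1_def y1_def
    using DERIV_chain2[OF DERIV_poly_exp \<tau>'[OF that], of y] by (simp add: mult_ac)
  have d\<psi>1: "(\<psi>1 has_real_derivative \<psi>2 s) (at s)" if "s > 0" for s
  proof -
    have q: "((\<lambda>s. \<tau> s / s) has_real_derivative (a / 2 - 1) * \<tau> s / s\<^sup>2) (at s)"
      using that by (auto intro!: derivative_eq_intros \<tau>' simp: field_simps power2_eq_square)
    have e: "((\<lambda>s. poly y1 (\<tau> s) * exp (- \<tau> s / 2)) has_real_derivative poly y2 (\<tau> s) * exp (- \<tau> s / 2) * (a / 2 * \<tau> s / s)) (at s)"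
      unfolding y2_def by (rule DERIV_chain2[OF DERIV_poly_exp \<tau>'[OF that]])
    have "((\<lambda>s. a / 2 * ((poly y1 (\<tau> s) * exp (- \<tau> s / 2)) * (\<tau> s / s))) has_real_derivative
        a / 2 * ((poly y2 (\<tau> s) * exp (- \<tau> s / 2) * (a / 2 * \<tau> s / s)) * (\<tau> s / s)
          + ((a / 2 - 1) * \<tau> s / s\<^sup>2) * (poly y1 (\<tau> s) * exp (- \<tau> s / 2)))) (at s)"
      by (intro DERIV_cmult DERIV_mult e q)
    thus ?thesis unfolding \<psi>1_def[abs_def] \<psi>2_def by (simp only: mult_ac)
  qed
  have Phi: "Phi P k a l m p = (\<lambda>x. p x * complex_of_real (\<psi> (x \<bullet> x)))"
    by (simp add: Phi_def fun_eq_iff \<psi>_def \<tau>_def norm_powr_inner laguerre_eq_poly y_def lam_def)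
  have U: "open (- {0 :: real^'n})" "\<And>\<alpha> y. y \<in> - {0 :: real^'n} \<Longrightarrow> reflection \<alpha> y \<in> - {0}"
  proof -
    fix \<alpha> y :: "real^'n" assume "y \<in> - {0}"
    thus "reflection \<alpha> y \<in> - {0}" using reflection_norm[of \<alpha> y] by auto
  qed auto
  have D: "\<And>y. y \<in> - {0 :: real^'n} \<Longrightarrow> (\<psi> has_real_derivative \<psi>1 (y \<bullet> y)) (at (y \<bullet> y))"
    "\<And>y. y \<in> - {0 :: real^'n} \<Longrightarrow> (\<psi>1 has_real_derivative \<psi>2 (y \<bullet> y)) (at (y \<bullet> y))"
    using d\<psi> d\<psi>1 by auto
  have xU: "x \<in> - {0}" using x by simp
  note LR = laplacian_radial(2)[OF P hp U D xU, folded Phi] laplacian_radial(3)[OF P hp U D xU, of k, folded Phi]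
  show "dir_smooth (Phi P k a l m p) x" by (rule LR(1))
  show "dir_smooth (dunkl_operator P k \<xi> (Phi P k a l m p)) x" by (rule LR(2))
  define s where "s = x \<bullet> x"
  define K where "K = real CARD('n) + 2 * mult_sum P k + 2 * real m"
  have s: "s > 0" using x by (simp add: s_def)
  have K: "K = a * (lam + 1) + 2 - a"
    using a by (simp add: K_def lam_def lambda_kam_def field_simps)
  define T where "T = \<tau> s"
  define ex where "ex = exp (- T / 2)"
  have ode: "T * poly (pderiv (pderiv y)) T + (lam + 1 - T) * poly (pderiv y) T + real l * poly y T = 0"
    unfolding y_def lam_def by (rule laguerre_ode_at[OF lam])
  have "2 * K * \<psi>1 s + 4 * s * \<psi>2 s = a\<^sup>2 * T / s * ex * (T * poly y2 T + (lam + 1) * poly y1 T)"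
    using s a unfolding K \<psi>1_def \<psi>2_def T_def[symmetric] ex_def[symmetric]
    by (simp add: field_simps power2_eq_square)
  also have "T * poly y2 T + (lam + 1) * poly y1 T
      = (T * poly (pderiv (pderiv y)) T + (lam + 1 - T) * poly (pderiv y) T + real l * poly y T)
        + (T / 4 - (lam + 1) / 2 - real l) * poly y T"
    by (simp add: y2_def y1_def pderiv_diff pderiv_smult field_simps)
  finally have rad: "2 * K * \<psi>1 s + 4 * s * \<psi>2 s = a\<^sup>2 * T / s * (T / 4 - (lam + 1) / 2 - real l) * \<psi> s"
    unfolding ode by (simp add: \<psi>_def T_def ex_def mult_ac)
  \<comment> \<open>this is where the factor $\|x\|^{2-a}$ compensates the chain rule for $\tau$\<close>
  have np: "norm x powr (2 - a) * (T / s) = 2 / a"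
  proof -
    have "norm x powr (2 - a) = s powr (1 - a / 2)" by (simp add: norm_powr_inner s_def diff_divide_distrib)
    hence "norm x powr (2 - a) * (T / s) = 2 / a * (s powr (1 - a / 2) * s powr (a / 2)) / s"
      by (simp add: T_def \<tau>_def)
    also have "s powr (1 - a / 2) * s powr (a / 2) = s" using s by (simp flip: powr_add)
    finally show ?thesis using s by simp
  qed
  have na: "norm x powr a = a / 2 * T" using a by (simp add: T_def \<tau>_def norm_powr_inner s_def)
  have "norm x powr (2 - a) * (2 * K * \<psi>1 s + 4 * s * \<psi>2 s)
      = a\<^sup>2 * (norm x powr (2 - a) * (T / s)) * (T / 4 - (lam + 1) / 2 - real l) * \<psi> s"
    unfolding rad by simp
  also have "\<dots> = (eigenvalue P k a l m + norm x powr a) * \<psi> s"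
    unfolding np na eigenvalue_def lam_def[symmetric] using a by (simp add: field_simps power2_eq_square)
  finally have fin: "norm x powr (2 - a) * (2 * K * \<psi>1 s + 4 * s * \<psi>2 s) - norm x powr a * \<psi> s = eigenvalue P k a l m * \<psi> s"
    by (simp add: algebra_simps)
  have "Delta_ka P k a (Phi P k a l m p) x
      = complex_of_real (norm x powr (2 - a) * (2 * K * \<psi>1 s + 4 * s * \<psi>2 s) - norm x powr a * \<psi> s) * p x"
  proof -
    have "dunkl_laplacian P k (Phi P k a l m p) x = complex_of_real (2 * K * \<psi>1 s + 4 * s * \<psi>2 s) * p x"
      unfolding Phi using laplacian_radial(1)[OF P hp U D xU, of k] by (simp add: p0 K_def s_def)
    moreover have "Phi P k a l m p x = complex_of_real (\<psi> s) * p x" by (simp add: Phi s_def)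
    ultimately show ?thesis unfolding Delta_ka_def by (simp only: of_real_mult of_real_diff left_diff_distrib mult.assoc)
  qed
  also have "\<dots> = complex_of_real (eigenvalue P k a l m) * Phi P k a l m p x"
    unfolding fin by (simp add: Phi s_def)
  finally show "Delta_ka P k a (Phi P k a l m p) x = complex_of_real (eigenvalue P k a l m) * Phi P k a l m p x" .
qed

lemma Delta_ka_combination:
  fixes g :: "'i \<Rightarrow> real^'n \<Rightarrow> complex"
  assumes sm: "\<And>i y. i \<in> S \<Longrightarrow> y \<noteq> 0 \<Longrightarrow> dir_smooth (g i) y"
    and smT: "\<And>i y \<xi>. i \<in> S \<Longrightarrow> y \<noteq> 0 \<Longrightarrow> dir_smooth (dunkl_operator P k \<xi> (g i)) y"
    and x: "x \<noteq> 0"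
  shows "Delta_ka P k a (\<lambda>x. \<Sum>i\<in>S. c i * g i x) x = (\<Sum>i\<in>S. c i * Delta_ka P k a (g i) x)"
proof -
  have U: "open (- {0 :: real^'n})" "\<And>\<alpha> y. y \<in> - {0 :: real^'n} \<Longrightarrow> reflection \<alpha> y \<in> - {0}"
  proof -
    fix \<alpha> y :: "real^'n" assume "y \<in> - {0}"
    thus "reflection \<alpha> y \<in> - {0}" using reflection_norm[of \<alpha> y] by auto
  qed auto
  have T1: "dunkl_operator P k \<xi> (\<lambda>x. \<Sum>i\<in>S. c i * g i x) y = (\<Sum>i\<in>S. c i * dunkl_operator P k \<xi> (g i) y)"
    if "y \<in> - {0}" for y \<xi>
    using sm that by (subst dunkl_operator_sum) (auto simp: dir_smooth_cmult dunkl_operator_cmult)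
  have "dunkl_operator P k \<xi> (dunkl_operator P k \<xi> (\<lambda>x. \<Sum>i\<in>S. c i * g i x)) x
      = (\<Sum>i\<in>S. c i * dunkl_operator P k \<xi> (dunkl_operator P k \<xi> (g i)) x)" for \<xi>
  proof -
    have "dunkl_operator P k \<xi> (dunkl_operator P k \<xi> (\<lambda>x. \<Sum>i\<in>S. c i * g i x)) x
        = dunkl_operator P k \<xi> (\<lambda>y. \<Sum>i\<in>S. c i * dunkl_operator P k \<xi> (g i) y) x"
      using x smT by (intro dunkl_operator_cong(1)[OF U(1) _ U(2) T1]) (auto intro!: dir_smooth_sum dir_smooth_cmult)
    also have "\<dots> = (\<Sum>i\<in>S. c i * dunkl_operator P k \<xi> (dunkl_operator P k \<xi> (g i)) x)"
      using smT x by (subst dunkl_operator_sum) (auto simp: dir_smooth_cmult dunkl_operator_cmult)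
    finally show ?thesis .
  qed
  hence "dunkl_laplacian P k (\<lambda>x. \<Sum>i\<in>S. c i * g i x) x = (\<Sum>i\<in>S. c i * dunkl_laplacian P k (g i) x)"
    unfolding dunkl_laplacian_def sum_distrib_left by (simp add: sum.swap[of _ S])
  thus ?thesis by (simp add: Delta_ka_def right_diff_distrib sum_subtractf sum_distrib_left mult_ac)
qed

text \<open>
  At the origin $\|x\|^{2-a}$ and $\|x\|^a$ both have the value $0$ here, whatever the exponent; this
  makes $\Delta_{k,a}f$ measurable for the eigenfunctions, whose second Dunkl derivatives may fail to
  exist there.
\<close>

lemma Delta_ka_origin: "Delta_ka P k a f 0 = 0"
  by (simp add: Delta_ka_def)

section \<open>Invariance of Lebesgue measure and integrals of radial functions\<close>

lemma nn_integral_lborel_affine: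
  fixes f :: "'a::euclidean_space \<Rightarrow> ennreal"
  assumes [measurable]: "f \<in> borel_measurable borel" and c: "c \<noteq> 0"
  shows "(\<integral>\<^sup>+x. f x \<partial>lborel) = ennreal (\<bar>c\<bar> ^ DIM('a)) * (\<integral>\<^sup>+x. f (t + c *\<^sub>R x) \<partial>lborel)"
  by (subst lborel_affine[OF c, of t], subst nn_integral_density) (auto simp: nn_integral_distr nn_integral_cmult)

lemma integral_lborel_affine:
  fixes f :: "'a::euclidean_space \<Rightarrow> 'b::{banach, second_countable_topology}"
  assumes f: "integrable lborel f" and c: "c \<noteq> 0"
  shows "integrable lborel (\<lambda>x. f (t + c *\<^sub>R x))"
    and "(LINT x|lborel. f x) = \<bar>c\<bar> ^ DIM('a) *\<^sub>R (LINT x|lborel. f (t + c *\<^sub>R x))"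
proof -
  have [measurable]: "f \<in> borel_measurable borel" using f by simp
  have "integrable (density (distr lborel borel (\<lambda>x. t + c *\<^sub>R x)) (\<lambda>_. ennreal (\<bar>c\<bar> ^ DIM('a)))) f"
    using f lborel_affine[OF c, of t] by simp
  hence "integrable lborel (\<lambda>x. \<bar>c\<bar> ^ DIM('a) *\<^sub>R f (t + c *\<^sub>R x))"
    by (subst (asm) integrable_density) (auto simp: integrable_distr_eq)
  from integrable_scaleR_right[of "1 / \<bar>c\<bar> ^ DIM('a)", OF this]
  show "integrable lborel (\<lambda>x. f (t + c *\<^sub>R x))" using c by simp
  have "(LINT x|lborel. f x) = (LINT x|density (distr lborel borel (\<lambda>x. t + c *\<^sub>R x)) (\<lambda>_. ennreal (\<bar>c\<bar> ^ DIM('a))). f x)"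
    by (subst lborel_affine[OF c, of t]) (rule refl)
  also have "\<dots> = \<bar>c\<bar> ^ DIM('a) *\<^sub>R (LINT x|lborel. f (t + c *\<^sub>R x))"
    by (subst integral_density) (auto simp: integral_distr)
  finally show "(LINT x|lborel. f x) = \<bar>c\<bar> ^ DIM('a) *\<^sub>R (LINT x|lborel. f (t + c *\<^sub>R x))" .
qed

lemma integral_lborel_translate:
  fixes f :: "'a::euclidean_space \<Rightarrow> 'b::{banach, second_countable_topology}"
  assumes f: "integrable lborel f"
  shows "integrable lborel (\<lambda>x. f (x + t))" and "(LINT x|lborel. f (x + t)) = (LINT x|lborel. f x)"
  using integral_lborel_affine[OF f, of 1 t] by (simp_all add: add.commute)

text \<open>
  A linear isometric involution $r$ preserves Lebesgue measure: with $g$ the indicator of the unit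
  ball, $\int f \circ r \cdot \int g = \iint f(rx)\,g(y + rx)\,dx\,dy = \int g \circ r \cdot \int f$
  by translation invariance alone, and $g \circ r = g$.
\<close>

lemma nn_integral_lborel_involution:
  fixes r :: "'a::euclidean_space \<Rightarrow> 'a"
  assumes lin: "linear r" and iso: "\<And>x. norm (r x) = norm x" and inv: "\<And>x. r (r x) = x"
    and f[measurable]: "f \<in> borel_measurable borel"
  shows "(\<integral>\<^sup>+x. f (r x) \<partial>lborel) = (\<integral>\<^sup>+x. f x \<partial>lborel)"
proof -
  have r[measurable]: "r \<in> borel_measurable borel"
    using linear_continuous_on[OF lin[unfolded linear_conv_bounded_linear], of UNIV] by (rule borel_measurable_continuous_onI)
  define g :: "'a \<Rightarrow> ennreal" where "g = indicator (ball 0 1)"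
  have g[measurable]: "g \<in> borel_measurable borel"
    unfolding g_def by (rule borel_measurable_indicator) simp
  have gr: "g (r x) = g x" for x by (simp add: g_def indicator_def iso)
  have tr: "(\<integral>\<^sup>+x. h (x + c) \<partial>lborel) = (\<integral>\<^sup>+x. h x \<partial>lborel)" if [measurable]: "h \<in> borel_measurable borel" for h :: "'a \<Rightarrow> ennreal" and c
    using nn_integral_lborel_affine[of h 1 c] by (simp add: add.commute)
  have neg: "(\<integral>\<^sup>+x. f (c - x) \<partial>lborel) = (\<integral>\<^sup>+x. f x \<partial>lborel)" for c
    using nn_integral_lborel_affine[of f "-1" c] by simp
  have radd: "r (x + y) = r x + r y" for x y using lin by (rule linear_add)
  let ?V = "\<integral>\<^sup>+x. g x \<partial>lborel"
  have "(\<integral>\<^sup>+x. f (r x) \<partial>lborel) * ?V = (\<integral>\<^sup>+x. (\<integral>\<^sup>+y. f (r x) * g (y + r x) \<partial>lborel) \<partial>lborel)"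
    by (subst nn_integral_multc[symmetric]) (auto simp: nn_integral_cmult tr)
  also have "\<dots> = (\<integral>\<^sup>+y. (\<integral>\<^sup>+x. f (r x) * g (y + r x) \<partial>lborel) \<partial>lborel)"
    by (rule lborel_pair.Fubini') measurable
  also have "\<dots> = (\<integral>\<^sup>+y. (\<integral>\<^sup>+x. f (r x - y) * g (r x) \<partial>lborel) \<partial>lborel)"
  proof (rule nn_integral_cong)
    fix y
    have "(\<integral>\<^sup>+x. f (r x) * g (y + r x) \<partial>lborel) = (\<integral>\<^sup>+x. f (r (x + r (- y))) * g (y + r (x + r (- y))) \<partial>lborel)"
      by (rule tr[symmetric]) measurable
    thus "(\<integral>\<^sup>+x. f (r x) * g (y + r x) \<partial>lborel) = (\<integral>\<^sup>+x. f (r x - y) * g (r x) \<partial>lborel)" by (simp add: radd inv)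
  qed
  also have "\<dots> = (\<integral>\<^sup>+x. (\<integral>\<^sup>+y. f (r x - y) * g (r x) \<partial>lborel) \<partial>lborel)"
    by (rule lborel_pair.Fubini'[symmetric]) measurable
  also have "\<dots> = (\<integral>\<^sup>+x. f x \<partial>lborel) * ?V"
    by (subst nn_integral_cmult[symmetric]) (auto simp: nn_integral_multc neg gr)
  finally have eq: "(\<integral>\<^sup>+x. f (r x) \<partial>lborel) * ?V = (\<integral>\<^sup>+x. f x \<partial>lborel) * ?V" .
  have V: "?V = emeasure lborel (ball (0::'a) 1)" by (simp add: g_def)
  \<comment> \<open>the ball has finite nonzero volume, so it can be divided out\<close>
  have V0: "?V \<noteq> 0" "?V \<noteq> top"
    using emeasure_lborel_ball_finite[of "0::'a" 1] content_ball_pos[of 1 "0::'a"] unfolding V by (auto simp: measure_def)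
  show ?thesis using arg_cong[OF eq, of "\<lambda>t. t / ?V"] unfolding mult_divide_eq_ennreal[OF V0] .
qed

lemma integral_lborel_involution:
  fixes r :: "'a::euclidean_space \<Rightarrow> 'a" and f :: "'a \<Rightarrow> 'b::{banach, second_countable_topology}"
  assumes lin: "linear r" and iso: "\<And>x. norm (r x) = norm x" and inv: "\<And>x. r (r x) = x"
    and f: "integrable lborel f"
  shows "integrable lborel (\<lambda>x. f (r x))" and "(LINT x|lborel. f (r x)) = (LINT x|lborel. f x)"
proof -
  have r[measurable]: "r \<in> borel_measurable borel"
    using linear_continuous_on[OF lin[unfolded linear_conv_bounded_linear], of UNIV] by (rule borel_measurable_continuous_onI)
  have d: "distr lborel borel r = lborel"
  proof (rule measure_eqI)
    fix A assume "A \<in> sets (distr lborel borel r)"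
    hence A[measurable]: "A \<in> sets borel" by simp
    have "emeasure (distr lborel borel r) A = (\<integral>\<^sup>+x. indicator A x \<partial>distr lborel borel r)" by simp
    also have "\<dots> = (\<integral>\<^sup>+x. indicator A (r x) \<partial>lborel)" by (subst nn_integral_distr) auto
    also have "\<dots> = (\<integral>\<^sup>+x. indicator A x \<partial>lborel)" by (rule nn_integral_lborel_involution[OF lin iso inv]) simp
    finally show "emeasure (distr lborel borel r) A = emeasure lborel A" by simp
  qed simp
  have [measurable]: "f \<in> borel_measurable borel" using f by simp
  have "integrable (distr lborel borel r) f" using f d by simp
  thus "integrable lborel (\<lambda>x. f (r x))" by (subst (asm) integrable_distr_eq) auto
  show "(LINT x|lborel. f (r x)) = (LINT x|lborel. f x)"
    using integral_distr[of r lborel borel f] d by simp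
qed

lemma reflection_linear: "linear (reflection \<alpha>)"
  by (rule linearI) (auto simp: reflection_def inner_add_right algebra_simps add_divide_distrib)

lemma reflection_isometry: "norm (reflection \<alpha> x) = norm x"
  by (simp add: norm_eq_sqrt_inner reflection_norm)

lemma inner_root_reflection: "\<alpha> \<noteq> 0 \<Longrightarrow> \<alpha> \<bullet> reflection \<alpha> x = - (\<alpha> \<bullet> x)"
  by (simp add: reflection_inner power2_norm_eq_inner)

lemma reflection_involution: "reflection \<alpha> (reflection \<alpha> x) = x"
proof (cases "\<alpha> = 0")
  case False
  have "reflection \<alpha> (reflection \<alpha> x) = reflection \<alpha> x - (2 * (\<alpha> \<bullet> reflection \<alpha> x) / (norm \<alpha>)\<^sup>2) *\<^sub>R \<alpha>"
    unfolding reflection_def[of \<alpha> "reflection \<alpha> x"] ..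
  also have "\<dots> = x" unfolding inner_root_reflection[OF False] by (simp add: reflection_def)
  finally show ?thesis .
qed (simp add: reflection_def)

lemma reflection_adjoint: "v \<bullet> reflection \<alpha> x = reflection \<alpha> v \<bullet> x"
  by (simp add: reflection_def inner_diff_left inner_diff_right inner_commute)

lemmas integral_reflection = integral_lborel_involution[OF reflection_linear reflection_isometry reflection_involution]

lemma AE_not_hyperplane:
  fixes \<alpha> :: "'a::euclidean_space"
  assumes "\<alpha> \<noteq> 0" shows "AE x in lborel. \<alpha> \<bullet> x \<noteq> 0"
proof -
  have "negligible {x. \<alpha> \<bullet> x = 0}" using assms by (intro negligible_hyperplane) simp
  moreover have b: "{x. \<alpha> \<bullet> x = 0} \<in> sets borel" by (intro borel_closed closed_hyperplane)
  ultimately have "{x. \<alpha> \<bullet> x = 0} \<in> null_sets lborel"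
    by (simp add: negligible_iff_null_sets null_sets_completion_iff)
  thus ?thesis by (rule AE_I') auto
qed

lemma AE_lborel_nonzero: "AE x in lborel. x \<noteq> (0::'a::euclidean_space)"
  using AE_lborel_singleton[of 0] by simp

lemma cball_borel [measurable]: "cball (x::'a::metric_space) r \<in> sets borel"
  by simp

text \<open>
  In the applications the radii $\rho_j$ are powers of $2$ and $b_j$ is the supremum of $f$ on a dyadic
  shell; the sum majorizes the integral up to the volume of the unit ball.
\<close>

lemma integrable_shells:
  fixes f :: "'a::euclidean_space \<Rightarrow> real"
  assumes f[measurable]: "f \<in> borel_measurable borel" and nn: "\<And>x. 0 \<le> f x"
    and \<rho>: "\<And>j::nat. \<rho> j \<ge> 0" and b: "\<And>j. b j \<ge> 0" and s: "summable (\<lambda>j. b j * \<rho> j ^ DIM('a))"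
    and bd: "\<And>x. x \<noteq> 0 \<Longrightarrow> f x = 0 \<or> (\<exists>j. norm x \<le> \<rho> j \<and> f x \<le> b j)"
  shows "integrable lborel f"
proof (rule integrableI_nonneg)
  let ?V = "unit_ball_vol (real DIM('a))"
  have nz: "AE x in lborel. x \<noteq> (0::'a)" by (rule AE_lborel_nonzero)
  have "(\<integral>\<^sup>+x. ennreal (f x) \<partial>lborel) \<le> (\<integral>\<^sup>+x. (\<Sum>j. ennreal (b j) * indicator (cball (0::'a) (\<rho> j)) x) \<partial>lborel)"
  proof (rule nn_integral_mono_AE)
    have "ennreal (f x) \<le> (\<Sum>j. ennreal (b j) * indicator (cball 0 (\<rho> j)) x)" if x: "x \<noteq> 0" for x
    proof (cases "f x = 0")
      case False
      then obtain j where j: "norm x \<le> \<rho> j" "f x \<le> b j" using bd[OF x] by blast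
      define F where "F i = ennreal (b i) * indicator (cball 0 (\<rho> i)) x" for i
      have "ennreal (f x) \<le> F j" unfolding F_def using j by (simp add: ennreal_leI)
      also have "\<dots> = (\<Sum>i\<in>{j}. F i)" by simp
      also have "\<dots> \<le> (\<Sum>i. F i)" by (rule sum_le_suminf) auto
      finally show ?thesis unfolding F_def .
    qed simp
    thus "AE x in lborel. ennreal (f x) \<le> (\<Sum>j. ennreal (b j) * indicator (cball 0 (\<rho> j)) x)"
      using nz by (auto elim: eventually_mono)
  qed
  also have "\<dots> = (\<Sum>j. \<integral>\<^sup>+x. ennreal (b j) * indicator (cball (0::'a) (\<rho> j)) x \<partial>lborel)"
    by (rule nn_integral_suminf)
      measurable
  also have "\<dots> = (\<Sum>j. ennreal (?V * (b j * \<rho> j ^ DIM('a))))"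
    using \<rho> b by (intro suminf_cong) (simp add: nn_integral_cmult_indicator emeasure_cball ennreal_mult'[symmetric] mult_ac)
  also have "\<dots> = ennreal (\<Sum>j. ?V * (b j * \<rho> j ^ DIM('a)))"
    using \<rho> b s by (intro suminf_ennreal2 summable_mult) auto
  finally show "(\<integral>\<^sup>+x. ennreal (f x) \<partial>lborel) < \<infinity>" using le_less_trans ennreal_less_top by (metis infinity_ennreal_def)
qed (use nn in auto)

lemma dyadic_below:
  fixes t :: real assumes "t \<ge> 1" obtains j :: nat where "2 ^ j \<le> t" "t < 2 ^ Suc j"
proof -
  define j where "j = nat \<lfloor>log 2 t\<rfloor>"
  have l: "log 2 t \<ge> 0" using assms by simp
  have "real j \<le> log 2 t" "log 2 t < real j + 1" using l by (auto simp: j_def)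
  hence "2 powr real j \<le> 2 powr (log 2 t)" "2 powr (log 2 t) < 2 powr (real j + 1)" by simp_all
  hence "2 powr real j \<le> t" "t < 2 powr (real j + 1)" using assms by simp_all
  thus ?thesis using that[of j] by (simp add: powr_realpow powr_add)
qed

lemma integrable_power_at_origin:
  fixes s :: real
  assumes s: "s > - real DIM('a::euclidean_space)"
  shows "integrable lborel (\<lambda>x::'a. norm x powr s * indicator (cball 0 1) x)"
proof (rule integrable_shells[where \<rho> = "\<lambda>j. (1/2) ^ j" and b = "\<lambda>j. 2 powr \<bar>s\<bar> * (1/2) powr (s * real j)"])
  let ?q = "(1/2) powr (s + real DIM('a))"
  have "?q < 1" using s powr_less_mono2_neg[of "s + real DIM('a)" "1/2" 1] powr_less_mono'[of "1/2" 0 "s + real DIM('a)"] by simp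
  hence "summable (\<lambda>j. 2 powr \<bar>s\<bar> * ?q ^ j)" by (intro summable_mult summable_geometric) simp
  moreover have "2 powr \<bar>s\<bar> * (1/2) powr (s * real j) * ((1/2) ^ j) ^ DIM('a) = 2 powr \<bar>s\<bar> * ?q ^ j" for j
  proof -
    have "?q ^ j = (1/2) powr ((s + real DIM('a)) * real j)" by (simp add: powr_powr flip: powr_realpow)
    also have "\<dots> = (1/2) powr (s * real j) * (1/2) powr (real DIM('a) * real j)" by (simp add: distrib_right powr_add)
    also have "(1/2) powr (real DIM('a) * real j) = ((1/2::real) ^ j) ^ DIM('a)"
      using powr_realpow[of "1/2" "j * DIM('a)"] by (simp add: power_mult mult.commute)
    finally show ?thesis by simp
  qed
  ultimately show "summable (\<lambda>j. 2 powr \<bar>s\<bar> * (1/2) powr (s * real j) * ((1/2) ^ j) ^ DIM('a))" by (simp only:)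
  fix x :: 'a assume x: "x \<noteq> 0"
  show "norm x powr s * indicator (cball 0 1) x = 0 \<or>
      (\<exists>j. norm x \<le> (1/2) ^ j \<and> norm x powr s * indicator (cball 0 1) x \<le> 2 powr \<bar>s\<bar> * (1/2) powr (s * real j))"
  proof (cases "norm x \<le> 1")
    case True
    hence "1 \<le> inverse (norm x)" using x by (simp add: one_le_inverse_iff)
    then obtain j where j: "2 ^ j \<le> inverse (norm x)" "inverse (norm x) < 2 ^ Suc j" by (rule dyadic_below)
    have nx: "norm x > 0" using x by simp
    have j1: "norm x \<le> (1/2) ^ j" and j2: "(1/2) ^ Suc j < norm x"
      using j nx by (auto simp: field_simps power_one_over)
    have "norm x powr s \<le> 2 powr \<bar>s\<bar> * (1/2) powr (s * real j)"
    proof (cases "s \<ge> 0")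
      case True
      have "norm x powr s \<le> ((1/2) ^ j) powr s" using j1 True by (intro powr_mono2) auto
      also have "\<dots> = (1/2) powr (s * real j)" by (simp add: powr_powr mult.commute flip: powr_realpow)
      also have "\<dots> \<le> 2 powr \<bar>s\<bar> * (1/2) powr (s * real j)" by (simp add: mult_le_cancel_right1 ge_one_powr_ge_zero)
      finally show ?thesis .
    next
      case False
      have "norm x powr s \<le> ((1/2) ^ Suc j) powr s" using j2 False by (intro powr_mono2') auto
      also have "((1/2::real) ^ Suc j) powr s = (1/2) powr s * (1/2) powr (s * real j)"
      proof -
        have "((1/2::real) ^ Suc j) powr s = ((1/2) powr real (Suc j)) powr s" by (subst powr_realpow) auto
        also have "\<dots> = (1/2) powr (s + s * real j)" by (simp add: powr_powr algebra_simps)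
        finally show ?thesis by (simp add: powr_add)
      qed
      also have "(1/2::real) powr s = 2 powr \<bar>s\<bar>" using False by (simp add: powr_divide powr_minus_divide)
      finally show ?thesis .
    qed
    thus ?thesis using j1 True by (intro disjI2 exI[of _ j]) simp
  qed simp
next
  show "(\<lambda>x::'a. norm x powr s * indicator (cball 0 1) x) \<in> borel_measurable borel" by measurable
qed auto

lemma integrable_decay_at_infinity:
  fixes t :: real
  assumes t: "t > real DIM('a::euclidean_space)"
  shows "integrable lborel (\<lambda>x::'a. norm x powr (- t) * indicator (- cball 0 1) x)"
proof (rule integrable_shells[where \<rho> = "\<lambda>j. 2 ^ Suc j" and b = "\<lambda>j. 2 powr (- t * real j)"])
  have tpos: "t > 0" using t by (smt (verit) of_nat_0_le_iff)
  let ?q = "2 powr (real DIM('a) - t)"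
  have "?q < 1" using t powr_less_mono[of "real DIM('a) - t" 0 2] by simp
  hence "summable (\<lambda>j. 2 ^ DIM('a) * ?q ^ j)" by (intro summable_mult summable_geometric) simp
  moreover have "2 powr (- t * real j) * (2 ^ Suc j) ^ DIM('a) = 2 ^ DIM('a) * ?q ^ j" for j
  proof -
    have "?q ^ j = 2 powr ((real DIM('a) - t) * real j)" by (simp add: powr_powr flip: powr_realpow)
    also have "\<dots> = 2 powr (real DIM('a) * real j) * 2 powr (- t * real j)"
      by (simp add: left_diff_distrib flip: powr_add)
    also have "2 powr (real DIM('a) * real j) = ((2::real) ^ j) ^ DIM('a)"
      using powr_realpow[of 2 "j * DIM('a)"] by (simp add: power_mult mult.commute)
    finally show ?thesis by (simp add: power_mult_distrib)
  qed
  ultimately show "summable (\<lambda>j. 2 powr (- t * real j) * (2 ^ Suc j) ^ DIM('a))" by (simp only:)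
  fix x :: 'a assume x: "x \<noteq> 0"
  show "norm x powr - t * indicator (- cball 0 1) x = 0 \<or>
      (\<exists>j. norm x \<le> 2 ^ Suc j \<and> norm x powr - t * indicator (- cball 0 1) x \<le> 2 powr (- t * real j))"
  proof (cases "norm x > 1")
    case True
    then obtain j where j: "2 ^ j \<le> norm x" "norm x < 2 ^ Suc j" by (metis dyadic_below less_imp_le)
    have "norm x powr - t \<le> (2 ^ j) powr - t" using j tpos by (intro powr_mono2') auto
    also have "((2::real) ^ j) powr - t = 2 powr (- t * real j)" by (simp add: powr_powr mult.commute flip: powr_realpow)
    finally show ?thesis using j by (intro disjI2 exI[of _ j]) (auto simp: indicator_def)
  qed simp
next
  show "(\<lambda>x::'a. norm x powr - t * indicator (- cball 0 1) x) \<in> borel_measurable borel" by measurable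
qed auto

lemma exp_decay_le_power:
  assumes c: "c > (0::real)" and a: "a > 0"
  obtains C where "C \<ge> 0" "\<And>t. t \<ge> 1 \<Longrightarrow> exp (- c * t powr a) \<le> C * t powr (- M)"
proof -
  obtain n :: nat where "M / a \<le> real n" using real_arch_simple by blast
  hence n: "real n * a \<ge> M" using a by (simp add: divide_le_eq)
  show ?thesis
  proof (rule that[of "fact n / c ^ n"])
    show "0 \<le> fact n / c ^ n" using c by simp
    fix t :: real assume t: "t \<ge> 1"
    define u where "u = c * t powr a"
    have u: "u > 0" using c t by (simp add: u_def)
    have "u ^ n /\<^sub>R fact n \<le> (\<Sum>i. u ^ i /\<^sub>R fact i)"
    proof -
      have "(\<Sum>i\<in>{n}. u ^ i /\<^sub>R fact i) \<le> (\<Sum>i. u ^ i /\<^sub>R fact i)"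
        using u by (intro sum_le_suminf summable_exp_generic) auto
      thus ?thesis by simp
    qed
    hence "u ^ n / fact n \<le> exp u" by (simp add: exp_def divide_inverse mult.commute)
    hence "exp (- u) \<le> fact n / u ^ n" using u by (simp add: exp_minus field_simps)
    also have "\<dots> = fact n / c ^ n * t powr (- (real n * a))"
      using t by (simp add: u_def power_mult_distrib powr_minus powr_powr divide_inverse mult.commute flip: powr_realpow)
    also have "\<dots> \<le> fact n / c ^ n * t powr (- M)"
      using n t c by (intro mult_left_mono powr_mono) auto
    finally show "exp (- c * t powr a) \<le> fact n / c ^ n * t powr (- M)" by (simp add: u_def)
  qed
qed

lemma integrable_radial_exp:
  fixes s c a :: real
  assumes s: "s > - real DIM('a::euclidean_space)" and c: "c > 0" and a: "a > 0"
  shows "integrable lborel (\<lambda>x::'a. norm x powr s * exp (- c * norm x powr a))"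
proof -
  obtain C where C: "C \<ge> 0" "\<And>t. t \<ge> 1 \<Longrightarrow> exp (- c * t powr a) \<le> C * t powr (- (s + real DIM('a) + 1))"
    using exp_decay_le_power[OF c a, where M = "s + real DIM('a) + 1"] by metis
  have "integrable lborel (\<lambda>x::'a. norm x powr s * indicator (cball 0 1) x
      + C * (norm x powr (- (real DIM('a) + 1)) * indicator (- cball 0 1) x))"
    by (intro Bochner_Integration.integrable_add integrable_mult_right integrable_power_at_origin
        integrable_decay_at_infinity s) simp
  thus ?thesis
  proof (rule Bochner_Integration.integrable_bound)
    show "AE x::'a in lborel. norm (norm x powr s * exp (- c * norm x powr a)) \<le> norm (norm x powr s * indicator (cball 0 1) x
      + C * (norm x powr (- (real DIM('a) + 1)) * indicator (- cball 0 1) x))"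
    proof (rule AE_I2)
      fix x :: 'a
      show "norm (norm x powr s * exp (- c * norm x powr a)) \<le> norm (norm x powr s * indicator (cball 0 1) x
          + C * (norm x powr (- (real DIM('a) + 1)) * indicator (- cball 0 1) x))"
      proof (cases "norm x \<le> 1")
        case True
        have "exp (- c * norm x powr a) \<le> 1" using c by simp
        thus ?thesis using True by (simp add: mult_left_le)
      next
        case False
        hence "norm x powr s * exp (- c * norm x powr a) \<le> norm x powr s * (C * norm x powr (- (s + real DIM('a) + 1)))"
          by (intro mult_left_mono C) auto
        also have "\<dots> = C * norm x powr (- (real DIM('a) + 1))"
          using False by (simp add: mult.left_commute flip: powr_add)
        finally show ?thesis using False C(1) by (simp add: indicator_def)
      qed
    qed
  qed measurable
qed

section \<open>Integrals of derivatives along measure-preserving flows\<close>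

text \<open>
  If the integral over space of $K'(s, \cdot)$ does not depend on $s$ and $K'(\cdot, x)$ is the
  derivative of a function with the same integral over space at times $0$ and $1$, then that
  constant is $0$.  Integrating in $s$ first, by the fundamental theorem of calculus, and over space
  first gives the two values.  Both flows below, translations and dilations, preserve integrals.
\<close>

lemma flow_integral_zero:
  fixes K' :: "real \<Rightarrow> 'a::euclidean_space \<Rightarrow> complex"
  assumes meas[measurable]: "(\<lambda>(s, x). K' s x) \<in> borel_measurable (borel \<Otimes>\<^sub>M borel)"
    and int: "\<And>s. integrable lborel (K' s)"
    and B: "\<And>s. s \<in> {0..1} \<Longrightarrow> (LINT x|lborel. norm (K' s x)) = B"
    and I: "\<And>s. s \<in> {0..1} \<Longrightarrow> (LINT x|lborel. K' s x) = I"
    and K: "integrable lborel Ka" "integrable lborel Kb" "(LINT x|lborel. Ka x) = (LINT x|lborel. Kb x)"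
    and ftc: "AE x in lborel. set_integrable lborel {0..1} (\<lambda>s. K' s x) \<longrightarrow> (LINT s:{0..1}|lborel. K' s x) = Kb x - Ka x"
  shows "I = 0"
proof -
  define F where "F s x = indicator {0..1} s *\<^sub>R K' s x" for s :: real and x :: 'a
  have F: "integrable (lborel \<Otimes>\<^sub>M lborel) (case_prod F)"
  proof (rule lborel_pair.Fubini_integrable)
    show "case_prod F \<in> borel_measurable (lborel \<Otimes>\<^sub>M lborel)" unfolding F_def by measurable
    have "(LINT x|lborel. norm (F s x)) = indicator {0..1} s * B" for s
      using B[of s] by (simp add: F_def indicator_def)
    thus "integrable lborel (\<lambda>s. LINT x|lborel. norm (case_prod F (s, x)))" by simp
    show "AE s in lborel. integrable lborel (\<lambda>x. case_prod F (s, x))"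
      unfolding F_def using int by (intro AE_I2) simp
  qed
  have "(LINT s|lborel. (LINT x|lborel. F s x)) = (LINT s|lborel. indicator {0..1::real} s *\<^sub>R I)"
    by (rule Bochner_Integration.integral_cong[OF refl]) (use I in \<open>auto simp: F_def indicator_def\<close>)
  also have "\<dots> = I" by simp
  finally have "I = (LINT s|lborel. (LINT x|lborel. F s x))" ..
  also have "\<dots> = (LINT x|lborel. (LINT s|lborel. F s x))"
    using lborel_pair.integral_fst[OF F] lborel_pair.integral_snd[OF F] by simp
  also have "\<dots> = (LINT x|lborel. Kb x - Ka x)"
  proof (rule integral_cong_AE)
    show "AE x in lborel. (LINT s|lborel. F s x) = Kb x - Ka x"
      using lborel_pair.AE_integrable_snd[OF F] ftc
      by eventually_elim (simp add: F_def set_integrable_def set_lebesgue_integral_def)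
    show "(\<lambda>x. LINT s|lborel. F s x) \<in> borel_measurable lborel" using lborel_pair.integrable_snd[OF F] by simp
  qed (use K in auto)
  also have "\<dots> = 0" using K by simp
  finally show ?thesis .
qed

lemma integral_directional_derivative_zero:
  fixes G H :: "'a::euclidean_space \<Rightarrow> complex"
  assumes G: "integrable lborel G" and H: "integrable lborel H"
    and line: "AE x in lborel. \<exists>S. finite S \<and> continuous_on {0..1} (\<lambda>s. G (x + s *\<^sub>R \<xi>)) \<and>
      (\<forall>s\<in>{0<..<1} - S. ((\<lambda>s. G (x + s *\<^sub>R \<xi>)) has_vector_derivative H (x + s *\<^sub>R \<xi>)) (at s))"
  shows "(LINT x|lborel. H x) = 0"
proof (rule flow_integral_zero[where K' = "\<lambda>s x. H (x + s *\<^sub>R \<xi>)" and Ka = G and Kb = "\<lambda>x. G (x + \<xi>)"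
      and B = "LINT x|lborel. norm (H x)"])
  have [measurable]: "H \<in> borel_measurable borel" using H by simp
  show "(\<lambda>(s, x). H (x + s *\<^sub>R \<xi>)) \<in> borel_measurable (borel \<Otimes>\<^sub>M borel)" by measurable
  show "integrable lborel (\<lambda>x. H (x + s *\<^sub>R \<xi>))" "(LINT x|lborel. norm (H (x + s *\<^sub>R \<xi>))) = (LINT x|lborel. norm (H x))"
    "(LINT x|lborel. H (x + s *\<^sub>R \<xi>)) = (LINT x|lborel. H x)" for s
    using integral_lborel_translate[OF H, of "s *\<^sub>R \<xi>"] integral_lborel_translate(2)[OF integrable_norm[OF H], of "s *\<^sub>R \<xi>"] by auto
  show "integrable lborel G" "integrable lborel (\<lambda>x. G (x + \<xi>))" "(LINT x|lborel. G x) = (LINT x|lborel. G (x + \<xi>))"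
    using integral_lborel_translate[OF G, of \<xi>] G by auto
  show "AE x in lborel. set_integrable lborel {0..1} (\<lambda>s. H (x + s *\<^sub>R \<xi>)) \<longrightarrow>
      (LINT s:{0..1}|lborel. H (x + s *\<^sub>R \<xi>)) = G (x + \<xi>) - G x"
    using line
  proof eventually_elim
    case (elim x)
    then obtain S where S: "finite S" "continuous_on {0..1} (\<lambda>s. G (x + s *\<^sub>R \<xi>))"
      "\<And>s. s \<in> {0<..<1} - S \<Longrightarrow> ((\<lambda>s. G (x + s *\<^sub>R \<xi>)) has_vector_derivative H (x + s *\<^sub>R \<xi>)) (at s)" by blast
    have "((\<lambda>s. H (x + s *\<^sub>R \<xi>)) has_integral (G (x + 1 *\<^sub>R \<xi>) - G (x + 0 *\<^sub>R \<xi>))) {0..1}"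
      by (rule fundamental_theorem_of_calculus_interior_strong[OF S(1) _ S(3) S(2)]) auto
    thus ?case using set_borel_integral_eq_integral(2)[of "{0..1}" "\<lambda>s. H (x + s *\<^sub>R \<xi>)"]
      by (auto simp: integral_unique)
  qed
qed

text \<open>
  The factor $e^{Ns}$ is the Jacobian of the dilation $x \mapsto e^s x$.
\<close>

lemma integral_dilation_derivative_zero:
  fixes G H :: "'a::euclidean_space \<Rightarrow> complex"
  assumes G: "integrable lborel G" and H: "integrable lborel H"
    and ray: "\<And>x s. x \<noteq> 0 \<Longrightarrow>
      ((\<lambda>s. complex_of_real (exp (real DIM('a) * s)) * G (exp s *\<^sub>R x)) has_vector_derivative
        complex_of_real (exp (real DIM('a) * s)) * H (exp s *\<^sub>R x)) (at s)"
  shows "(LINT x|lborel. H x) = 0"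
proof (rule flow_integral_zero[where K' = "\<lambda>s x. complex_of_real (exp (real DIM('a) * s)) * H (exp s *\<^sub>R x)"
      and Ka = G and Kb = "\<lambda>x. complex_of_real (exp (real DIM('a))) * G (exp 1 *\<^sub>R x)" and B = "LINT x|lborel. norm (H x)"])
  have [measurable]: "H \<in> borel_measurable borel" using H by simp
  have e: "exp (real DIM('a) * s) = \<bar>exp s\<bar> ^ DIM('a)" for s :: real by (simp add: exp_of_nat_mult)
  show "(\<lambda>(s, x). complex_of_real (exp (real DIM('a) * s)) * H (exp s *\<^sub>R x)) \<in> borel_measurable (borel \<Otimes>\<^sub>M borel)"
    by measurable
  have sc: "integrable lborel (\<lambda>x. complex_of_real (exp (real DIM('a) * s)) * f (exp s *\<^sub>R x))"
    "(LINT x|lborel. complex_of_real (exp (real DIM('a) * s)) * f (exp s *\<^sub>R x)) = (LINT x|lborel. f x)"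
    if "integrable lborel f" for s :: real and f :: "'a \<Rightarrow> complex"
    using integral_lborel_affine[OF that, of "exp s" 0] unfolding e by (auto simp: scaleR_conv_of_real)
  show "integrable lborel (\<lambda>x. complex_of_real (exp (real DIM('a) * s)) * H (exp s *\<^sub>R x))"
    "(LINT x|lborel. complex_of_real (exp (real DIM('a) * s)) * H (exp s *\<^sub>R x)) = (LINT x|lborel. H x)" for s
    using sc[OF H] by auto
  show "(LINT x|lborel. norm (complex_of_real (exp (real DIM('a) * s)) * H (exp s *\<^sub>R x))) = (LINT x|lborel. norm (H x))" for s
    using integral_lborel_affine(2)[OF integrable_norm[OF H], of "exp s" 0] unfolding norm_mult norm_of_real e by simp
  show "integrable lborel G" "integrable lborel (\<lambda>x. complex_of_real (exp (real DIM('a))) * G (exp 1 *\<^sub>R x))"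
    "(LINT x|lborel. G x) = (LINT x|lborel. complex_of_real (exp (real DIM('a))) * G (exp 1 *\<^sub>R x))"
    using sc[OF G, of 1] G by auto
  show "AE x in lborel. set_integrable lborel {0..1} (\<lambda>s. complex_of_real (exp (real DIM('a) * s)) * H (exp s *\<^sub>R x)) \<longrightarrow>
      (LINT s:{0..1}|lborel. complex_of_real (exp (real DIM('a) * s)) * H (exp s *\<^sub>R x))
        = complex_of_real (exp (real DIM('a))) * G (exp 1 *\<^sub>R x) - G x"
    using AE_lborel_nonzero
  proof eventually_elim
    case (elim x)
    have "((\<lambda>s. complex_of_real (exp (real DIM('a) * s)) * H (exp s *\<^sub>R x)) has_integral
        (complex_of_real (exp (real DIM('a) * 1)) * G (exp 1 *\<^sub>R x) - complex_of_real (exp (real DIM('a) * 0)) * G (exp 0 *\<^sub>R x))) {0..1}"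
      by (rule fundamental_theorem_of_calculus) (auto intro!: has_vector_derivative_at_within ray elim)
    thus ?case using set_borel_integral_eq_integral(2)[of "{0..1}" "\<lambda>s. complex_of_real (exp (real DIM('a) * s)) * H (exp s *\<^sub>R x)"]
      by (auto simp: integral_unique)
  qed
qed

section \<open>Integrability at a hyperplane\<close>

lemma integrable_inverse_growth:
  assumes T: "T > real DIM('a::euclidean_space)"
  shows "integrable lborel (\<lambda>x::'a. (1 + norm x) powr (- T))"
proof (rule Bochner_Integration.integrable_bound)
  show "integrable lborel (\<lambda>x::'a. norm x powr 0 * indicator (cball 0 1) x + norm x powr (- T) * indicator (- cball 0 1) x)"
    by (intro Bochner_Integration.integrable_add integrable_power_at_origin integrable_decay_at_infinity T) simp
  have Tp: "T \<ge> 0" using T by (smt (verit) of_nat_0_le_iff)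
  have "norm ((1 + norm x) powr (- T)) \<le> norm (norm x powr 0 * indicator (cball 0 1) x + norm x powr (- T) * indicator (- cball 0 1) x)"
    if "x \<noteq> 0" for x :: 'a
  proof (cases "norm x \<le> 1")
    case True
    have "(1 + norm x) powr (- T) \<le> (1 + norm x) powr 0" using Tp by (intro powr_mono) auto
    moreover have "(1 + norm x) powr 0 = 1" using norm_ge_zero[of x] by (simp add: add_nonneg_eq_0_iff)
    ultimately show ?thesis using True that by (simp add: indicator_def)
  next
    case False
    have "(1 + norm x) powr (- T) \<le> norm x powr (- T)" using Tp that by (intro powr_mono2') auto
    thus ?thesis using False by (simp add: indicator_def)
  qed
  thus "AE x::'a in lborel. norm ((1 + norm x) powr (- T)) \<le> norm (norm x powr 0 * indicator (cball 0 1) x + norm x powr (- T) * indicator (- cball 0 1) x)"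
    using AE_lborel_nonzero by (auto elim: eventually_mono)
qed measurable

lemma nn_integral_abs_powr_interval:
  assumes \<kappa>: "\<kappa> > 0" and L: "L \<ge> (0::real)"
  shows "(\<integral>\<^sup>+v. ennreal (indicator {-L..L} v * \<bar>v\<bar> powr (\<kappa> - 1)) \<partial>lborel) \<le> ennreal (2 * L powr \<kappa> / \<kappa>)"
proof -
  define h where "h v = indicator {0..L} v * v powr (\<kappa> - 1)" for v :: real
  have hm[measurable]: "h \<in> borel_measurable borel" unfolding h_def by measurable
  have hn: "h v \<ge> 0" for v by (simp add: h_def)
  have "((\<lambda>v. if v \<in> {0..L} then v powr (\<kappa> - 1) else 0) has_integral (L powr (\<kappa> - 1 + 1) / (\<kappa> - 1 + 1))) UNIV"
    unfolding has_integral_restrict_UNIV by (rule has_integral_powr_from_0) (use \<kappa> L in auto)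
  moreover have "(\<lambda>v. if v \<in> {0..L} then v powr (\<kappa> - 1) else 0) = h" by (auto simp: h_def fun_eq_iff)
  ultimately have "(h has_integral (L powr \<kappa> / \<kappa>)) UNIV" by simp
  hence I: "(\<integral>\<^sup>+v. ennreal (h v) \<partial>lborel) = ennreal (L powr \<kappa> / \<kappa>)"
    by (rule nn_integral_has_integral_lborel[OF hm hn])
  have I': "(\<integral>\<^sup>+v. ennreal (h (- v)) \<partial>lborel) = ennreal (L powr \<kappa> / \<kappa>)"
    using nn_integral_real_affine[of "\<lambda>v. ennreal (h v)" "-1" 0] I by simp
  have "(\<integral>\<^sup>+v. ennreal (indicator {-L..L} v * \<bar>v\<bar> powr (\<kappa> - 1)) \<partial>lborel) \<le> (\<integral>\<^sup>+v. ennreal (h v) + ennreal (h (- v)) \<partial>lborel)"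
  proof (rule nn_integral_mono)
    fix v :: real
    have "indicator {-L..L} v * \<bar>v\<bar> powr (\<kappa> - 1) \<le> h v + h (- v)"
      by (cases "v \<ge> 0") (auto simp: h_def indicator_def)
    thus "ennreal (indicator {-L..L} v * \<bar>v\<bar> powr (\<kappa> - 1)) \<le> ennreal (h v) + ennreal (h (- v))"
      using hn by (simp add: ennreal_plus[symmetric] ennreal_leI del: ennreal_plus)
  qed
  also have "\<dots> = ennreal (L powr \<kappa> / \<kappa>) + ennreal (L powr \<kappa> / \<kappa>)"
    by (subst nn_integral_add) (auto simp: I I')
  also have "\<dots> = ennreal (2 * L powr \<kappa> / \<kappa>)" using \<kappa> by (subst ennreal_plus[symmetric]) auto
  finally show ?thesis .
qed

text \<open>
  Averaging over the translations by $s\alpha$, $0 \le s \le 1$, does not change the integral and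
  turns the singular factor into its mean along a segment, which is bounded by a power of
  $1 + \|x\|$.
\<close>

lemma integrable_hyperplane_singularity:
  fixes \<alpha> :: "'a::euclidean_space"
  assumes \<alpha>: "\<alpha> \<noteq> 0" and \<kappa>: "\<kappa> > 0" and T: "T > real DIM('a) + \<kappa>"
  shows "integrable lborel (\<lambda>x. \<bar>\<alpha> \<bullet> x\<bar> powr (\<kappa> - 1) * (1 + norm x) powr (- T))"
proof (rule integrableI_nonneg)
  define g where "g x = \<bar>\<alpha> \<bullet> x\<bar> powr (\<kappa> - 1) * (1 + norm x) powr (- T)" for x :: 'a
  have g[measurable]: "g \<in> borel_measurable borel" unfolding g_def by measurable
  define A where "A = \<alpha> \<bullet> \<alpha>"
  have A: "A > 0" using \<alpha> by (simp add: A_def)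
  have Tp: "T \<ge> 0" using T \<kappa> by (smt (verit) of_nat_0_le_iff)
  define C where "C = (1 + norm \<alpha>) powr T * (2 / (\<kappa> * A)) * (norm \<alpha> + A) powr \<kappa>"
  have tr: "(\<integral>\<^sup>+x. ennreal (g (x + s *\<^sub>R \<alpha>)) \<partial>lborel) = (\<integral>\<^sup>+x. ennreal (g x) \<partial>lborel)" for s
    using nn_integral_lborel_affine[of "\<lambda>x. ennreal (g x)" 1 "s *\<^sub>R \<alpha>"] by (simp add: add.commute)
  have "(\<integral>\<^sup>+x. ennreal (g x) \<partial>lborel) = (\<integral>\<^sup>+s. indicator {0..1::real} s * (\<integral>\<^sup>+x. ennreal (g x) \<partial>lborel) \<partial>lborel)"
    by (simp add: nn_integral_multc)
  also have "\<dots> = (\<integral>\<^sup>+s. (\<integral>\<^sup>+x. indicator {0..1::real} s * ennreal (g (x + s *\<^sub>R \<alpha>)) \<partial>lborel) \<partial>lborel)"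
    by (intro nn_integral_cong) (simp add: nn_integral_cmult tr)
  also have "\<dots> = (\<integral>\<^sup>+x. (\<integral>\<^sup>+s. indicator {0..1::real} s * ennreal (g (x + s *\<^sub>R \<alpha>)) \<partial>lborel) \<partial>lborel)"
    by (rule lborel_pair.Fubini'[symmetric]) measurable
  also have "\<dots> \<le> (\<integral>\<^sup>+x. ennreal (C * (1 + norm (x::'a)) powr (- (T - \<kappa>))) \<partial>lborel)"
  proof (rule nn_integral_mono)
    fix x :: 'a
    define u where "u = \<alpha> \<bullet> x"
    define L where "L = \<bar>u\<bar> + A"
    define D where "D = (1 + norm \<alpha>) powr T * (1 + norm x) powr (- T)"
    have L: "L \<ge> 0" using A by (simp add: L_def)
    have D: "D \<ge> 0" by (simp add: D_def)
    let ?f = "\<lambda>v. indicator {-L..L} v * \<bar>v\<bar> powr (\<kappa> - 1)"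
    have pt: "indicator {0..1::real} s * ennreal (g (x + s *\<^sub>R \<alpha>)) \<le> ennreal D * ennreal (?f (u + A * s))" for s :: real
    proof (cases "s \<in> {0..1}")
      case True
      have "1 + norm x \<le> (1 + norm \<alpha>) * (1 + norm (x + s *\<^sub>R \<alpha>))"
      proof -
        have "norm x \<le> norm (x + s *\<^sub>R \<alpha>) + norm (s *\<^sub>R \<alpha>)" using norm_triangle_ineq4[of "x + s *\<^sub>R \<alpha>" "s *\<^sub>R \<alpha>"] by simp
        also have "norm (s *\<^sub>R \<alpha>) \<le> 1 * norm \<alpha>" unfolding norm_scaleR using True by (intro mult_right_mono) auto
        finally have "1 + norm x \<le> 1 + norm (x + s *\<^sub>R \<alpha>) + norm \<alpha>" by simp
        also have "\<dots> \<le> 1 + norm (x + s *\<^sub>R \<alpha>) + norm \<alpha> + norm \<alpha> * norm (x + s *\<^sub>R \<alpha>)" by simp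
        finally show ?thesis by (simp add: algebra_simps)
      qed
      hence "((1 + norm \<alpha>) * (1 + norm (x + s *\<^sub>R \<alpha>))) powr (- T) \<le> (1 + norm x) powr (- T)"
        using Tp by (intro powr_mono2') (auto simp: add_pos_nonneg)
      hence "(1 + norm \<alpha>) powr (- T) * (1 + norm (x + s *\<^sub>R \<alpha>)) powr (- T) \<le> (1 + norm x) powr (- T)"
        by (simp add: powr_mult)
      hence "(1 + norm \<alpha>) powr T * ((1 + norm \<alpha>) powr (- T) * (1 + norm (x + s *\<^sub>R \<alpha>)) powr (- T)) \<le> D"
        unfolding D_def by (intro mult_left_mono) auto
      moreover have "(1 + norm \<alpha>) powr T * (1 + norm \<alpha>) powr (- T) = 1"
      proof -
        have "1 + norm \<alpha> \<noteq> 0" using norm_ge_zero[of \<alpha>] by linarith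
        thus ?thesis by (simp add: powr_minus)
      qed
      ultimately have dec: "(1 + norm (x + s *\<^sub>R \<alpha>)) powr (- T) \<le> D" by (simp add: mult.assoc[symmetric])
      have as: "A * s \<le> A" "A * s \<ge> 0" using True A by (auto simp: mult_left_le)
      hence inL: "u + A * s \<in> {-L..L}" by (auto simp: L_def)
      have "g (x + s *\<^sub>R \<alpha>) = \<bar>u + A * s\<bar> powr (\<kappa> - 1) * (1 + norm (x + s *\<^sub>R \<alpha>)) powr (- T)"
        by (simp add: g_def u_def A_def inner_add_right mult.commute)
      also have "\<dots> \<le> \<bar>u + A * s\<bar> powr (\<kappa> - 1) * D" using dec by (intro mult_left_mono) auto
      also have "\<dots> = D * ?f (u + A * s)" using inL by simp
      finally show ?thesis using True D by (simp add: ennreal_mult'[symmetric] ennreal_leI)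
    qed simp
    have "(\<integral>\<^sup>+s. indicator {0..1::real} s * ennreal (g (x + s *\<^sub>R \<alpha>)) \<partial>lborel)
        \<le> (\<integral>\<^sup>+s. ennreal D * ennreal (?f (u + A * s)) \<partial>lborel)" by (intro nn_integral_mono pt)
    also have "\<dots> = ennreal D * (\<integral>\<^sup>+s. ennreal (?f (u + A * s)) \<partial>lborel)" by (rule nn_integral_cmult) measurable
    also have "(\<integral>\<^sup>+s. ennreal (?f (u + A * s)) \<partial>lborel) \<le> ennreal (2 * L powr \<kappa> / \<kappa> / A)"
    proof -
      have "ennreal A * (\<integral>\<^sup>+s. ennreal (?f (u + A * s)) \<partial>lborel) \<le> ennreal (2 * L powr \<kappa> / \<kappa>)"
        using nn_integral_real_affine[of "\<lambda>v. ennreal (?f v)" A u] nn_integral_abs_powr_interval[OF \<kappa> L] A by simp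
      hence "ennreal (1 / A) * (ennreal A * (\<integral>\<^sup>+s. ennreal (?f (u + A * s)) \<partial>lborel)) \<le> ennreal (1 / A) * ennreal (2 * L powr \<kappa> / \<kappa>)"
        by (rule mult_left_mono) simp
      moreover have "ennreal (1 / A) * ennreal A = 1" using A by (simp add: ennreal_mult'[symmetric])
      ultimately show ?thesis
        using A by (simp add: mult.assoc[symmetric] ennreal_mult'[symmetric]) (simp add: mult.commute)
    qed
    also have "ennreal D * ennreal (2 * L powr \<kappa> / \<kappa> / A) = ennreal (D * (2 * L powr \<kappa> / \<kappa> / A))"
      by (rule ennreal_mult'[OF D, symmetric])
    also have "\<dots> \<le> ennreal (C * (1 + norm x) powr (- (T - \<kappa>)))"
    proof (rule ennreal_leI)
      have "L \<le> (norm \<alpha> + A) * (1 + norm x)"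
      proof -
        have "\<bar>u\<bar> \<le> norm \<alpha> * norm x" unfolding u_def by (rule Cauchy_Schwarz_ineq2)
        moreover have "0 \<le> norm \<alpha>" "0 \<le> A * norm x" using A by auto
        moreover have "(norm \<alpha> + A) * (1 + norm x) = norm \<alpha> + norm \<alpha> * norm x + A + A * norm x"
          by (simp add: algebra_simps)
        ultimately show ?thesis unfolding L_def by linarith
      qed
      hence "L powr \<kappa> \<le> ((norm \<alpha> + A) * (1 + norm x)) powr \<kappa>" using L \<kappa> by (intro powr_mono2) auto
      also have "\<dots> = (norm \<alpha> + A) powr \<kappa> * (1 + norm x) powr \<kappa>" by (rule powr_mult)
      finally have "D * (2 * L powr \<kappa> / \<kappa> / A) \<le> D * (2 * ((norm \<alpha> + A) powr \<kappa> * (1 + norm x) powr \<kappa>) / \<kappa> / A)"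
        using D \<kappa> A by (intro mult_left_mono divide_right_mono) auto
      also have "\<dots> = C * ((1 + norm x) powr (- T) * (1 + norm x) powr \<kappa>)"
        by (simp add: D_def C_def)
      also have "(1 + norm x) powr (- T) * (1 + norm x) powr \<kappa> = (1 + norm x) powr (- (T - \<kappa>))"
        by (simp flip: powr_add)
      finally show "D * (2 * L powr \<kappa> / \<kappa> / A) \<le> C * (1 + norm x) powr (- (T - \<kappa>))" .
    qed
    finally show "(\<integral>\<^sup>+s. indicator {0..1::real} s * ennreal (g (x + s *\<^sub>R \<alpha>)) \<partial>lborel)
        \<le> ennreal (C * (1 + norm x) powr (- (T - \<kappa>)))" by (simp add: mult_left_mono)
  qed
  also have "\<dots> < \<infinity>"
  proof -
    have "integrable lborel (\<lambda>x::'a. C * (1 + norm x) powr (- (T - \<kappa>)))"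
      by (intro integrable_mult_right integrable_inverse_growth) (use T in auto)
    thus ?thesis unfolding integrable_iff_bounded
      using A \<kappa> by (simp add: C_def abs_mult)
  qed
  finally show "(\<integral>\<^sup>+x. ennreal (\<bar>\<alpha> \<bullet> x\<bar> powr (\<kappa> - 1) * (1 + norm x) powr (- T)) \<partial>lborel) < \<infinity>"
    by (simp add: g_def)
qed auto

lemma exp_decay_le_growth:
  assumes c: "c > (0::real)" and a: "a > 0" and e: "e \<ge> 0" and T: "T \<ge> 0"
  obtains C where "C \<ge> 0" "\<And>t. t > 0 \<Longrightarrow> t powr e * exp (- c * t powr a) \<le> C * (1 + t) powr (- T)"
proof -
  obtain C where C: "C \<ge> 0" "\<And>t. t \<ge> 1 \<Longrightarrow> exp (- c * t powr a) \<le> C * t powr (- (e + T))"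
    using exp_decay_le_power[OF c a, where M = "e + T"] by metis
  show ?thesis
  proof (rule that[of "(C + 1) * 2 powr T"])
    show "0 \<le> (C + 1) * 2 powr T" using C by simp
    fix t :: real assume t: "t > 0"
    show "t powr e * exp (- c * t powr a) \<le> (C + 1) * 2 powr T * (1 + t) powr (- T)"
    proof (cases "t \<le> 1")
      case True
      have "t powr e * exp (- c * t powr a) \<le> 1 * 1" using True t e c by (intro mult_mono powr_le1) auto
      moreover have "1 \<le> 2 powr T * (1 + t) powr (- T)"
      proof -
        have "2 powr (- T) \<le> (1 + t) powr (- T)" using True t T by (intro powr_mono2') auto
        hence "2 powr T * 2 powr (- T) \<le> 2 powr T * (1 + t) powr (- T)" by (intro mult_left_mono) auto
        thus ?thesis by (simp flip: powr_add)
      qed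
      ultimately have "t powr e * exp (- c * t powr a) \<le> 1 * (2 powr T * (1 + t) powr (- T))" by linarith
      also have "\<dots> \<le> (C + 1) * (2 powr T * (1 + t) powr (- T))" using C by (intro mult_right_mono) auto
      finally show ?thesis by (simp add: mult.assoc)
    next
      case False
      hence "t powr e * exp (- c * t powr a) \<le> t powr e * (C * t powr (- (e + T)))" using C by (intro mult_left_mono) auto
      also have "\<dots> = C * t powr (- T)" by (simp add: mult.left_commute flip: powr_add)
      also have "t powr (- T) \<le> 2 powr T * (1 + t) powr (- T)"
      proof -
        have "(2 * t) powr (- T) \<le> (1 + t) powr (- T)" using False T by (intro powr_mono2') auto
        hence "2 powr T * (2 powr (- T) * t powr (- T)) \<le> 2 powr T * (1 + t) powr (- T)"
          using False by (intro mult_left_mono) (auto simp: powr_mult)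
        thus ?thesis by (simp add: mult.assoc[symmetric] flip: powr_add)
      qed
      hence "C * t powr (- T) \<le> C * (2 powr T * (1 + t) powr (- T))" using C by (intro mult_left_mono)
      also have "\<dots> \<le> (C + 1) * (2 powr T * (1 + t) powr (- T))" by (intro mult_right_mono) auto
      finally show ?thesis by (simp add: mult.assoc)
    qed
  qed
qed

section \<open>The weight of a root system\<close>

locale dunkl_setting =
  fixes R P :: "(real^'n) set" and k :: "real^'n \<Rightarrow> real" and a :: real
  assumes root: "root_system R" and pos: "positive_subsystem R P" and mult: "multiplicity_function R k"
    and k_nonneg: "\<And>\<alpha>. \<alpha> \<in> R \<Longrightarrow> k \<alpha> \<ge> 0" and a_pos: "a > 0"
    and index_pos: "a + 2 * mult_sum P k + real CARD('n) - 2 > 0"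
begin

abbreviation "\<kappa> \<equiv> mult_sum P k"

text \<open>
  A root of multiplicity $0$ contributes the factor $1$, so that $w$ is continuous; off the root
  hyperplanes $\vartheta_{k,a}(x) = \|x\|^{a-2} w(x)$.
\<close>

definition w :: "real^'n \<Rightarrow> real" where
  "w x = (\<Prod>\<alpha>\<in>R. if k \<alpha> = 0 then 1 else \<bar>\<alpha> \<bullet> x\<bar> powr k \<alpha>)"

lemma finite_R: "finite R" and zero_R: "0 \<notin> R" and P_R: "P \<subseteq> R"
  using root pos by (auto simp: root_system_def positive_subsystem_def)

lemma finite_P: "finite P" and zero_P: "0 \<notin> P"
  using finite_R zero_R P_R finite_subset by auto

lemma reflection_bij: "\<beta> \<in> R \<Longrightarrow> bij_betw (reflection \<beta>) R R"
  using root reflection_involution unfolding root_system_def bij_betw_def inj_on_def by metis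

lemma reflection_R: "\<beta> \<in> R \<Longrightarrow> \<alpha> \<in> R \<Longrightarrow> reflection \<beta> \<alpha> \<in> R"
  using reflection_bij by (meson bij_betwE)

lemma k_reflection: "\<beta> \<in> R \<Longrightarrow> \<alpha> \<in> R \<Longrightarrow> k (reflection \<beta> \<alpha>) = k \<alpha>"
  using mult coxeter_group.mult[OF _ coxeter_group.one, of \<beta> R] by (auto simp: multiplicity_function_def)

lemma reflection_self: "\<alpha> \<noteq> 0 \<Longrightarrow> reflection \<alpha> \<alpha> = - \<alpha>"
  by (simp add: reflection_def power2_norm_eq_inner scaleR_2)

lemma minus_R: "\<alpha> \<in> R \<Longrightarrow> - \<alpha> \<in> R" and k_minus: "\<alpha> \<in> R \<Longrightarrow> k (- \<alpha>) = k \<alpha>"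
  using reflection_R[of \<alpha> \<alpha>] k_reflection[of \<alpha> \<alpha>] reflection_self[of \<alpha>] zero_R by metis+

lemma R_split: "R = P \<union> uminus ` P" "P \<inter> uminus ` P = {}"
proof -
  obtain u where u: "\<And>\<alpha>. \<alpha> \<in> R \<Longrightarrow> \<alpha> \<bullet> u \<noteq> 0" "P = {\<alpha> \<in> R. \<alpha> \<bullet> u > 0}"
    using pos by (auto simp: positive_subsystem_def)
  show "P \<inter> uminus ` P = {}" unfolding u(2) by auto
  show "R = P \<union> uminus ` P"
  proof (intro equalityI subsetI)
    fix \<alpha> assume \<alpha>: "\<alpha> \<in> R"
    show "\<alpha> \<in> P \<union> uminus ` P"
    proof (cases "\<alpha> \<bullet> u > 0")
      case False
      hence "- \<alpha> \<in> P" using u(1)[OF \<alpha>] minus_R[OF \<alpha>] by (simp add: u(2))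
      thus ?thesis by (metis UnI2 imageI minus_minus)
    qed (use \<alpha> u(2) in simp)
  qed (use P_R minus_R in auto)
qed

lemma sum_R: "(\<Sum>\<alpha>\<in>R. f \<alpha>) = (\<Sum>\<alpha>\<in>P. f \<alpha> + f (- \<alpha>))" for f :: "real^'n \<Rightarrow> 'b::comm_monoid_add"
proof -
  have "(\<Sum>\<alpha>\<in>R. f \<alpha>) = (\<Sum>\<alpha>\<in>P. f \<alpha>) + (\<Sum>\<alpha>\<in>uminus ` P. f \<alpha>)"
    using finite_P R_split by (metis finite_imageI sum.union_disjoint)
  also have "(\<Sum>\<alpha>\<in>uminus ` P. f \<alpha>) = (\<Sum>\<alpha>\<in>P. f (- \<alpha>))" by (subst sum.reindex) (auto simp: inj_on_def)
  finally show ?thesis by (simp add: sum.distrib)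
qed

lemma kappa_nonneg: "\<kappa> \<ge> 0"
  unfolding mult_sum_def using k_nonneg P_R by (intro sum_nonneg) auto

lemma sum_k_R: "(\<Sum>\<alpha>\<in>R. k \<alpha>) = 2 * \<kappa>"
proof -
  have "(\<Sum>\<alpha>\<in>R. k \<alpha>) = (\<Sum>\<alpha>\<in>P. 2 * k \<alpha>)"
    unfolding sum_R using k_minus P_R by (intro sum.cong) auto
  thus ?thesis by (simp add: mult_sum_def sum_distrib_left)
qed

lemma w_nonneg: "w x \<ge> 0"
  unfolding w_def by (intro prod_nonneg) auto

lemma continuous_w: "continuous_on A w"
  unfolding w_def
proof (intro continuous_on_prod)
  fix \<alpha> assume "\<alpha> \<in> R"
  show "continuous_on A (\<lambda>x. if k \<alpha> = 0 then 1 else \<bar>\<alpha> \<bullet> x\<bar> powr k \<alpha>)"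
  proof (cases "k \<alpha> = 0")
    case False
    hence "k \<alpha> > 0" using k_nonneg[OF \<open>\<alpha> \<in> R\<close>] by simp
    hence "continuous_on A (\<lambda>x. \<bar>\<alpha> \<bullet> x\<bar> powr k \<alpha>)"
      by (intro continuous_on_powr' continuous_intros) auto
    thus ?thesis using False by simp
  qed simp
qed

lemma w_measurable [measurable]: "w \<in> borel_measurable borel"
  by (rule borel_measurable_continuous_onI[OF continuous_w])

lemma w_reflection: "\<beta> \<in> R \<Longrightarrow> w (reflection \<beta> x) = w x"
proof -
  assume \<beta>: "\<beta> \<in> R"
  have "w (reflection \<beta> x) = (\<Prod>\<alpha>\<in>R. if k (reflection \<beta> \<alpha>) = 0 then 1 else \<bar>reflection \<beta> \<alpha> \<bullet> x\<bar> powr k (reflection \<beta> \<alpha>))"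
    unfolding w_def by (intro prod.cong refl) (simp add: reflection_adjoint k_reflection \<beta>)
  also have "\<dots> = w x" unfolding w_def
    by (rule prod.reindex_bij_betw[OF reflection_bij[OF \<beta>], where g = "\<lambda>\<alpha>. if k \<alpha> = 0 then 1 else \<bar>\<alpha> \<bullet> x\<bar> powr k \<alpha>"])
  finally show ?thesis .
qed

lemma w_scale: assumes "t > 0" shows "w (t *\<^sub>R x) = t powr (2 * \<kappa>) * w x"
proof -
  have "w (t *\<^sub>R x) = (\<Prod>\<alpha>\<in>R. t powr k \<alpha> * (if k \<alpha> = 0 then 1 else \<bar>\<alpha> \<bullet> x\<bar> powr k \<alpha>))"
    unfolding w_def using assms by (intro prod.cong refl) (auto simp: abs_mult powr_mult)
  also have "\<dots> = (\<Prod>\<alpha>\<in>R. t powr k \<alpha>) * w x" by (simp add: prod.distrib w_def)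
  also have "(\<Prod>\<alpha>\<in>R. t powr k \<alpha>) = t powr (2 * \<kappa>)"
    unfolding sum_k_R[symmetric] using assms finite_R by (subst powr_sum) auto
  finally show ?thesis .
qed

lemma partial_weight_bound:
  assumes "A \<subseteq> R" "x \<noteq> 0"
  shows "(\<Prod>\<alpha>\<in>A. if k \<alpha> = 0 then 1 else \<bar>\<alpha> \<bullet> x\<bar> powr k \<alpha>) \<le> (\<Prod>\<alpha>\<in>A. norm \<alpha> powr k \<alpha>) * norm x powr (\<Sum>\<alpha>\<in>A. k \<alpha>)"
proof -
  have "(\<Prod>\<alpha>\<in>A. if k \<alpha> = 0 then 1 else \<bar>\<alpha> \<bullet> x\<bar> powr k \<alpha>) \<le> (\<Prod>\<alpha>\<in>A. norm \<alpha> powr k \<alpha> * norm x powr k \<alpha>)"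
  proof (intro prod_mono conjI)
    fix \<alpha> assume "\<alpha> \<in> A"
    hence \<alpha>: "\<alpha> \<in> R" "\<alpha> \<noteq> 0" using assms zero_R by auto
    show "(if k \<alpha> = 0 then 1 else \<bar>\<alpha> \<bullet> x\<bar> powr k \<alpha>) \<le> norm \<alpha> powr k \<alpha> * norm x powr k \<alpha>"
    proof (cases "k \<alpha> = 0")
      case False
      have "\<bar>\<alpha> \<bullet> x\<bar> powr k \<alpha> \<le> (norm \<alpha> * norm x) powr k \<alpha>"
        using k_nonneg[OF \<alpha>(1)] by (intro powr_mono2 Cauchy_Schwarz_ineq2) auto
      thus ?thesis using False by (simp add: powr_mult)
    qed (use \<alpha> assms in simp)
  qed auto
  also have "\<dots> = (\<Prod>\<alpha>\<in>A. norm \<alpha> powr k \<alpha>) * norm x powr (\<Sum>\<alpha>\<in>A. k \<alpha>)"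
    using assms finite_subset[OF assms(1) finite_R] by (subst powr_sum) (auto simp: prod.distrib)
  finally show ?thesis .
qed

definition root_norms :: real where "root_norms = (\<Prod>\<alpha>\<in>R. norm \<alpha> powr k \<alpha>)"

lemma w_bound: "x \<noteq> 0 \<Longrightarrow> w x \<le> root_norms * norm x powr (2 * \<kappa>)"
  using partial_weight_bound[of R x] by (simp add: w_def root_norms_def sum_k_R)

lemma AE_regular: "AE x in lborel. x \<noteq> 0 \<and> (\<forall>\<alpha>\<in>R. \<alpha> \<bullet> x \<noteq> 0)"
proof -
  have "AE x in lborel. \<forall>\<alpha>\<in>R. \<alpha> \<bullet> x \<noteq> 0"
  proof (rule AE_finite_allI[OF finite_R])
    show "AE x in lborel. \<alpha> \<bullet> x \<noteq> 0" if "\<alpha> \<in> R" for \<alpha>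
      using that zero_R by (intro AE_not_hyperplane) auto
  qed
  thus ?thesis using AE_lborel_nonzero by eventually_elim auto
qed

lemma theta_AE: "AE x in lborel. theta R k a x = norm x powr (a - 2) * w x"
  using AE_regular
proof eventually_elim
  case (elim x)
  have "(\<Prod>\<alpha>\<in>R. \<bar>\<alpha> \<bullet> x\<bar> powr k \<alpha>) = w x" unfolding w_def using elim by (intro prod.cong) auto
  thus ?case by (simp add: theta_def)
qed

lemma w_pos_AE: "AE x in lborel. w x > 0"
  using AE_regular by eventually_elim (auto simp: w_def intro!: prod_pos)

lemma integrable_weighted:
  assumes f: "hpoly d f" and c: "c > 0" and s: "real d + s + 2 * \<kappa> + real CARD('n) > 0"
  shows "integrable lborel (\<lambda>x. f x * complex_of_real (norm x powr s * exp (- c * norm x powr a) * w x))"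
proof -
  obtain C where C: "C \<ge> 0" "\<And>x. cmod (f x) \<le> C * norm x ^ d" using hpoly_bound[OF f] by blast
  have "integrable lborel (\<lambda>x::real^'n. (C * root_norms) * (norm x powr (real d + s + 2 * \<kappa>) * exp (- c * norm x powr a)))"
    using s by (intro integrable_mult_right integrable_radial_exp c a_pos) simp
  thus ?thesis
  proof (rule Bochner_Integration.integrable_bound)
    have [measurable]: "f \<in> borel_measurable borel" by (rule borel_measurable_continuous_onI[OF hpoly_continuous[OF f]])
    show "(\<lambda>x. f x * complex_of_real (norm x powr s * exp (- c * norm x powr a) * w x)) \<in> borel_measurable lborel" by measurable
    show "AE x in lborel. norm (f x * complex_of_real (norm x powr s * exp (- c * norm x powr a) * w x))
        \<le> norm ((C * root_norms) * (norm x powr (real d + s + 2 * \<kappa>) * exp (- c * norm x powr a)))"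
      using AE_lborel_nonzero
    proof eventually_elim
      case (elim x)
      have nx: "norm x > 0" using elim by simp
      have rn: "root_norms \<ge> 0" unfolding root_norms_def by (intro prod_nonneg) auto
      have "norm (f x * complex_of_real (norm x powr s * exp (- c * norm x powr a) * w x))
          = cmod (f x) * (norm x powr s * exp (- c * norm x powr a) * w x)"
        unfolding norm_mult norm_of_real using w_nonneg[of x] by (simp add: abs_mult)
      also have "\<dots> \<le> (C * norm x ^ d) * (norm x powr s * exp (- c * norm x powr a) * (root_norms * norm x powr (2 * \<kappa>)))"
        using C w_bound[OF elim] w_nonneg[of x] by (intro mult_mono) auto
      also have "\<dots> = (C * root_norms) * ((norm x powr real d * norm x powr s * norm x powr (2 * \<kappa>)) * exp (- c * norm x powr a))"
        using nx by (simp add: powr_realpow mult_ac)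
      also have "norm x powr real d * norm x powr s * norm x powr (2 * \<kappa>) = norm x powr (real d + s + 2 * \<kappa>)"
        by (simp add: powr_add)
      finally show ?case using C(1) rn by (simp add: abs_mult)
    qed
  qed
qed

text \<open>
  The roots $\alpha$ and $-\alpha$ together contribute $|\langle\alpha,x\rangle|^{2k_\alpha}$ to $w$, so dividing by
  $\langle\alpha,x\rangle$ leaves the exponent $2k_\alpha - 1 > -1$, which is integrable across the
  hyperplane.
\<close>

lemma integrable_weighted_singular:
  assumes f: "hpoly d f" and c: "c > 0" and \<alpha>: "\<alpha> \<in> R" and k\<alpha>: "k \<alpha> > 0"
  shows "integrable lborel (\<lambda>x. f x * complex_of_real (exp (- c * norm x powr a) * w x / (\<alpha> \<bullet> x)))"
proof -
  define e where "e = real d + (2 * \<kappa> - 2 * k \<alpha>)"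
  define T where "T = real CARD('n) + 2 * k \<alpha> + 1"
  define A where "A = R - {\<alpha>, - \<alpha>}"
  define K where "K = (\<Prod>\<beta>\<in>A. norm \<beta> powr k \<beta>)"
  have \<alpha>0: "\<alpha> \<noteq> 0" using \<alpha> zero_R by auto
  have ne: "\<alpha> \<noteq> - \<alpha>"
  proof
    assume "\<alpha> = - \<alpha>"
    hence "\<alpha> + \<alpha> = 0" by (metis add.right_inverse)
    thus False using \<alpha>0 by (simp flip: scaleR_2)
  qed
  have RA: "R = insert \<alpha> (insert (- \<alpha>) A)" "\<alpha> \<notin> insert (- \<alpha>) A" "- \<alpha> \<notin> A" "finite A"
    using \<alpha> minus_R ne finite_R by (auto simp: A_def)
  have sumA: "(\<Sum>\<beta>\<in>A. k \<beta>) = 2 * \<kappa> - 2 * k \<alpha>"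
    using sum_k_R RA k_minus[OF \<alpha>] by simp
  have "(\<Sum>\<beta>\<in>A. k \<beta>) \<ge> 0" using k_nonneg by (intro sum_nonneg) (auto simp: A_def)
  hence e0: "e \<ge> 0" using sumA by (simp add: e_def)
  obtain C where C: "C \<ge> 0" "\<And>x. cmod (f x) \<le> C * norm x ^ d" using hpoly_bound[OF f] by blast
  obtain C' where C': "C' \<ge> 0" "\<And>t. t > 0 \<Longrightarrow> t powr e * exp (- c * t powr a) \<le> C' * (1 + t) powr (- T)"
    using exp_decay_le_growth[OF c a_pos e0, where T = T] k\<alpha> by (auto simp: T_def)
  have K: "K \<ge> 0" unfolding K_def by (intro prod_nonneg) auto
  have "integrable lborel (\<lambda>x. (C * K * C') * (\<bar>\<alpha> \<bullet> x\<bar> powr (2 * k \<alpha> - 1) * (1 + norm x) powr (- T)))"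
    using k\<alpha> by (intro integrable_mult_right integrable_hyperplane_singularity \<alpha>0) (auto simp: T_def)
  thus ?thesis
  proof (rule Bochner_Integration.integrable_bound)
    have [measurable]: "f \<in> borel_measurable borel" by (rule borel_measurable_continuous_onI[OF hpoly_continuous[OF f]])
    show "(\<lambda>x. f x * complex_of_real (exp (- c * norm x powr a) * w x / (\<alpha> \<bullet> x))) \<in> borel_measurable lborel" by measurable
    show "AE x in lborel. norm (f x * complex_of_real (exp (- c * norm x powr a) * w x / (\<alpha> \<bullet> x)))
        \<le> norm ((C * K * C') * (\<bar>\<alpha> \<bullet> x\<bar> powr (2 * k \<alpha> - 1) * (1 + norm x) powr (- T)))"
      using AE_regular
    proof eventually_elim
      case (elim x)
      hence nx: "norm x > 0" and ax: "\<bar>\<alpha> \<bullet> x\<bar> > 0" using \<alpha> by auto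
      have "w x = \<bar>\<alpha> \<bullet> x\<bar> powr k \<alpha> * (\<bar>\<alpha> \<bullet> x\<bar> powr k \<alpha> * (\<Prod>\<beta>\<in>A. if k \<beta> = 0 then 1 else \<bar>\<beta> \<bullet> x\<bar> powr k \<beta>))"
        unfolding w_def using RA k_minus[OF \<alpha>] k\<alpha> by simp
      also have "\<dots> = \<bar>\<alpha> \<bullet> x\<bar> powr (2 * k \<alpha>) * (\<Prod>\<beta>\<in>A. if k \<beta> = 0 then 1 else \<bar>\<beta> \<bullet> x\<bar> powr k \<beta>)"
        by (simp add: mult.assoc[symmetric] flip: powr_add)
      also have "\<dots> \<le> \<bar>\<alpha> \<bullet> x\<bar> powr (2 * k \<alpha>) * (K * norm x powr (2 * \<kappa> - 2 * k \<alpha>))"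
        using partial_weight_bound[of A x] elim sumA by (intro mult_left_mono) (auto simp: K_def A_def)
      finally have wb: "w x \<le> \<bar>\<alpha> \<bullet> x\<bar> powr (2 * k \<alpha>) * (K * norm x powr (2 * \<kappa> - 2 * k \<alpha>))" .
      have "norm (f x * complex_of_real (exp (- c * norm x powr a) * w x / (\<alpha> \<bullet> x)))
          = cmod (f x) * (exp (- c * norm x powr a) * w x / \<bar>\<alpha> \<bullet> x\<bar>)"
        unfolding norm_mult norm_of_real using w_nonneg[of x] by (simp add: abs_mult)
      also have "\<dots> \<le> (C * norm x ^ d) * (exp (- c * norm x powr a) * (\<bar>\<alpha> \<bullet> x\<bar> powr (2 * k \<alpha>) * (K * norm x powr (2 * \<kappa> - 2 * k \<alpha>))) / \<bar>\<alpha> \<bullet> x\<bar>)"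
        using C wb w_nonneg[of x] by (intro mult_mono divide_right_mono) auto
      also have "\<dots> = C * K * (\<bar>\<alpha> \<bullet> x\<bar> powr (2 * k \<alpha>) / \<bar>\<alpha> \<bullet> x\<bar>) * ((norm x powr real d * norm x powr (2 * \<kappa> - 2 * k \<alpha>)) * exp (- c * norm x powr a))"
        using nx by (simp add: powr_realpow mult_ac)
      also have "\<bar>\<alpha> \<bullet> x\<bar> powr (2 * k \<alpha>) / \<bar>\<alpha> \<bullet> x\<bar> = \<bar>\<alpha> \<bullet> x\<bar> powr (2 * k \<alpha> - 1)" using ax by (simp add: powr_diff)
      also have "norm x powr real d * norm x powr (2 * \<kappa> - 2 * k \<alpha>) = norm x powr e" by (simp add: e_def powr_add)
      also have "C * K * \<bar>\<alpha> \<bullet> x\<bar> powr (2 * k \<alpha> - 1) * (norm x powr e * exp (- c * norm x powr a))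
          \<le> C * K * \<bar>\<alpha> \<bullet> x\<bar> powr (2 * k \<alpha> - 1) * (C' * (1 + norm x) powr (- T))"
        using C K nx by (intro mult_left_mono C') auto
      finally show ?case using C(1) K C'(1) by (simp add: abs_mult mult_ac)
    qed
  qed
qed

end

section \<open>Antisymmetry of Dunkl operators and orthogonality\<close>

context dunkl_setting
begin

definition gauss :: "real \<Rightarrow> real^'n \<Rightarrow> real" where
  "gauss c x = exp (- c * norm x powr a)"

lemma gauss_reflection: "gauss c (reflection \<alpha> x) = gauss c x"
  by (simp add: gauss_def reflection_isometry)

lemma continuous_gauss: "continuous_on A (gauss c)"
  unfolding gauss_def using a_pos by (intro continuous_intros continuous_on_powr') auto

lemma abs_powr_derivative:
  assumes "u \<noteq> 0"
  shows "((\<lambda>t. \<bar>u + t * v\<bar> powr r) has_real_derivative r * v / u * \<bar>u\<bar> powr r) (at 0)"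
proof -
  have eq: "\<bar>z\<bar> powr r = (z\<^sup>2) powr (r / 2)" for z :: real
  proof (cases "z = 0")
    case False
    hence "z\<^sup>2 = \<bar>z\<bar> powr 2" by (simp add: powr_numeral)
    hence "(z\<^sup>2) powr (r / 2) = \<bar>z\<bar> powr (2 * (r / 2))" by (simp only: powr_powr)
    thus ?thesis by simp
  qed simp
  have "((\<lambda>t. (u + t * v)\<^sup>2) has_real_derivative 2 * u * v) (at 0)"
    by (auto intro!: derivative_eq_intros)
  moreover have "((\<lambda>s. s powr (r / 2)) has_real_derivative r / 2 * (u\<^sup>2) powr (r / 2 - 1)) (at ((u + 0 * v)\<^sup>2))"
    using has_real_derivative_powr[of "u\<^sup>2" "r / 2"] assms by simp
  ultimately have "((\<lambda>t. ((u + t * v)\<^sup>2) powr (r / 2)) has_real_derivative r / 2 * (u\<^sup>2) powr (r / 2 - 1) * (2 * u * v)) (at 0)"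
    by (rule DERIV_chain2[rotated])
  moreover have "r / 2 * (u\<^sup>2) powr (r / 2 - 1) * (2 * u * v) = r * v / u * \<bar>u\<bar> powr r"
  proof -
    have q: "(u\<^sup>2) powr (r / 2 - 1) = (u\<^sup>2) powr (r / 2) / u\<^sup>2" using assms by (simp add: powr_diff)
    show ?thesis using assms unfolding q eq[of u] by (simp add: power2_eq_square)
  qed
  ultimately show ?thesis unfolding eq by simp
qed

lemma w_derivative:
  assumes y: "\<And>\<alpha>. \<alpha> \<in> R \<Longrightarrow> \<alpha> \<bullet> y \<noteq> 0"
  shows "has_dir (\<lambda>x. complex_of_real (w x)) y \<xi> (complex_of_real ((\<Sum>\<alpha>\<in>R. k \<alpha> * (\<alpha> \<bullet> \<xi>) / (\<alpha> \<bullet> y)) * w y))"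
proof -
  define f where "f \<alpha> t = (if k \<alpha> = 0 then 1 else \<bar>\<alpha> \<bullet> y + t * (\<alpha> \<bullet> \<xi>)\<bar> powr k \<alpha>)" for \<alpha> and t :: real
  have df: "(f \<alpha> has_real_derivative k \<alpha> * (\<alpha> \<bullet> \<xi>) / (\<alpha> \<bullet> y) * f \<alpha> 0) (at 0)" if "\<alpha> \<in> R" for \<alpha>
    unfolding f_def using abs_powr_derivative[OF y[OF that]] by (cases "k \<alpha> = 0") auto
  have prodA: "((\<lambda>t. \<Prod>\<alpha>\<in>A. f \<alpha> t) has_real_derivative (\<Sum>\<alpha>\<in>A. k \<alpha> * (\<alpha> \<bullet> \<xi>) / (\<alpha> \<bullet> y)) * (\<Prod>\<alpha>\<in>A. f \<alpha> 0)) (at 0)"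
    if "A \<subseteq> R" for A
    using finite_subset[OF that finite_R] that
  proof (induction A)
    case (insert \<alpha> A)
    have "((\<lambda>t. f \<alpha> t * (\<Prod>\<alpha>\<in>A. f \<alpha> t)) has_real_derivative
        (k \<alpha> * (\<alpha> \<bullet> \<xi>) / (\<alpha> \<bullet> y) * f \<alpha> 0) * (\<Prod>\<alpha>\<in>A. f \<alpha> 0)
        + ((\<Sum>\<alpha>\<in>A. k \<alpha> * (\<alpha> \<bullet> \<xi>) / (\<alpha> \<bullet> y)) * (\<Prod>\<alpha>\<in>A. f \<alpha> 0)) * f \<alpha> 0) (at 0)"
      using insert by (intro DERIV_mult df) auto
    thus ?case using insert by (simp add: algebra_simps)
  qed simp
  have wf: "(\<Prod>\<alpha>\<in>R. f \<alpha> t) = w (y + t *\<^sub>R \<xi>)" for t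
    unfolding w_def f_def by (intro prod.cong refl) (simp only: inner_add_right inner_scaleR_right)
  have "((\<lambda>t. w (y + t *\<^sub>R \<xi>)) has_real_derivative (\<Sum>\<alpha>\<in>R. k \<alpha> * (\<alpha> \<bullet> \<xi>) / (\<alpha> \<bullet> y)) * w y) (at 0)"
    using prodA[OF order_refl] unfolding wf by simp
  hence "((\<lambda>t. w (y + t *\<^sub>R \<xi>)) has_vector_derivative (\<Sum>\<alpha>\<in>R. k \<alpha> * (\<alpha> \<bullet> \<xi>) / (\<alpha> \<bullet> y)) * w y) (at 0)"
    by (simp add: has_real_derivative_iff_has_vector_derivative)
  thus ?thesis unfolding has_dir_def
    by (rule bounded_linear.has_vector_derivative[OF bounded_linear_of_real])
qed

lemma gauss_derivative:
  assumes y: "y \<noteq> 0"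
  shows "has_dir (\<lambda>x. complex_of_real (gauss c x)) y \<xi> (complex_of_real (- c * a * norm y powr (a - 2) * (y \<bullet> \<xi>) * gauss c y))"
proof -
  define \<psi> where "\<psi> s = exp (- c * s powr (a / 2))" for s :: real
  have yy: "y \<bullet> y > 0" using y by simp
  have "(\<psi> has_real_derivative exp (- c * (y \<bullet> y) powr (a / 2)) * (- c * (a / 2 * (y \<bullet> y) powr (a / 2 - 1)))) (at (y \<bullet> y))"
    unfolding \<psi>_def by (intro DERIV_fun_exp DERIV_cmult has_real_derivative_powr yy)
  from has_dir_radial[OF this, of \<xi>]
  have hd: "has_dir (\<lambda>x. complex_of_real (\<psi> (x \<bullet> x))) y \<xi> (complex_of_real (2 * (y \<bullet> \<xi>) *
      (exp (- c * (y \<bullet> y) powr (a / 2)) * (- c * (a / 2 * (y \<bullet> y) powr (a / 2 - 1))))))" .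
  have F: "(\<lambda>x. complex_of_real (\<psi> (x \<bullet> x))) = (\<lambda>x. complex_of_real (gauss c x))"
    by (simp add: \<psi>_def gauss_def norm_powr_inner fun_eq_iff)
  have E: "2 * (y \<bullet> \<xi>) * (exp (- c * (y \<bullet> y) powr (a / 2)) * (- c * (a / 2 * (y \<bullet> y) powr (a / 2 - 1))))
      = - c * a * norm y powr (a - 2) * (y \<bullet> \<xi>) * gauss c y"
    by (simp add: gauss_def norm_powr_inner diff_divide_distrib)
  show ?thesis using hd unfolding F E .
qed

lemma has_dir_shift:
  assumes "has_dir G (x + s *\<^sub>R \<xi>) \<xi> d"
  shows "((\<lambda>s. G (x + s *\<^sub>R \<xi>)) has_vector_derivative d) (at s)"
proof -
  have "((\<lambda>t::real. t - s) has_vector_derivative 1) (at s)"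
    by (auto intro!: derivative_eq_intros)
  moreover have "((\<lambda>t. G (x + s *\<^sub>R \<xi> + t *\<^sub>R \<xi>)) has_vector_derivative d) (at (s - s))"
    using assms by (simp add: has_dir_def)
  ultimately have "((\<lambda>t. G (x + s *\<^sub>R \<xi> + t *\<^sub>R \<xi>)) \<circ> (\<lambda>t. t - s) has_vector_derivative 1 *\<^sub>R d) (at s)"
    by (rule vector_diff_chain_at)
  thus ?thesis by (simp add: o_def scaleR_diff_left)
qed

lemma integrable_gauss:
  assumes "hpoly d f" "c > 0"
  shows "integrable lborel (\<lambda>x. f x * complex_of_real (gauss c x * w x))"
proof -
  have "integrable lborel (\<lambda>x. f x * complex_of_real (norm x powr 0 * exp (- c * norm x powr a) * w x))"
    using kappa_nonneg by (intro integrable_weighted[OF assms]) (simp add: add_nonneg_pos)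
  moreover have "AE x in lborel. f x * complex_of_real (norm x powr 0 * exp (- c * norm x powr a) * w x) = f x * complex_of_real (gauss c x * w x)"
    using AE_lborel_nonzero by eventually_elim (simp add: gauss_def)
  moreover have "f \<in> borel_measurable borel" by (rule borel_measurable_continuous_onI[OF hpoly_continuous[OF assms(1)]])
  moreover have "gauss c \<in> borel_measurable borel" by (rule borel_measurable_continuous_onI[OF continuous_gauss])
  ultimately show ?thesis by (subst integrable_cong_AE[symmetric]) (auto intro: integrable_cong_AE_imp)
qed

lemma integrable_gauss_radial:
  assumes "hpoly d f" "c > 0" "real d + s + 2 * \<kappa> + real CARD('n) > 0"
  shows "integrable lborel (\<lambda>x. f x * complex_of_real (norm x powr s * gauss c x * w x))"
  using integrable_weighted[OF assms] by (simp add: gauss_def)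

lemma integrable_gauss_singular:
  assumes "hpoly d f" "c > 0" "\<alpha> \<in> R"
  shows "integrable lborel (\<lambda>x. complex_of_real (k \<alpha> * t) * (f x * complex_of_real (gauss c x * w x / (\<alpha> \<bullet> x))))"
proof (cases "k \<alpha> = 0")
  case False
  hence "k \<alpha> > 0" using k_nonneg[OF assms(3)] by simp
  thus ?thesis unfolding gauss_def by (intro integrable_mult_right integrable_weighted_singular[OF assms(1,2,3)])
qed simp

lemma finite_line_zeros:
  fixes u v :: "'b::real_vector"
  assumes "u \<noteq> 0" shows "finite {s::real. u + s *\<^sub>R v = 0}"
proof (cases "\<exists>s. u + s *\<^sub>R v = 0")
  case True
  then obtain s where s: "u + s *\<^sub>R v = 0" by blast
  have "t = s" if "u + t *\<^sub>R v = 0" for t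
  proof -
    have "(t - s) *\<^sub>R v = (u + t *\<^sub>R v) - (u + s *\<^sub>R v)" by (simp add: scaleR_diff_left)
    hence "(t - s) *\<^sub>R v = 0" using that s by simp
    moreover have "v \<noteq> 0" using s assms by auto
    ultimately show ?thesis by simp
  qed
  thus ?thesis using s by (metis (mono_tags, lifting) finite.simps finite_subset insertI1 mem_Collect_eq subsetI)
qed simp

text \<open>
  The divergence theorem for $p\,e^{-c\|x\|^a} w$ in direction $\xi$.  For almost every $x$ the line
  through $x$ in direction $\xi$ meets the root hyperplanes and the origin in finitely many points, and
  $w$ is continuous across them, so the fundamental theorem of calculus holds along it.
\<close>

lemma weighted_divergence:
  assumes p: "hpoly d p" and c: "c > 0"
  shows "(LINT x|lborel. dir_deriv \<xi> p x * complex_of_real (gauss c x * w x)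
      + complex_of_real (- c * a) * ((complex_of_real (\<xi> \<bullet> x) * p x) * complex_of_real (norm x powr (a - 2) * gauss c x * w x))
      + (\<Sum>\<alpha>\<in>R. complex_of_real (k \<alpha> * (\<alpha> \<bullet> \<xi>)) * (p x * complex_of_real (gauss c x * w x / (\<alpha> \<bullet> x))))) = 0"
    (is "(LINT x|lborel. ?H x) = 0")
proof (rule integral_directional_derivative_zero[where \<xi> = \<xi>])
  define G where "G x = p x * complex_of_real (gauss c x * w x)" for x
  show "integrable lborel G" unfolding G_def by (rule integrable_gauss[OF p c])
  have "integrable lborel (\<lambda>x. dir_deriv \<xi> p x * complex_of_real (gauss c x * w x))"
    using hpoly_dir_deriv_aux[OF p, of \<xi>] integrable_gauss[OF _ c] by (cases d) auto
  moreover have "integrable lborel (\<lambda>x. (complex_of_real (\<xi> \<bullet> x) * p x) * complex_of_real (norm x powr (a - 2) * gauss c x * w x))"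
    using index_pos by (intro integrable_gauss_radial[OF hpoly_linear_mult[OF p] c]) simp
  ultimately show "integrable lborel ?H"
    by (intro Bochner_Integration.integrable_add Bochner_Integration.integrable_sum integrable_mult_right integrable_gauss_singular[OF p c])
  show "AE x in lborel. \<exists>S. finite S \<and> continuous_on {0..1} (\<lambda>s. G (x + s *\<^sub>R \<xi>)) \<and>
      (\<forall>s\<in>{0<..<1} - S. ((\<lambda>s. G (x + s *\<^sub>R \<xi>)) has_vector_derivative ?H (x + s *\<^sub>R \<xi>)) (at s))"
    using AE_regular
  proof eventually_elim
    case (elim x)
    define S where "S = {s. x + s *\<^sub>R \<xi> = 0} \<union> (\<Union>\<alpha>\<in>R. {s. \<alpha> \<bullet> x + s *\<^sub>R (\<alpha> \<bullet> \<xi>) = 0})"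
    have "finite S" unfolding S_def using elim finite_R by (intro finite_UnI finite_UN_I finite_line_zeros) auto
    moreover have "continuous_on {0..1} (\<lambda>s. G (x + s *\<^sub>R \<xi>))"
    proof -
      have "continuous_on UNIV G" unfolding G_def
        by (intro continuous_intros hpoly_continuous[OF p] continuous_gauss continuous_w)
      thus ?thesis by (rule continuous_on_compose2) (auto intro!: continuous_intros)
    qed
    moreover have "((\<lambda>s. G (x + s *\<^sub>R \<xi>)) has_vector_derivative ?H (x + s *\<^sub>R \<xi>)) (at s)" if "s \<notin> S" for s
    proof (rule has_dir_shift)
      define y where "y = x + s *\<^sub>R \<xi>"
      have y: "y \<noteq> 0" "\<And>\<alpha>. \<alpha> \<in> R \<Longrightarrow> \<alpha> \<bullet> y \<noteq> 0"
        using that by (auto simp: S_def y_def inner_add_right)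
      have hd: "has_dir (\<lambda>x. p x * (complex_of_real (gauss c x) * complex_of_real (w x))) y \<xi>
          (p y * (complex_of_real (gauss c y) * complex_of_real ((\<Sum>\<alpha>\<in>R. k \<alpha> * (\<alpha> \<bullet> \<xi>) / (\<alpha> \<bullet> y)) * w y)
            + complex_of_real (- c * a * norm y powr (a - 2) * (y \<bullet> \<xi>) * gauss c y) * complex_of_real (w y))
          + dir_deriv \<xi> p y * (complex_of_real (gauss c y) * complex_of_real (w y)))"
        by (intro has_dir_mult dir_smoothD[OF hpoly_smooth[OF p]] gauss_derivative[OF y(1)] w_derivative[OF y(2)])
      have F: "(\<lambda>x. p x * (complex_of_real (gauss c x) * complex_of_real (w x))) = G"
        by (simp add: G_def fun_eq_iff)
      have E: "p y * (complex_of_real (gauss c y) * complex_of_real ((\<Sum>\<alpha>\<in>R. k \<alpha> * (\<alpha> \<bullet> \<xi>) / (\<alpha> \<bullet> y)) * w y)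
            + complex_of_real (- c * a * norm y powr (a - 2) * (y \<bullet> \<xi>) * gauss c y) * complex_of_real (w y))
          + dir_deriv \<xi> p y * (complex_of_real (gauss c y) * complex_of_real (w y)) = ?H y"
        by (simp add: algebra_simps inner_commute sum_distrib_left sum_distrib_right)
      show "has_dir G (x + s *\<^sub>R \<xi>) \<xi> (?H (x + s *\<^sub>R \<xi>))" using hd unfolding F E unfolding y_def .
    qed
    ultimately show ?case by blast
  qed
qed

lemma odd_integral_zero:
  fixes f :: "real^'n \<Rightarrow> complex"
  assumes f: "integrable lborel f" and odd: "\<And>x. f (reflection \<alpha> x) = - f x"
  shows "(LINT x|lborel. f x) = 0"
proof -
  have "(LINT x|lborel. f x) = (LINT x|lborel. f (reflection \<alpha> x))" by (rule integral_reflection(2)[OF f, symmetric])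
  also have "\<dots> = - (LINT x|lborel. f x)" by (simp add: odd)
  finally show ?thesis by simp
qed

text \<open>
  The difference quotients contribute $2pq/\langle\alpha,x\rangle$, which is the logarithmic
  derivative of the weight, minus a term that is odd under $r_\alpha$.
\<close>

lemma dunkl_antisymmetric:
  assumes p: "hpoly m p" and q: "hpoly n q" and c: "c > 0"
  shows "(LINT x|lborel. (dunkl_operator P k \<xi> p x * q x) * complex_of_real (gauss c x * w x)
      + (p x * dunkl_operator P k \<xi> q x) * complex_of_real (gauss c x * w x)
      + complex_of_real (- c * a) * ((complex_of_real (\<xi> \<bullet> x) * (p x * q x)) * complex_of_real (norm x powr (a - 2) * gauss c x * w x))) = 0"
    (is "(LINT x|lborel. ?L x) = 0")
proof -
  let ?H = "\<lambda>x. dir_deriv \<xi> (\<lambda>x. p x * q x) x * complex_of_real (gauss c x * w x)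
      + complex_of_real (- c * a) * ((complex_of_real (\<xi> \<bullet> x) * (p x * q x)) * complex_of_real (norm x powr (a - 2) * gauss c x * w x))
      + (\<Sum>\<alpha>\<in>R. complex_of_real (k \<alpha> * (\<alpha> \<bullet> \<xi>)) * ((p x * q x) * complex_of_real (gauss c x * w x / (\<alpha> \<bullet> x))))"
  define S where "S \<alpha> x = p (reflection \<alpha> x) * q x + p x * q (reflection \<alpha> x)" for \<alpha> x
  let ?O = "\<lambda>\<alpha> x. complex_of_real (k \<alpha> * (\<alpha> \<bullet> \<xi>)) * (S \<alpha> x * complex_of_real (gauss c x * w x / (\<alpha> \<bullet> x)))"
  have pq: "hpoly (m + n) (\<lambda>x. p x * q x)" by (rule hpoly_mult[OF p q])
  have H0: "(LINT x|lborel. ?H x) = 0" by (rule weighted_divergence[OF pq c])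
  have hS: "hpoly (m + n) (S \<alpha>)" for \<alpha>
    unfolding S_def by (intro hpoly.add hpoly_mult hpoly_reflection p q)
  have Oint: "integrable lborel (?O \<alpha>)" if "\<alpha> \<in> P" for \<alpha>
    using integrable_gauss_singular[OF hS c] that P_R by blast
  have O0: "(LINT x|lborel. ?O \<alpha> x) = 0" if "\<alpha> \<in> P" for \<alpha>
  proof (rule odd_integral_zero[OF Oint[OF that]])
    fix x
    have \<alpha>: "\<alpha> \<in> R" "\<alpha> \<noteq> 0" using that P_R zero_R by auto
    show "?O \<alpha> (reflection \<alpha> x) = - ?O \<alpha> x"
      unfolding S_def reflection_involution gauss_reflection w_reflection[OF \<alpha>(1)] inner_root_reflection[OF \<alpha>(2)]
      by (simp add: add.commute mult.commute)
  qed
  have hint: "integrable lborel (\<lambda>x. (dunkl_operator P k \<xi> p x * q x) * complex_of_real (gauss c x * w x))"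
    "integrable lborel (\<lambda>x. (p x * dunkl_operator P k \<xi> q x) * complex_of_real (gauss c x * w x))"
    by (rule integrable_gauss[OF hpoly_mult c]; rule hpoly_dunkl[OF zero_P] p q, (rule p q)?)+
  have rint: "integrable lborel (\<lambda>x. (complex_of_real (\<xi> \<bullet> x) * (p x * q x)) * complex_of_real (norm x powr (a - 2) * gauss c x * w x))"
    using index_pos by (intro integrable_gauss_radial[OF hpoly_linear_mult[OF pq] c]) simp
  have Lint: "integrable lborel ?L"
    by (intro Bochner_Integration.integrable_add integrable_mult_right hint rint)
  have "(LINT x|lborel. ?L x) = (LINT x|lborel. ?L x + (\<Sum>\<alpha>\<in>P. ?O \<alpha> x))"
    using Oint O0 by (subst Bochner_Integration.integral_add[OF Lint]) (auto simp: Bochner_Integration.integral_sum)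
  also have "\<dots> = (LINT x|lborel. ?H x)"
  proof (rule integral_cong_AE)
    show "AE x in lborel. ?L x + (\<Sum>\<alpha>\<in>P. ?O \<alpha> x) = ?H x"
      using AE_regular
    proof eventually_elim
      case (elim x)
      define g where "g = complex_of_real (gauss c x * w x)"
      have dd: "dir_deriv \<xi> (\<lambda>x. p x * q x) x = dir_deriv \<xi> p x * q x + p x * dir_deriv \<xi> q x"
        using has_dir_unique[OF has_dir_mult[OF dir_smoothD[OF hpoly_smooth[OF p]] dir_smoothD[OF hpoly_smooth[OF q]]]]
        by (simp add: add.commute)
      have "(\<Sum>\<alpha>\<in>R. complex_of_real (k \<alpha> * (\<alpha> \<bullet> \<xi>)) * ((p x * q x) * complex_of_real (gauss c x * w x / (\<alpha> \<bullet> x))))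
          = (\<Sum>\<alpha>\<in>P. complex_of_real (k \<alpha> * (\<alpha> \<bullet> \<xi>)) * (2 * (p x * q x) * (g / complex_of_real (\<alpha> \<bullet> x))))"
        unfolding sum_R using k_minus P_R by (intro sum.cong refl) (auto simp: g_def)
      moreover have "complex_of_real (k \<alpha> * (\<alpha> \<bullet> \<xi>)) * dunkl_quotient \<alpha> p x * q x * g
          + p x * (complex_of_real (k \<alpha> * (\<alpha> \<bullet> \<xi>)) * dunkl_quotient \<alpha> q x) * g + ?O \<alpha> x
          = complex_of_real (k \<alpha> * (\<alpha> \<bullet> \<xi>)) * (2 * (p x * q x) * (g / complex_of_real (\<alpha> \<bullet> x)))" if "\<alpha> \<in> P" for \<alpha>
      proof -
        have ax: "\<alpha> \<bullet> x \<noteq> 0" using elim that P_R by auto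
        show ?thesis
          using ax by (simp add: dunkl_quotient_def S_def g_def[symmetric] divide_simps del: of_real_mult)
            (simp add: g_def algebra_simps)
      qed
      hence "(\<Sum>\<alpha>\<in>P. complex_of_real (k \<alpha> * (\<alpha> \<bullet> \<xi>)) * dunkl_quotient \<alpha> p x * q x * g)
          + (\<Sum>\<alpha>\<in>P. p x * (complex_of_real (k \<alpha> * (\<alpha> \<bullet> \<xi>)) * dunkl_quotient \<alpha> q x) * g) + (\<Sum>\<alpha>\<in>P. ?O \<alpha> x)
          = (\<Sum>\<alpha>\<in>P. complex_of_real (k \<alpha> * (\<alpha> \<bullet> \<xi>)) * (2 * (p x * q x) * (g / complex_of_real (\<alpha> \<bullet> x))))"
        unfolding sum.distrib[symmetric] by (intro sum.cong refl)
      moreover have "dunkl_operator P k \<xi> p x * q x * g = dir_deriv \<xi> p x * q x * g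
          + (\<Sum>\<alpha>\<in>P. complex_of_real (k \<alpha> * (\<alpha> \<bullet> \<xi>)) * dunkl_quotient \<alpha> p x * q x * g)"
        unfolding dunkl_operator_def by (simp only: distrib_right sum_distrib_right)
      moreover have "p x * dunkl_operator P k \<xi> q x * g = p x * dir_deriv \<xi> q x * g
          + (\<Sum>\<alpha>\<in>P. p x * (complex_of_real (k \<alpha> * (\<alpha> \<bullet> \<xi>)) * dunkl_quotient \<alpha> q x) * g)"
        unfolding dunkl_operator_def by (simp only: distrib_left distrib_right sum_distrib_left sum_distrib_right)
      moreover have "(A1 + A) + (A2 + B) + rr + Os = (d1 + d2) * g + rr + RS"
        if "A + B + Os = C" "RS = C" "A1 = d1 * g" "A2 = d2 * g" for A1 A A2 B rr Os d1 d2 RS C :: complex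
        using that by (simp add: distrib_right flip: that(1))
      ultimately show ?case
        unfolding dd g_def[symmetric] by simp
    qed
    show "(\<lambda>x. ?L x + (\<Sum>\<alpha>\<in>P. ?O \<alpha> x)) \<in> borel_measurable lborel"
      using Lint Oint by (intro borel_measurable_add borel_measurable_sum borel_measurable_integrable) auto
    have "hpoly (m + n - 1) (dir_deriv \<xi> (\<lambda>x. p x * q x))"
      using hpoly_dir_deriv_aux[OF pq, of \<xi>] by (cases "m + n") (auto simp: hpoly_zero)
    from integrable_gauss[OF this c] have "integrable lborel (\<lambda>x. dir_deriv \<xi> (\<lambda>x. p x * q x) x * complex_of_real (gauss c x * w x))" .
    thus "?H \<in> borel_measurable lborel"
      by (rule borel_measurable_integrable[OF Bochner_Integration.integrable_add[OF Bochner_Integration.integrable_add]])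
        (rule integrable_mult_right[OF rint], rule Bochner_Integration.integrable_sum, rule integrable_gauss_singular[OF pq c])
  qed
  finally show ?thesis using H0 by simp
qed

text \<open>
  Green's formula.  By antisymmetry and Euler's identity, $\Delta_k p = 0$ evaluates
  $\int \sum_\xi T_\xi p\,T_\xi q\,e^{-c\|x\|^a}w$ as $ca\,(mI + Z)$, where $I$ is the integral in question
  and $Z$ collects the reflected products; $\Delta_k q = 0$ gives $ca\,(nI + Z)$ with the same $Z$.
\<close>

lemma harmonic_orthogonal:
  assumes p: "p \<in> harmonics P k m" and q: "q \<in> harmonics P k n" and c: "c > 0" and mn: "m \<noteq> n"
  shows "(LINT x|lborel. (p x * q x) * complex_of_real (norm x powr (a - 2) * gauss c x * w x)) = 0"
proof -
  let ?T = "dunkl_operator P k"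
  let ?g = "\<lambda>x. complex_of_real (gauss c x * w x)" and ?r = "\<lambda>x. complex_of_real (norm x powr (a - 2) * gauss c x * w x)"
  have rint: "integrable lborel (\<lambda>x. f x * ?r x)" if "hpoly d f" for d f
    using index_pos by (intro integrable_gauss_radial[OF that c]) simp
  have green: "(LINT x|lborel. (\<Sum>\<xi>\<in>Basis. (?T \<xi> p x * ?T \<xi> q x) * ?g x))
      = complex_of_real (c * a) * (of_nat m * (LINT x|lborel. (p x * q x) * ?r x)
        + (\<Sum>\<alpha>\<in>P. complex_of_real (k \<alpha>) * ((LINT x|lborel. (p x * q x) * ?r x) - (LINT x|lborel. (p (reflection \<alpha> x) * q x) * ?r x))))"
    if p: "p \<in> harmonics P k m" and q: "q \<in> harmonics P k n" for p q m n
  proof -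
    have hp: "hpoly m p" and hq: "hpoly n q" and lap: "\<And>x. dunkl_laplacian P k p x = 0"
      using p q by (auto simp: harmonics_iff)
    have hT: "hpoly (m - 1) (?T \<xi> p)" "hpoly (m - 1 - 1) (?T \<xi> (?T \<xi> p))" "hpoly (n - 1) (?T \<xi> q)" for \<xi>
      using hpoly_dunkl[OF zero_P] hp hq by blast+
    have i1: "integrable lborel (\<lambda>x. (?T \<xi> (?T \<xi> p) x * q x) * ?g x)" for \<xi>
      by (rule integrable_gauss[OF hpoly_mult[OF hT(2) hq] c])
    have i2: "integrable lborel (\<lambda>x. (?T \<xi> p x * ?T \<xi> q x) * ?g x)" for \<xi>
      by (rule integrable_gauss[OF hpoly_mult[OF hT(1,3)] c])
    have i3: "integrable lborel (\<lambda>x. (complex_of_real (\<xi> \<bullet> x) * (?T \<xi> p x * q x)) * ?r x)" for \<xi>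
      by (rule rint[OF hpoly_linear_mult[OF hpoly_mult[OF hT(1) hq]]])
    have each: "(LINT x|lborel. (?T \<xi> (?T \<xi> p) x * q x) * ?g x) + (LINT x|lborel. (?T \<xi> p x * ?T \<xi> q x) * ?g x)
        = complex_of_real (c * a) * (LINT x|lborel. (complex_of_real (\<xi> \<bullet> x) * (?T \<xi> p x * q x)) * ?r x)" for \<xi>
    proof -
      have "(LINT x|lborel. (?T \<xi> (?T \<xi> p) x * q x) * ?g x) + (LINT x|lborel. (?T \<xi> p x * ?T \<xi> q x) * ?g x)
          + complex_of_real (- c * a) * (LINT x|lborel. (complex_of_real (\<xi> \<bullet> x) * (?T \<xi> p x * q x)) * ?r x) = 0"
        using dunkl_antisymmetric[OF hT(1)[of \<xi>] hq c, of \<xi>]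
        unfolding Bochner_Integration.integral_add[OF Bochner_Integration.integrable_add[OF i1[of \<xi>] i2[of \<xi>]] integrable_mult_right[OF i3[of \<xi>]]]
          Bochner_Integration.integral_add[OF i1[of \<xi>] i2[of \<xi>]] integral_mult_right_zero .
      thus ?thesis by (simp add: add_eq_0_iff)
    qed
    have "(\<Sum>\<xi>\<in>Basis. (LINT x|lborel. (?T \<xi> (?T \<xi> p) x * q x) * ?g x)) = (LINT x|lborel. (\<Sum>\<xi>\<in>Basis. (?T \<xi> (?T \<xi> p) x * q x) * ?g x))"
      using i1 by (subst Bochner_Integration.integral_sum) auto
    also have "(\<lambda>x. \<Sum>\<xi>\<in>Basis. (?T \<xi> (?T \<xi> p) x * q x) * ?g x) = (\<lambda>x. dunkl_laplacian P k p x * q x * ?g x)"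
      by (simp only: dunkl_laplacian_def sum_distrib_right)
    finally have z: "(\<Sum>\<xi>\<in>Basis. (LINT x|lborel. (?T \<xi> (?T \<xi> p) x * q x) * ?g x)) = 0" by (simp add: lap)
    have "(LINT x|lborel. (\<Sum>\<xi>\<in>Basis. (?T \<xi> p x * ?T \<xi> q x) * ?g x)) = (\<Sum>\<xi>\<in>Basis. (LINT x|lborel. (?T \<xi> p x * ?T \<xi> q x) * ?g x))"
      using i2 by (subst Bochner_Integration.integral_sum) auto
    also have "\<dots> = (\<Sum>\<xi>\<in>Basis. (LINT x|lborel. (?T \<xi> (?T \<xi> p) x * q x) * ?g x) + (LINT x|lborel. (?T \<xi> p x * ?T \<xi> q x) * ?g x))"
      using z by (simp add: sum.distrib)
    also have "\<dots> = complex_of_real (c * a) * (\<Sum>\<xi>\<in>Basis. (LINT x|lborel. (complex_of_real (\<xi> \<bullet> x) * (?T \<xi> p x * q x)) * ?r x))"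
      unfolding each by (simp add: sum_distrib_left)
    also have "(\<Sum>\<xi>\<in>Basis. (LINT x|lborel. (complex_of_real (\<xi> \<bullet> x) * (?T \<xi> p x * q x)) * ?r x))
        = (LINT x|lborel. (\<Sum>\<xi>\<in>Basis. (complex_of_real (\<xi> \<bullet> x) * (?T \<xi> p x * q x)) * ?r x))"
      using i3 by (subst Bochner_Integration.integral_sum) auto
    also have "\<dots> = (LINT x|lborel. of_nat m * ((p x * q x) * ?r x)
        + (\<Sum>\<alpha>\<in>P. complex_of_real (k \<alpha>) * ((p x * q x) * ?r x - (p (reflection \<alpha> x) * q x) * ?r x)))"
    proof (rule Bochner_Integration.integral_cong[OF refl])
      fix x
      have "(\<Sum>\<xi>\<in>Basis. (complex_of_real (\<xi> \<bullet> x) * (?T \<xi> p x * q x)) * ?r x)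
          = (\<Sum>\<xi>\<in>Basis. complex_of_real (x \<bullet> \<xi>) * ?T \<xi> p x) * (q x * ?r x)"
        unfolding sum_distrib_right by (intro sum.cong refl) (simp only: inner_commute mult.assoc)
      thus "(\<Sum>\<xi>\<in>Basis. (complex_of_real (\<xi> \<bullet> x) * (?T \<xi> p x * q x)) * ?r x) = of_nat m * ((p x * q x) * ?r x)
        + (\<Sum>\<alpha>\<in>P. complex_of_real (k \<alpha>) * ((p x * q x) * ?r x - (p (reflection \<alpha> x) * q x) * ?r x))"
        unfolding dunkl_euler[OF hp]
        by (simp only: distrib_right sum_distrib_right left_diff_distrib right_diff_distrib mult.assoc)
    qed
    also have "\<dots> = of_nat m * (LINT x|lborel. (p x * q x) * ?r x)
        + (\<Sum>\<alpha>\<in>P. complex_of_real (k \<alpha>) * ((LINT x|lborel. (p x * q x) * ?r x) - (LINT x|lborel. (p (reflection \<alpha> x) * q x) * ?r x)))"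
      using rint[OF hpoly_mult[OF hp hq]] rint[OF hpoly_mult[OF hpoly_reflection[OF hp] hq]]
      by (simp only: Bochner_Integration.integral_add Bochner_Integration.integral_diff Bochner_Integration.integral_sum
        Bochner_Integration.integrable_add Bochner_Integration.integrable_diff Bochner_Integration.integrable_sum
        integrable_mult_right integral_mult_right_zero)
    finally show ?thesis .
  qed
  have refl_swap: "(LINT x|lborel. (q (reflection \<alpha> x) * p x) * ?r x) = (LINT x|lborel. (p (reflection \<alpha> x) * q x) * ?r x)"
    if "\<alpha> \<in> P" for \<alpha>
  proof -
    have \<alpha>: "\<alpha> \<in> R" using that P_R by auto
    have hp: "hpoly m p" and hq: "hpoly n q" using p q by (auto simp: harmonics_iff)
    have "(LINT x|lborel. (p (reflection \<alpha> x) * q x) * ?r x)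
        = (LINT x|lborel. (p (reflection \<alpha> (reflection \<alpha> x)) * q (reflection \<alpha> x)) * ?r (reflection \<alpha> x))"
      by (rule integral_reflection(2)[OF rint[OF hpoly_mult[OF hpoly_reflection[OF hp] hq]], symmetric])
    thus ?thesis by (simp only: reflection_involution gauss_reflection w_reflection[OF \<alpha>] reflection_isometry mult.commute)
  qed
  define I where "I = (LINT x|lborel. (p x * q x) * ?r x)"
  have I': "(LINT x|lborel. (q x * p x) * ?r x) = I" by (simp add: I_def mult.commute)
  have comm: "(\<lambda>x. \<Sum>\<xi>\<in>Basis. (?T \<xi> q x * ?T \<xi> p x) * ?g x) = (\<lambda>x. \<Sum>\<xi>\<in>Basis. (?T \<xi> p x * ?T \<xi> q x) * ?g x)"
    by (simp add: mult.commute)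
  define Z where "Z = (\<Sum>\<alpha>\<in>P. complex_of_real (k \<alpha>) * (I - (LINT x|lborel. (p (reflection \<alpha> x) * q x) * ?r x)))"
  have Z': "(\<Sum>\<alpha>\<in>P. complex_of_real (k \<alpha>) * (I - (LINT x|lborel. (q (reflection \<alpha> x) * p x) * ?r x))) = Z"
    unfolding Z_def by (intro sum.cong refl) (simp only: refl_swap)
  have "complex_of_real (c * a) * (of_nat m * I + Z) = complex_of_real (c * a) * (of_nat n * I + Z)"
    using green[OF p q, folded I_def, folded Z_def] green[OF q p, unfolded comm I' Z'] by (rule trans[OF sym])
  hence "of_nat m * I = of_nat n * I" using c a_pos by simp
  hence "I = 0" using mn by simp
  thus ?thesis by (simp add: I_def)
qed

text \<open>
  Apart from the exponential the integrand is homogeneous of degree $s + d + 2\langle k\rangle$, so the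
  generator of dilations multiplies it by that degree and takes a factor $-ca\|x\|^a$ from the
  exponential; the Jacobian adds $N$.
\<close>

lemma moment_recursion:
  assumes h: "hpoly d h" and c: "c > 0" and s: "s + real d + 2 * \<kappa> + real CARD('n) > 0"
  shows "complex_of_real (s + real d + 2 * \<kappa> + real CARD('n)) * (LINT x|lborel. h x * complex_of_real (norm x powr s * gauss c x * w x))
    = complex_of_real (c * a) * (LINT x|lborel. h x * complex_of_real (norm x powr (s + a) * gauss c x * w x))"
proof -
  define D where "D = s + real d + 2 * \<kappa> + real CARD('n)"
  define G where "G x = h x * complex_of_real (norm x powr s * gauss c x * w x)" for x
  define G' where "G' x = h x * complex_of_real (norm x powr (s + a) * gauss c x * w x)" for x
  have G: "integrable lborel G" unfolding G_def using s by (intro integrable_gauss_radial[OF h c]) simp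
  have G': "integrable lborel G'" unfolding G'_def using s a_pos by (intro integrable_gauss_radial[OF h c]) simp
  have "(LINT x|lborel. complex_of_real D * G x - complex_of_real (c * a) * G' x) = 0"
  proof (rule integral_dilation_derivative_zero[OF G])
    show "integrable lborel (\<lambda>x. complex_of_real D * G x - complex_of_real (c * a) * G' x)" using G G' by simp
    fix x :: "real^'n" and t :: real assume x: "x \<noteq> 0"
    \<comment> \<open>along a ray the integrand is $E(t)\,A$, the Jacobian $e^{Nt}$ included\<close>
    define A where "A = h x * complex_of_real (norm x powr s * w x)"
    define E where "E t = exp (D * t) * exp (- c * (exp (a * t) * norm x powr a))" for t
    have sc: "norm (exp t *\<^sub>R x) powr r = exp (r * t) * norm x powr r" for t r
      by (simp add: powr_mult exp_powr_real mult.commute)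
    have Gs: "complex_of_real (exp (real DIM(real^'n) * t)) * G (exp t *\<^sub>R x) = complex_of_real (E t) * A" for t
    proof -
      have wt: "w (exp t *\<^sub>R x) = exp (2 * \<kappa> * t) * w x" using w_scale[of "exp t" x] by (simp add: powr_def)
      have hs: "h (exp t *\<^sub>R x) = complex_of_real (exp (real d * t)) * h x"
        using hpoly_homogeneous[OF h, of "exp t" x] by (simp add: exp_of_nat_mult)
      have "exp (real DIM(real^'n) * t) * (exp (real d * t) * (exp (s * t) * exp (2 * \<kappa> * t))) = exp (D * t)"
        by (simp add: D_def algebra_simps flip: exp_add)
      hence "complex_of_real (exp (D * t)) = complex_of_real (exp (real DIM(real^'n) * t)) * (complex_of_real (exp (real d * t))
          * (complex_of_real (exp (s * t)) * complex_of_real (exp (2 * \<kappa> * t))))" by (simp only: of_real_mult[symmetric])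
      thus ?thesis unfolding G_def hs wt gauss_def sc A_def E_def
        by (simp only: of_real_mult mult_ac)
    qed
    have Gs': "complex_of_real (exp (real DIM(real^'n) * t)) * G' (exp t *\<^sub>R x) = complex_of_real (exp (a * t) * norm x powr a * E t) * A" for t
    proof -
      have "G' y = complex_of_real (norm y powr a) * G y" for y
        by (simp add: G_def G'_def powr_add)
      hence "complex_of_real (exp (real DIM(real^'n) * t)) * G' (exp t *\<^sub>R x)
          = complex_of_real (norm (exp t *\<^sub>R x) powr a) * (complex_of_real (exp (real DIM(real^'n) * t)) * G (exp t *\<^sub>R x))"
        by (simp only: mult_ac)
      thus ?thesis unfolding Gs sc by (simp only: of_real_mult mult_ac)
    qed
    have "(E has_real_derivative E t * (D - c * a * (exp (a * t) * norm x powr a))) (at t)"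
      unfolding E_def by (auto intro!: derivative_eq_intros simp: algebra_simps)
    hence "(E has_vector_derivative E t * (D - c * a * (exp (a * t) * norm x powr a))) (at t)"
      by (simp add: has_real_derivative_iff_has_vector_derivative)
    hence "((\<lambda>t. complex_of_real (E t)) has_vector_derivative complex_of_real (E t * (D - c * a * (exp (a * t) * norm x powr a)))) (at t)"
      by (rule bounded_linear.has_vector_derivative[OF bounded_linear_of_real])
    hence "((\<lambda>t. complex_of_real (E t) * A) has_vector_derivative complex_of_real (E t * (D - c * a * (exp (a * t) * norm x powr a))) * A) (at t)"
      by (rule has_vector_derivative_mult_left)
    moreover have "complex_of_real (E t * (D - c * a * (exp (a * t) * norm x powr a))) * A
        = complex_of_real (exp (real DIM(real^'n) * t)) * (complex_of_real D * G (exp t *\<^sub>R x) - complex_of_real (c * a) * G' (exp t *\<^sub>R x))"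
    proof -
      have "complex_of_real (exp (real DIM(real^'n) * t)) * (complex_of_real D * G (exp t *\<^sub>R x) - complex_of_real (c * a) * G' (exp t *\<^sub>R x))
          = complex_of_real D * (complex_of_real (E t) * A) - complex_of_real (c * a) * (complex_of_real (exp (a * t) * norm x powr a * E t) * A)"
        unfolding Gs[symmetric] Gs'[symmetric] by (simp add: algebra_simps)
      thus ?thesis by (simp add: algebra_simps)
    qed
    ultimately show "((\<lambda>s. complex_of_real (exp (real DIM(real^'n) * s)) * G (exp s *\<^sub>R x)) has_vector_derivative
        complex_of_real (exp (real DIM(real^'n) * t)) * (complex_of_real D * G (exp t *\<^sub>R x) - complex_of_real (c * a) * G' (exp t *\<^sub>R x))) (at t)"
      unfolding Gs by simp
  qed
  hence "complex_of_real D * (LINT x|lborel. G x) - complex_of_real (c * a) * (LINT x|lborel. G' x) = 0"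
    using G G' by simp
  thus ?thesis by (simp add: D_def G_def G'_def)
qed

end

section \<open>The eigenfunctions in $L^2$\<close>

lemma dir_deriv_cnj:
  assumes "dir_smooth f x"
  shows "dir_deriv \<xi> (\<lambda>x. cnj (f x)) x = cnj (dir_deriv \<xi> f x)"
proof (rule has_dir_unique)
  show "has_dir (\<lambda>x. cnj (f x)) x \<xi> (cnj (dir_deriv \<xi> f x))"
    using dir_smoothD[OF assms] unfolding has_dir_def by (rule has_vector_derivative_cnj)
qed

lemma dunkl_operator_cnj:
  assumes "dir_smooth f x"
  shows "dunkl_operator P k \<xi> (\<lambda>x. cnj (f x)) x = cnj (dunkl_operator P k \<xi> f x)"
proof -
  have "dunkl_quotient \<alpha> (\<lambda>x. cnj (f x)) x = cnj (dunkl_quotient \<alpha> f x)" for \<alpha>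
    by (simp add: dunkl_quotient_def dir_deriv_cnj[OF assms])
  thus ?thesis by (simp add: dunkl_operator_def dir_deriv_cnj[OF assms])
qed

lemma harmonics_cnj:
  assumes P: "0 \<notin> P" and p: "p \<in> harmonics P k m"
  shows "(\<lambda>x. cnj (p x)) \<in> harmonics P k m"
proof -
  have hp: "hpoly m p" and p0: "\<And>x. dunkl_laplacian P k p x = 0" using p by (auto simp: harmonics_iff)
  have "dunkl_operator P k \<xi> (\<lambda>x. cnj (p x)) = (\<lambda>x. cnj (dunkl_operator P k \<xi> p x))" for \<xi>
    using hpoly_smooth[OF hp] by (simp add: fun_eq_iff dunkl_operator_cnj)
  moreover have "dunkl_operator P k \<xi> (\<lambda>x. cnj (dunkl_operator P k \<xi> p x)) x = cnj (dunkl_operator P k \<xi> (dunkl_operator P k \<xi> p) x)" for \<xi> x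
    by (rule dunkl_operator_cnj[OF hpoly_smooth[OF hpoly_dunkl[OF P hp]]])
  ultimately have "dunkl_laplacian P k (\<lambda>x. cnj (p x)) x = cnj (dunkl_laplacian P k p x)" for x
    by (simp add: dunkl_laplacian_def)
  thus ?thesis using hpoly_cnj[OF hp] p0 by (simp add: harmonics_iff)
qed

lemma hpoly_measurable: "hpoly m p \<Longrightarrow> p \<in> borel_measurable borel"
  by (rule borel_measurable_continuous_onI[OF hpoly_continuous])

context dunkl_setting
begin

abbreviation "M \<equiv> theta_measure R k a"

lemma theta_measurable [measurable]: "theta R k a \<in> borel_measurable borel"
  unfolding theta_def[abs_def] by measurable

lemma theta_nonneg: "theta R k a x \<ge> 0"
  unfolding theta_def by (intro mult_nonneg_nonneg prod_nonneg) auto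

lemma sets_M [simp, measurable_cong]: "sets M = sets borel" and space_M [simp]: "space M = UNIV"
  by (simp_all add: theta_measure_def)

lemma measurable_M: "(f \<in> borel_measurable M) = (f \<in> borel_measurable borel)"
  using measurable_cong_sets[OF sets_M refl] by blast

lemma AE_M: "(AE x in M. Q x) \<longleftrightarrow> (AE x in lborel. Q x)"
proof -
  have "AE x in lborel. theta R k a x > 0"
    using theta_AE w_pos_AE AE_lborel_nonzero by eventually_elim simp
  hence "(AE x in lborel. 0 < theta R k a x \<longrightarrow> Q x) \<longleftrightarrow> (AE x in lborel. Q x)"
    by (intro iffI) (auto elim: eventually_elim2 eventually_mono)
  moreover have "(AE x in M. Q x) \<longleftrightarrow> (AE x in lborel. 0 < theta R k a x \<longrightarrow> Q x)"
    unfolding theta_measure_def by (subst AE_density) simp_all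
  ultimately show ?thesis by simp
qed

lemma integral_M:
  fixes f :: "real^'n \<Rightarrow> complex"
  assumes f[measurable]: "f \<in> borel_measurable borel"
  shows "integrable M f \<longleftrightarrow> integrable lborel (\<lambda>x. f x * complex_of_real (norm x powr (a - 2) * w x))"
    and "(LINT x|M. f x) = (LINT x|lborel. f x * complex_of_real (norm x powr (a - 2) * w x))"
proof -
  have ae: "AE x in lborel. theta R k a x *\<^sub>R f x = f x * complex_of_real (norm x powr (a - 2) * w x)"
    using theta_AE by eventually_elim (simp add: scaleR_conv_of_real)
  have "integrable M f \<longleftrightarrow> integrable lborel (\<lambda>x. theta R k a x *\<^sub>R f x)"
    unfolding theta_measure_def by (rule integrable_density) (auto simp: theta_nonneg)
  also have "\<dots> \<longleftrightarrow> integrable lborel (\<lambda>x. f x * complex_of_real (norm x powr (a - 2) * w x))"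
    by (rule integrable_cong_AE) (use ae in auto)
  finally show "integrable M f \<longleftrightarrow> integrable lborel (\<lambda>x. f x * complex_of_real (norm x powr (a - 2) * w x))" .
  have "(LINT x|M. f x) = (LINT x|lborel. theta R k a x *\<^sub>R f x)"
    unfolding theta_measure_def by (rule integral_density) (auto simp: theta_nonneg)
  also have "\<dots> = (LINT x|lborel. f x * complex_of_real (norm x powr (a - 2) * w x))"
    by (rule integral_cong_AE) (use ae in auto)
  finally show "(LINT x|M. f x) = (LINT x|lborel. f x * complex_of_real (norm x powr (a - 2) * w x))" .
qed

text \<open>
  The functions $h\,\|x\|^{aj}e^{-b\|x\|^a}$: for $b = \frac{1}{a}$ they span the same space as the
  $\Phi^{(a)}_\ell(h,\cdot)$, and products of two of them are again of this form.
\<close>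

definition gauss_moment :: "(real^'n \<Rightarrow> complex) \<Rightarrow> nat \<Rightarrow> real \<Rightarrow> real^'n \<Rightarrow> complex" where
  "gauss_moment h j b x = h x * complex_of_real ((norm x powr a) ^ j * exp (- b * norm x powr a))"

lemma gauss_moment_measurable: "hpoly d h \<Longrightarrow> gauss_moment h j b \<in> borel_measurable borel"
  unfolding gauss_moment_def[abs_def] using hpoly_measurable by measurable

lemma gauss_moment_weight_AE:
  "AE x in lborel. gauss_moment h j b x * complex_of_real (norm x powr (a - 2) * w x)
    = h x * complex_of_real (norm x powr (a - 2 + a * real j) * gauss b x * w x)"
  using AE_lborel_nonzero
proof eventually_elim
  case (elim x)
  have "(norm x powr a) ^ j = norm x powr (a * real j)" using elim by (simp add: powr_powr flip: powr_realpow)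
  thus ?case by (simp add: gauss_moment_def gauss_def powr_add mult_ac)
qed

lemma integrable_gauss_moment:
  assumes h: "hpoly d h" and b: "b > 0"
  shows "integrable M (gauss_moment h j b)"
    and "(LINT x|M. gauss_moment h j b x) = (LINT x|lborel. h x * complex_of_real (norm x powr (a - 2 + a * real j) * gauss b x * w x))"
proof -
  have aj: "a * real j \<ge> 0" using a_pos by simp
  have I: "integrable lborel (\<lambda>x. h x * complex_of_real (norm x powr (a - 2 + a * real j) * gauss b x * w x))"
    using index_pos aj by (intro integrable_gauss_radial[OF h b]) simp
  note [measurable] = gauss_moment_measurable[OF h, of j b]
  have m: "(\<lambda>x. gauss_moment h j b x * complex_of_real (norm x powr (a - 2) * w x)) \<in> borel_measurable lborel" by simp
  show "integrable M (gauss_moment h j b)"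
    unfolding integral_M(1)[OF gauss_moment_measurable[OF h]]
    by (rule integrable_cong_AE_imp[OF I m]) (use gauss_moment_weight_AE[of h j b] in \<open>eventually_elim, simp only:\<close>)
  show "(LINT x|M. gauss_moment h j b x) = (LINT x|lborel. h x * complex_of_real (norm x powr (a - 2 + a * real j) * gauss b x * w x))"
    unfolding integral_M(2)[OF gauss_moment_measurable[OF h]]
    by (rule integral_cong_AE[OF m _ gauss_moment_weight_AE]) (use I in simp)
qed

lemma gauss_moment_product:
  "gauss_moment h i b x * cnj (gauss_moment g j b' x) = gauss_moment (\<lambda>x. h x * cnj (g x)) (i + j) (b + b') x"
  by (simp add: gauss_moment_def power_add distrib_right exp_add exp_diff exp_minus field_simps)

lemma gauss_moment_L2:
  assumes h: "hpoly d h" and b: "b > 0"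
  shows "gauss_moment h j b \<in> sq_integrable M"
proof -
  have "integrable M (gauss_moment (\<lambda>x. h x * cnj (h x)) (j + j) (b + b))"
    using b by (intro integrable_gauss_moment(1)[OF hpoly_mult[OF h hpoly_cnj[OF h]]]) simp
  hence "integrable M (\<lambda>x. complex_of_real ((cmod (gauss_moment h j b x))\<^sup>2))"
    unfolding complex_norm_square gauss_moment_product .
  hence "integrable M (\<lambda>x. (cmod (gauss_moment h j b x))\<^sup>2)" using complex_of_real_integrable_eq by blast
  thus ?thesis using gauss_moment_measurable[OF h, of j b] by (simp add: sq_integrable_def measurable_M)
qed

lemma lambda_gt: "lambda_kam P k a m > -1"
  using index_pos a_pos by (simp add: lambda_kam_def field_simps)

lemma Phi_as_moments:
  "Phi P k a l m p x = (\<Sum>i\<le>l. complex_of_real (coeff (laguerre_poly l (lambda_kam P k a m)) i * (2 / a) ^ i) * gauss_moment p i (1 / a) x)"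
proof -
  have "laguerre l (lambda_kam P k a m) (2 / a * norm x powr a)
      = (\<Sum>i\<le>l. coeff (laguerre_poly l (lambda_kam P k a m)) i * (2 / a * norm x powr a) ^ i)"
    unfolding laguerre_eq_poly poly_altdef degree_laguerre_poly(2)[OF lambda_gt] ..
  thus ?thesis
    unfolding Phi_def gauss_moment_def of_real_sum sum_distrib_left sum_distrib_right
    by (simp only: of_real_sum sum_distrib_left sum_distrib_right power_mult_distrib of_real_mult of_real_power mult_minus_left mult_ac
      divide_inverse mult_1_left)
qed

lemma Phi_L2: "p \<in> harmonics P k m \<Longrightarrow> Phi P k a l m p \<in> sq_integrable M"
  unfolding Phi_as_moments[abs_def] using a_pos
  by (intro sq_integrable_sum sq_integrable_scale gauss_moment_L2[of m]) (auto simp: harmonics_iff)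

text \<open>
  Orthogonality in the angular variable comes from harmonic polynomials of different degree, in the
  radial variable from the moment recursion, which is that of the Laguerre weight.
\<close>

lemma Phi_orthogonal:
  assumes p: "p \<in> harmonics P k m" and q: "q \<in> harmonics P k n" and ne: "(l, m) \<noteq> (l', n)"
  shows "l2_inner M (Phi P k a l m p) (Phi P k a l' n q) = 0"
proof -
  have hp: "hpoly m p" and hq: "hpoly n q" using p q by (auto simp: harmonics_iff)
  define h where "h x = p x * cnj (q x)" for x
  have hh: "hpoly (m + n) h" unfolding h_def by (rule hpoly_mult[OF hp hpoly_cnj[OF hq]])
  define c where "c = 2 / a"
  have c: "c > 0" using a_pos by (simp add: c_def)
  have ca: "c * a = 2" using a_pos by (simp add: c_def)
  define mom where "mom j = (LINT x|M. gauss_moment h j c x)" for j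
  have mi: "integrable M (gauss_moment h j c)" for j by (rule integrable_gauss_moment(1)[OF hh c])
  define \<Lambda> where "\<Lambda> f = (LINT x|M. h x * complex_of_real (poly f (c * norm x powr a) * exp (- c * norm x powr a)))" for f
  have int: "integrable M (\<lambda>x. h x * complex_of_real (poly f (c * norm x powr a) * exp (- c * norm x powr a)))" for f
  proof -
    have "(\<lambda>x. h x * complex_of_real (poly f (c * norm x powr a) * exp (- c * norm x powr a)))
        = (\<lambda>x. \<Sum>i\<le>degree f. complex_of_real (coeff f i * c ^ i) * gauss_moment h i c x)"
      by (simp add: poly_altdef gauss_moment_def fun_eq_iff sum_distrib_left sum_distrib_right power_mult_distrib mult_ac)
    thus ?thesis using mi by (simp add: integrable_mult_right)
  qed
  \<comment> \<open>$\Lambda$ integrates polynomials in $\frac{2}{a}\|x\|^a$ against $p\bar q\,e^{-2\|x\|^a/a}$\<close>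
  have \<Lambda>_add: "\<Lambda> (f + g) = \<Lambda> f + \<Lambda> g" for f g
    unfolding \<Lambda>_def using int[of f] int[of g]
    by (simp add: distrib_left distrib_right)
  have \<Lambda>_smult: "\<Lambda> (smult t f) = complex_of_real t * \<Lambda> f" for t f
    unfolding \<Lambda>_def by (subst integral_mult_right_zero[symmetric]) (simp add: mult_ac)
  have \<Lambda>_monom: "\<Lambda> (monom 1 j) = complex_of_real (c ^ j) * mom j" for j
    unfolding \<Lambda>_def mom_def
    by (subst integral_mult_right_zero[symmetric]) (simp add: poly_monom gauss_moment_def power_mult_distrib mult_ac)
  have rec: "complex_of_real (a - 2 + a * real j + real (m + n) + 2 * \<kappa> + real CARD('n)) * mom j = 2 * mom (Suc j)" for j
  proof -
    have aj: "a * real j \<ge> 0" using a_pos by simp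
    have s: "a - 2 + a * real j + a = a - 2 + a * real (Suc j)" by (simp add: algebra_simps)
    have "a - 2 + a * real j + real (m + n) + 2 * \<kappa> + real CARD('n) > 0" using index_pos aj by simp
    from moment_recursion[OF hh c this] show ?thesis
      unfolding mom_def integrable_gauss_moment(2)[OF hh c] s ca by simp
  qed
  have "l2_inner M (Phi P k a l m p) (Phi P k a l' n q)
      = \<Lambda> (laguerre_poly l (lambda_kam P k a m) * laguerre_poly l' (lambda_kam P k a n))"
    unfolding l2_inner_def \<Lambda>_def
  proof (rule Bochner_Integration.integral_cong[OF refl])
    fix x :: "real^'n"
    have e: "exp (- c * norm x powr a) = exp (- (1 / a) * norm x powr a) * exp (- (1 / a) * norm x powr a)"
      by (simp add: c_def flip: exp_add)
    show "Phi P k a l m p x * cnj (Phi P k a l' n q x) = h x * complex_of_real (poly (laguerre_poly l (lambda_kam P k a m)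
        * laguerre_poly l' (lambda_kam P k a n)) (c * norm x powr a) * exp (- c * norm x powr a))"
      unfolding e by (simp add: Phi_def h_def laguerre_eq_poly c_def mult_ac)
  qed
  also have "\<dots> = 0"
  proof (cases "m = n")
    case True
    hence ll: "l \<noteq> l'" using ne by simp
    \<comment> \<open>$2/a$ in the exponent and $\frac{2}{a}\|x\|^a$ as variable turn the dilation recursion into Laguerre's\<close>
    have "\<Lambda> (monom 1 (Suc j)) = complex_of_real (lambda_kam P k a m + 1 + real j) * \<Lambda> (monom 1 j)" for j
    proof -
      have "a - 2 + a * real j + real (m + n) + 2 * \<kappa> + real CARD('n) = a * (lambda_kam P k a m + 1 + real j)"
        using a_pos True by (simp add: lambda_kam_def field_simps)
      hence "complex_of_real a * (complex_of_real (lambda_kam P k a m + 1 + real j) * mom j)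
          = complex_of_real (c * a) * mom (Suc j)"
        using rec[of j] unfolding ca by (simp only: of_real_mult mult.assoc of_real_numeral)
      hence "complex_of_real a * (complex_of_real (lambda_kam P k a m + 1 + real j) * mom j)
          = complex_of_real a * (complex_of_real c * mom (Suc j))"
        by (simp only: of_real_mult mult_ac)
      hence "complex_of_real (lambda_kam P k a m + 1 + real j) * mom j = complex_of_real c * mom (Suc j)"
        using a_pos by (simp only: mult_cancel_left of_real_eq_0_iff) simp
      thus ?thesis by (simp add: \<Lambda>_monom mult_ac)
    qed
    from laguerre_orthogonal[OF lambda_gt \<Lambda>_add \<Lambda>_smult this ll] show ?thesis using True by simp
  next
    case False
    have "mom j = 0" for j
    proof (induction j)
      case 0
      have "(LINT x|lborel. (p x * cnj (q x)) * complex_of_real (norm x powr (a - 2) * gauss c x * w x)) = 0"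
        by (rule harmonic_orthogonal[OF p harmonics_cnj[OF zero_P q] c False])
      thus ?case unfolding mom_def integrable_gauss_moment(2)[OF hh c] by (simp add: h_def)
    next
      case (Suc j)
      thus ?case using rec[of j] by simp
    qed
    hence \<Lambda>0: "\<Lambda> (monom 1 j) = 0" for j by (simp add: \<Lambda>_monom)
    have "\<Lambda> (\<Sum>i\<in>A. smult (coeff f i) (monom 1 i)) = 0" if "finite A" for A f
      using that
    proof (induction A)
      case empty
      show ?case using \<Lambda>_smult[of 0 0] by simp
    next
      case (insert i A)
      have "\<Lambda> (smult (coeff f i) (monom 1 i)) = 0" by (simp only: \<Lambda>_smult \<Lambda>0 mult_zero_right)
      thus ?case unfolding sum.insert[OF insert.hyps] \<Lambda>_add insert.IH by simp
    qed
    from this[of "{..degree f}" f for f] show ?thesis by (simp add: smult_monom poly_as_sum_of_monoms)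
  qed
  finally show ?thesis .
qed

section \<open>Completeness of the eigenfunctions\<close>

text \<open>
  Leading coefficients of Laguerre polynomials do not vanish, so orthogonality to all
  $\Phi^{(a)}_\ell(h, \cdot)$ is orthogonality to all $h\,\|x\|^{aj} e^{-\|x\|^a/a}$.
\<close>

lemma orthogonal_to_moments:
  assumes f: "f \<in> sq_integrable M" and h: "h \<in> harmonics P k m"
    and orth: "\<And>l. l2_inner M f (Phi P k a l m h) = 0"
  shows "l2_inner M f (gauss_moment h j (1 / a)) = 0"
proof (induction j rule: less_induct)
  case (less j)
  have hp: "hpoly m h" using h by (simp add: harmonics_iff)
  have b: "1 / a > 0" using a_pos by simp
  let ?c = "\<lambda>i. complex_of_real (coeff (laguerre_poly j (lambda_kam P k a m)) i * (2 / a) ^ i)"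
  have "0 = l2_inner M f (\<lambda>x. \<Sum>i\<le>j. ?c i * gauss_moment h i (1 / a) x)"
    using orth[of j] unfolding Phi_as_moments[abs_def] by simp
  also have "\<dots> = (\<Sum>i\<le>j. cnj (?c i) * l2_inner M f (gauss_moment h i (1 / a)))"
    using f gauss_moment_L2[OF hp b]
    by (subst l2_inner_sum_right) (auto simp: l2_inner_scale_right intro: sq_integrable_scale)
  also have "\<dots> = cnj (?c j) * l2_inner M f (gauss_moment h j (1 / a))"
    by (subst sum.remove[of _ j]) (auto simp: less intro!: sum.neutral)
  finally show ?case using degree_laguerre_poly(1)[OF lambda_gt, of j m] a_pos by simp
qed

text \<open>
  Expanding $e^{-\delta\|x\|^a}$ with $\delta = \frac{1}{2a}$ into its power series moves the exponent $b$ up to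
  $b + \delta$.  The partial sums are bounded by $e^{\delta\|x\|^a}$, which $e^{-b\|x\|^a}$ absorbs since
  $b \ge \frac{1}{a} > \delta$.
\<close>

lemma orthogonal_to_exponentials:
  assumes f: "f \<in> sq_integrable M" and h: "hpoly m h"
    and orth: "\<And>j. l2_inner M f (gauss_moment h j (1 / a)) = 0"
  shows "l2_inner M f (gauss_moment h j (1 / a + real n / (2 * a))) = 0"
proof (induction n arbitrary: j)
  case 0
  show ?case using orth by simp
next
  case (Suc n)
  define b where "b = 1 / a + real n / (2 * a)"
  define \<delta> where "\<delta> = 1 / (2 * a)"
  have \<delta>: "\<delta> > 0" using a_pos by (simp add: \<delta>_def)
  have b\<delta>: "b - \<delta> > 0"
  proof -
    have "b - \<delta> = \<delta> + real n / (2 * a)" using a_pos by (simp add: b_def \<delta>_def field_simps)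
    thus ?thesis using \<delta> a_pos by (simp add: add_pos_nonneg)
  qed
  hence b: "b > 0" using \<delta> by simp
  have bS: "1 / a + real (Suc n) / (2 * a) = b + \<delta>" using a_pos by (simp add: b_def \<delta>_def field_simps)
  have fm: "f \<in> borel_measurable borel" using f by (simp add: sq_integrable_def measurable_M)
  define s where "s N x = (\<Sum>r<N. complex_of_real ((- \<delta>) ^ r / fact r) * (f x * cnj (gauss_moment h (j + r) b x)))" for N x
  have sx: "s N x = f x * cnj (gauss_moment h j b x) * complex_of_real (\<Sum>r<N. (- (\<delta> * norm x powr a)) ^ r / fact r)" for N x
    unfolding s_def of_real_sum sum_distrib_left
    by (intro sum.cong refl) (simp add: gauss_moment_def power_add power_mult_distrib power_minus[of "\<delta> * _"] power_minus[of \<delta>] mult_ac)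
  have "(\<lambda>N. LINT x|M. s N x) \<longlonglongrightarrow> (LINT x|M. f x * cnj (gauss_moment h j (b + \<delta>) x))"
  proof (rule integral_dominated_convergence[where w = "\<lambda>x. cmod (f x * cnj (gauss_moment h j (b - \<delta>) x))"])
    show "integrable M (\<lambda>x. cmod (f x * cnj (gauss_moment h j (b - \<delta>) x)))"
      by (intro integrable_norm integrable_l2_product f gauss_moment_L2[OF h b\<delta>])
    show "(\<lambda>x. f x * cnj (gauss_moment h j (b + \<delta>) x)) \<in> borel_measurable M"
      using fm gauss_moment_measurable[OF h] unfolding measurable_M by measurable
    show "s N \<in> borel_measurable M" for N
      unfolding s_def[abs_def] using fm gauss_moment_measurable[OF h] unfolding measurable_M by measurable
    show "AE x in M. (\<lambda>N. s N x) \<longlonglongrightarrow> f x * cnj (gauss_moment h j (b + \<delta>) x)"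
    proof (rule AE_I2)
      fix x :: "real^'n"
      have "(\<lambda>r. (- (\<delta> * norm x powr a)) ^ r / fact r) sums exp (- (\<delta> * norm x powr a))"
        using exp_converges[of "- (\<delta> * norm x powr a)"] by (simp add: divide_inverse mult.commute)
      hence "(\<lambda>N. s N x) \<longlonglongrightarrow> f x * cnj (gauss_moment h j b x) * complex_of_real (exp (- (\<delta> * norm x powr a)))"
        unfolding sx sums_def by (intro tendsto_intros)
      moreover have "cnj (gauss_moment h j b x) * complex_of_real (exp (- (\<delta> * norm x powr a))) = cnj (gauss_moment h j (b + \<delta>) x)"
        by (simp add: gauss_moment_def distrib_right exp_add exp_diff exp_minus field_simps)
      ultimately show "(\<lambda>N. s N x) \<longlonglongrightarrow> f x * cnj (gauss_moment h j (b + \<delta>) x)" by (simp add: mult.assoc)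
    qed
    show "AE x in M. norm (s N x) \<le> cmod (f x * cnj (gauss_moment h j (b - \<delta>) x))" for N
    proof (rule AE_I2)
      fix x :: "real^'n"
      define t where "t = \<delta> * norm x powr a"
      have t: "t \<ge> 0" using \<delta> by (simp add: t_def)
      have "\<bar>\<Sum>r<N. (- t) ^ r / fact r\<bar> \<le> (\<Sum>r<N. \<bar>(- t) ^ r / fact r\<bar>)" by (rule sum_abs)
      also have "\<dots> = (\<Sum>r<N. t ^ r /\<^sub>R fact r)" using t by (intro sum.cong) (simp_all add: abs_mult power_abs divide_inverse mult.commute)
      also have "\<dots> \<le> exp t" unfolding exp_def using t by (intro sum_le_suminf summable_exp_generic) auto
      finally have le: "\<bar>\<Sum>r<N. (- t) ^ r / fact r\<bar> \<le> exp t" .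
      have "norm (s N x) = cmod (f x * cnj (gauss_moment h j b x)) * \<bar>\<Sum>r<N. (- t) ^ r / fact r\<bar>"
        unfolding sx t_def norm_mult norm_of_real ..
      also have "\<dots> \<le> cmod (f x * cnj (gauss_moment h j b x)) * exp t" using le by (intro mult_left_mono) auto
      also have "\<dots> = cmod (f x) * (cmod (gauss_moment h j b x * complex_of_real (exp t)))" by (simp add: norm_mult)
      also have "gauss_moment h j b x * complex_of_real (exp t) = gauss_moment h j (b - \<delta>) x"
        by (simp add: gauss_moment_def t_def left_diff_distrib exp_add exp_diff exp_minus field_simps)
      finally show "norm (s N x) \<le> cmod (f x * cnj (gauss_moment h j (b - \<delta>) x))" by (simp add: norm_mult)
    qed
  qed
  moreover have "(LINT x|M. s N x) = 0" for N
  proof -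
    have "(LINT x|M. s N x) = (\<Sum>r<N. complex_of_real ((- \<delta>) ^ r / fact r) * l2_inner M f (gauss_moment h (j + r) b))"
      unfolding s_def l2_inner_def using integrable_l2_product[OF f gauss_moment_L2[OF h b]]
      by (subst Bochner_Integration.integral_sum) auto
    thus ?thesis using Suc.IH by (simp add: b_def)
  qed
  ultimately have "(LINT x|M. f x * cnj (gauss_moment h j (b + \<delta>) x)) = 0" by (simp add: LIMSEQ_const_iff)
  thus ?case unfolding bS l2_inner_def .
qed

definition cutoff :: "(real \<Rightarrow> real) \<Rightarrow> bool" where
  "cutoff F \<longleftrightarrow> continuous_on UNIV F \<and> (\<exists>r0>0. \<forall>r\<ge>r0. F r = 0)"

lemma cutoff_mult: "cutoff F \<Longrightarrow> continuous_on UNIV G \<Longrightarrow> cutoff (\<lambda>r. G r * F r)"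
  unfolding cutoff_def by (auto intro!: continuous_on_mult)

lemma cutoff_measurable: "cutoff F \<Longrightarrow> F \<in> borel_measurable borel"
  unfolding cutoff_def by (intro borel_measurable_continuous_onI) auto

text \<open>
  In the variable $u = e^{-\|x\|^a/(2a)}$ a radial function of bounded support is $e^{-\|x\|^a/a}$
  times a continuous function $G(u)$ on $[0,1]$, which vanishes near $0$.
\<close>

lemma cutoff_substitution:
  assumes F: "cutoff F"
  obtains G :: "real \<Rightarrow> real" where "continuous_on {0..1} G"
    "\<And>r. r \<ge> 0 \<Longrightarrow> F r = exp (- (1 / a) * r powr a) * G (exp (- (r powr a) / (2 * a)))"
proof -
  obtain r0 where r0: "r0 > 0" "\<And>r. r \<ge> r0 \<Longrightarrow> F r = 0" and Fc: "continuous_on UNIV F" using F by (auto simp: cutoff_def)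
  \<comment> \<open>$\rho$ inverts $r \mapsto u$, and $u \le u_0$ corresponds to $r \ge r_0$, where $F$ vanishes\<close>
  define \<rho> where "\<rho> u = (- (2 * a) * ln u) powr (1 / a)" for u :: real
  define u0 where "u0 = exp (- (r0 powr a) / (2 * a))"
  have u0: "0 < u0" "u0 < 1" using r0 a_pos by (auto simp: u0_def)
  define G where "G u = (if u \<le> u0 then 0 else F (\<rho> u) / u\<^sup>2)" for u :: real
  have \<rho>_exp: "\<rho> (exp (- (r powr a) / (2 * a))) = r" if "r \<ge> 0" for r
    using that a_pos by (simp add: \<rho>_def powr_powr)
  have big: "F (\<rho> u) = 0" if "0 < u" "u \<le> u0" for u
  proof (rule r0(2))
    have "ln u \<le> - (r0 powr a) / (2 * a)" using that u0(1) ln_le_cancel_iff[of u u0] by (simp add: u0_def)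
    hence "r0 powr a \<le> - (2 * a) * ln u" using a_pos by (simp add: field_simps)
    hence "(r0 powr a) powr (1 / a) \<le> \<rho> u" unfolding \<rho>_def using a_pos by (intro powr_mono2) auto
    thus "r0 \<le> \<rho> u" using r0(1) a_pos by (simp add: powr_powr)
  qed
  have "continuous_on ({0..u0} \<union> {u0..1}) (\<lambda>u. if u \<le> u0 then 0 else F (\<rho> u) / u\<^sup>2)"
  proof (rule continuous_on_If)
    have "continuous_on {u0..1} \<rho>" unfolding \<rho>_def using u0 a_pos
      by (intro continuous_on_powr' continuous_intros) (auto simp: mult_nonneg_nonpos mult_nonpos_nonpos)
    hence "continuous_on {u0..1} (\<lambda>u. F (\<rho> u))"
      using continuous_on_compose2[OF Fc] by blast
    thus "continuous_on {u0..1} (\<lambda>u. F (\<rho> u) / u\<^sup>2)" using u0 by (intro continuous_intros) auto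
  qed (use u0 big[of u0] in auto)
  moreover have "{0..u0} \<union> {u0..1} = {0..1}" using u0 by auto
  ultimately have "continuous_on {0..1} G" by (simp add: G_def[abs_def])
  moreover have "F r = exp (- (1 / a) * r powr a) * G (exp (- (r powr a) / (2 * a)))" if r: "r \<ge> 0" for r
  proof (cases "exp (- (r powr a) / (2 * a)) \<le> u0")
    case True
    hence "F r = 0" using big[of "exp (- (r powr a) / (2 * a))"] \<rho>_exp[OF r] by simp
    thus ?thesis using True by (simp add: G_def)
  next
    case False
    have "(exp (- (r powr a) / (2 * a)))\<^sup>2 = exp (- (1 / a) * r powr a)"
      using a_pos by (simp add: power2_eq_square flip: exp_add)
    thus ?thesis using False \<rho>_exp[OF r] by (simp add: G_def)
  qed
  ultimately show ?thesis using that by blast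
qed

lemma integrable_cutoff:
  assumes f: "f \<in> sq_integrable M" and h: "hpoly m h" and F: "cutoff F"
  shows "integrable M (\<lambda>x. f x * cnj (h x) * complex_of_real (F (norm x)))"
proof -
  obtain G where G: "continuous_on {0..1} G"
    "\<And>r. r \<ge> 0 \<Longrightarrow> F r = exp (- (1 / a) * r powr a) * G (exp (- (r powr a) / (2 * a)))"
    using cutoff_substitution[OF F] by blast
  have "bounded (G ` {0..1})" using G(1) by (intro compact_imp_bounded compact_continuous_image) auto
  then obtain B where B: "\<And>u. u \<in> {0..1} \<Longrightarrow> \<bar>G u\<bar> \<le> B" by (force simp: bounded_iff)
  have b: "1 / a > 0" using a_pos by simp
  have "integrable M (\<lambda>x. complex_of_real B * (f x * cnj (gauss_moment h 0 (1 / a) x)))"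
    by (intro integrable_mult_right integrable_l2_product f gauss_moment_L2[OF h b])
  thus ?thesis
  proof (rule Bochner_Integration.integrable_bound)
    have [measurable]: "f \<in> borel_measurable borel" using f by (simp add: sq_integrable_def measurable_M)
    note [measurable] = hpoly_measurable[OF h] cutoff_measurable[OF F]
    show "(\<lambda>x. f x * cnj (h x) * complex_of_real (F (norm x))) \<in> borel_measurable M"
      unfolding measurable_M by measurable
    show "AE x in M. norm (f x * cnj (h x) * complex_of_real (F (norm x))) \<le> norm (complex_of_real B * (f x * cnj (gauss_moment h 0 (1 / a) x)))"
    proof (rule AE_I2)
      fix x :: "real^'n"
      have "\<bar>F (norm x)\<bar> = exp (- (1 / a) * norm x powr a) * \<bar>G (exp (- (norm x powr a) / (2 * a)))\<bar>"
        using G(2)[of "norm x"] by (simp add: abs_mult)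
      also have "\<dots> \<le> exp (- (1 / a) * norm x powr a) * B" using a_pos by (intro mult_left_mono B) auto
      also have "\<dots> \<le> exp (- (1 / a) * norm x powr a) * \<bar>B\<bar>" by (intro mult_left_mono) auto
      finally have "cmod (f x) * cmod (h x) * \<bar>F (norm x)\<bar> \<le> cmod (f x) * cmod (h x) * (exp (- (1 / a) * norm x powr a) * \<bar>B\<bar>)"
        by (intro mult_left_mono) auto
      thus "norm (f x * cnj (h x) * complex_of_real (F (norm x))) \<le> norm (complex_of_real B * (f x * cnj (gauss_moment h 0 (1 / a) x)))"
        by (simp add: norm_mult gauss_moment_def mult_ac)
    qed
  qed
qed

text \<open>
  By Weierstrass $G(u)$ is a uniform limit of polynomials in $u$, and $u^i e^{-\|x\|^a/a}$ is the
  exponential with $\frac{1}{a} + \frac{i}{2a}$ in place of $\frac{1}{a}$.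
\<close>

lemma orthogonal_to_cutoffs:
  assumes f: "f \<in> sq_integrable M" and h: "hpoly m h"
    and orth: "\<And>n. l2_inner M f (gauss_moment h 0 (1 / a + real n / (2 * a))) = 0" and F: "cutoff F"
  shows "(LINT x|M. f x * cnj (h x) * complex_of_real (F (norm x))) = 0"
proof -
  obtain G where G: "continuous_on {0..1} G"
    "\<And>r. r \<ge> 0 \<Longrightarrow> F r = exp (- (1 / a) * r powr a) * G (exp (- (r powr a) / (2 * a)))"
    using cutoff_substitution[OF F] by blast
  let ?g = "\<lambda>x. f x * cnj (gauss_moment h 0 (1 / a) x)"
  define u where "u x = exp (- (norm x powr a) / (2 * a))" for x :: "real^'n"
  have u01: "u x \<in> {0..1}" for x using a_pos by (simp add: u_def)
  have pos: "1 / a + real i / (2 * a) > 0" for i using a_pos by (intro add_pos_nonneg) auto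
  have b: "1 / a > 0" using a_pos by simp
  have gi: "integrable M ?g" by (intro integrable_l2_product f gauss_moment_L2[OF h b])
  have fF: "f x * cnj (h x) * complex_of_real (F (norm x)) = ?g x * complex_of_real (G (u x))" for x
    using G(2)[of "norm x"] by (simp add: gauss_moment_def u_def mult_ac)
  have fFi: "integrable M (\<lambda>x. ?g x * complex_of_real (G (u x)))"
    using integrable_cutoff[OF f h F] unfolding fF .
  define J where "J = (LINT x|M. cmod (?g x))"
  have J: "J \<ge> 0" by (simp add: J_def)
  have "cmod (LINT x|M. ?g x * complex_of_real (G (u x))) \<le> \<epsilon> * J" if \<epsilon>: "\<epsilon> > 0" for \<epsilon>
  proof -
    obtain Q where Q: "real_polynomial_function Q" "\<And>v. v \<in> {0..1} \<Longrightarrow> \<bar>G v - Q v\<bar> < \<epsilon>"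
      using Stone_Weierstrass_real_polynomial_function[OF compact_Icc G(1) \<epsilon>] by blast
    obtain q n where q: "Q = (\<lambda>v. \<Sum>i\<le>n. q i * v ^ i)" using Q(1) unfolding real_polynomial_function_iff_sum by blast
    have Qg: "?g x * complex_of_real (Q (u x)) = (\<Sum>i\<le>n. complex_of_real (q i) * (f x * cnj (gauss_moment h 0 (1 / a + real i / (2 * a)) x)))" for x
    proof -
      have "u x ^ i = exp (- (real i / (2 * a)) * norm x powr a)" for i
        by (simp add: u_def exp_of_nat_mult[symmetric])
      hence "exp (- (1 / a) * norm x powr a) * u x ^ i = exp (- (1 / a + real i / (2 * a)) * norm x powr a)" for i
        by (simp add: exp_add[symmetric] algebra_simps)
      hence "cnj (gauss_moment h 0 (1 / a) x) * complex_of_real (u x ^ i) = cnj (gauss_moment h 0 (1 / a + real i / (2 * a)) x)" for i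
        unfolding gauss_moment_def complex_cnj_mult complex_cnj_complex_of_real
        by (simp only: mult.assoc of_real_mult[symmetric] power_0 mult_1_left)
      hence "?g x * complex_of_real (q i * u x ^ i) = complex_of_real (q i) * (f x * cnj (gauss_moment h 0 (1 / a + real i / (2 * a)) x))" for i
        by (metis (no_types, lifting) mult.assoc mult.left_commute of_real_mult)
      thus ?thesis by (simp only: q of_real_sum sum_distrib_left)
    qed
    have each: "integrable M (\<lambda>x. f x * cnj (gauss_moment h 0 (1 / a + real i / (2 * a)) x))" for i
      by (intro integrable_l2_product f gauss_moment_L2[OF h pos])
    have Qi: "integrable M (\<lambda>x. ?g x * complex_of_real (Q (u x)))"
      unfolding Qg by (intro Bochner_Integration.integrable_sum integrable_mult_right each)
    have "(LINT x|M. ?g x * complex_of_real (Q (u x))) = (\<Sum>i\<le>n. complex_of_real (q i) * l2_inner M f (gauss_moment h 0 (1 / a + real i / (2 * a))))"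
      unfolding Qg l2_inner_def using each by (subst Bochner_Integration.integral_sum) auto
    also have "\<dots> = 0" by (simp add: orth)
    finally have "cmod (LINT x|M. ?g x * complex_of_real (G (u x)))
        = cmod (LINT x|M. ?g x * complex_of_real (G (u x)) - ?g x * complex_of_real (Q (u x)))"
      using fFi Qi by simp
    also have "\<dots> \<le> (LINT x|M. cmod (?g x * complex_of_real (G (u x)) - ?g x * complex_of_real (Q (u x))))"
      by (rule integral_norm_bound)
    also have "\<dots> \<le> (LINT x|M. \<epsilon> * cmod (?g x))"
    proof (rule integral_mono)
      show "integrable M (\<lambda>x. cmod (?g x * complex_of_real (G (u x)) - ?g x * complex_of_real (Q (u x))))"
        by (intro integrable_norm Bochner_Integration.integrable_diff fFi Qi)
      show "integrable M (\<lambda>x. \<epsilon> * cmod (?g x))" by (intro integrable_mult_right integrable_norm gi)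
      fix x :: "real^'n"
      have "cmod (?g x * complex_of_real (G (u x)) - ?g x * complex_of_real (Q (u x))) = cmod (?g x) * \<bar>G (u x) - Q (u x)\<bar>"
        unfolding right_diff_distrib[symmetric] of_real_diff[symmetric] norm_mult norm_of_real ..
      also have "\<dots> \<le> cmod (?g x) * \<epsilon>" using Q(2)[OF u01[of x]] by (intro mult_left_mono) auto
      finally show "cmod (?g x * complex_of_real (G (u x)) - ?g x * complex_of_real (Q (u x))) \<le> \<epsilon> * cmod (?g x)"
        by (simp only: mult.commute)
    qed
    finally show ?thesis by (simp add: J_def)
  qed
  hence "cmod (LINT x|M. ?g x * complex_of_real (G (u x))) \<le> 0 + \<epsilon>" if "\<epsilon> > 0" for \<epsilon>
  proof -
    have "cmod (LINT x|M. ?g x * complex_of_real (G (u x))) \<le> \<epsilon> / (J + 1) * J"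
      using \<open>\<And>\<epsilon>. \<epsilon> > 0 \<Longrightarrow> cmod (LINT x|M. ?g x * complex_of_real (G (u x))) \<le> \<epsilon> * J\<close>[of "\<epsilon> / (J + 1)"] that J by simp
    also have "\<dots> \<le> \<epsilon>" using that J by (simp add: field_simps)
    finally show ?thesis by simp
  qed
  hence "cmod (LINT x|M. ?g x * complex_of_real (G (u x))) \<le> 0" by (rule field_le_epsilon)
  thus ?thesis unfolding fF by simp
qed

text \<open>
  A choice of the harmonic component for each monomial makes the eigenfunctions a countable family.
\<close>

definition harmonic_part :: "('n \<Rightarrow> nat) \<Rightarrow> real^'n \<Rightarrow> complex" where
  "harmonic_part \<beta> = (SOME h. h \<in> harmonics P k (sum \<beta> UNIV) \<and> (\<exists>q. (if sum \<beta> UNIV < 2 then q = (\<lambda>x. 0) else hpoly (sum \<beta> UNIV - 2) q) \<and>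
    monomial \<beta> = (\<lambda>x. h x + complex_of_real (x \<bullet> x) * q x)))"

lemma harmonic_part:
  "harmonic_part \<beta> \<in> harmonics P k (sum \<beta> UNIV)"
  "\<exists>q. (if sum \<beta> UNIV < 2 then q = (\<lambda>x. 0) else hpoly (sum \<beta> UNIV - 2) q) \<and>
    monomial \<beta> = (\<lambda>x. harmonic_part \<beta> x + complex_of_real (x \<bullet> x) * q x)"
proof -
  have "\<exists>h. h \<in> harmonics P k (sum \<beta> UNIV) \<and> (\<exists>q. (if sum \<beta> UNIV < 2 then q = (\<lambda>x. 0) else hpoly (sum \<beta> UNIV - 2) q) \<and>
    monomial \<beta> = (\<lambda>x. h x + complex_of_real (x \<bullet> x) * q x))"
    using harmonic_decomposition[OF zero_P kappa_nonneg hpoly_monomial[of \<beta>]] by blast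
  from someI_ex[OF this] show "harmonic_part \<beta> \<in> harmonics P k (sum \<beta> UNIV)"
    "\<exists>q. (if sum \<beta> UNIV < 2 then q = (\<lambda>x. 0) else hpoly (sum \<beta> UNIV - 2) q) \<and>
    monomial \<beta> = (\<lambda>x. harmonic_part \<beta> x + complex_of_real (x \<bullet> x) * q x)"
    unfolding harmonic_part_def[symmetric] by blast+
qed

text \<open>
  The harmonic parts of the monomials suffice: $\|x\|^2$ can be absorbed into the radial cutoff, so
  the decomposition of monomials reduces the degree.
\<close>

lemma orthogonal_to_polynomials:
  assumes f: "f \<in> sq_integrable M"
    and orth: "\<And>\<beta> F. cutoff F \<Longrightarrow> (LINT x|M. f x * cnj (harmonic_part \<beta> x) * complex_of_real (F (norm x))) = 0"
    and p: "hpoly m p" and F: "cutoff F"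
  shows "(LINT x|M. f x * cnj (p x) * complex_of_real (F (norm x))) = 0"
  using p F
proof (induction m arbitrary: p F rule: less_induct)
  case (less m)
  have mon: "(LINT x|M. f x * cnj (monomial \<beta> x) * complex_of_real (F (norm x))) = 0" if \<beta>: "sum \<beta> UNIV = m" for \<beta>
  proof -
    obtain q where q: "if sum \<beta> UNIV < 2 then q = (\<lambda>x. 0) else hpoly (sum \<beta> UNIV - 2) q"
      "monomial \<beta> = (\<lambda>x. harmonic_part \<beta> x + complex_of_real (x \<bullet> x) * q x)" using harmonic_part(2) by blast
    have hh: "hpoly m (harmonic_part \<beta>)" using harmonic_part(1)[of \<beta>] \<beta> by (simp add: harmonics_iff)
    have F2: "cutoff (\<lambda>r. r\<^sup>2 * F r)" by (rule cutoff_mult[OF less.prems(2)]) (intro continuous_intros)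
    obtain m' where hq: "hpoly m' q" and z: "(LINT x|M. f x * cnj (q x) * complex_of_real ((norm x)\<^sup>2 * F (norm x))) = 0"
    proof (cases "m < 2")
      case True
      thus ?thesis using q(1) \<beta> that[of 0] hpoly_zero[of 0] by simp
    next
      case False
      hence "hpoly (m - 2) q" using q(1) \<beta> by simp
      thus ?thesis using that[of "m - 2"] less.IH[OF _ _ F2, of "m - 2" q] False by simp
    qed
    have "f x * cnj (monomial \<beta> x) * complex_of_real (F (norm x)) = f x * cnj (harmonic_part \<beta> x) * complex_of_real (F (norm x))
        + f x * cnj (q x) * complex_of_real ((norm x)\<^sup>2 * F (norm x))" for x
      by (simp add: q(2) power2_norm_eq_inner algebra_simps)
    thus ?thesis using integrable_cutoff[OF f hh less.prems(2)] integrable_cutoff[OF f hq F2] orth[OF less.prems(2)] z by simp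
  qed
  obtain c where c: "p = (\<lambda>x. \<Sum>\<beta> | sum \<beta> UNIV = m. c \<beta> * monomial \<beta> x)"
    using less.prems(1) unfolding homogeneous_polynomial_iff_hpoly[symmetric] homogeneous_polynomial_monomial by blast
  have "f x * cnj (p x) * complex_of_real (F (norm x))
      = (\<Sum>\<beta> | sum \<beta> UNIV = m. cnj (c \<beta>) * (f x * cnj (monomial \<beta> x) * complex_of_real (F (norm x))))" for x
    by (simp add: c sum_distrib_left sum_distrib_right mult_ac)
  hence "(LINT x|M. f x * cnj (p x) * complex_of_real (F (norm x)))
      = (\<Sum>\<beta> | sum \<beta> UNIV = m. cnj (c \<beta>) * (LINT x|M. f x * cnj (monomial \<beta> x) * complex_of_real (F (norm x))))"
    using integrable_cutoff[OF f hpoly_monomial less.prems(2)] by (simp add: Bochner_Integration.integral_sum)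
  thus ?case using mon by simp
qed

end

text \<open>
  Arbitrary polynomials, as sums of homogeneous ones.
\<close>

inductive polynomial_sum :: "(real^'n \<Rightarrow> complex) \<Rightarrow> bool" where
  base: "hpoly m p \<Longrightarrow> polynomial_sum p"
| add: "polynomial_sum p \<Longrightarrow> polynomial_sum q \<Longrightarrow> polynomial_sum (\<lambda>x. p x + q x)"

lemma polynomial_sum_mult: "polynomial_sum p \<Longrightarrow> polynomial_sum q \<Longrightarrow> polynomial_sum (\<lambda>x. p x * q x)"
proof (induction rule: polynomial_sum.induct)
  case (base m p)
  from base(2,1) show ?case
  proof (induction rule: polynomial_sum.induct)
    case (base n q)
    thus ?case using hpoly_mult polynomial_sum.base by blast
  next
    case (add q r)
    from polynomial_sum.add[OF add.IH(1)[OF add.prems] add.IH(2)[OF add.prems]] show ?case by (simp add: distrib_left)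
  qed
next
  case (add p r)
  from polynomial_sum.add[OF add.IH(1)[OF add.prems] add.IH(2)[OF add.prems]] show ?case by (simp add: distrib_right)
qed

lemma real_polynomial_function_sum:
  fixes Q :: "real^'n \<Rightarrow> real"
  shows "real_polynomial_function Q \<Longrightarrow> polynomial_sum (\<lambda>x. complex_of_real (Q x))"
proof (induction rule: real_polynomial_function.induct)
  case (linear f)
  have "f x = adjoint f 1 \<bullet> x" for x
    using adjoint_works[OF bounded_linear.linear[OF linear], of x 1] by (simp add: inner_commute)
  hence "(\<lambda>x. complex_of_real (f x)) = (\<lambda>x. complex_of_real (adjoint f 1 \<bullet> x) * 1)" by simp
  thus ?case using polynomial_sum.base[OF hpoly_linear_mult[OF hpoly.const[of 1]]] by simp
next
  case (const c)
  show ?case by (rule polynomial_sum.base[OF hpoly.const])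
next
  case (add f g)
  from polynomial_sum.add[OF add.IH] show ?case by simp
next
  case (mult f g)
  from polynomial_sum_mult[OF mult.IH] show ?case by simp
qed

text \<open>
  An integrable function whose integral over every closed set vanishes is zero almost everywhere;
  integrals over closed sets are limits of integrals against continuous functions.
\<close>

lemma AE_zero_of_continuous_test:
  fixes g :: "'a::euclidean_space \<Rightarrow> complex"
  assumes g: "integrable lborel g"
    and test: "\<And>\<phi> :: 'a \<Rightarrow> real. continuous_on UNIV \<phi> \<Longrightarrow> (\<And>x. \<bar>\<phi> x\<bar> \<le> 1) \<Longrightarrow> (LINT x|lborel. complex_of_real (\<phi> x) * g x) = 0"
  shows "AE x in lborel. g x = 0"
proof (rule sigma_finite_measure.density_unique_banach[OF sigma_finite_lborel g integrable_zero])
  have [measurable]: "g \<in> borel_measurable borel" using g by simp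
  have int: "integrable lborel (\<lambda>x. complex_of_real (indicator A x) * g x)" if "A \<in> sets borel" for A
    using integrable_mult_indicator[OF _ g, of A] that by (simp add: scaleR_conv_of_real)
  have closed: "(LINT x|lborel. complex_of_real (indicator C x) * g x) = 0" if C: "closed C" for C
  proof (cases "C = {}")
    case False
    define \<phi> where "\<phi> n x = max 0 (1 - real n * infdist x C)" for n x
    have "(\<lambda>n. LINT x|lborel. complex_of_real (\<phi> n x) * g x) \<longlonglongrightarrow> (LINT x|lborel. complex_of_real (indicator C x) * g x)"
    proof (rule integral_dominated_convergence[where w = "\<lambda>x. cmod (g x)"])
      have \<phi>c: "continuous_on UNIV (\<phi> n)" for n unfolding \<phi>_def by (intro continuous_intros)
      have [measurable]: "\<phi> n \<in> borel_measurable borel" for n by (rule borel_measurable_continuous_onI[OF \<phi>c])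
      show "(\<lambda>x. complex_of_real (\<phi> n x) * g x) \<in> borel_measurable lborel" for n by measurable
      show "(\<lambda>x. complex_of_real (indicator C x) * g x) \<in> borel_measurable lborel" using C borel_closed by measurable
      show "AE x in lborel. norm (complex_of_real (\<phi> n x) * g x) \<le> cmod (g x)" for n
        by (intro AE_I2) (auto simp: norm_mult \<phi>_def infdist_nonneg intro!: mult_left_le_one_le)
      show "AE x in lborel. (\<lambda>n. complex_of_real (\<phi> n x) * g x) \<longlonglongrightarrow> complex_of_real (indicator C x) * g x"
      proof (intro AE_I2 tendsto_intros)
        fix x :: 'a
        show "(\<lambda>n. \<phi> n x) \<longlonglongrightarrow> indicator C x"
        proof (cases "x \<in> C")
          case True
          thus ?thesis by (simp add: \<phi>_def)
        next
          case x: False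
          hence d: "infdist x C > 0" using in_closed_iff_infdist_zero[OF C False] infdist_nonneg[of x C] by (simp add: less_le)
          obtain n0 where n0: "real n0 * infdist x C > 1" using d by (metis reals_Archimedean3)
          have "\<phi> n x = 0" if "n \<ge> n0" for n
          proof -
            have "real n0 * infdist x C \<le> real n * infdist x C" using that d by (intro mult_right_mono) auto
            thus ?thesis using n0 by (simp add: \<phi>_def)
          qed
          hence "eventually (\<lambda>n. \<phi> n x = 0) sequentially" by (rule eventually_sequentiallyI)
          thus ?thesis using x by (simp add: tendsto_eventually)
        qed
      qed
    qed (use g in auto)
    moreover have "(LINT x|lborel. complex_of_real (\<phi> n x) * g x) = 0" for n
      by (rule test) (auto simp: \<phi>_def infdist_nonneg intro!: continuous_intros)
    ultimately show ?thesis by (simp add: LIMSEQ_const_iff)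
  qed simp
  have tot: "(LINT x|lborel. g x) = 0" using closed[of UNIV] by simp
  fix A :: "'a set" assume "A \<in> sets lborel"
  hence A: "A \<in> sigma_sets UNIV (Collect closed)" by (simp add: borel_eq_closed)
  have "Int_stable (Collect closed :: 'a set set)" "Collect closed \<subseteq> Pow (UNIV :: 'a set)" by (auto simp: Int_stable_def)
  hence "(LINT x|lborel. complex_of_real (indicator A x) * g x) = 0"
    using A
  proof (induction rule: sigma_sets_induct_disjoint)
    case (basic A) thus ?case using closed by simp
  next
    case (compl A)
    hence Am: "A \<in> sets borel" by (simp add: borel_eq_closed)
    have "complex_of_real (indicator (UNIV - A) x) * g x = g x - complex_of_real (indicator A x) * g x" for x
      by (simp add: indicator_def)
    thus ?case using compl int[OF Am] g tot by simp
  next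
    case (union A)
    hence Am: "A i \<in> sets borel" for i by (auto simp: borel_eq_closed)
    hence UAm: "(\<Union>i. A i) \<in> sets borel" by blast
    have dis: "disjoint_family A" by fact
    have ps: "complex_of_real (indicator (\<Union>i<n. A i) x) * g x = (\<Sum>i<n. complex_of_real (indicator (A i) x) * g x)" for n x
    proof -
      have "(indicator (\<Union>i<n. A i) x :: real) = (\<Sum>i<n. indicator (A i) x)"
        using dis by (intro indicator_UN_disjoint) (auto simp: disjoint_family_on_def)
      thus ?thesis by (simp add: sum_distrib_right)
    qed
    have "(\<lambda>n. LINT x|lborel. complex_of_real (indicator (\<Union>i<n. A i) x) * g x) \<longlonglongrightarrow> (LINT x|lborel. complex_of_real (indicator (\<Union>i. A i) x) * g x)"
    proof (rule integral_dominated_convergence[where w = "\<lambda>x. cmod (g x)"])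
      show "(\<lambda>x. complex_of_real (indicator (\<Union>i<n. A i) x) * g x) \<in> borel_measurable lborel" for n
        using int[of "\<Union>i<n. A i"] Am by (intro borel_measurable_integrable) auto
      show "(\<lambda>x. complex_of_real (indicator (\<Union>i. A i) x) * g x) \<in> borel_measurable lborel"
        using int[OF UAm] by (rule borel_measurable_integrable)
      show "AE x in lborel. norm (complex_of_real (indicator (\<Union>i<n. A i) x) * g x) \<le> cmod (g x)" for n
        by (intro AE_I2) (auto simp: indicator_def)
      show "AE x in lborel. (\<lambda>n. complex_of_real (indicator (\<Union>i<n. A i) x) * g x) \<longlonglongrightarrow> complex_of_real (indicator (\<Union>i. A i) x) * g x"
        by (intro AE_I2 tendsto_intros LIMSEQ_indicator_UN)
    qed (use g in auto)
    moreover have "(LINT x|lborel. complex_of_real (indicator (\<Union>i<n. A i) x) * g x) = 0" for n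
      unfolding ps using int[OF Am] union by (subst Bochner_Integration.integral_sum) auto
    ultimately show ?case by (simp add: LIMSEQ_const_iff)
  qed simp
  thus "set_lebesgue_integral lborel A g = set_lebesgue_integral lborel A (\<lambda>x. 0)"
    by (simp add: set_lebesgue_integral_def scaleR_conv_of_real)
qed

context dunkl_setting
begin

text \<open>
  By \<open>orthogonal_to_polynomials\<close> and the theorem of Stone and Weierstrass on balls, $F_n(\|x\|) f(x)$
  is orthogonal to all continuous functions, where $F_n$ is a radial cutoff equal to $1$ up to
  radius $n$.
\<close>

theorem eigenfunctions_total:
  assumes f: "f \<in> sq_integrable M"
    and orth: "\<And>l \<beta>. l2_inner M f (Phi P k a l (sum \<beta> UNIV) (harmonic_part \<beta>)) = 0"
  shows "AE x in M. f x = 0"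
proof -
  have fm[measurable]: "f \<in> borel_measurable borel" using f by (simp add: sq_integrable_def measurable_M)
  have oh: "(LINT x|M. f x * cnj (harmonic_part \<beta> x) * complex_of_real (F (norm x))) = 0" if F: "cutoff F" for \<beta> F
  proof -
    have h: "hpoly (sum \<beta> UNIV) (harmonic_part \<beta>)" using harmonic_part(1) by (simp add: harmonics_iff)
    show ?thesis
      by (rule orthogonal_to_cutoffs[OF f h orthogonal_to_exponentials[OF f h orthogonal_to_moments[OF f harmonic_part(1) orth]] F])
  qed
  define F where "F n r = max 0 (min 1 (real n + 1 - r))" for n and r :: real
  have F: "cutoff (F n)" for n
    unfolding cutoff_def F_def by (intro conjI exI[of _ "real n + 1"]) (auto intro!: continuous_intros)
  have "AE x in lborel. f x * complex_of_real (F n (norm x)) * complex_of_real (norm x powr (a - 2) * w x) = 0" for n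
  proof (rule AE_zero_of_continuous_test)
    have fF: "integrable M (\<lambda>x. f x * complex_of_real (F n (norm x)))"
      using integrable_cutoff[OF f hpoly.const[of 1] F[of n]] by simp
    have Fm[measurable]: "F n \<in> borel_measurable borel" by (rule cutoff_measurable[OF F])
    show "integrable lborel (\<lambda>x. f x * complex_of_real (F n (norm x)) * complex_of_real (norm x powr (a - 2) * w x))"
      using fF by (subst (asm) integral_M(1)) auto
    fix \<phi> :: "real^'n \<Rightarrow> real" assume \<phi>: "continuous_on UNIV \<phi>" "\<And>x. \<bar>\<phi> x\<bar> \<le> 1"
    have \<phi>m[measurable]: "\<phi> \<in> borel_measurable borel" by (rule borel_measurable_continuous_onI[OF \<phi>(1)])
    let ?g = "\<lambda>x. f x * complex_of_real (F n (norm x))"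
    have g\<phi>: "integrable M (\<lambda>x. complex_of_real (\<phi> x) * ?g x)"
    proof (rule Bochner_Integration.integrable_bound[OF fF])
      show "(\<lambda>x. complex_of_real (\<phi> x) * ?g x) \<in> borel_measurable M" unfolding measurable_M by measurable
      show "AE x in M. norm (complex_of_real (\<phi> x) * ?g x) \<le> norm (?g x)"
        using \<phi>(2) by (intro AE_I2) (simp add: norm_mult mult_left_le_one_le)
    qed
    \<comment> \<open>outside the support of $F_n$ the approximation error is irrelevant, inside it is less than $\epsilon$\<close>
    define J where "J = (LINT x|M. cmod (?g x))"
    have J: "J \<ge> 0" by (simp add: J_def)
    have small: "cmod (LINT x|M. complex_of_real (\<phi> x) * ?g x) \<le> \<epsilon> * J" if \<epsilon>: "\<epsilon> > 0" for \<epsilon>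
    proof -
      obtain Q where Q: "real_polynomial_function Q" "\<And>x. x \<in> cball 0 (real n + 1) \<Longrightarrow> \<bar>\<phi> x - Q x\<bar> < \<epsilon>"
        using Stone_Weierstrass_real_polynomial_function[OF compact_cball continuous_on_subset[OF \<phi>(1) subset_UNIV] \<epsilon>] by blast
      have "polynomial_sum q \<Longrightarrow> integrable M (\<lambda>x. f x * cnj (q x) * complex_of_real (F n (norm x)))
          \<and> (LINT x|M. f x * cnj (q x) * complex_of_real (F n (norm x))) = 0" for q
      proof (induction rule: polynomial_sum.induct)
        case (base m p)
        thus ?case using integrable_cutoff[OF f _ F] orthogonal_to_polynomials[OF f oh _ F] by blast
      next
        case (add p q)
        have "f x * cnj (p x + q x) * complex_of_real (F n (norm x))
          = f x * cnj (p x) * complex_of_real (F n (norm x)) + f x * cnj (q x) * complex_of_real (F n (norm x))" for x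
          by (simp add: algebra_simps)
        thus ?case using add.IH by simp
      qed
      from this[OF real_polynomial_function_sum[OF Q(1)]]
      have Qi: "integrable M (\<lambda>x. complex_of_real (Q x) * ?g x)" and Q0: "(LINT x|M. complex_of_real (Q x) * ?g x) = 0"
        by (simp_all add: mult_ac)
      have "cmod (LINT x|M. complex_of_real (\<phi> x) * ?g x)
          = cmod (LINT x|M. complex_of_real (\<phi> x) * ?g x - complex_of_real (Q x) * ?g x)"
        using g\<phi> Qi Q0 by simp
      also have "\<dots> \<le> (LINT x|M. cmod (complex_of_real (\<phi> x) * ?g x - complex_of_real (Q x) * ?g x))"
        by (rule integral_norm_bound)
      also have "\<dots> \<le> (LINT x|M. \<epsilon> * cmod (?g x))"
      proof (rule integral_mono)
        show "integrable M (\<lambda>x. cmod (complex_of_real (\<phi> x) * ?g x - complex_of_real (Q x) * ?g x))"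
          by (intro integrable_norm Bochner_Integration.integrable_diff g\<phi> Qi)
        show "integrable M (\<lambda>x. \<epsilon> * cmod (?g x))" by (intro integrable_mult_right integrable_norm fF)
        fix x :: "real^'n"
        have eq: "cmod (complex_of_real (\<phi> x) * ?g x - complex_of_real (Q x) * ?g x) = \<bar>\<phi> x - Q x\<bar> * cmod (?g x)"
          unfolding left_diff_distrib[symmetric] of_real_diff[symmetric] norm_mult norm_of_real ..
        show "cmod (complex_of_real (\<phi> x) * ?g x - complex_of_real (Q x) * ?g x) \<le> \<epsilon> * cmod (?g x)"
        proof (cases "norm x \<le> real n + 1")
          case True
          hence "\<bar>\<phi> x - Q x\<bar> \<le> \<epsilon>" using Q(2)[of x] by simp
          thus ?thesis unfolding eq by (intro mult_right_mono) auto
        next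
          case False
          hence "F n (norm x) = 0" by (simp add: F_def)
          thus ?thesis by simp
        qed
      qed
      finally show ?thesis by (simp add: J_def)
    qed
    have "cmod (LINT x|M. complex_of_real (\<phi> x) * ?g x) \<le> 0 + \<epsilon>" if "\<epsilon> > 0" for \<epsilon>
    proof -
      have "cmod (LINT x|M. complex_of_real (\<phi> x) * ?g x) \<le> \<epsilon> / (J + 1) * J" using small[of "\<epsilon> / (J + 1)"] that J by simp
      also have "\<dots> \<le> \<epsilon>" using that J by (simp add: field_simps)
      finally show ?thesis by simp
    qed
    hence "cmod (LINT x|M. complex_of_real (\<phi> x) * ?g x) \<le> 0" by (rule field_le_epsilon)
    hence "(LINT x|M. complex_of_real (\<phi> x) * ?g x) = 0" by simp
    thus "(LINT x|lborel. complex_of_real (\<phi> x) * (f x * complex_of_real (F n (norm x)) * complex_of_real (norm x powr (a - 2) * w x))) = 0"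
      by (subst (asm) integral_M(2)) (auto simp: mult.assoc)
  qed
  hence "AE x in lborel. \<forall>n. f x * complex_of_real (F n (norm x)) * complex_of_real (norm x powr (a - 2) * w x) = 0"
    unfolding AE_all_countable by blast
  hence "AE x in lborel. f x = 0"
    using w_pos_AE AE_lborel_nonzero
  proof eventually_elim
    fix x :: "real^'n"
    assume elim: "\<forall>n. f x * complex_of_real (F n (norm x)) * complex_of_real (norm x powr (a - 2) * w x) = 0" "0 < w x" "x \<noteq> 0"
    obtain n where n: "norm x \<le> real n" using real_arch_simple by blast
    have "F n (norm x) = 1" using n by (simp add: F_def)
    thus "f x = 0" using elim(1)[rule_format, of n] elim(2,3) by simp
  qed
  thus ?thesis by (simp add: AE_M)
qed

end

section \<open>The closure of $\Delta_{k,a}$ and its semigroup\<close>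

lemma complex_span_zero: "(\<lambda>x. 0) \<in> complex_span G"
  unfolding complex_span_def by (rule CollectI, rule exI[of _ "{}"]) simp

lemma complex_span_generator:
  assumes "f \<in> G" shows "f \<in> complex_span G"
  unfolding complex_span_def using assms by (intro CollectI exI[of _ "{f}"] exI[of _ "\<lambda>_. 1"]) simp

lemma complex_span_linear:
  assumes "f \<in> complex_span G" "h \<in> complex_span G"
  shows "(\<lambda>x. c * f x + h x) \<in> complex_span G"
proof -
  obtain S d where S: "finite S" "S \<subseteq> G" and f: "f = (\<lambda>x. \<Sum>g\<in>S. d g * g x)"
    using assms(1) by (auto simp: complex_span_def)
  obtain T d' where T: "finite T" "T \<subseteq> G" and h: "h = (\<lambda>x. \<Sum>g\<in>T. d' g * g x)"
    using assms(2) by (auto simp: complex_span_def)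
  have "c * f x = (\<Sum>g\<in>S \<union> T. (if g \<in> S then c * d g else 0) * g x)" for x
    unfolding f sum_distrib_left using S(1) T(1) by (intro sum.mono_neutral_cong_left) auto
  moreover have "h x = (\<Sum>g\<in>S \<union> T. (if g \<in> T then d' g else 0) * g x)" for x
    unfolding h using S(1) T(1) by (intro sum.mono_neutral_cong_left) auto
  ultimately have "(\<lambda>x. c * f x + h x)
      = (\<lambda>x. \<Sum>g\<in>S \<union> T. ((if g \<in> S then c * d g else 0) + (if g \<in> T then d' g else 0)) * g x)"
    by (simp only: distrib_right sum.distrib)
  thus ?thesis using S T unfolding complex_span_def
    by (intro CollectI exI[of _ "S \<union> T"] exI[of _ "\<lambda>g. (if g \<in> S then c * d g else 0) + (if g \<in> T then d' g else 0)"]) simp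
qed

lemma complex_span_sum:
  assumes "\<And>i. i \<in> A \<Longrightarrow> f i \<in> complex_span G"
  shows "(\<lambda>x. \<Sum>i\<in>A. c i * f i x) \<in> complex_span G"
  using assms
proof (induction A rule: infinite_finite_induct)
  case (insert i A)
  have "(\<lambda>x. c i * f i x + (\<Sum>i\<in>A. c i * f i x)) \<in> complex_span G"
    using insert by (intro complex_span_linear) auto
  thus ?case using insert.hyps by simp
qed (auto simp: complex_span_zero)

lemma complex_span_mono: "G \<subseteq> H \<Longrightarrow> complex_span G \<subseteq> complex_span H"
  unfolding complex_span_def by blast

text \<open>
  A geometric series in finitely many variables: the eigenvalue of $\Phi_\ell^{(a)}(p,\cdot)$ is
  linear in $\ell$ and in the multi-index of the monomial underlying $p$.
\<close>

lemma summable_geometric_multiindex: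
  fixes g :: "nat \<Rightarrow> nat \<times> ('n::finite \<Rightarrow> nat)"
  assumes g: "inj g" and p: "0 < p" "p < 1" and q: "0 < q" "q < (1::real)"
  shows "summable (\<lambda>n. p ^ fst (g n) * q ^ sum (snd (g n)) UNIV)"
proof (rule bounded_imp_summable)
  let ?t = "\<lambda>y :: nat \<times> ('n \<Rightarrow> nat). p ^ fst y * q ^ sum (snd y) UNIV"
  have t0: "?t y \<ge> 0" for y using p q by simp
  show "0 \<le> ?t (g n)" for n by (rule t0)
  have geo: "(\<Sum>j\<le>K. r ^ j) \<le> 1 / (1 - r)" if "0 < r" "r < 1" for r :: real and K
  proof -
    have "(\<Sum>j\<le>K. r ^ j) \<le> (\<Sum>j. r ^ j)"
      using that by (intro sum_le_suminf summable_geometric) auto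
    thus ?thesis using that by (simp add: suminf_geometric)
  qed
  show "(\<Sum>n\<le>N. ?t (g n)) \<le> 1 / (1 - p) * (1 / (1 - q)) ^ CARD('n)" for N
  proof -
    define A where "A = g ` {..N}"
    define K where "K = Max (insert 0 (fst ` A \<union> (\<Union>y\<in>A. range (snd y))))"
    have fin: "finite (insert 0 (fst ` A \<union> (\<Union>y\<in>A. range (snd y))))" by (simp add: A_def)
    have K: "fst y \<le> K" "snd y i \<le> K" if "y \<in> A" for y i
      using that unfolding K_def by (auto intro!: Max_ge[OF fin])
    define B :: "(nat \<times> ('n \<Rightarrow> nat)) set" where "B = {..K} \<times> PiE UNIV (\<lambda>_. {..K})"
    have AB: "A \<subseteq> B" using K by (auto simp: B_def)
    have finB: "finite B" unfolding B_def by (intro finite_cartesian_product finite_PiE) auto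
    have "(\<Sum>n\<le>N. ?t (g n)) = sum ?t A"
      unfolding A_def by (subst sum.reindex) (use g in \<open>auto intro: inj_on_subset simp: o_def\<close>)
    also have "\<dots> \<le> sum ?t B" using t0 by (intro sum_mono2[OF finB AB]) auto
    also have "\<dots> = (\<Sum>l\<le>K. \<Sum>\<beta>\<in>PiE UNIV (\<lambda>_ :: 'n. {..K}). p ^ l * q ^ sum \<beta> UNIV)"
      unfolding B_def sum.cartesian_product by (simp add: case_prod_beta)
    also have "\<dots> = (\<Sum>l\<le>K. p ^ l) * (\<Sum>\<beta>\<in>PiE UNIV (\<lambda>_ :: 'n. {..K}). \<Prod>i\<in>UNIV. q ^ \<beta> i)"
      by (simp add: sum_product power_sum)
    also have "(\<Sum>\<beta>\<in>PiE UNIV (\<lambda>_ :: 'n. {..K}). \<Prod>i\<in>UNIV. q ^ \<beta> i) = (\<Sum>j\<le>K. q ^ j) ^ CARD('n)"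
      by (subst prod_sum_PiE[symmetric]) auto
    also have "(\<Sum>l\<le>K. p ^ l) * (\<Sum>j\<le>K. q ^ j) ^ CARD('n) \<le> 1 / (1 - p) * (1 / (1 - q)) ^ CARD('n)"
      using p q by (intro mult_mono power_mono geo) (auto intro!: sum_nonneg zero_le_power)
    finally show ?thesis .
  qed
qed

context dunkl_setting
begin

text \<open>
  The label is the eigenvalue, as different pairs $(\ell, m)$ can share it; spaces with different labels
  are orthogonal.
\<close>

definition eigenspace :: "real \<Rightarrow> (real^'n \<Rightarrow> complex) set" where
  "eigenspace t = complex_span {Phi P k a l m p | l m p. p \<in> harmonics P k m \<and> eigenvalue P k a l m = t}"

lemma eigenspace_W: "eigenspace t \<subseteq> W_ka P k a"
  unfolding eigenspace_def W_ka_def by (rule complex_span_mono) blast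

lemma W_L2: "f \<in> W_ka P k a \<Longrightarrow> f \<in> sq_integrable M"
  unfolding W_ka_def complex_span_def using Phi_L2 by (auto intro!: sq_integrable_sum sq_integrable_scale)

lemma eigenspace_L2: "f \<in> eigenspace t \<Longrightarrow> f \<in> sq_integrable M"
  using eigenspace_W W_L2 by blast

lemma eigenspace_orthogonal:
  assumes "s \<noteq> t" and f: "f \<in> eigenspace s" and g: "g \<in> eigenspace t"
  shows "l2_inner M f g = 0"
proof -
  let ?G = "\<lambda>t. {Phi P k a l m p | l m p. p \<in> harmonics P k m \<and> eigenvalue P k a l m = t}"
  have GL: "u \<in> sq_integrable M" if "u \<in> ?G t'" for u t' using that Phi_L2 by blast
  have GG: "l2_inner M u v = 0" if uG: "u \<in> ?G s" and vG: "v \<in> ?G t" for u v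
  proof -
    obtain l m p where u: "u = Phi P k a l m p" "p \<in> harmonics P k m" "eigenvalue P k a l m = s"
      using uG by blast
    obtain l' n q where v: "v = Phi P k a l' n q" "q \<in> harmonics P k n" "eigenvalue P k a l' n = t"
      using vG by blast
    have "(l, m) \<noteq> (l', n)" using u(3) v(3) assms(1) by blast
    thus ?thesis unfolding u(1) v(1) by (rule Phi_orthogonal[OF u(2) v(2)])
  qed
  obtain S c where S: "S \<subseteq> ?G s" "f = (\<lambda>x. \<Sum>u\<in>S. c u * u x)"
    using f unfolding eigenspace_def complex_span_def by blast
  obtain T d where T: "T \<subseteq> ?G t" "g = (\<lambda>x. \<Sum>v\<in>T. d v * v x)"
    using g unfolding eigenspace_def complex_span_def by blast
  have gL: "g \<in> sq_integrable M" by (rule eigenspace_L2[OF g])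
  have "l2_inner M u g = 0" if u: "u \<in> S" for u
  proof -
    have uL: "u \<in> sq_integrable M" using u S(1) GL by blast
    have "l2_inner M u g = (\<Sum>v\<in>T. l2_inner M u (\<lambda>x. d v * v x))"
      unfolding T(2) using T(1) GL by (intro l2_inner_sum_right uL sq_integrable_scale) blast
    also have "\<dots> = 0" unfolding l2_inner_scale_right using GG[OF subsetD[OF S(1) u] subsetD[OF T(1)]] by (intro sum.neutral) simp
    finally show ?thesis .
  qed
  moreover have "l2_inner M f g = (\<Sum>u\<in>S. l2_inner M (\<lambda>x. c u * u x) g)"
    unfolding S(2) using S(1) GL by (intro l2_inner_sum_left gL sq_integrable_scale) blast
  ultimately show ?thesis by (simp add: l2_inner_scale_left)
qed

lemma eigenvalue_neg: "eigenvalue P k a l m \<le> 0"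
  using lambda_gt[of m] a_pos by (simp add: eigenvalue_def)

lemma eigenvalue_le: "eigenvalue P k a l m \<le> - (2 * a * real l + 2 * real m)"
proof -
  have "eigenvalue P k a l m = - (2 * a * real l + 2 * real m + (a + 2 * \<kappa> + real CARD('n) - 2))"
    using a_pos by (simp add: eigenvalue_def lambda_kam_def field_simps)
  thus ?thesis using index_pos by simp
qed

lemma Delta_ka_W:
  assumes f: "f \<in> W_ka P k a"
  obtains S t c where "finite S" "\<And>g. g \<in> S \<Longrightarrow> g \<in> eigenspace (t g)" "f = (\<lambda>x. \<Sum>g\<in>S. c g * g x)"
    "\<And>x. x \<noteq> 0 \<Longrightarrow> Delta_ka P k a f x = (\<Sum>g\<in>S. c g * (complex_of_real (t g) * g x))"
proof -
  obtain S c where S: "finite S" "S \<subseteq> {Phi P k a l m p | l m p. p \<in> harmonics P k m}"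
    and fc: "f = (\<lambda>x. \<Sum>g\<in>S. c g * g x)"
    using f unfolding W_ka_def complex_span_def by blast
  have ex: "\<exists>t. g \<in> eigenspace t \<and> (\<forall>x. x \<noteq> 0 \<longrightarrow> Delta_ka P k a g x = complex_of_real t * g x
      \<and> dir_smooth g x \<and> (\<forall>\<xi>. dir_smooth (dunkl_operator P k \<xi> g) x))" if gS: "g \<in> S" for g
  proof -
    obtain l m p where g: "g = Phi P k a l m p" and p: "p \<in> harmonics P k m" using gS S(2) by blast
    show ?thesis
    proof (intro exI[of _ "eigenvalue P k a l m"] conjI allI impI)
      show "g \<in> eigenspace (eigenvalue P k a l m)"
        unfolding eigenspace_def g using p by (intro complex_span_generator) blast
    qed (auto simp: g intro!: Phi_eigenfunction[OF zero_P a_pos lambda_gt p])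
  qed
  define t where "t g = (SOME t. g \<in> eigenspace t \<and> (\<forall>x. x \<noteq> 0 \<longrightarrow> Delta_ka P k a g x = complex_of_real t * g x
      \<and> dir_smooth g x \<and> (\<forall>\<xi>. dir_smooth (dunkl_operator P k \<xi> g) x)))" for g
  note tspec = someI_ex[OF ex, folded t_def]
  have t: "g \<in> eigenspace (t g)" if "g \<in> S" for g using tspec[OF that] by blast
  have D: "Delta_ka P k a g x = complex_of_real (t g) * g x" if "g \<in> S" "x \<noteq> 0" for g x
    using tspec[OF that(1)] that(2) by blast
  have s: "dir_smooth g x" and sT: "dir_smooth (dunkl_operator P k \<xi> g) x" if "g \<in> S" "x \<noteq> 0" for g x \<xi>
    using tspec[OF that(1)] that(2) by blast+
  have "Delta_ka P k a f x = (\<Sum>g\<in>S. c g * (complex_of_real (t g) * g x))" if x: "x \<noteq> 0" for x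
  proof -
    have "Delta_ka P k a f x = (\<Sum>g\<in>S. c g * Delta_ka P k a g x)"
      unfolding fc by (rule Delta_ka_combination) (use s sT x in auto)
    thus ?thesis using D x by simp
  qed
  thus ?thesis by (intro that[OF S(1) t fc])
qed

text \<open>
  The eigenfunctions built from the harmonic parts of the monomials are enumerated by pairs of $\ell$
  and a multi-index, and orthonormalized within the eigenspaces.  The resulting basis lies in
  $W_{k,a}$ and diagonalizes $\Delta_{k,a}$ on it, so that \<open>closure_eq_diag\<close> and \<open>diag_semigroup\<close> apply.
\<close>

theorem laguerre_semigroup_properties:
  "(\<forall>z. Re z > 0 \<longrightarrow> hilbert_schmidt M (laguerre_semigroup R P k a z)) \<and>
   (\<forall>z\<^sub>1 z\<^sub>2. Re z\<^sub>1 > 0 \<longrightarrow> Re z\<^sub>2 > 0 \<longrightarrow>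
      laguerre_semigroup R P k a z\<^sub>2 O laguerre_semigroup R P k a z\<^sub>1 = laguerre_semigroup R P k a (z\<^sub>1 + z\<^sub>2)) \<and>
   (\<forall>f \<in> sq_integrable M. \<forall>g \<in> sq_integrable M.
      (\<lambda>z. l2_inner M (op_app (laguerre_semigroup R P k a z) f) g) holomorphic_on {z. Re z > 0}) \<and>
   one_parameter_unitary_group M (\<lambda>t. laguerre_semigroup R P k a (\<i> * of_real t))"
proof -
  define \<iota> :: "nat \<Rightarrow> nat \<times> ('n \<Rightarrow> nat)" where "\<iota> = from_nat_into UNIV"
  have "infinite (UNIV :: (nat \<times> ('n \<Rightarrow> nat)) set)" by (simp add: finite_prod)
  hence \<iota>: "bij \<iota>" unfolding \<iota>_def by (intro bij_betw_from_nat_into) auto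
  define v where "v n = (case \<iota> n of (l, \<beta>) \<Rightarrow> Phi P k a l (sum \<beta> UNIV) (harmonic_part \<beta>))" for n
  define \<mu> where "\<mu> n = (case \<iota> n of (l, \<beta>) \<Rightarrow> eigenvalue P k a l (sum \<beta> UNIV))" for n
  have vX: "v n \<in> eigenspace (\<mu> n)" for n
    unfolding v_def \<mu>_def eigenspace_def using harmonic_part(1)
    by (cases "\<iota> n") (auto intro!: complex_span_generator)
  have total: "AE x in M. f x = 0" if f: "f \<in> sq_integrable M" and orth: "\<And>n. l2_inner M f (v n) = 0" for f
  proof (rule eigenfunctions_total[OF f])
    fix l \<beta>
    obtain n where "\<iota> n = (l, \<beta>)" using \<iota> by (metis bij_pointE)
    thus "l2_inner M f (Phi P k a l (sum \<beta> UNIV) (harmonic_part \<beta>)) = 0" using orth[of n] by (simp add: v_def)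
  qed
  have "\<exists>e. diagonal_system M e \<and> (\<forall>n. e n \<in> eigenspace (\<mu> n))"
  proof (rule eigenvector_basis_exists[where v = v])
    show "v n \<in> eigenspace (\<mu> n)" for n by (rule vX)
    show "u \<in> sq_integrable M" if "u \<in> eigenspace t" for u t by (rule eigenspace_L2[OF that])
    show "(\<lambda>x. c * u x + w x) \<in> eigenspace t" if "u \<in> eigenspace t" "w \<in> eigenspace t" for t u w c
      using that unfolding eigenspace_def by (rule complex_span_linear)
    show "(\<lambda>x. 0) \<in> eigenspace t" for t unfolding eigenspace_def by (rule complex_span_zero)
    show "l2_inner M u w = 0" if "s \<noteq> t" "u \<in> eigenspace s" "w \<in> eigenspace t" for s t u w
      using that by (rule eigenspace_orthogonal)
    show "AE x in M. f x = 0" if "f \<in> sq_integrable M" "\<And>n. l2_inner M f (v n) = 0" for f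
      using that by (rule total)
  qed
  then obtain e where ds: "diagonal_system M e" and eX: "\<And>n. e n \<in> eigenspace (\<mu> n)" by blast
  interpret diagonal_system M e \<mu> by (rule ds)
  have closed: "Delta_ka_closed R P k a = diag complex_of_real"
    unfolding Delta_ka_closed_def
  proof (rule closure_eq_diag)
    fix f g assume "(f, g) \<in> {(f, Delta_ka P k a f) | f. f \<in> W_ka P k a}"
    hence f: "f \<in> W_ka P k a" and g: "g = Delta_ka P k a f" by auto
    obtain S t c where S: "finite S" "\<And>g. g \<in> S \<Longrightarrow> g \<in> eigenspace (t g)" and fc: "f = (\<lambda>x. \<Sum>g\<in>S. c g * g x)"
      and D: "\<And>x. x \<noteq> 0 \<Longrightarrow> Delta_ka P k a f x = (\<Sum>g\<in>S. c g * (complex_of_real (t g) * g x))"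
      by (rule Delta_ka_W[OF f]) (rule that)
    have SL: "u \<in> sq_integrable M" if "u \<in> S" for u using S(2)[OF that] by (rule eigenspace_L2)
    define h where "h x = (\<Sum>u\<in>S. c u * (complex_of_real (t u) * u x))" for x
    have hL: "h \<in> sq_integrable M" unfolding h_def[abs_def] using SL by (intro sq_integrable_sum sq_integrable_scale)
    \<comment> \<open>the two sides of the eigenvalue equation may differ at the origin, a null set\<close>
    have gh: "g = (\<lambda>x. if x = 0 then 0 else h x)" by (auto simp: fun_eq_iff g h_def D Delta_ka_origin)
    have [measurable]: "h \<in> borel_measurable borel" using hL by (simp add: sq_integrable_def measurable_M)
    have gm: "g \<in> borel_measurable M" unfolding measurable_M gh by measurable
    have gL: "g \<in> sq_integrable M"
      using hL gm unfolding sq_integrable_def gh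
      by (auto elim!: Bochner_Integration.integrable_bound simp: measurable_M)
    have "AE x in M. g x = h x" unfolding AE_M using AE_lborel_nonzero by eventually_elim (simp add: gh)
    hence "coeff g n = coeff h n" for n by (rule coeff_cong_AE[OF _ gL hL])
    also have "coeff h n = complex_of_real (\<mu> n) * coeff f n" for n
    proof -
      have "coeff h n = (\<Sum>u\<in>S. c u * (complex_of_real (t u) * l2_inner M u (e n)))"
        unfolding coeff_def h_def[abs_def] using SL e_L2
        by (subst l2_inner_sum_left) (auto simp: l2_inner_scale_left intro!: sq_integrable_scale)
      also have "\<dots> = (\<Sum>u\<in>S. complex_of_real (\<mu> n) * (c u * l2_inner M u (e n)))"
      proof (rule sum.cong[OF refl])
        fix u assume u: "u \<in> S"
        show "c u * (complex_of_real (t u) * l2_inner M u (e n)) = complex_of_real (\<mu> n) * (c u * l2_inner M u (e n))"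
          using eigenspace_orthogonal[OF _ S(2)[OF u] eX[of n]] by (cases "t u = \<mu> n") auto
      qed
      also have "\<dots> = complex_of_real (\<mu> n) * coeff f n"
        unfolding coeff_def fc sum_distrib_left[symmetric] using SL e_L2
        by (subst l2_inner_sum_left) (auto simp: l2_inner_scale_left intro!: sq_integrable_scale)
      finally show ?thesis .
    qed
    finally show "(f, g) \<in> diag complex_of_real" using W_L2[OF f] gL by (simp add: diag_def)
  next
    fix c :: "nat \<Rightarrow> complex" and N
    have "e n \<in> W_ka P k a" for n using eX eigenspace_W by blast
    hence "(\<lambda>x. \<Sum>n<N. c n * e n x) \<in> W_ka P k a" unfolding W_ka_def by (intro complex_span_sum)
    thus "\<exists>g. (\<lambda>x. \<Sum>n<N. c n * e n x, g) \<in> {(f, Delta_ka P k a f) | f. f \<in> W_ka P k a}" by blast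
  qed
  have neg: "\<mu> n \<le> 0" for n unfolding \<mu>_def by (cases "\<iota> n") (simp add: eigenvalue_neg)
  have trace: "summable (\<lambda>n. exp (s * \<mu> n))" if s: "s > 0" for s
  proof (rule summable_comparison_test)
    show "summable (\<lambda>n. exp (- (2 * a * s)) ^ fst (\<iota> n) * exp (- (2 * s)) ^ sum (snd (\<iota> n)) UNIV)"
      using s a_pos \<iota> by (intro summable_geometric_multiindex) (auto simp: bij_def)
    have "exp (s * \<mu> n) \<le> exp (- (2 * a * s)) ^ fst (\<iota> n) * exp (- (2 * s)) ^ sum (snd (\<iota> n)) UNIV" for n
    proof -
      obtain l \<beta> where lb: "\<iota> n = (l, \<beta>)" by (cases "\<iota> n")
      have "s * \<mu> n \<le> s * (- (2 * a * real l + 2 * real (sum \<beta> UNIV)))"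
        using eigenvalue_le[of l "sum \<beta> UNIV"] s by (intro mult_left_mono) (auto simp: \<mu>_def lb)
      also have "\<dots> = real l * (- (2 * a * s)) + real (sum \<beta> UNIV) * (- (2 * s))" by (simp add: algebra_simps)
      finally have "exp (s * \<mu> n) \<le> exp (real l * (- (2 * a * s))) * exp (real (sum \<beta> UNIV) * (- (2 * s)))"
        by (simp only: exp_add[symmetric] exp_le_cancel_iff)
      thus ?thesis unfolding exp_of_nat_mult lb by simp
    qed
    thus "\<exists>N. \<forall>n\<ge>N. norm (exp (s * \<mu> n)) \<le> exp (- (2 * a * s)) ^ fst (\<iota> n) * exp (- (2 * s)) ^ sum (snd (\<iota> n)) UNIV"
      by simp
  qed
  show ?thesis unfolding laguerre_semigroup_def closed by (rule diag_semigroup[OF a_pos neg trace])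
qed

end

theorem theoremB:
  fixes R P :: "(real^'n) set" and k :: "real^'n \<Rightarrow> real" and a :: real
  assumes "root_system R"
    and "positive_subsystem R P"
    and "multiplicity_function R k"
    and "\<forall>\<alpha>\<in>R. k \<alpha> \<ge> 0"
    and "a > 0"
    and "a + 2 * mult_sum P k + real CARD('n) - 2 > 0"
  shows "(\<forall>z. Re z > 0 \<longrightarrow>
            hilbert_schmidt (theta_measure R k a) (laguerre_semigroup R P k a z)) \<and>
         (\<forall>z\<^sub>1 z\<^sub>2. Re z\<^sub>1 > 0 \<longrightarrow> Re z\<^sub>2 > 0 \<longrightarrow>
            laguerre_semigroup R P k a z\<^sub>2 O laguerre_semigroup R P k a z\<^sub>1 =
            laguerre_semigroup R P k a (z\<^sub>1 + z\<^sub>2)) \<and>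
         (\<forall>f \<in> sq_integrable (theta_measure R k a). \<forall>g \<in> sq_integrable (theta_measure R k a).
            (\<lambda>z. l2_inner (theta_measure R k a) (op_app (laguerre_semigroup R P k a z) f) g)
              holomorphic_on {z. Re z > 0}) \<and>
         one_parameter_unitary_group (theta_measure R k a)
           (\<lambda>t. laguerre_semigroup R P k a (\<i> * of_real t))"
proof -
  interpret dunkl_setting R P k a using assms by unfold_locales auto
  show ?thesis by (rule laguerre_semigroup_properties)
qed

end
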